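(* Let $f:\Sigma\to\mathcal{Z}$ be an umbilic-free Legendre map and let $\mathfrak{p}\in\mathbb{R}^{4,2}$ be a vector that is not lightlike and not zero. The following are equivalent: (a) $f$ is a special $\Omega$-surface of type $1$ (with respect to some gauge potential) whose middle pencil admits a polynomial conserved quantity $p(t)=p_0+tp_1$ of degree $1$ with $p(0)=\mathfrak{p}$ such that $(p(t),p(t))$ is a non-zero constant; (b) $\Lambda:=f\cap\langle\mathfrak{p}\rangle^{\perp}$ is a rank $1$ bundle defining an isothermic surface $\Lambda:\Sigma\to\mathbb{P}(\mathcal{L}^{\mathfrak{p}})$ of the conformal geometry $\langle\mathfrak{p}\rangle^{\perp}$. In other words, the special $\Omega$-surfaces of type $1$ whose degree $1$ polynomial conserved quantity $p$ satisfies $(p(t),p(t))$ being a non-zero constant are the (Legendre lifts of) isothermic surfaces of the conformal geometry defined by $\langle p(0)\rangle^{\perp}$.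
   Context: $\mathbb{R}^{4,2}$ is a 6-dimensional real vector space with a non-degenerate symmetric bilinear form $(\,,\,)$ of signature $(4,2)$, $\mathcal{L}$ its lightcone; $\wedge^2\mathbb{R}^{4,2}\cong\mathfrak{o}(4,2)$ via $a\wedge b\,(c)=(a,c)b-(b,c)a$. $\Sigma$ is a smooth 2-manifold, $\underline{\mathbb{R}}^{4,2}=\Sigma\times\mathbb{R}^{4,2}$, $d$ its trivial connection. For a subbundle $W$ of $\underline{\mathbb{R}}^{4,2}$, $W^{(1)}$ is spanned by sections of $W$ and their derivatives. $\mathcal{Z}$ is the Grassmannian of isotropic 2-dimensional subspaces of $\mathbb{R}^{4,2}$; a smooth $f:\Sigma\to\mathcal{Z}$ is viewed as a rank 2 subbundle of $\underline{\mathbb{R}}^{4,2}$. It is a Legendre map if $f^{(1)}\le f^\perp$ and no non-zero $X\in T\Sigma$ satisfies $d_X\sigma\in f$ for all $\sigma\in\Gamma f$. A curvature sphere at $p$ is a line $s(p)\le f(p)$ such that the map $\sigma\mapsto d_X\sigma \bmod f$ kills $s(p)$ for all $X$ in some non-zero subspace $T_{s(p)}\le T_p\Sigma$ (taken maximal). $f$ is umbilic-free if there are exactly two curvature spheres at each point; they then form rank 1 bundles $s_1,s_2$ with $f=s_1\oplus s_2$ and curvature subbundles $T_1,T_2$, $T\Sigma=T_1\oplus T_2$. A gauge potential for $f$ is a closed $\eta\in\Omega^1(f\wedge f^\perp)$ with $[\eta\wedge\eta]=0$ (where $[\eta\wedge\eta](X,Y)=2[\eta(X),\eta(Y)]$;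 this is automatic for closed $\eta$ when $f$ is umbilic-free) such that $q(X,Y)=\mathrm{tr}(\sigma\mapsto\eta(X)d_Y\sigma:f\to f)$ is non-zero. $f$ is an $\Omega$-surface if it has a gauge potential with $q$ non-degenerate on a dense open set. Standing assumption: the signature of $q$ is constant on $\Sigma$. The gauge orbit is $\{\eta-d\tau:\tau\in\Gamma(\wedge^2f)\}$, and $q$ depends only on it. Let $S_1=\langle\sigma_1,d_Y\sigma_1,d_Yd_Y\sigma_1\rangle$, $S_2=\langle\sigma_2,d_X\sigma_2,d_Xd_X\sigma_2\rangle$ for $\sigma_i\in\Gamma s_i$, $X\in\Gamma T_1$, $Y\in\Gamma T_2$; then $\underline{\mathbb{R}}^{4,2}=S_1\oplus_\perp S_2$. The middle potential $\eta^{mid}$ is the unique member of the gauge orbit whose $S_1\wedge S_2$-component takes values in $\wedge^2f$; the middle pencil is the family of flat connections $\{d+t\eta^{mid}\}_{t\in\mathbb{R}}$. A polynomial conserved quantity of it is a non-zero polynomial $p(t)=\sum_k p_kt^k$ with $p_k\in\Gamma\underline{\mathbb{R}}^{4,2}$ and $(d+t\eta^{mid})p(t)=0$ for all $t\in\mathbb{R}$. A special $\Omega$-surface of type $d$ is an umbilic-free $\Omega$-surface whose middle pencil admits a polynomial conserved quantity of degree $d$. For $\mathfrak{p}$ non-lightlike, $\langle\mathfrak{p}\rangle^\perp$ defines a (Riemannian or Lorentzian) conformal geometry with point space $\mathbb{P}(\mathcal{L}^{\mathfrak{p}})$, $\mathcal{L}^{\mathfrak{p}}=\mathcal{L}\cap\langle\mathfrak{p}\rangle^\perp$.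 An isothermic surface is an immersion $\Lambda:\Sigma\to\mathbb{P}(\mathcal{L}^{\mathfrak{p}})$ (viewed as a null line subbundle) admitting a non-zero closed 1-form $\eta\in\Omega^1(\Lambda\wedge\Lambda^{(1)})$. A Legendre lift of $\Lambda$ is a Legendre map $f$ with $\Lambda\le f$.
   Formalization: In the definition of an isothermic surface, the "non-zero closed 1-form" is required to be non-zero on every connected component of Σ; for connected Σ this is the stated condition, while for disconnected Σ the equivalence fails without it. *)

theory Defs
  imports "HOL-Analysis.Analysis"
begin

section \<open>Smooth surfaces\<close>

primrec C_k_on :: "nat \<Rightarrow> 'm::euclidean_space set \<Rightarrow> ('m \<Rightarrow> 'b::real_normed_vector) \<Rightarrow> bool" where
  "C_k_on 0 S g \<longleftrightarrow> continuous_on S g"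
| "C_k_on (Suc k) S g \<longleftrightarrow> (\<forall>z\<in>S. g differentiable (at z)) \<and>
     (\<forall>v. C_k_on k S (\<lambda>z. frechet_derivative g (at z) v))"

text \<open>Only used for open sets \<open>S\<close>.\<close>

definition smooth_on :: "'m::euclidean_space set \<Rightarrow> ('m \<Rightarrow> 'b::real_normed_vector) \<Rightarrow> bool" where
  "smooth_on S g \<longleftrightarrow> (\<forall>k. C_k_on k S g)"

text \<open>A chart is a pair \<open>(U, \<phi>)\<close>; only the values of \<open>\<phi>\<close> on its domain \<open>U\<close> matter. The surface
  \<open>\<Sigma>\<close> is a whole (Hausdorff, second countable) type \<open>'a\<close> with a smooth atlas.\<close>

type_synonym 'a chart = "'a set \<times> ('a \<Rightarrow> real ^ 2)"

definition chart_inv :: "'a chart \<Rightarrow> real ^ 2 \<Rightarrow> 'a" where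
  "chart_inv c = inv_into (fst c) (snd c)"

definition smooth_surface :: "'a::{t2_space, second_countable_topology} chart set \<Rightarrow> bool" where
  "smooth_surface A \<longleftrightarrow>
     (\<Union>c\<in>A. fst c) = UNIV \<and>
     (\<forall>c\<in>A. open (fst c) \<and> open (snd c ` fst c) \<and>
            homeomorphism (fst c) (snd c ` fst c) (snd c) (chart_inv c)) \<and>
     (\<forall>c\<in>A. \<forall>c'\<in>A. smooth_on (snd c ` (fst c \<inter> fst c')) (snd c' \<circ> chart_inv c))"

text \<open>The tangent space at \<open>x\<close> is identified with \<open>\<real>\<^sup>2\<close> by means of a preferred chart around \<open>x\<close>;
  \<open>chart_to_tangent\<close> and \<open>tangent_to_chart\<close> convert between this identification and the
  coordinates given by an arbitrary chart \<open>c\<close> around \<open>x\<close>.\<close>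

definition chart_at :: "'a chart set \<Rightarrow> 'a \<Rightarrow> 'a chart" where
  "chart_at A x = (SOME c. c \<in> A \<and> x \<in> fst c)"

definition chart_to_tangent :: "'a chart set \<Rightarrow> 'a chart \<Rightarrow> 'a \<Rightarrow> real ^ 2 \<Rightarrow> real ^ 2" where
  "chart_to_tangent A c x v =
     frechet_derivative (snd (chart_at A x) \<circ> chart_inv c) (at (snd c x)) v"

definition tangent_to_chart :: "'a chart set \<Rightarrow> 'a chart \<Rightarrow> 'a \<Rightarrow> real ^ 2 \<Rightarrow> real ^ 2" where
  "tangent_to_chart A c x X =
     frechet_derivative (snd c \<circ> chart_inv (chart_at A x)) (at (snd (chart_at A x) x)) X"

definition smooth_fun ::
    "'a::topological_space chart set \<Rightarrow> 'a set \<Rightarrow> ('a \<Rightarrow> 'b::real_normed_vector) \<Rightarrow> bool" where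
  "smooth_fun A U g \<longleftrightarrow> (\<forall>c\<in>A. smooth_on (snd c ` (U \<inter> fst c)) (g \<circ> chart_inv c))"

text \<open>\<open>dder A g x X\<close> is \<open>d\<^sub>X g\<close> at \<open>x\<close>, for the trivial connection \<open>d\<close>.\<close>

definition dder :: "'a chart set \<Rightarrow> ('a \<Rightarrow> 'b::real_normed_vector) \<Rightarrow> 'a \<Rightarrow> real ^ 2 \<Rightarrow> 'b" where
  "dder A g x X = frechet_derivative (g \<circ> chart_inv (chart_at A x)) (at (snd (chart_at A x) x)) X"

text \<open>Subbundles of trivial bundles, and germs at \<open>x\<close> of smooth sections (respectively of smooth
  vector fields with values in a subbundle of the tangent bundle).\<close>

definition smooth_subbundle ::
    "'a::topological_space chart set \<Rightarrow> 'a set \<Rightarrow> nat \<Rightarrow> ('a \<Rightarrow> 'v::euclidean_space set) \<Rightarrow> bool" where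
  "smooth_subbundle A U r W \<longleftrightarrow>
     (\<forall>x\<in>U. subspace (W x) \<and> dim (W x) = r \<and>
        (\<exists>N (e :: nat \<Rightarrow> 'a \<Rightarrow> 'v). open N \<and> x \<in> N \<and> N \<subseteq> U \<and> (\<forall>i<r. smooth_fun A N (e i)) \<and>
           (\<forall>y\<in>N. W y = span ((\<lambda>i. e i y) ` {..<r}))))"

definition section_at ::
    "'a::topological_space chart set \<Rightarrow> ('a \<Rightarrow> 'b::real_normed_vector set) \<Rightarrow> 'a \<Rightarrow> ('a \<Rightarrow> 'b) \<Rightarrow> bool" where
  "section_at A W x \<sigma> \<longleftrightarrow>
     (\<exists>N. open N \<and> x \<in> N \<and> smooth_fun A N \<sigma> \<and> (\<forall>y\<in>N. \<sigma> y \<in> W y))"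

definition vector_field_at ::
    "'a::topological_space chart set \<Rightarrow> ('a \<Rightarrow> (real ^ 2) set) \<Rightarrow> 'a \<Rightarrow> ('a \<Rightarrow> real ^ 2) \<Rightarrow> bool" where
  "vector_field_at A T x Y \<longleftrightarrow>
     (\<exists>N. open N \<and> x \<in> N \<and> (\<forall>y\<in>N. Y y \<in> T y) \<and>
        (\<forall>c\<in>A. smooth_on (snd c ` (N \<inter> fst c))
                  ((\<lambda>y. tangent_to_chart A c y (Y y)) \<circ> chart_inv c)))"

text \<open>The derived bundle \<open>W\<^sup>(\<^sup>1\<^sup>)\<close>.\<close>

definition derived_bundle ::
    "'a::topological_space chart set \<Rightarrow> ('a \<Rightarrow> 'v::real_normed_vector set) \<Rightarrow> 'a \<Rightarrow> 'v set" where
  "derived_bundle A W x =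
     span ({\<sigma> x |\<sigma>. section_at A W x \<sigma>} \<union> {dder A \<sigma> x X |\<sigma> X. section_at A W x \<sigma>})"

text \<open>One-forms with values in a normed vector space, and their exterior derivative: in a chart \<open>c\<close>,
  \<open>(d\<eta>)(u, v) = \<partial>\<^sub>u(\<eta>(v)) - \<partial>\<^sub>v(\<eta>(u))\<close> for constant coordinate vector fields \<open>u\<close>, \<open>v\<close>.\<close>

definition form_in_chart ::
    "'a chart set \<Rightarrow> ('a \<Rightarrow> real ^ 2 \<Rightarrow> 'b) \<Rightarrow> 'a chart \<Rightarrow> real ^ 2 \<Rightarrow> real ^ 2 \<Rightarrow> 'b" where
  "form_in_chart A \<eta> c v z = \<eta> (chart_inv c z) (chart_to_tangent A c (chart_inv c z) v)"

definition one_form ::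
    "'a chart set \<Rightarrow> ('a \<Rightarrow> real ^ 2 \<Rightarrow> 'b::real_normed_vector) \<Rightarrow> bool" where
  "one_form A \<eta> \<longleftrightarrow> (\<forall>x. linear (\<eta> x)) \<and>
     (\<forall>c\<in>A. \<forall>v. smooth_on (snd c ` fst c) (form_in_chart A \<eta> c v))"

definition closed_form ::
    "'a chart set \<Rightarrow> ('a \<Rightarrow> real ^ 2 \<Rightarrow> 'b::real_normed_vector) \<Rightarrow> bool" where
  "closed_form A \<eta> \<longleftrightarrow>
     (\<forall>c\<in>A. \<forall>z\<in>snd c ` fst c. \<forall>u v.
        frechet_derivative (form_in_chart A \<eta> c v) (at z) u
        - frechet_derivative (form_in_chart A \<eta> c u) (at z) v = 0)"

text \<open>The surface is not required to be connected, so ``non-zero'' is read componentwise; on a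
  connected surface this says that \<open>\<eta>\<close> is not identically zero.\<close>

definition nonzero_form ::
    "('a::topological_space \<Rightarrow> real ^ 2 \<Rightarrow> 'b::real_normed_vector) \<Rightarrow> bool" where
  "nonzero_form \<eta> \<longleftrightarrow> (\<forall>C \<in> components UNIV. \<exists>x\<in>C. \<exists>X. \<eta> x X \<noteq> 0)"


section \<open>The space \<open>\<real>\<^sup>4\<^sup>,\<^sup>2\<close>\<close>

definition has_signature ::
    "('w::euclidean_space \<Rightarrow> 'w \<Rightarrow> real) \<Rightarrow> nat \<Rightarrow> nat \<Rightarrow> bool" where
  "has_signature b m n \<longleftrightarrow>
     (\<exists>E. independent E \<and> span E = UNIV \<and> (\<forall>e\<in>E. \<forall>e'\<in>E. e \<noteq> e' \<longrightarrow> b e e' = 0) \<and>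
        card {e \<in> E. b e e > 0} = m \<and> card {e \<in> E. b e e < 0} = n)"

text \<open>\<open>B\<close> makes the 6-dimensional vector space \<open>'v\<close> into \<open>\<real>\<^sup>4\<^sup>,\<^sup>2\<close>; the Euclidean structure of \<open>'v\<close>
  serves only to differentiate. Non-degeneracy follows from \<open>4 + 2 = 6\<close>.\<close>

definition R42_form :: "('v::euclidean_space \<Rightarrow> 'v \<Rightarrow> real) \<Rightarrow> bool" where
  "R42_form B \<longleftrightarrow> DIM('v) = 6 \<and> bilinear B \<and> (\<forall>a b. B a b = B b a) \<and> has_signature B 4 2"

definition lightcone :: "('v::euclidean_space \<Rightarrow> 'v \<Rightarrow> real) \<Rightarrow> 'v set" where
  "lightcone B = {v. B v v = 0}"

definition perp :: "('v::euclidean_space \<Rightarrow> 'v \<Rightarrow> real) \<Rightarrow> 'v set \<Rightarrow> 'v set" where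
  "perp B W = {v. \<forall>w\<in>W. B w v = 0}"

definition lie_grassmannian :: "('v::euclidean_space \<Rightarrow> 'v \<Rightarrow> real) \<Rightarrow> 'v set set" where
  "lie_grassmannian B = {W. subspace W \<and> dim W = 2 \<and> (\<forall>a\<in>W. \<forall>b\<in>W. B a b = 0)}"

text \<open>\<open>\<and>\<^sup>2\<real>\<^sup>4\<^sup>,\<^sup>2\<close> is realised as the skew endomorphisms of \<open>\<real>\<^sup>4\<^sup>,\<^sup>2\<close>.\<close>

definition wedge ::
    "('v::euclidean_space \<Rightarrow> 'v \<Rightarrow> real) \<Rightarrow> 'v \<Rightarrow> 'v \<Rightarrow> 'v \<Rightarrow>\<^sub>L 'v" where
  "wedge B a b = Blinfun (\<lambda>c. B a c *\<^sub>R b - B b c *\<^sub>R a)"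

definition wedge_space ::
    "('v::euclidean_space \<Rightarrow> 'v \<Rightarrow> real) \<Rightarrow> 'v set \<Rightarrow> 'v set \<Rightarrow> ('v \<Rightarrow>\<^sub>L 'v) set" where
  "wedge_space B V W = span {wedge B a b |a b. a \<in> V \<and> b \<in> W}"

text \<open>Trace of an endomorphism \<open>L\<close> of a subspace \<open>W\<close>.\<close>

definition trace_on :: "'v::euclidean_space set \<Rightarrow> ('v \<Rightarrow> 'v) \<Rightarrow> real" where
  "trace_on W L =
     (let E = (SOME E. independent E \<and> span E = W) in \<Sum>e\<in>E. representation E (L e) e)"


section \<open>Legendre maps and curvature spheres\<close>

definition legendre_map ::
    "'a::{t2_space, second_countable_topology} chart set \<Rightarrow> ('v::euclidean_space \<Rightarrow> 'v \<Rightarrow> real) \<Rightarrow>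
     ('a \<Rightarrow> 'v set) \<Rightarrow> bool" where
  "legendre_map A B f \<longleftrightarrow>
     (\<forall>x. f x \<in> lie_grassmannian B) \<and> smooth_subbundle A UNIV 2 f \<and>
     (\<forall>x. derived_bundle A f x \<subseteq> perp B (f x)) \<and>
     (\<forall>x X. (\<forall>\<sigma>. section_at A f x \<sigma> \<longrightarrow> dder A \<sigma> x X \<in> f x) \<longrightarrow> X = 0)"

text \<open>The maximal space of \<open>X \<in> T\<^sub>x\<Sigma>\<close> for which \<open>\<sigma> \<mapsto> d\<^sub>X\<sigma> mod f\<close>, a tensorial map on \<open>f x\<close>, kills
  the line \<open>l\<close>.\<close>

definition curvature_space ::
    "'a::topological_space chart set \<Rightarrow> ('a \<Rightarrow> 'v::euclidean_space set) \<Rightarrow> 'a \<Rightarrow> 'v set \<Rightarrow> (real ^ 2) set" where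
  "curvature_space A f x l = {X. \<forall>\<sigma>. section_at A f x \<sigma> \<and> \<sigma> x \<in> l \<longrightarrow> dder A \<sigma> x X \<in> f x}"

definition curvature_spheres ::
    "'a::topological_space chart set \<Rightarrow> ('a \<Rightarrow> 'v::euclidean_space set) \<Rightarrow> 'a \<Rightarrow> 'v set set" where
  "curvature_spheres A f x =
     {l. subspace l \<and> dim l = 1 \<and> l \<subseteq> f x \<and> (\<exists>X\<in>curvature_space A f x l. X \<noteq> 0)}"

definition umbilic_free ::
    "'a::topological_space chart set \<Rightarrow> ('a \<Rightarrow> 'v::euclidean_space set) \<Rightarrow> bool" where
  "umbilic_free A f \<longleftrightarrow> (\<forall>x. card (curvature_spheres A f x) = 2)"

text \<open>The curvature sphere bundles \<open>s\<^sub>1\<close>, \<open>s\<^sub>2\<close> over an open set \<open>U\<close>. They are labelled only locally,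
  since monodromy may interchange them; nothing below depends on the labelling.\<close>

definition curvature_sphere_bundles ::
    "'a::topological_space chart set \<Rightarrow> ('a \<Rightarrow> 'v::euclidean_space set) \<Rightarrow> 'a set \<Rightarrow>
     ('a \<Rightarrow> 'v set) \<Rightarrow> ('a \<Rightarrow> 'v set) \<Rightarrow> bool" where
  "curvature_sphere_bundles A f U s1 s2 \<longleftrightarrow>
     open U \<and> smooth_subbundle A U 1 s1 \<and> smooth_subbundle A U 1 s2 \<and>
     (\<forall>y\<in>U. s1 y \<noteq> s2 y \<and> curvature_spheres A f y = {s1 y, s2 y})"

text \<open>\<open>\<langle>\<sigma>, d\<^sub>Y\<sigma>, d\<^sub>Yd\<^sub>Y\<sigma>\<rangle>\<close> at \<open>x\<close>, for \<open>\<sigma> \<in> \<Gamma>s\<close> and \<open>Y \<in> \<Gamma>T\<close>.\<close>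

definition second_osculating ::
    "'a::topological_space chart set \<Rightarrow> ('a \<Rightarrow> 'v::euclidean_space set) \<Rightarrow> ('a \<Rightarrow> (real ^ 2) set) \<Rightarrow>
     'a \<Rightarrow> 'v set" where
  "second_osculating A s T x =
     span (\<Union>{{\<sigma> x, dder A \<sigma> x (Y x), dder A (\<lambda>y. dder A \<sigma> y (Y y)) x (Y x)} |\<sigma> Y.
              section_at A s x \<sigma> \<and> vector_field_at A T x Y})"


section \<open>Gauge potentials and \<open>\<Omega>\<close>-surfaces\<close>

text \<open>\<open>q(X, Y) = tr (\<sigma> \<mapsto> \<eta>(X) d\<^sub>Y\<sigma> : f \<rightarrow> f)\<close>; the value of \<open>\<eta>(X) d\<^sub>Y\<sigma>\<close> at \<open>x\<close> depends only on
  \<open>\<sigma> x\<close> when \<open>f\<close> is a Legendre map and \<open>\<eta>\<close> takes values in \<open>f \<and> f\<^sup>\<bottom>\<close>.\<close>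

definition q_endo ::
    "'a::topological_space chart set \<Rightarrow> ('a \<Rightarrow> 'v::euclidean_space set) \<Rightarrow>
     ('a \<Rightarrow> real ^ 2 \<Rightarrow> 'v \<Rightarrow>\<^sub>L 'v) \<Rightarrow> 'a \<Rightarrow> real ^ 2 \<Rightarrow> real ^ 2 \<Rightarrow> 'v \<Rightarrow> 'v" where
  "q_endo A f \<eta> x X Y a =
     (THE w. \<exists>\<sigma>. section_at A f x \<sigma> \<and> \<sigma> x = a \<and> w = blinfun_apply (\<eta> x X) (dder A \<sigma> x Y))"

definition q_form ::
    "'a::topological_space chart set \<Rightarrow> ('a \<Rightarrow> 'v::euclidean_space set) \<Rightarrow>
     ('a \<Rightarrow> real ^ 2 \<Rightarrow> 'v \<Rightarrow>\<^sub>L 'v) \<Rightarrow> 'a \<Rightarrow> real ^ 2 \<Rightarrow> real ^ 2 \<Rightarrow> real" where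
  "q_form A f \<eta> x X Y = trace_on (f x) (q_endo A f \<eta> x X Y)"

definition gauge_potential ::
    "'a::{t2_space, second_countable_topology} chart set \<Rightarrow> ('v::euclidean_space \<Rightarrow> 'v \<Rightarrow> real) \<Rightarrow>
     ('a \<Rightarrow> 'v set) \<Rightarrow> ('a \<Rightarrow> real ^ 2 \<Rightarrow> 'v \<Rightarrow>\<^sub>L 'v) \<Rightarrow> bool" where
  "gauge_potential A B f \<eta> \<longleftrightarrow>
     one_form A \<eta> \<and> closed_form A \<eta> \<and>
     (\<forall>x X. \<eta> x X \<in> wedge_space B (f x) (perp B (f x))) \<and>
     (\<forall>x X Y. 2 *\<^sub>R (\<eta> x X o\<^sub>L \<eta> x Y - \<eta> x Y o\<^sub>L \<eta> x X) = 0) \<and>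
     (\<exists>x X Y. q_form A f \<eta> x X Y \<noteq> 0)"

text \<open>The last conjunct is the standing assumption that the signature of \<open>q\<close> is constant.\<close>

definition Omega_potential ::
    "'a::{t2_space, second_countable_topology} chart set \<Rightarrow> ('v::euclidean_space \<Rightarrow> 'v \<Rightarrow> real) \<Rightarrow>
     ('a \<Rightarrow> 'v set) \<Rightarrow> ('a \<Rightarrow> real ^ 2 \<Rightarrow> 'v \<Rightarrow>\<^sub>L 'v) \<Rightarrow> bool" where
  "Omega_potential A B f \<eta> \<longleftrightarrow>
     gauge_potential A B f \<eta> \<and>
     (\<exists>D. open D \<and> closure D = UNIV \<and>
          (\<forall>x\<in>D. \<forall>X. (\<forall>Y. q_form A f \<eta> x X Y = 0) \<longrightarrow> X = 0)) \<and>
     (\<exists>m n. \<forall>x. has_signature (q_form A f \<eta> x) m n)"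

definition gauge_orbit ::
    "'a::topological_space chart set \<Rightarrow> ('v::euclidean_space \<Rightarrow> 'v \<Rightarrow> real) \<Rightarrow>
     ('a \<Rightarrow> 'v set) \<Rightarrow> ('a \<Rightarrow> real ^ 2 \<Rightarrow> 'v \<Rightarrow>\<^sub>L 'v) \<Rightarrow> ('a \<Rightarrow> real ^ 2 \<Rightarrow> 'v \<Rightarrow>\<^sub>L 'v) set" where
  "gauge_orbit A B f \<eta> =
     {(\<lambda>x X. \<eta> x X - dder A \<tau> x X) |\<tau>.
        smooth_fun A UNIV \<tau> \<and> (\<forall>x. \<tau> x \<in> wedge_space B (f x) (f x))}"

text \<open>\<open>\<eta>'\<close> is the middle potential in the gauge orbit of \<open>\<eta>\<close>: with respect to
  \<open>\<and>\<^sup>2(S\<^sub>1 \<oplus> S\<^sub>2) = \<and>\<^sup>2S\<^sub>1 \<oplus> \<and>\<^sup>2S\<^sub>2 \<oplus> S\<^sub>1 \<and> S\<^sub>2\<close>, its last component \<open>c\<close> has values in \<open>\<and>\<^sup>2f\<close>.\<close>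

definition middle_potential ::
    "'a::topological_space chart set \<Rightarrow> ('v::euclidean_space \<Rightarrow> 'v \<Rightarrow> real) \<Rightarrow>
     ('a \<Rightarrow> 'v set) \<Rightarrow> ('a \<Rightarrow> real ^ 2 \<Rightarrow> 'v \<Rightarrow>\<^sub>L 'v) \<Rightarrow> ('a \<Rightarrow> real ^ 2 \<Rightarrow> 'v \<Rightarrow>\<^sub>L 'v) \<Rightarrow> bool" where
  "middle_potential A B f \<eta> \<eta>' \<longleftrightarrow>
     \<eta>' \<in> gauge_orbit A B f \<eta> \<and>
     (\<forall>x. \<exists>U s1 s2. curvature_sphere_bundles A f U s1 s2 \<and> x \<in> U \<and>
        (let S1 = second_osculating A s1 (\<lambda>y. curvature_space A f y (s2 y)) x;
             S2 = second_osculating A s2 (\<lambda>y. curvature_space A f y (s1 y)) x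
         in \<forall>X. \<exists>b1 b2 c. \<eta>' x X = b1 + b2 + c \<and>
              b1 \<in> wedge_space B S1 S1 \<and> b2 \<in> wedge_space B S2 S2 \<and> c \<in> wedge_space B S1 S2 \<and>
              c \<in> wedge_space B (f x) (f x)))"

text \<open>A polynomial \<open>p(t) = \<Sum>\<^sub>k p\<^sub>k t\<^sup>k\<close> of sections is given by its coefficients.\<close>

definition poly_section :: "(nat \<Rightarrow> 'a \<Rightarrow> 'v::real_vector) \<Rightarrow> nat \<Rightarrow> real \<Rightarrow> 'a \<Rightarrow> 'v" where
  "poly_section p n t x = (\<Sum>k\<le>n. t ^ k *\<^sub>R p k x)"

definition conserved_polynomial ::
    "'a::topological_space chart set \<Rightarrow> ('a \<Rightarrow> real ^ 2 \<Rightarrow> 'v::euclidean_space \<Rightarrow>\<^sub>L 'v) \<Rightarrow>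
     (nat \<Rightarrow> 'a \<Rightarrow> 'v) \<Rightarrow> nat \<Rightarrow> bool" where
  "conserved_polynomial A \<eta> p n \<longleftrightarrow>
     (\<forall>k. smooth_fun A UNIV (p k)) \<and>
     (\<exists>x. p n x \<noteq> 0) \<and> (\<forall>k>n. \<forall>x. p k x = 0) \<and>
     (\<forall>t x X. dder A (poly_section p n t) x X + t *\<^sub>R blinfun_apply (\<eta> x X) (poly_section p n t x) = 0)"

definition special_Omega_surface ::
    "'a::{t2_space, second_countable_topology} chart set \<Rightarrow> ('v::euclidean_space \<Rightarrow> 'v \<Rightarrow> real) \<Rightarrow>
     ('a \<Rightarrow> 'v set) \<Rightarrow> ('a \<Rightarrow> real ^ 2 \<Rightarrow> 'v \<Rightarrow>\<^sub>L 'v) \<Rightarrow> nat \<Rightarrow> bool" where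
  "special_Omega_surface A B f \<eta> n \<longleftrightarrow>
     legendre_map A B f \<and> umbilic_free A f \<and> Omega_potential A B f \<eta> \<and>
     (\<exists>\<eta>' p. middle_potential A B f \<eta> \<eta>' \<and> conserved_polynomial A \<eta>' p n)"


section \<open>Isothermic surfaces\<close>

text \<open>A map \<open>\<Lambda>\<close> into \<open>\<P>(\<L>\<^sup>\<pp>)\<close> is viewed as a null line bundle. The differential of \<open>\<Lambda>\<close> at \<open>x\<close> is
  \<open>X \<mapsto> (\<sigma> \<mapsto> d\<^sub>X\<sigma> mod \<Lambda>)\<close>, and \<open>\<Lambda>\<close> is immersed when it is injective.\<close>

definition isothermic_surface ::
    "'a::{t2_space, second_countable_topology} chart set \<Rightarrow> ('v::euclidean_space \<Rightarrow> 'v \<Rightarrow> real) \<Rightarrow>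
     'v \<Rightarrow> ('a \<Rightarrow> 'v set) \<Rightarrow> bool" where
  "isothermic_surface A B \<pp> \<Lambda> \<longleftrightarrow>
     smooth_subbundle A UNIV 1 \<Lambda> \<and>
     (\<forall>x. \<Lambda> x \<subseteq> lightcone B \<inter> perp B {\<pp>}) \<and>
     (\<forall>x X. (\<forall>\<sigma>. section_at A \<Lambda> x \<sigma> \<longrightarrow> dder A \<sigma> x X \<in> \<Lambda> x) \<longrightarrow> X = 0) \<and>
     (\<exists>\<eta>. one_form A \<eta> \<and> closed_form A \<eta> \<and> nonzero_form \<eta> \<and>
          (\<forall>x X. \<eta> x X \<in> wedge_space B (\<Lambda> x) (derived_bundle A \<Lambda> x)))"

end

theory Submission
  imports Defs
begin

text \<open>
  Choose local sections \<open>s\<^sub>1\<close>, \<open>s\<^sub>2\<close> of the curvature sphere bundles and \<open>X\<close>, \<open>Y\<close> of the curvature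
  subbundles, so that \<open>d\<^sub>X s\<^sub>1, d\<^sub>Y s\<^sub>2 \<in> f\<close>, while \<open>y\<^sub>1 = d\<^sub>Y s\<^sub>1\<close> and \<open>x\<^sub>2 = d\<^sub>X s\<^sub>2\<close> form an orthogonal basis of
  the Euclidean plane \<open>f\<^sup>\<bottom>/f\<close>. A closed \<open>\<eta>\<close> with values in \<open>f \<and> f\<^sup>\<bottom>\<close> kills \<open>f\<close>, and differentiating
  \<open>\<eta>(v) r = 0\<close> gives \<open>\<eta>(v) d\<^sub>u r = \<eta>(u) d\<^sub>v r\<close> for sections \<open>r\<close> of \<open>f\<close>; in particular \<open>\<eta>(X) y\<^sub>1 = \<eta>(Y) x\<^sub>2 = 0\<close>.

  If \<open>\<pp> + t p\<^sub>1\<close> is conserved, then \<open>\<eta>\<^sup>m\<^sup>i\<^sup>d p\<^sub>1 = 0\<close> and \<open>d p\<^sub>1 = - \<eta>\<^sup>m\<^sup>i\<^sup>d \<pp>\<close>. Since \<open>\<eta>\<^sup>m\<^sup>i\<^sup>d(Y) y\<^sub>1\<close> and \<open>\<eta>\<^sup>m\<^sup>i\<^sup>d(X) x\<^sub>2\<close> are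
  non-zero multiples of \<open>s\<^sub>1\<close> and \<open>s\<^sub>2\<close>, this forces \<open>p\<^sub>1 = \<alpha> u\<^sub>1 s\<^sub>1 + \<beta> u\<^sub>2 s\<^sub>2\<close> with \<open>u\<^sub>i = (s\<^sub>i, \<pp>)\<close> and \<open>\<alpha>, \<beta> \<noteq> 0\<close>,
  and \<open>(p\<^sub>1, \<pp>) = 0\<close> reads \<open>\<alpha> u\<^sub>1\<^sup>2 + \<beta> u\<^sub>2\<^sup>2 = 0\<close>. The \<open>u\<^sub>i\<close> vanish nowhere, as otherwise \<open>\<pp>\<close> would be null, so
  \<open>p\<^sub>1\<close> spans \<open>\<Lambda>\<close>; the gauge transform of \<open>\<eta>\<^sup>m\<^sup>i\<^sup>d\<close> that kills \<open>\<pp>\<close> takes values in \<open>\<Lambda> \<and> \<Lambda>\<^sup>(\<^sup>1\<^sup>)\<close>.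

  Conversely, scale the \<open>s\<^sub>i\<close> so that \<open>s = s\<^sub>1 + s\<^sub>2\<close> spans \<open>\<Lambda>\<close>. Closedness gives \<open>\<eta>(X) = b s \<and> d\<^sub>X s\<close> and
  \<open>\<eta>(Y) = - b s \<and> d\<^sub>Y s\<close>, where \<open>b\<close> solves a linear total differential system and hence has no zeros. Then
  \<open>\<tau> = b s\<^sub>1 \<and> s\<^sub>2\<close> defines the middle potential \<open>\<eta> - d\<tau>\<close>, and \<open>\<pp> + t \<tau> \<pp>\<close> is conserved.
\<close>

section \<open>Smooth functions\<close>

text \<open>The curvature spheres carry no global labels, since monodromy may interchange them. The
  computations therefore run in local frames over plane domains, and the gauge transformation
  \<open>\<tau>\<close> has to be glued. Towards (b) it is \<open>p1\<close> wedged with any vector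
  \<open>n\<close> of \<open>f\<close> with \<open>B n p = 1\<close>; two such vectors differ by a
  multiple of \<open>p1\<close>. Towards (a) the value \<open>b s1 \<and> s2\<close> is pinned down
  pointwise by a condition that mentions no frame. The middle condition enters through one
  consequence: the potential maps the derivatives of a section with value in a curvature sphere back
  into that sphere. So \<open>\<eta>(Y) y1\<close> and \<open>\<eta>(X) x2\<close> are multiples of
  \<open>s1\<close> and \<open>s2\<close>; the factors are the diagonal entries of \<open>q\<close>
  in the curvature directions, and non-degeneracy of \<open>q\<close>, a gauge invariant, makes them
  non-zero. Umbilic-freeness is a mere count at each point, so smooth curvature sphere bundles must
  first be constructed; they come from the two simple roots of a quadratic equation.\<close>

abbreviation fd :: "('m::real_normed_vector \<Rightarrow> 'b::real_normed_vector) \<Rightarrow> 'm \<Rightarrow> 'm \<Rightarrow> 'b"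
  where "fd g z \<equiv> frechet_derivative g (at z)"

lemma has_derivative_fd: "g differentiable at z \<Longrightarrow> (g has_derivative fd g z) (at z)"
  by (simp add: frechet_derivative_works)

lemma fd_eq: "(g has_derivative g') (at z) \<Longrightarrow> fd g z = g'"
  by (metis frechet_derivative_at)

lemma differentiable_cong_open:
  assumes "open S" "z \<in> S" "\<And>y. y \<in> S \<Longrightarrow> f y = g y" "f differentiable at z"
  shows "g differentiable at z"
  using assms by (meson differentiable_def has_derivative_transform_within_open)

lemma fd_cong_open:
  assumes "open S" "z \<in> S" "\<And>y. y \<in> S \<Longrightarrow> f y = g y"
  shows "fd f z = fd g z"
proof (cases "f differentiable at z")
  case True
  then show ?thesis
    using frechet_derivative_transform_within_open[OF True assms(1,2)] assms(3) by simp
next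
  case False
  \<comment> \<open>Neither function has a derivative here, so both values of
    \<open>frechet_derivative\<close> are choices from the same unsatisfiable predicate and hence
    equal.\<close>
  then have "\<not> (f has_derivative h) (at z)" "\<not> (g has_derivative h) (at z)" for h
    using differentiable_cong_open[of S z g f] assms by (auto simp: differentiable_def)
  then show ?thesis by (simp add: frechet_derivative_def)
qed

lemma C_k_on_cong:
  assumes "open S" "\<And>z. z \<in> S \<Longrightarrow> f z = g z" "C_k_on k S f"
  shows "C_k_on k S g"
  using assms(2,3)
proof (induction k arbitrary: f g)
  case 0
  then show ?case using continuous_on_cong by (metis C_k_on.simps(1))
next
  case (Suc k)
  have "g differentiable at z" if "z \<in> S" for z
    using differentiable_cong_open[OF assms(1) that Suc.prems(1)] Suc.prems(2) that by auto
  moreover have "fd f z v = fd g z v" if "z \<in> S" for z v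
    using fd_cong_open[OF assms(1) that Suc.prems(1)] by simp
  then have "C_k_on k S (\<lambda>z. fd g z v)" for v
    using Suc.IH[of "\<lambda>z. fd f z v"] Suc.prems(2) by simp
  ultimately show ?case by simp
qed

text \<open>Derivatives are unique, so a derivative \<open>G\<close> found by the usual rules may
  stand in for \<open>frechet_derivative\<close>, which the definition of \<open>C_k_on\<close>
  mentions.\<close>

lemma C_k_on_SucI:
  assumes "open S" "\<And>z. z \<in> S \<Longrightarrow> (g has_derivative G z) (at z)" "\<And>v. C_k_on k S (\<lambda>z. G z v)"
  shows "C_k_on (Suc k) S g"
proof -
  have "g differentiable at z" if "z \<in> S" for z
    using assms(2)[OF that] differentiable_def by blast
  moreover have "C_k_on k S (\<lambda>z. fd g z v)" for v
    by (rule C_k_on_cong[OF assms(1) _ assms(3)[of v]]) (simp add: fd_eq[OF assms(2)])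
  ultimately show ?thesis by simp
qed

lemma C_k_on_Suc_fd: "C_k_on (Suc k) S f \<Longrightarrow> z \<in> S \<Longrightarrow> (f has_derivative fd f z) (at z)"
  by (simp add: has_derivative_fd)

lemma C_k_on_Suc_fd2: "C_k_on (Suc k) S f \<Longrightarrow> C_k_on k S (\<lambda>z. fd f z v)"
  by simp

lemma C_k_on_mono: "C_k_on k S f \<Longrightarrow> T \<subseteq> S \<Longrightarrow> C_k_on k T f"
  by (induction k arbitrary: f) (auto intro: continuous_on_subset)

lemma C_k_on_SucD: "C_k_on (Suc k) S f \<Longrightarrow> C_k_on k S f"
proof (induction k arbitrary: f)
  case 0
  then show ?case
    by (simp add: continuous_at_imp_continuous_on differentiable_imp_continuous_within)
next
  case (Suc k)
  then show ?case by (metis C_k_on.simps(2))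
qed

lemma C_k_on_const: "C_k_on k S (\<lambda>_. c)"
  by (induction k arbitrary: c) auto

lemma C_k_on_add:
  assumes "open S" "C_k_on k S f" "C_k_on k S g"
  shows "C_k_on k S (\<lambda>z. f z + g z)"
  using assms(2,3)
proof (induction k arbitrary: f g)
  case 0
  then show ?case by (simp add: continuous_on_add)
next
  case (Suc k)
  show ?case
    by (rule C_k_on_SucI[OF assms(1) has_derivative_add[OF C_k_on_Suc_fd C_k_on_Suc_fd]])
      (use Suc in auto)
qed

lemma C_k_on_bilinear:
  assumes "bounded_bilinear h" "open S" "C_k_on k S f" "C_k_on k S g"
  shows "C_k_on k S (\<lambda>z. h (f z) (g z))"
  using assms(3,4)
proof (induction k arbitrary: f g)
  case 0
  then show ?case by (simp add: bounded_bilinear.continuous_on[OF assms(1)])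
next
  case (Suc k)
  show ?case
  proof (rule C_k_on_SucI[OF assms(2) bounded_bilinear.FDERIV[OF assms(1) C_k_on_Suc_fd C_k_on_Suc_fd]])
    show "C_k_on k S (\<lambda>z. h (f z) (fd g z v) + h (fd f z v) (g z))" for v
      by (intro C_k_on_add assms Suc.IH C_k_on_SucD[OF Suc.prems(1)] C_k_on_SucD[OF Suc.prems(2)]
          C_k_on_Suc_fd2[OF Suc.prems(1)] C_k_on_Suc_fd2[OF Suc.prems(2)])
  qed (use Suc.prems in auto)
qed

text \<open>The bilinear rule applied to \<open>r *\<^sub>R h x\<close> with the constant scalar
  1.\<close>

lemma C_k_on_linear:
  assumes "bounded_linear h" "open S" "C_k_on k S f"
  shows "C_k_on k S (\<lambda>z. h (f z))"
proof -
  have "bounded_bilinear (\<lambda>(r::real) x. r *\<^sub>R h x)"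
    using bounded_bilinear.comp[OF bounded_bilinear_scaleR bounded_linear_ident assms(1)] by simp
  from C_k_on_bilinear[OF this assms(2) C_k_on_const[of k S 1] assms(3)] show ?thesis by simp
qed

lemma C_k_on_sum:
  assumes "open S" "finite I" "\<And>i. i \<in> I \<Longrightarrow> C_k_on k S (f i)"
  shows "C_k_on k S (\<lambda>z. \<Sum>i\<in>I. f i z)"
  using assms(2,3) by (induction I rule: finite_induct) (auto simp: C_k_on_const intro: C_k_on_add[OF assms(1)])

text \<open>The derivative of \<open>1/g\<close> is built from the derivative of \<open>g\<close>
  and \<open>1/g\<close> itself, so smoothness of one order less, available from the induction,
  closes the step.\<close>

lemma C_k_on_inverse:
  fixes g :: "'m::euclidean_space \<Rightarrow> real"
  assumes "open S" "C_k_on k S g" "\<And>z. z \<in> S \<Longrightarrow> g z \<noteq> 0"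
  shows "C_k_on k S (\<lambda>z. inverse (g z))"
  using assms(2)
proof (induction k)
  case 0
  then show ?case using assms(3) by (simp add: continuous_on_inverse)
next
  case (Suc k)
  have IH: "C_k_on k S (\<lambda>z. inverse (g z))" using Suc C_k_on_SucD by blast
  have d: "((\<lambda>z. inverse (g z)) has_derivative (\<lambda>v. - (inverse (g z) * fd g z v * inverse (g z)))) (at z)"
    if "z \<in> S" for z
    using Suc.prems that assms(3) by (intro Deriv.has_derivative_inverse has_derivative_fd) auto
  have "C_k_on k S (\<lambda>z. - (inverse (g z) * fd g z v * inverse (g z)))" for v
    using Suc.prems IH
    by (intro C_k_on_linear[OF bounded_linear_minus[OF bounded_linear_ident]] C_k_on_bilinear[OF bounded_bilinear_mult] assms(1)) auto
  then show ?case using C_k_on_SucI[OF assms(1) d] by blast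
qed

text \<open>As for the inverse: besides the derivative of \<open>g\<close>, only
  \<open>sqrt g\<close> occurs in the derivative, at one order less.\<close>

lemma C_k_on_sqrt:
  fixes g :: "'m::euclidean_space \<Rightarrow> real"
  assumes "open S" "C_k_on k S g" "\<And>z. z \<in> S \<Longrightarrow> g z > 0"
  shows "C_k_on k S (\<lambda>z. sqrt (g z))"
  using assms(2)
proof (induction k)
  case 0
  then show ?case by (simp add: continuous_on_real_sqrt)
next
  case (Suc k)
  have IH: "C_k_on k S (\<lambda>z. sqrt (g z))" using Suc C_k_on_SucD by blast
  have "C_k_on k S g" using Suc.prems C_k_on_SucD by blast
  from C_k_on_inverse[OF assms(1) IH] have inv: "C_k_on k S (\<lambda>z. inverse (sqrt (g z)))"
    using assms(3) by force
  have d: "((\<lambda>z. sqrt (g z)) has_derivative (\<lambda>v. fd g z v * (inverse (sqrt (g z)) / 2))) (at z)"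
    if "z \<in> S" for z
    using has_derivative_real_sqrt[OF assms(3)[OF that] has_derivative_fd[of g z]] Suc.prems that
    by (simp add: field_simps)
  have "C_k_on k S (\<lambda>z. fd g z v * (inverse (sqrt (g z)) / 2))" for v
    using Suc.prems inv
    by (intro C_k_on_linear[OF bounded_linear_divide[of 2]] C_k_on_bilinear[OF bounded_bilinear_mult] assms(1)) auto
  then show ?case using C_k_on_SucI[OF assms(1) d] by blast
qed

lemma linear_basis_expand:
  fixes L :: "'m::euclidean_space \<Rightarrow> 'b::real_vector"
  assumes "linear L"
  shows "L v = (\<Sum>b\<in>Basis. (v \<bullet> b) *\<^sub>R L b)"
  by (metis (no_types, lifting) assms euclidean_representation linear_cmul linear_sum sum.cong)

text \<open>\<open>C_k_on\<close> controls derivatives in fixed directions only, while the chain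
  rule differentiates \<open>g\<close> in the moving direction \<open>fd f z v\<close>. Expanding
  that direction in the basis leaves products of functions covered by the induction.\<close>

lemma C_k_on_compose:
  fixes f :: "'m::euclidean_space \<Rightarrow> 'n::euclidean_space"
  assumes "open S" "C_k_on k S f" "C_k_on k T g" "\<And>z. z \<in> S \<Longrightarrow> f z \<in> T"
  shows "C_k_on k S (\<lambda>z. g (f z))"
  using assms(2,3)
proof (induction k arbitrary: g)
  case 0
  then show ?case using assms(4) continuous_on_compose2 by (metis C_k_on.simps(1) image_subsetI)
next
  case (Suc k)
  have d: "((\<lambda>z. g (f z)) has_derivative (\<lambda>v. \<Sum>b\<in>Basis. (fd f z v \<bullet> b) *\<^sub>R fd g (f z) b)) (at z)"
    if "z \<in> S" for z
  proof -
    have g: "g differentiable at (f z)" "f differentiable at z" using Suc.prems assms(4) that by auto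
    have "((\<lambda>z. g (f z)) has_derivative (\<lambda>v. fd g (f z) (fd f z v))) (at z)"
      using has_derivative_compose[OF has_derivative_fd[OF g(2)] has_derivative_fd[OF g(1)]] .
    moreover have "fd g (f z) (fd f z v) = (\<Sum>b\<in>Basis. (fd f z v \<bullet> b) *\<^sub>R fd g (f z) b)" for v
      using linear_basis_expand[OF linear_frechet_derivative[OF g(1)]] .
    ultimately show ?thesis by simp
  qed
  have "C_k_on k S (\<lambda>z. \<Sum>b\<in>Basis. (fd f z v \<bullet> b) *\<^sub>R fd g (f z) b)" for v
    using Suc.prems C_k_on_SucD[OF Suc.prems(1)]
    by (intro C_k_on_sum C_k_on_bilinear[OF bounded_bilinear_scaleR] C_k_on_bilinear[OF bounded_bilinear_inner]
          C_k_on_const assms(1) Suc.IH) auto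
  then show ?case using C_k_on_SucI[OF assms(1) d] by blast
qed

lemma C_k_on_local:
  assumes "\<And>z. z \<in> S \<Longrightarrow> \<exists>N. open N \<and> z \<in> N \<and> C_k_on k N g"
  shows "C_k_on k S g"
  using assms
proof (induction k arbitrary: g)
  case 0
  have "continuous (at z within S) g" if z: "z \<in> S" for z
  proof -
    obtain N where "open N" "z \<in> N" "continuous_on N g" using 0 z by auto
    then show ?thesis by (meson continuous_at_imp_continuous_within continuous_on_eq_continuous_at)
  qed
  then show ?case by (simp add: continuous_on_eq_continuous_within)
next
  case (Suc k)
  then show ?case by (simp; meson)
qed

lemma smooth_on_cong: "open S \<Longrightarrow> smooth_on S f \<Longrightarrow> (\<And>z. z \<in> S \<Longrightarrow> f z = g z) \<Longrightarrow> smooth_on S g"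
  unfolding smooth_on_def using C_k_on_cong by blast

lemma smooth_on_subset: "smooth_on S f \<Longrightarrow> T \<subseteq> S \<Longrightarrow> smooth_on T f"
  unfolding smooth_on_def using C_k_on_mono by blast

lemma smooth_on_local:
  assumes "\<And>z. z \<in> S \<Longrightarrow> \<exists>N. open N \<and> z \<in> N \<and> smooth_on N g"
  shows "smooth_on S g"
  unfolding smooth_on_def using C_k_on_local[of S _ g] assms unfolding smooth_on_def by meson

lemma smooth_on_differentiable: "smooth_on S f \<Longrightarrow> z \<in> S \<Longrightarrow> f differentiable at z"
  unfolding smooth_on_def using C_k_on.simps(2) by blast

lemma smooth_on_continuous: "smooth_on S f \<Longrightarrow> continuous_on S f"
  unfolding smooth_on_def using C_k_on.simps(1) by blast

lemma smooth_on_fd_const: "smooth_on S f \<Longrightarrow> smooth_on S (\<lambda>z. fd f z v)"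
  unfolding smooth_on_def using C_k_on.simps(2) by blast

lemma smooth_on_const: "smooth_on S (\<lambda>_. c)"
  unfolding smooth_on_def using C_k_on_const by blast

lemma smooth_on_linear: "bounded_linear h \<Longrightarrow> open S \<Longrightarrow> smooth_on S f \<Longrightarrow> smooth_on S (\<lambda>z. h (f z))"
  unfolding smooth_on_def using C_k_on_linear by blast

lemma smooth_on_bilinear:
  "bounded_bilinear h \<Longrightarrow> open S \<Longrightarrow> smooth_on S f \<Longrightarrow> smooth_on S g \<Longrightarrow> smooth_on S (\<lambda>z. h (f z) (g z))"
  unfolding smooth_on_def using C_k_on_bilinear by blast

lemma smooth_on_add: "open S \<Longrightarrow> smooth_on S f \<Longrightarrow> smooth_on S g \<Longrightarrow> smooth_on S (\<lambda>z. f z + g z)"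
  unfolding smooth_on_def using C_k_on_add by blast

lemma smooth_on_minus: "open S \<Longrightarrow> smooth_on S f \<Longrightarrow> smooth_on S (\<lambda>z. - f z)"
  using smooth_on_linear[OF bounded_linear_minus[OF bounded_linear_ident]] .

lemma smooth_on_diff: "open S \<Longrightarrow> smooth_on S f \<Longrightarrow> smooth_on S g \<Longrightarrow> smooth_on S (\<lambda>z. f z - g z)"
  using smooth_on_add[of S f "\<lambda>z. - g z"] smooth_on_minus by fastforce

lemma smooth_on_sum:
  "open S \<Longrightarrow> finite I \<Longrightarrow> (\<And>i. i \<in> I \<Longrightarrow> smooth_on S (f i)) \<Longrightarrow> smooth_on S (\<lambda>z. \<Sum>i\<in>I. f i z)"
  unfolding smooth_on_def using C_k_on_sum by blast

lemmas smooth_on_scaleR = smooth_on_bilinear[OF bounded_bilinear_scaleR]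
lemmas smooth_on_inner = smooth_on_bilinear[OF bounded_bilinear_inner]

lemma smooth_on_mult:
  fixes f g :: "'m::euclidean_space \<Rightarrow> real"
  shows "open S \<Longrightarrow> smooth_on S f \<Longrightarrow> smooth_on S g \<Longrightarrow> smooth_on S (\<lambda>z. f z * g z)"
  by (rule smooth_on_bilinear[OF bounded_bilinear_mult])

lemma smooth_on_divide:
  fixes f g :: "'m::euclidean_space \<Rightarrow> real"
  assumes "open S" "smooth_on S f" "smooth_on S g" "\<And>z. z \<in> S \<Longrightarrow> g z \<noteq> 0"
  shows "smooth_on S (\<lambda>z. f z / g z)"
proof -
  have "smooth_on S (\<lambda>z. inverse (g z))"
    using assms C_k_on_inverse unfolding smooth_on_def by blast
  from smooth_on_mult[OF assms(1,2) this] show ?thesis by (simp add: field_simps)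
qed

lemma smooth_on_sqrt:
  fixes g :: "'m::euclidean_space \<Rightarrow> real"
  shows "open S \<Longrightarrow> smooth_on S g \<Longrightarrow> (\<And>z. z \<in> S \<Longrightarrow> g z > 0) \<Longrightarrow> smooth_on S (\<lambda>z. sqrt (g z))"
  using C_k_on_sqrt unfolding smooth_on_def by blast

lemma smooth_on_compose:
  fixes f :: "'m::euclidean_space \<Rightarrow> 'n::euclidean_space"
  shows "open S \<Longrightarrow> smooth_on S f \<Longrightarrow> smooth_on T g \<Longrightarrow> (\<And>z. z \<in> S \<Longrightarrow> f z \<in> T) \<Longrightarrow> smooth_on S (\<lambda>z. g (f z))"
  unfolding smooth_on_def using C_k_on_compose by blast

text \<open>The same expansion in the basis; it turns smoothness of a form or of a derivative in
  constant directions into smoothness along a vector field.\<close>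

lemma smooth_on_linear_family:
  fixes L :: "'m::euclidean_space \<Rightarrow> 'n::euclidean_space \<Rightarrow> 'b::real_normed_vector"
  assumes "open S" "\<And>z. z \<in> S \<Longrightarrow> linear (L z)" "\<And>v. smooth_on S (\<lambda>z. L z v)" "smooth_on S w"
  shows "smooth_on S (\<lambda>z. L z (w z))"
proof -
  have "smooth_on S (\<lambda>z. \<Sum>b\<in>Basis. (w z \<bullet> b) *\<^sub>R L z b)"
    by (intro smooth_on_sum smooth_on_scaleR smooth_on_inner smooth_on_const assms) auto
  then show ?thesis
    by (rule smooth_on_cong[OF assms(1)]) (use linear_basis_expand assms(2) in metis)
qed

lemma linear_fd: "smooth_on S f \<Longrightarrow> z \<in> S \<Longrightarrow> linear (fd f z)"
  by (simp add: linear_frechet_derivative smooth_on_differentiable)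

lemma smooth_on_fd:
  fixes f :: "'m::euclidean_space \<Rightarrow> 'b::real_normed_vector"
  assumes "open S" "smooth_on S f" "smooth_on S w"
  shows "smooth_on S (\<lambda>z. fd f z (w z))"
  by (rule smooth_on_linear_family[OF assms(1) linear_fd[OF assms(2)] smooth_on_fd_const[OF assms(2)] assms(3)])

lemmas smooth_on_intros = smooth_on_const smooth_on_add smooth_on_diff smooth_on_minus
  smooth_on_scaleR smooth_on_inner smooth_on_mult smooth_on_divide smooth_on_sqrt smooth_on_fd smooth_on_sum

lemma fd_bilinear:
  assumes "bounded_bilinear h" "f differentiable at z" "g differentiable at z"
  shows "fd (\<lambda>z. h (f z) (g z)) z v = h (f z) (fd g z v) + h (fd f z v) (g z)"
  using fd_eq[OF bounded_bilinear.FDERIV[OF assms(1) has_derivative_fd[OF assms(2)] has_derivative_fd[OF assms(3)]]]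
  by simp

lemmas fd_scaleR = fd_bilinear[OF bounded_bilinear_scaleR]

lemma fd_linear:
  assumes "bounded_linear h" "f differentiable at z"
  shows "fd (\<lambda>z. h (f z)) z v = h (fd f z v)"
  using fd_eq[OF bounded_linear.has_derivative[OF assms(1) has_derivative_fd[OF assms(2)]]] by simp

lemma fd_add:
  assumes "f differentiable at z" "g differentiable at z"
  shows "fd (\<lambda>z. f z + g z) z v = fd f z v + fd g z v"
  using fd_eq[OF has_derivative_add[OF has_derivative_fd[OF assms(1)] has_derivative_fd[OF assms(2)]]] by simp

lemma fd_diff:
  assumes "f differentiable at z" "g differentiable at z"
  shows "fd (\<lambda>z. f z - g z) z v = fd f z v - fd g z v"
  using fd_eq[OF has_derivative_diff[OF has_derivative_fd[OF assms(1)] has_derivative_fd[OF assms(2)]]] by simp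

lemma fd_compose:
  assumes "f differentiable at z" "g differentiable at (f z)"
  shows "fd (\<lambda>z. g (f z)) z v = fd g (f z) (fd f z v)"
  using fd_eq[OF has_derivative_compose[OF has_derivative_fd[OF assms(1)] has_derivative_fd[OF assms(2)]]] by simp

text \<open>The quotient is symmetric in \<open>u\<close> and \<open>v\<close>, so one limit serves
  for both mixed derivatives. The mean value theorem in direction \<open>u\<close> replaces the
  second difference by a difference of two values of the derivative along \<open>u\<close>, which
  differentiability at \<open>z\<close> controls.\<close>

lemma second_difference:
  fixes f :: "'m::real_normed_vector \<Rightarrow> real"
  assumes "open S" "z \<in> S" "\<And>y. y \<in> S \<Longrightarrow> f differentiable at y"
    and diff: "(\<lambda>y. fd f y u) differentiable at z"
  shows "((\<lambda>t. (f (z + t *\<^sub>R u + t *\<^sub>R v) - f (z + t *\<^sub>R u) - f (z + t *\<^sub>R v) + f z) / t^2)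
            \<longlongrightarrow> fd (\<lambda>y. fd f y u) z v) (at_right 0)"
proof (rule tendstoI)
  fix e :: real assume "e > 0"
  define g where "g y = fd f y u" for y
  define L where "L = fd g z"
  have gL: "(g has_derivative L) (at z)"
    unfolding L_def using diff has_derivative_fd g_def by (metis (no_types, lifting) ext)
  \<comment> \<open>The two linearisation errors add up to
    \<open>e' * t * (2 * norm u + norm v)\<close>; the summand 1 keeps \<open>K\<close> positive and
    the estimate strict.\<close>
  define K where "K = 2 * norm u + norm v + 1"
  have K: "K > 0" unfolding K_def by (simp add: add_nonneg_pos)
  define e' where "e' = e / (2 * K)"
  have e': "e' > 0" using \<open>e > 0\<close> K by (simp add: e'_def)
  obtain d1 where d1: "d1 > 0" "\<And>y. norm (y - z) < d1 \<Longrightarrow> norm (g y - g z - L (y - z)) \<le> e' * norm (y - z)"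
    using gL e' unfolding has_derivative_at_alt by blast
  obtain d2 where d2: "d2 > 0" "ball z d2 \<subseteq> S" using assms(1,2) open_contains_ball by blast
  define d where "d = min d1 d2 / K"
  have d: "d > 0" using d1 d2 K by (simp add: d_def)
  have linL: "linear L" using gL has_derivative_linear by blast
  have "dist ((f (z + t *\<^sub>R u + t *\<^sub>R v) - f (z + t *\<^sub>R u) - f (z + t *\<^sub>R v) + f z) / t^2) (L v) < e"
    if t: "0 < t" "t < d" for t
  proof -
    have small: "norm (s *\<^sub>R u + r *\<^sub>R v) \<le> t * (norm u + norm v)" if "0 \<le> s" "s \<le> t" "0 \<le> r" "r \<le> t" for s r
    proof -
      have "norm (s *\<^sub>R u + r *\<^sub>R v) \<le> s * norm u + r * norm v"
        using norm_triangle_ineq[of "s *\<^sub>R u" "r *\<^sub>R v"] that by simp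
      also have "\<dots> \<le> t * norm u + t * norm v" using that by (intro add_mono mult_right_mono) auto
      finally show ?thesis by (simp add: algebra_simps)
    qed
    have tK: "t * K < min d1 d2" using t K by (simp add: d_def pos_less_divide_eq)
    have "t * (norm u + norm v) \<le> t * K" using t by (simp add: K_def)
    then have small': "norm (s *\<^sub>R u + r *\<^sub>R v) < d1" "z + s *\<^sub>R u + r *\<^sub>R v \<in> S" if "0 \<le> s" "s \<le> t" "0 \<le> r" "r \<le> t" for s r
    proof -
      have "norm (s *\<^sub>R u + r *\<^sub>R v) < min d1 d2"
        using small[OF that] tK \<open>t * (norm u + norm v) \<le> t * K\<close> by linarith
      then show "norm (s *\<^sub>R u + r *\<^sub>R v) < d1" "z + s *\<^sub>R u + r *\<^sub>R v \<in> S"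
        using d2 by (auto simp: dist_norm subset_iff norm_minus_commute add.assoc)
    qed
    define \<phi> where "\<phi> s = f (z + s *\<^sub>R u + t *\<^sub>R v) - f (z + s *\<^sub>R u)" for s
    have der: "DERIV \<phi> s :> g (z + s *\<^sub>R u + t *\<^sub>R v) - g (z + s *\<^sub>R u)" if s: "0 \<le> s" "s \<le> t" for s
    proof -
      have *: "((\<lambda>s. f (z + s *\<^sub>R u + r *\<^sub>R v)) has_real_derivative g (z + s *\<^sub>R u + r *\<^sub>R v)) (at s)"
        if r: "0 \<le> r" "r \<le> t" for r
      proof -
        have df: "f differentiable at (z + s *\<^sub>R u + r *\<^sub>R v)" using assms(3) small'(2) s r by blast
        have "((\<lambda>s. z + s *\<^sub>R u + r *\<^sub>R v) has_derivative (\<lambda>h. h *\<^sub>R u)) (at s)"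
          by (auto intro!: derivative_eq_intros)
        from has_derivative_compose[OF this has_derivative_fd[OF df]]
        have "((\<lambda>s. f (z + s *\<^sub>R u + r *\<^sub>R v)) has_derivative (\<lambda>h. fd f (z + s *\<^sub>R u + r *\<^sub>R v) (h *\<^sub>R u))) (at s)" .
        moreover have "fd f (z + s *\<^sub>R u + r *\<^sub>R v) (h *\<^sub>R u) = g (z + s *\<^sub>R u + r *\<^sub>R v) * h" for h
          using linear_cmul[OF linear_frechet_derivative[OF df], of h u] by (simp add: g_def)
        ultimately show ?thesis by (simp add: has_field_derivative_def mult_commute_abs)
      qed
      show ?thesis unfolding \<phi>_def using DERIV_diff[OF *[of t] *[of 0]] t by simp
    qed
    have "\<exists>s>0. s < t \<and> \<phi> t - \<phi> 0 = (t - 0) * (g (z + s *\<^sub>R u + t *\<^sub>R v) - g (z + s *\<^sub>R u))"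
      by (rule MVT2[OF t(1)]) (rule der)
    then obtain s where s: "0 < s" "s < t"
      "\<phi> t - \<phi> 0 = (t - 0) * (g (z + s *\<^sub>R u + t *\<^sub>R v) - g (z + s *\<^sub>R u))" by blast
    have "norm (g (z + s *\<^sub>R u + t *\<^sub>R v) - g z - L (s *\<^sub>R u + t *\<^sub>R v)) \<le> e' * norm (s *\<^sub>R u + t *\<^sub>R v)"
      using d1(2)[of "z + s *\<^sub>R u + t *\<^sub>R v"] small'(1)[of s t] s t by (simp add: add.assoc)
    moreover have "norm (s *\<^sub>R u + t *\<^sub>R v) \<le> t * (norm u + norm v)" using small s by simp
    ultimately have a: "\<bar>g (z + s *\<^sub>R u + t *\<^sub>R v) - g z - L (s *\<^sub>R u + t *\<^sub>R v)\<bar> \<le> e' * (t * (norm u + norm v))"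
      using e' by (smt (verit) mult_left_mono real_norm_def)
    have "norm (g (z + s *\<^sub>R u) - g z - L (s *\<^sub>R u)) \<le> e' * norm (s *\<^sub>R u)"
      using d1(2)[of "z + s *\<^sub>R u"] small'(1)[of s 0] s t by simp
    moreover have "norm (s *\<^sub>R u) \<le> t * norm u" using s by (simp add: mult_right_mono)
    ultimately have b: "\<bar>g (z + s *\<^sub>R u) - g z - L (s *\<^sub>R u)\<bar> \<le> e' * (t * norm u)"
      using e' by (smt (verit) mult_left_mono real_norm_def)
    have "L (s *\<^sub>R u + t *\<^sub>R v) - L (s *\<^sub>R u) = t * L v"
      using linear_add[OF linL] linear_cmul[OF linL] by simp
    then have "\<bar>g (z + s *\<^sub>R u + t *\<^sub>R v) - g (z + s *\<^sub>R u) - t * L v\<bar> \<le> e' * (t * (norm u + norm v)) + e' * (t * norm u)"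
      using a b by linarith
    also have "\<dots> < e' * (t * K)" using e' t by (simp add: K_def algebra_simps)
    also have "\<dots> = t * (e / 2)" using K by (simp add: e'_def)
    finally have "\<bar>g (z + s *\<^sub>R u + t *\<^sub>R v) - g (z + s *\<^sub>R u) - t * L v\<bar> < t * (e / 2)" .
    then have "\<bar>(g (z + s *\<^sub>R u + t *\<^sub>R v) - g (z + s *\<^sub>R u)) / t - L v\<bar> < e"
      using t \<open>e > 0\<close> by (simp add: abs_if field_simps split: if_splits)
    moreover have "(f (z + t *\<^sub>R u + t *\<^sub>R v) - f (z + t *\<^sub>R u) - f (z + t *\<^sub>R v) + f z) = t * (g (z + s *\<^sub>R u + t *\<^sub>R v) - g (z + s *\<^sub>R u))"
      using s(3) by (simp add: \<phi>_def)
    ultimately show ?thesis using t by (simp add: dist_real_def power2_eq_square)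
  qed
  then show "\<forall>\<^sub>F t in at_right 0. dist ((f (z + t *\<^sub>R u + t *\<^sub>R v) - f (z + t *\<^sub>R u) - f (z + t *\<^sub>R v) + f z) / t^2) (fd (\<lambda>y. fd f y u) z v) < e"
    unfolding L_def g_def using d eventually_at_right_field by blast
qed

lemma fd_fd_commute_real:
  fixes f :: "'m::euclidean_space \<Rightarrow> real"
  assumes "open S" "z \<in> S" "smooth_on S f"
  shows "fd (\<lambda>y. fd f y u) z v = fd (\<lambda>y. fd f y v) z u"
proof -
  note d = smooth_on_differentiable[OF assms(3)]
    smooth_on_differentiable[OF smooth_on_fd_const[OF assms(3)] assms(2)]
  have "((\<lambda>t. (f (z + t *\<^sub>R u + t *\<^sub>R v) - f (z + t *\<^sub>R u) - f (z + t *\<^sub>R v) + f z) / t^2)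
            \<longlongrightarrow> fd (\<lambda>y. fd f y v) z u) (at_right 0)"
    using second_difference[OF assms(1,2) d, of v u] by (simp add: algebra_simps)
  then show ?thesis
    using second_difference[OF assms(1,2) d, of u v] tendsto_unique[OF trivial_limit_at_right_real] by blast
qed

lemma fd_fd_commute:
  fixes f :: "'m::euclidean_space \<Rightarrow> 'b::euclidean_space"
  assumes "open S" "z \<in> S" "smooth_on S f"
  shows "fd (\<lambda>y. fd f y u) z v = fd (\<lambda>y. fd f y v) z u"
proof (rule euclidean_eqI)
  fix b :: 'b assume "b \<in> Basis"
  have bl: "bounded_linear (\<lambda>x::'b. x \<bullet> b)" by (rule bounded_linear_inner_left)
  have sm: "smooth_on S (\<lambda>y. f y \<bullet> b)" using smooth_on_linear[OF bl assms(1,3)] .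
  have *: "fd (\<lambda>y. fd (\<lambda>y. f y \<bullet> b) y u) z v = fd (\<lambda>y. fd f y u) z v \<bullet> b" for u v
  proof -
    have "fd (\<lambda>y. fd (\<lambda>y. f y \<bullet> b) y u) z = fd (\<lambda>y. fd f y u \<bullet> b) z"
      by (rule fd_cong_open[OF assms(1,2)]) (rule fd_linear[OF bl smooth_on_differentiable[OF assms(3)]])
    then show ?thesis
      using fd_linear[OF bl smooth_on_differentiable[OF smooth_on_fd_const[OF assms(3)] assms(2)]] by simp
  qed
  show "fd (\<lambda>y. fd f y u) z v \<bullet> b = fd (\<lambda>y. fd f y v) z u \<bullet> b"
    using fd_fd_commute_real[OF assms(1,2) sm, of u v] unfolding * .
qed

text \<open>Evaluation at vectors plays the part of the Euclidean components.\<close>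

lemma fd_fd_commute_blinfun:
  fixes f :: "'m::euclidean_space \<Rightarrow> ('a::real_normed_vector \<Rightarrow>\<^sub>L 'b::euclidean_space)"
  assumes "open S" "z \<in> S" "smooth_on S f"
  shows "fd (\<lambda>y. fd f y u) z v = fd (\<lambda>y. fd f y v) z u"
proof (rule blinfun_eqI)
  fix a :: 'a
  have bl: "bounded_linear (\<lambda>x::'a \<Rightarrow>\<^sub>L 'b. blinfun_apply x a)" by (rule blinfun.bounded_linear_left)
  have sm: "smooth_on S (\<lambda>y. blinfun_apply (f y) a)" using smooth_on_linear[OF bl assms(1,3)] .
  have *: "fd (\<lambda>y. fd (\<lambda>y. blinfun_apply (f y) a) y u) z v = blinfun_apply (fd (\<lambda>y. fd f y u) z v) a" for u v
  proof -
    have "fd (\<lambda>y. fd (\<lambda>y. blinfun_apply (f y) a) y u) z = fd (\<lambda>y. blinfun_apply (fd f y u) a) z"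
      by (rule fd_cong_open[OF assms(1,2)]) (rule fd_linear[OF bl smooth_on_differentiable[OF assms(3)]])
    then show ?thesis
      using fd_linear[OF bl smooth_on_differentiable[OF smooth_on_fd_const[OF assms(3)] assms(2)]] by simp
  qed
  show "blinfun_apply (fd (\<lambda>y. fd f y u) z v) a = blinfun_apply (fd (\<lambda>y. fd f y v) z u) a"
    using fd_fd_commute[OF assms(1,2) sm, of u v] unfolding * .
qed

text \<open>Along a ray from \<open>z\<close>, \<open>h\<^sup>2\<close> times a decaying exponential is nonincreasing.\<close>

lemma gronwall_ball:
  fixes h :: "'m::euclidean_space \<Rightarrow> real"
  assumes "\<And>y. y \<in> ball z r \<Longrightarrow> h differentiable at y"
    and "\<And>y v. y \<in> ball z r \<Longrightarrow> \<bar>fd h y v\<bar> \<le> C * norm v * \<bar>h y\<bar>"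
    and "h z = 0" "y \<in> ball z r"
  shows "h y = 0"
proof -
  define v where "v = y - z"
  have inb: "z + t *\<^sub>R v \<in> ball z r" if "0 \<le> t" "t \<le> 1" for t
  proof -
    have "norm (t *\<^sub>R v) \<le> 1 * norm v" unfolding norm_scaleR using that by (intro mult_right_mono) auto
    then show ?thesis using assms(4) by (simp add: v_def dist_norm norm_minus_commute)
  qed
  \<comment> \<open>With this rate the derivative of \<open>h\<^sup>2\<close> along the ray is at
    most \<open>K * h\<^sup>2\<close>.\<close>
  define K where "K = 2 * (C * norm v)"
  define g where "g t = (h (z + t *\<^sub>R v))\<^sup>2 * exp (- (K * t))" for t
  have der: "\<exists>g'. DERIV g t :> g' \<and> g' \<le> 0" if t: "0 \<le> t" "t \<le> 1" for t
  proof -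
    define y where "y = z + t *\<^sub>R v"
    have dh: "h differentiable at y" using assms(1) inb[OF t] y_def by blast
    have "((\<lambda>s. z + s *\<^sub>R v) has_derivative (\<lambda>s. s *\<^sub>R v)) (at t)"
      by (auto intro!: derivative_eq_intros)
    from has_derivative_compose[OF this has_derivative_fd[OF dh, unfolded y_def]]
    have "((\<lambda>s. h (z + s *\<^sub>R v)) has_derivative (\<lambda>s. fd h y (s *\<^sub>R v))) (at t)" unfolding y_def .
    moreover have "fd h y (s *\<^sub>R v) = fd h y v * s" for s
      using linear_cmul[OF linear_frechet_derivative[OF dh], of s v] by simp
    ultimately have D: "((\<lambda>s. h (z + s *\<^sub>R v)) has_real_derivative fd h y v) (at t)"
      by (simp add: has_field_derivative_def mult_commute_abs)
    have "DERIV g t :> (2 * h y * fd h y v - K * (h y)\<^sup>2) * exp (- (K * t))"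
      unfolding g_def by (auto intro!: derivative_eq_intros D simp: y_def algebra_simps)
    moreover have "2 * h y * fd h y v \<le> K * (h y)\<^sup>2"
    proof -
      have "2 * h y * fd h y v \<le> 2 * (\<bar>h y\<bar> * \<bar>fd h y v\<bar>)" by (simp add: flip: abs_mult)
      also have "\<dots> \<le> 2 * (\<bar>h y\<bar> * (C * norm v * \<bar>h y\<bar>))"
        using assms(2) inb[OF t] unfolding y_def by (intro mult_left_mono) auto
      also have "\<dots> = K * (\<bar>h y\<bar> * \<bar>h y\<bar>)" by (simp add: K_def)
      also have "\<dots> = K * (h y)\<^sup>2" by (simp add: power2_eq_square flip: abs_mult)
      finally show ?thesis .
    qed
    ultimately show ?thesis by (meson diff_le_0_iff_le exp_ge_zero mult_nonpos_nonneg)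
  qed
  have "g 1 \<le> g 0" using DERIV_nonpos_imp_nonincreasing[of 0 1 g] der by auto
  then have "(h y)\<^sup>2 * exp (- K) \<le> 0" using assms(3) by (simp add: g_def v_def)
  then show ?thesis by (simp add: mult_le_0_iff)
qed

section \<open>Charts\<close>

locale surface =
  fixes A :: "'a::{t2_space, second_countable_topology} chart set"
  assumes smooth_surface: "smooth_surface A"
begin

lemma chart_open: "c \<in> A \<Longrightarrow> open (fst c)"
  and chart_image_open: "c \<in> A \<Longrightarrow> open (snd c ` fst c)"
  and chart_homeo: "c \<in> A \<Longrightarrow> homeomorphism (fst c) (snd c ` fst c) (snd c) (chart_inv c)"
  using smooth_surface unfolding smooth_surface_def by blast+

lemma chart_inv_left [simp]: "c \<in> A \<Longrightarrow> x \<in> fst c \<Longrightarrow> chart_inv c (snd c x) = x"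
  using chart_homeo homeomorphism_apply1 by blast

lemma chart_inv_right [simp]: "c \<in> A \<Longrightarrow> z \<in> snd c ` fst c \<Longrightarrow> snd c (chart_inv c z) = z"
  by auto

lemma chart_exists: "\<exists>c\<in>A. x \<in> fst c"
  using smooth_surface unfolding smooth_surface_def by blast

lemma chart_at_mem: "chart_at A x \<in> A" and chart_at_dom: "x \<in> fst (chart_at A x)"
proof -
  have "chart_at A x \<in> A \<and> x \<in> fst (chart_at A x)"
    unfolding chart_at_def by (rule someI_ex) (use chart_exists in blast)
  then show "chart_at A x \<in> A" "x \<in> fst (chart_at A x)" by auto
qed

lemma chart_open_image:
  assumes "c \<in> A" "open N"
  shows "open (snd c ` (N \<inter> fst c))"
proof -
  have "continuous_on (snd c ` fst c) (chart_inv c)"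
    using chart_homeo[OF assms(1)] homeomorphism_def by blast
  then have "open (snd c ` fst c \<inter> chart_inv c -` N)"
    using continuous_open_preimage chart_image_open assms by blast
  moreover have "snd c ` fst c \<inter> chart_inv c -` N = snd c ` (N \<inter> fst c)"
    using assms(1) by auto
  ultimately show ?thesis by simp
qed

lemma chart_open_image': "c \<in> A \<Longrightarrow> open N \<Longrightarrow> N \<subseteq> fst c \<Longrightarrow> open (snd c ` N)"
  using chart_open_image by (metis inf.absorb1)

lemma chart_open_preimage:
  assumes "c \<in> A" "open V"
  shows "open {x \<in> fst c. snd c x \<in> V}"
proof -
  have "continuous_on (fst c) (snd c)" using chart_homeo[OF assms(1)] homeomorphism_def by blast
  then have "open (fst c \<inter> snd c -` V)"
    using continuous_open_preimage chart_open assms by blast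
  then show ?thesis by (simp add: vimage_def Int_def)
qed

lemma transition_smooth:
  assumes "c \<in> A" "c' \<in> A"
  shows "smooth_on (snd c ` (fst c \<inter> fst c')) (\<lambda>z. snd c' (chart_inv c z))"
  using smooth_surface assms unfolding smooth_surface_def by (auto simp: o_def)

text \<open>Chain rule for the transitions from \<open>c\<close> over \<open>c'\<close> to
  \<open>c''\<close>. With \<open>c'' = c\<close> the two transition derivatives become mutually
  inverse, which identifies tangent vectors with chart coordinates.\<close>

lemma transition_fd_inverse:
  assumes "c \<in> A" "c' \<in> A" "c'' \<in> A" "x \<in> fst c" "x \<in> fst c'" "x \<in> fst c''"
  shows "fd (\<lambda>z. snd c'' (chart_inv c z)) (snd c x) v =
    fd (\<lambda>z. snd c'' (chart_inv c' z)) (snd c' x) (fd (\<lambda>z. snd c' (chart_inv c z)) (snd c x) v)"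
proof -
  have 1: "(\<lambda>z. snd c' (chart_inv c z)) differentiable at (snd c x)"
    by (rule smooth_on_differentiable[OF transition_smooth]) (use assms in auto)
  have 2: "(\<lambda>z. snd c'' (chart_inv c' z)) differentiable at (snd c' (chart_inv c (snd c x)))"
    by (rule smooth_on_differentiable[OF transition_smooth[OF assms(2,3)]]) (use assms in auto)
  have "open (snd c ` (fst c' \<inter> fst c))" using chart_open_image chart_open assms by blast
  then have "fd (\<lambda>z. snd c'' (chart_inv c z)) (snd c x) =
      fd (\<lambda>z. snd c'' (chart_inv c' (snd c' (chart_inv c z)))) (snd c x)"
    by (rule fd_cong_open) (use assms in auto)
  then show ?thesis using fd_compose[OF 1 2] assms by simp
qed

lemma transition_fd_self:
  assumes "c \<in> A" "x \<in> fst c"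
  shows "fd (\<lambda>z. snd c (chart_inv c z)) (snd c x) v = v"
proof -
  have "fd (\<lambda>z. snd c (chart_inv c z)) (snd c x) = fd (\<lambda>z. z) (snd c x)"
    by (rule fd_cong_open[OF chart_image_open[OF assms(1)]]) (use assms in auto)
  then show ?thesis by simp
qed

lemma tangent_to_chart_to_tangent [simp]:
  assumes "c \<in> A" "x \<in> fst c"
  shows "tangent_to_chart A c x (chart_to_tangent A c x v) = v"
  unfolding tangent_to_chart_def chart_to_tangent_def o_def
  using transition_fd_inverse[OF assms(1) chart_at_mem assms(1) assms(2) chart_at_dom assms(2)]
    transition_fd_self[OF assms] by metis

lemma chart_to_tangent_to_chart [simp]:
  assumes "c \<in> A" "x \<in> fst c"
  shows "chart_to_tangent A c x (tangent_to_chart A c x X) = X"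
  unfolding tangent_to_chart_def chart_to_tangent_def o_def
  using transition_fd_inverse[OF chart_at_mem assms(1) chart_at_mem chart_at_dom assms(2) chart_at_dom]
    transition_fd_self[OF chart_at_mem chart_at_dom] by metis

lemma tangent_to_chart_transition:
  assumes "c \<in> A" "c' \<in> A" "x \<in> fst c" "x \<in> fst c'"
  shows "tangent_to_chart A c' x (chart_to_tangent A c x v) = fd (\<lambda>z. snd c' (chart_inv c z)) (snd c x) v"
  unfolding tangent_to_chart_def chart_to_tangent_def o_def
  using transition_fd_inverse[OF assms(1) chart_at_mem assms(2,3) chart_at_dom assms(4)] by simp

lemma linear_tangent_to_chart: "c \<in> A \<Longrightarrow> x \<in> fst c \<Longrightarrow> linear (tangent_to_chart A c x)"
  unfolding tangent_to_chart_def o_def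
  using linear_fd[OF transition_smooth[OF chart_at_mem], of c "snd (chart_at A x) x" x] chart_at_dom
  by (auto simp: image_iff)

lemma linear_chart_to_tangent: "c \<in> A \<Longrightarrow> x \<in> fst c \<Longrightarrow> linear (chart_to_tangent A c x)"
  unfolding chart_to_tangent_def o_def
  using linear_fd[OF transition_smooth[OF _ chart_at_mem], of c "snd c x" x] chart_at_dom
  by (auto simp: image_iff)

section \<open>Smooth functions, derivatives and forms on the surface\<close>

lemma smooth_fun_chartD:
  assumes "smooth_fun A U g" "c \<in> A" "N \<subseteq> U \<inter> fst c"
  shows "smooth_on (snd c ` N) (\<lambda>z. g (chart_inv c z))"
  by (rule smooth_on_subset[of "snd c ` (U \<inter> fst c)"]) (use assms in \<open>auto simp: smooth_fun_def o_def\<close>)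

lemma smooth_fun_mono: "smooth_fun A U g \<Longrightarrow> N \<subseteq> U \<Longrightarrow> smooth_fun A N g"
  unfolding smooth_fun_def by (meson smooth_on_subset image_mono Int_mono order_refl)

text \<open>A single chart around \<open>N\<close> decides, since every other chart differs from it
  by a smooth transition map.\<close>

lemma smooth_fun_chartI:
  assumes "c \<in> A" "open N" "N \<subseteq> fst c" "smooth_on (snd c ` N) (\<lambda>z. g (chart_inv c z))"
  shows "smooth_fun A N g"
  unfolding smooth_fun_def
proof
  fix c' assume c': "c' \<in> A"
  have op: "open (snd c' ` (N \<inter> fst c'))" using chart_open_image c' assms by blast
  have "smooth_on (snd c' ` (N \<inter> fst c')) (\<lambda>z. snd c (chart_inv c' z))"
    by (rule smooth_on_subset[OF transition_smooth[OF c' assms(1)]]) (use assms in auto)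
  then have "smooth_on (snd c' ` (N \<inter> fst c')) (\<lambda>z. g (chart_inv c (snd c (chart_inv c' z))))"
    by (rule smooth_on_compose[OF op _ assms(4)]) (use c' in auto)
  then show "smooth_on (snd c' ` (N \<inter> fst c')) (g \<circ> chart_inv c')"
    by (rule smooth_on_cong[OF op]) (use assms c' in auto)
qed

lemma smooth_fun_pull:
  assumes "c \<in> A" "open N" "N \<subseteq> fst c" "smooth_on (snd c ` N) h"
  shows "smooth_fun A N (\<lambda>y. h (snd c y))"
  using chart_open_image'[OF assms(1-3)] assms
  by (intro smooth_fun_chartI[OF assms(1-3)] smooth_on_cong[OF _ assms(4)]) auto

lemma smooth_fun_local:
  assumes "\<And>x. x \<in> U \<Longrightarrow> \<exists>N. open N \<and> x \<in> N \<and> smooth_fun A N g"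
  shows "smooth_fun A U g"
  unfolding smooth_fun_def
proof
  fix c assume c: "c \<in> A"
  show "smooth_on (snd c ` (U \<inter> fst c)) (g \<circ> chart_inv c)"
  proof (rule smooth_on_local)
    fix z assume "z \<in> snd c ` (U \<inter> fst c)"
    then obtain x where x: "x \<in> U" "x \<in> fst c" "z = snd c x" by blast
    then obtain N where "open N" "x \<in> N" "smooth_fun A N g" using assms by blast
    then show "\<exists>N. open N \<and> z \<in> N \<and> smooth_on N (g \<circ> chart_inv c)"
      using x c chart_open_image unfolding smooth_fun_def by blast
  qed
qed

lemma smooth_fun_cong:
  assumes "open N" "smooth_fun A N g" "\<And>y. y \<in> N \<Longrightarrow> g y = h y"
  shows "smooth_fun A N h"
  unfolding smooth_fun_def
proof
  fix c assume c: "c \<in> A"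
  show "smooth_on (snd c ` (N \<inter> fst c)) (h \<circ> chart_inv c)"
    by (rule smooth_on_cong[OF chart_open_image[OF c assms(1)], of "g \<circ> chart_inv c"])
      (use assms c in \<open>auto simp: smooth_fun_def\<close>)
qed

lemma smooth_fun_const: "smooth_fun A U (\<lambda>_. c)"
  unfolding smooth_fun_def o_def by (simp add: smooth_on_const)

text \<open>Frees \<open>dder\<close> from the preferred chart at \<open>x\<close>: by the chain
  rule the transition map is absorbed in \<open>tangent_to_chart\<close>.\<close>

lemma dder_chart:
  assumes "open N" "x \<in> N" "smooth_fun A N g" "c \<in> A" "x \<in> fst c"
  shows "dder A g x X = fd (\<lambda>z. g (chart_inv c z)) (snd c x) (tangent_to_chart A c x X)"
proof -
  let ?c = "chart_at A x"
  note c0 = chart_at_mem[of x] chart_at_dom[of x]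
  have 1: "(\<lambda>z. snd c (chart_inv ?c z)) differentiable at (snd ?c x)"
    by (rule smooth_on_differentiable[OF transition_smooth]) (use assms c0 in auto)
  have 2: "(\<lambda>z. g (chart_inv c z)) differentiable at (snd c (chart_inv ?c (snd ?c x)))"
    by (rule smooth_on_differentiable[OF smooth_fun_chartD[OF assms(3,4) order_refl]]) (use assms c0 in auto)
  have "open (snd ?c ` (fst c \<inter> fst ?c))" using chart_open_image chart_open assms c0 by blast
  then have "fd (\<lambda>z. g (chart_inv ?c z)) (snd ?c x) = fd (\<lambda>z. g (chart_inv c (snd c (chart_inv ?c z)))) (snd ?c x)"
    by (rule fd_cong_open) (use assms c0 in auto)
  then show ?thesis
    unfolding dder_def o_def tangent_to_chart_def using fd_compose[OF 1 2] c0 by simp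
qed

lemma dder_chart_to_tangent:
  assumes "open N" "x \<in> N" "smooth_fun A N g" "c \<in> A" "x \<in> fst c"
  shows "dder A g x (chart_to_tangent A c x v) = fd (\<lambda>z. g (chart_inv c z)) (snd c x) v"
  using dder_chart[OF assms] assms by simp

lemma dder_pull:
  assumes "c \<in> A" "open N" "N \<subseteq> fst c" "smooth_on (snd c ` N) h" "x \<in> N"
  shows "dder A (\<lambda>y. h (snd c y)) x X = fd h (snd c x) (tangent_to_chart A c x X)"
proof -
  have "fd (\<lambda>z. h (snd c (chart_inv c z))) (snd c x) = fd h (snd c x)"
    by (rule fd_cong_open[OF chart_open_image'[OF assms(1-3)]]) (use assms in auto)
  then show ?thesis using dder_chart[OF assms(2,5) smooth_fun_pull[OF assms(1-4)] assms(1)] assms by auto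
qed

lemma dder_cong:
  assumes "open N" "x \<in> N" "\<And>y. y \<in> N \<Longrightarrow> g y = h y"
  shows "dder A g x X = dder A h x X"
proof -
  note c0 = chart_at_mem[of x] chart_at_dom[of x]
  have "fd (g \<circ> chart_inv (chart_at A x)) (snd (chart_at A x) x) = fd (h \<circ> chart_inv (chart_at A x)) (snd (chart_at A x) x)"
    by (rule fd_cong_open[OF chart_open_image[OF c0(1) assms(1)]]) (use assms c0 in auto)
  then show ?thesis unfolding dder_def by simp
qed

lemma linear_dder:
  assumes "open N" "x \<in> N" "smooth_fun A N g"
  shows "linear (dder A g x)"
  unfolding dder_def o_def
  using linear_fd[OF smooth_fun_chartD[OF assms(3) chart_at_mem order_refl], of "snd (chart_at A x) x" x] assms(2) chart_at_dom
  by (auto simp: image_iff)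

lemma one_form_dder:
  assumes "smooth_fun A UNIV g"
  shows "one_form A (dder A g)"
  unfolding one_form_def
proof (intro conjI allI ballI)
  show "linear (dder A g x)" for x using linear_dder[OF open_UNIV UNIV_I assms] .
  fix c v assume c: "c \<in> A"
  have "smooth_on (snd c ` fst c) (\<lambda>z. fd (\<lambda>z. g (chart_inv c z)) z v)"
    by (rule smooth_on_fd_const[OF smooth_fun_chartD[OF assms c]]) auto
  then show "smooth_on (snd c ` fst c) (form_in_chart A (dder A g) c v)"
    by (rule smooth_on_cong[OF chart_image_open[OF c]])
      (use c in \<open>auto simp: form_in_chart_def dder_chart_to_tangent[OF open_UNIV UNIV_I assms]\<close>)
qed

text \<open>In a chart this is the symmetry of second derivatives.\<close>

lemma closed_form_dder:
  fixes g :: "'a \<Rightarrow> ('v::real_normed_vector \<Rightarrow>\<^sub>L 'w::euclidean_space)"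
  assumes "smooth_fun A UNIV g"
  shows "closed_form A (dder A g)"
  unfolding closed_form_def
proof (intro ballI allI)
  fix c z u v assume c: "c \<in> A" and z: "z \<in> snd c ` fst c"
  have sm: "smooth_on (snd c ` fst c) (\<lambda>z. g (chart_inv c z))"
    by (rule smooth_fun_chartD[OF assms c]) auto
  have "fd (form_in_chart A (dder A g) c w) z = fd (\<lambda>z. fd (\<lambda>z. g (chart_inv c z)) z w) z" for w
    by (rule fd_cong_open[OF chart_image_open[OF c] z])
      (use c in \<open>auto simp: form_in_chart_def dder_chart_to_tangent[OF open_UNIV UNIV_I assms]\<close>)
  then show "fd (form_in_chart A (dder A g) c v) z u - fd (form_in_chart A (dder A g) c u) z v = 0"
    using fd_fd_commute_blinfun[OF chart_image_open[OF c] z sm, of u v] by simp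
qed

lemma one_form_diff:
  assumes "one_form A \<eta>" "one_form A \<theta>"
  shows "one_form A (\<lambda>x X. \<eta> x X - \<theta> x X)"
  using assms unfolding one_form_def form_in_chart_def
  by (auto intro!: linear_compose_sub smooth_on_diff chart_image_open)

lemma closed_form_diff:
  assumes "one_form A \<eta>" "one_form A \<theta>" "closed_form A \<eta>" "closed_form A \<theta>"
  shows "closed_form A (\<lambda>x X. \<eta> x X - \<theta> x X)"
  unfolding closed_form_def
proof (intro ballI allI)
  fix c z u v assume c: "c \<in> A" and z: "z \<in> snd c ` fst c"
  have d: "form_in_chart A \<eta> c w differentiable at z" "form_in_chart A \<theta> c w differentiable at z" for w
    using assms c by (auto simp: one_form_def intro!: smooth_on_differentiable[OF _ z])
  have "form_in_chart A (\<lambda>x X. \<eta> x X - \<theta> x X) c w = (\<lambda>z. form_in_chart A \<eta> c w z - form_in_chart A \<theta> c w z)" for w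
    by (auto simp: form_in_chart_def)
  then have "fd (form_in_chart A (\<lambda>x X. \<eta> x X - \<theta> x X) c w) z w' =
      fd (form_in_chart A \<eta> c w) z w' - fd (form_in_chart A \<theta> c w) z w'" for w w'
    using fd_diff[OF d] by simp
  then show "fd (form_in_chart A (\<lambda>x X. \<eta> x X - \<theta> x X) c v) z u - fd (form_in_chart A (\<lambda>x X. \<eta> x X - \<theta> x X) c u) z v = 0"
    using assms(3)[unfolded closed_form_def, rule_format, OF c z, of v u]
      assms(4)[unfolded closed_form_def, rule_format, OF c z, of v u] by simp
qed

lemma form_in_chart_tangent:
  assumes "c \<in> A" "x \<in> fst c"
  shows "\<eta> x X = form_in_chart A \<eta> c (tangent_to_chart A c x X) (snd c x)"
  using assms by (simp add: form_in_chart_def)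

lemma linear_form_in_chart:
  assumes "one_form A \<eta>" "c \<in> A" "z \<in> snd c ` fst c"
  shows "linear (\<lambda>v. form_in_chart A \<eta> c v z)"
proof -
  have "linear (\<eta> (chart_inv c z) \<circ> chart_to_tangent A c (chart_inv c z))"
    using assms by (intro linear_compose linear_chart_to_tangent) (auto simp: one_form_def)
  then show ?thesis by (simp add: form_in_chart_def o_def)
qed

text \<open>The coordinates in a second chart arise from \<open>X\<close> through the derivative of
  the transition map and so stay smooth.\<close>

lemma vector_field_at_pull:
  assumes "c \<in> A" "open N" "N \<subseteq> fst c" "smooth_on (snd c ` N) X" "x \<in> N"
    and "\<And>y. y \<in> N \<Longrightarrow> chart_to_tangent A c y (X (snd c y)) \<in> T y"
  shows "vector_field_at A T x (\<lambda>y. chart_to_tangent A c y (X (snd c y)))"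
  unfolding vector_field_at_def
proof (intro exI[of _ N] conjI ballI)
  fix c' assume c': "c' \<in> A"
  have op: "open (snd c ` (N \<inter> fst c'))" and op': "open (snd c' ` (N \<inter> fst c'))"
    using chart_open_image[OF c' assms(2)] chart_open_image'[OF assms(1) open_Int[OF assms(2) chart_open[OF c']]] assms(3)
    by auto
  have s1: "smooth_on (snd c ` (N \<inter> fst c')) (\<lambda>z. fd (\<lambda>z. snd c' (chart_inv c z)) z (X z))"
    by (intro smooth_on_fd op smooth_on_subset[OF assms(4)] smooth_on_subset[OF transition_smooth[OF assms(1) c']])
      (use assms(3) in auto)
  have s2: "smooth_on (snd c' ` (N \<inter> fst c')) (\<lambda>z. snd c (chart_inv c' z))"
    by (rule smooth_on_subset[OF transition_smooth[OF c' assms(1)]]) (use assms in auto)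
  have "smooth_on (snd c' ` (N \<inter> fst c'))
      (\<lambda>z. fd (\<lambda>z. snd c' (chart_inv c z)) (snd c (chart_inv c' z)) (X (snd c (chart_inv c' z))))"
    by (rule smooth_on_compose[OF op' s2 s1]) (use c' in auto)
  then show "smooth_on (snd c' ` (N \<inter> fst c')) ((\<lambda>y. tangent_to_chart A c' y (chart_to_tangent A c y (X (snd c y)))) \<circ> chart_inv c')"
    by (rule smooth_on_cong[OF op'])
      (use assms c' in \<open>auto simp: tangent_to_chart_transition subset_iff\<close>)
qed (use assms in auto)

end

section \<open>Linear algebra of \<open>\<real>\<^sup>4\<^sup>,\<^sup>2\<close>\<close>

lemma span_pair: "v \<in> span {a, b} \<longleftrightarrow> (\<exists>k l. v = k *\<^sub>R a + l *\<^sub>R b)"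
  by (auto simp: span_insert algebra_simps)

lemma dim_span_pair_independent:
  fixes a b :: "'v::euclidean_space"
  assumes "dim (span {a, b}) = 2" "k *\<^sub>R a + l *\<^sub>R b = 0"
  shows "k = 0 \<and> l = 0"
proof -
  have d: "dim {a, b} = 2" using assms(1) by (simp add: dim_span)
  have "dim {c} \<le> 1" for c :: 'v using dim_le_card'[of "{c}"] by simp
  then have *: "\<not> {a, b} \<subseteq> span {c}" for c
    using d dim_subset[of "{a, b}" "span {c}"] by (metis dim_span le_trans not_less_eq_eq numeral_2_eq_2 One_nat_def)
  show ?thesis
  proof (rule ccontr)
    assume "\<not> (k = 0 \<and> l = 0)"
    then consider "k \<noteq> 0" | "l \<noteq> 0" by blast
    then show False
    proof cases
      case 1
      have "k *\<^sub>R a = (- l) *\<^sub>R b" using assms(2) by (simp add: add_eq_0_iff2)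
      then have "a = (- l / k) *\<^sub>R b" using 1 by (metis divide_inverse_commute scaleR_one scaleR_scaleR left_inverse)
      then have "{a, b} \<subseteq> span {b}" by (metis empty_subsetI insert_subset span_base span_scale singletonI)
      then show False using * by blast
    next
      case 2
      have "l *\<^sub>R b = (- k) *\<^sub>R a" using assms(2) by (simp add: add_eq_0_iff)
      then have "b = (- k / l) *\<^sub>R a" using 2 by (metis divide_inverse_commute scaleR_one scaleR_scaleR left_inverse)
      then have "{a, b} \<subseteq> span {a}" by (metis empty_subsetI insert_subset span_base span_scale singletonI)
      then show False using * by blast
    qed
  qed
qed

locale R42 =
  fixes B :: "'v::euclidean_space \<Rightarrow> 'v \<Rightarrow> real"
  assumes R42_form: "R42_form B"
begin

lemma DIM_6: "DIM('v) = 6" and bilinear_B: "bilinear B" and B_sym: "B a b = B b a" and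
  signature_B: "has_signature B 4 2"
  using R42_form unfolding R42_form_def by auto

lemma bounded_bilinear_B: "bounded_bilinear B"
  using bilinear_B bilinear_conv_bounded_bilinear by blast

sublocale B: bounded_bilinear B by (rule bounded_bilinear_B)

lemmas B_simps = B.add_left B.add_right B.diff_left B.diff_right B.minus_left B.minus_right
  B.scaleR_left B.scaleR_right B.zero_left B.zero_right

text \<open>The vectors of positive and of negative square in an orthogonal basis span
  \<open>P\<close> and \<open>N\<close>. As 4 + 2 exhausts the six basis vectors, none is null, and
  pairing with them shows non-degeneracy.\<close>

lemma signature_spaces:
  obtains P N where "subspace P" "dim P = 4" "\<And>v. v \<in> P \<Longrightarrow> v \<noteq> 0 \<Longrightarrow> B v v > 0"
    "subspace N" "dim N = 2" "\<And>v. v \<in> N \<Longrightarrow> v \<noteq> 0 \<Longrightarrow> B v v < 0"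
    "\<And>v. (\<And>w. B v w = 0) \<Longrightarrow> v = 0"
proof -
  obtain E where E: "independent E" "span E = UNIV" "\<And>e e'. e \<in> E \<Longrightarrow> e' \<in> E \<Longrightarrow> e \<noteq> e' \<Longrightarrow> B e e' = 0"
    "card {e \<in> E. B e e > 0} = 4" "card {e \<in> E. B e e < 0} = 2"
    using signature_B unfolding has_signature_def by blast
  have fin: "finite E" using E(1) by (rule independent_imp_finite)
  have "card E = 6" using E(1,2) DIM_6 dim_span_eq_card_independent[OF E(1)] by (simp add: dim_UNIV)
  have ex: "B (\<Sum>e\<in>S. c e *\<^sub>R e) e' = c e' * B e' e'" if "S \<subseteq> E" "e' \<in> S" for c S e'
  proof -
    have "B (\<Sum>e\<in>S. c e *\<^sub>R e) e' = (\<Sum>e\<in>S. c e * B e e')" by (simp add: B.sum_left B_simps)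
    also have "\<dots> = (\<Sum>e\<in>S. if e = e' then c e' * B e' e' else 0)"
      using that E(3) by (intro sum.cong) auto
    also have "\<dots> = c e' * B e' e'" using that fin finite_subset by fastforce
    finally show ?thesis .
  qed
  have sq: "B (\<Sum>e\<in>S. c e *\<^sub>R e) (\<Sum>e\<in>S. c e *\<^sub>R e) = (\<Sum>e\<in>S. (c e)\<^sup>2 * B e e)" if "S \<subseteq> E" for c S
    using ex[OF that, of _ c] by (subst B.sum_right) (auto simp: B_simps power2_eq_square intro!: sum.cong)
  let ?P = "{e \<in> E. B e e > 0}" and ?N = "{e \<in> E. B e e < 0}"
  have part: "?P \<union> ?N = E"
  proof (rule card_subset_eq[OF fin])
    have "card (?P \<union> ?N) = card ?P + card ?N" by (rule card_Un_disjoint) (use fin in auto)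
    then show "card (?P \<union> ?N) = card E" using E \<open>card E = 6\<close> by simp
  qed auto
  have sp: "\<exists>c. v = (\<Sum>e\<in>S. c e *\<^sub>R e)" if "v \<in> span S" "S \<subseteq> E" for v S
    using that fin finite_subset[of S E] span_finite[of S] by auto
  show thesis
  proof
    show "subspace (span ?P)" "subspace (span ?N)" by auto
    show "dim (span ?P) = 4" "dim (span ?N) = 2"
      using E dim_span_eq_card_independent independent_mono[OF E(1)] by (metis (no_types, lifting) mem_Collect_eq subsetI)+
    show "B v v > 0" if v: "v \<in> span ?P" "v \<noteq> 0" for v
    proof -
      obtain c where c: "v = (\<Sum>e\<in>?P. c e *\<^sub>R e)" using sp[OF v(1)] by auto
      obtain e0 where "e0 \<in> ?P" "c e0 \<noteq> 0" using v(2) c by (metis (no_types, lifting) scaleR_eq_0_iff sum.neutral)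
      then have "0 < (\<Sum>e\<in>?P. (c e)\<^sup>2 * B e e)"
        by (intro sum_pos2[of _ e0]) (use fin in auto)
      then show ?thesis using sq[of ?P c] c by auto
    qed
    show "B v v < 0" if v: "v \<in> span ?N" "v \<noteq> 0" for v
    proof -
      obtain c where c: "v = (\<Sum>e\<in>?N. c e *\<^sub>R e)" using sp[OF v(1)] by auto
      obtain e0 where "e0 \<in> ?N" "c e0 \<noteq> 0" using v(2) c by (metis (no_types, lifting) scaleR_eq_0_iff sum.neutral)
      then have "0 < (\<Sum>e\<in>?N. (c e)\<^sup>2 * - B e e)"
        by (intro sum_pos2[of _ e0]) (use fin in \<open>auto simp: mult_pos_neg mult_nonneg_nonpos\<close>)
      then show ?thesis using sq[of ?N c] c by (auto simp: sum_negf)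
    qed
    show "v = 0" if v: "\<And>w. B v w = 0" for v
    proof -
      obtain c where c: "v = (\<Sum>e\<in>E. c e *\<^sub>R e)" using sp[of v E] E(2) by auto
      have "c e = 0" if "e \<in> E" for e
      proof -
        have "c e * B e e = 0" using ex[OF order_refl that, of c] v[of e] c by simp
        moreover have "e \<in> {e \<in> E. B e e > 0} \<union> {e \<in> E. B e e < 0}" using part that by simp
        then have "B e e \<noteq> 0" by force
        ultimately show ?thesis by simp
      qed
      then show ?thesis using c by simp
    qed
  qed
qed

lemma nondegenerate: "(\<And>w. B v w = 0) \<Longrightarrow> v = 0"
  using signature_spaces by metis

lemma subspace_perp: "subspace (perp B W)"
  unfolding perp_def subspace_def by (auto simp: B_simps)

lemma lie_grassmannianD:
  assumes "W \<in> lie_grassmannian B"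
  shows "subspace W" "dim W = 2" "\<And>a b. a \<in> W \<Longrightarrow> b \<in> W \<Longrightarrow> B a b = 0"
  using assms unfolding lie_grassmannian_def by auto

lemma perpD: "v \<in> perp B W \<Longrightarrow> w \<in> W \<Longrightarrow> B w v = 0"
  unfolding perp_def by auto

lemma perpD': "v \<in> perp B W \<Longrightarrow> w \<in> W \<Longrightarrow> B v w = 0"
  unfolding perp_def by (auto simp: B_sym)

lemma subset_perp: "W \<in> lie_grassmannian B \<Longrightarrow> W \<subseteq> perp B W"
  using lie_grassmannianD unfolding perp_def by blast

lemma exists_int:
  fixes U W :: "'v set"
  assumes "subspace U" "subspace W" "dim U + dim W > 6"
  obtains v where "v \<in> U" "v \<in> W" "v \<noteq> 0"
proof -
  have "dim {x + y |x y. x \<in> U \<and> y \<in> W} + dim (U \<inter> W) = dim U + dim W"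
    using dim_sums_Int[OF assms(1,2)] .
  moreover have "dim {x + y |x y. x \<in> U \<and> y \<in> W} \<le> 6"
    using dim_subset_UNIV[of "{x + y |x y. x \<in> U \<and> y \<in> W}"] DIM_6 by simp
  ultimately have "dim (U \<inter> W) \<noteq> 0" using assms(3) by linarith
  then show ?thesis using that dim_eq_0[of "U \<inter> W"] by auto
qed

text \<open>Otherwise the 3-dimensional span of \<open>W\<close> and \<open>v\<close> would contain
  no vector of positive square, yet it meets the 4-dimensional positive space, since 3 + 4 >
  6.\<close>

lemma perp_positive:
  assumes W: "W \<in> lie_grassmannian B" and v: "v \<in> perp B W" "v \<notin> W"
  shows "B v v > 0"
proof (rule ccontr)
  assume neg: "\<not> B v v > 0"
  note Wd = lie_grassmannianD[OF W]
  obtain P where P: "subspace P" "dim P = 4" "\<And>v. v \<in> P \<Longrightarrow> v \<noteq> 0 \<Longrightarrow> B v v > 0"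
    using signature_spaces by metis
  have "span W = W" using Wd(1) by (simp add: span_eq_iff)
  then have "dim (span (insert v W)) = 3" using v Wd(2) by (metis dim_insert dim_span add_2_eq_Suc' One_nat_def Suc_1 numeral_3_eq_3 Suc_eq_plus1)
  then obtain w where w: "w \<in> span (insert v W)" "w \<in> P" "w \<noteq> 0"
    using exists_int[of "span (insert v W)" P] P by auto
  then obtain k where k: "w - k *\<^sub>R v \<in> W" using \<open>span W = W\<close> by (auto simp: span_insert)
  define u where "u = w - k *\<^sub>R v"
  have "w = u + k *\<^sub>R v" "u \<in> W" using k by (auto simp: u_def)
  then have "B w w = k * k * B v v"
    using Wd(3) perpD[OF v(1)] perpD'[OF v(1)] by (simp add: B_simps)
  then have "B w w \<le> 0" using neg by (simp add: mult_nonneg_nonpos)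
  then show False using P(3) w by fastforce
qed

lemma perp_null: "W \<in> lie_grassmannian B \<Longrightarrow> v \<in> perp B W \<Longrightarrow> B v v = 0 \<Longrightarrow> v \<in> W"
  using perp_positive by fastforce

text \<open>On \<open>W\<^sup>\<bottom>\<close> the form is nowhere negative, while a space of
  dimension 5 would meet the negative definite plane.\<close>

lemma dim_perp_le: assumes W: "W \<in> lie_grassmannian B" shows "dim (perp B W) \<le> 4"
proof (rule ccontr)
  assume "\<not> dim (perp B W) \<le> 4"
  moreover obtain N where N: "subspace N" "dim N = 2" "\<And>v. v \<in> N \<Longrightarrow> v \<noteq> 0 \<Longrightarrow> B v v < 0"
    using signature_spaces by metis
  ultimately obtain v where v: "v \<in> perp B W" "v \<in> N" "v \<noteq> 0"
    using exists_int[of "perp B W" N] subspace_perp by auto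
  then have "B v v \<ge> 0"
    using perp_positive[OF W v(1)] lie_grassmannianD(3)[OF W] by fastforce
  then show False using N(3) v by fastforce
qed

text \<open>\<open>W\<^sup>\<bottom>/W\<close> is a Euclidean plane, with orthogonal basis \<open>y, x\<close>.\<close>

lemma perp_expand:
  assumes W: "W \<in> lie_grassmannian B"
    and x: "x \<in> perp B W" "x \<notin> W" and y: "y \<in> perp B W" "y \<notin> W" and xy: "B x y = 0"
    and v: "v \<in> perp B W"
  shows "v - (B v y / B y y) *\<^sub>R y - (B v x / B x x) *\<^sub>R x \<in> W"
proof -
  note Wd = lie_grassmannianD[OF W]
  have px: "B x x > 0" and py: "B y y > 0" using perp_positive W x y by auto
  have sW: "span W = W" using Wd(1) by (simp add: span_eq_iff)
  have d3: "dim (span (insert y W)) = 3" using y Wd(2) sW by (metis dim_insert dim_span One_nat_def Suc_1 numeral_3_eq_3 Suc_eq_plus1)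
  have xn: "x \<notin> span (insert y W)"
  proof
    assume "x \<in> span (insert y W)"
    then obtain k where k: "x - k *\<^sub>R y \<in> W" using sW by (auto simp: span_insert)
    then have "B (x - k *\<^sub>R y) y = 0" using perpD[OF y(1)] by blast
    then have "k = 0" using xy py by (simp add: B_simps)
    then show False using k x by simp
  qed
  have "dim (insert x (insert y W)) = 4"
    using xn d3 by (simp add: dim_insert dim_span)
  moreover have "insert x (insert y W) \<subseteq> perp B W" using x y subset_perp[OF W] by auto
  ultimately have "span (insert x (insert y W)) = perp B W"
    using dim_perp_le[OF W] subspace_perp[of W]
    by (metis dim_span span_minimal subspace_dim_equal subspace_span)
  then obtain k l where kl: "v - k *\<^sub>R x - l *\<^sub>R y \<in> W"
    using v span_breakdown_eq[of v x "insert y W"] span_breakdown_eq[of _ y W] sW by blast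
  have "B (v - k *\<^sub>R x - l *\<^sub>R y) x = 0" "B (v - k *\<^sub>R x - l *\<^sub>R y) y = 0"
    using kl perpD x y by blast+
  then have "B v x = k * B x x" "B v y = l * B y y"
    using xy B_sym[of x y] by (auto simp: B_simps)
  then show ?thesis using kl px py by (simp add: algebra_simps)
qed

lemma perp_exists:
  assumes S: "subspace S" and v: "v \<notin> S"
  obtains w where "\<And>s. s \<in> S \<Longrightarrow> B s w = 0" "B v w = 1"
proof -
  \<comment> \<open>\<open>?T w\<close> is the Euclidean representative of the functional pairing
    with \<open>w\<close>. Non-degeneracy makes \<open>?T\<close> bijective, so the part
    \<open>z\<close> of \<open>v\<close> that is Euclidean-orthogonal to \<open>S\<close> is
    realised, suitably scaled, by some \<open>w\<close>.\<close>
  let ?T = "\<lambda>w. (\<Sum>b\<in>Basis. B b w *\<^sub>R b)"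
  have TB: "a \<bullet> ?T w = B a w" for a w
  proof -
    have "a \<bullet> ?T w = (\<Sum>b\<in>Basis. (a \<bullet> b) * B b w)" by (simp add: inner_sum_right mult.commute)
    also have "\<dots> = B (\<Sum>b\<in>Basis. (a \<bullet> b) *\<^sub>R b) w" by (simp add: B.sum_left B_simps)
    finally show ?thesis by (simp add: euclidean_representation)
  qed
  have "linear ?T"
    by (rule linearI) (simp_all add: B.add_right B.scaleR_right scaleR_add_left sum.distrib scaleR_sum_right)
  moreover have "inj ?T"
    unfolding linear_injective_0[OF \<open>linear ?T\<close>]
  proof (intro allI impI)
    fix w assume "?T w = 0"
    then have "B w a = 0" for a using TB[of a w] B_sym by auto
    then show "w = 0" by (rule nondegenerate)
  qed
  ultimately have "surj ?T" by (rule linear_inj_imp_surj)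
  obtain y z where yz: "y \<in> S" "\<And>w. w \<in> S \<Longrightarrow> orthogonal z w" "v = y + z"
    using orthogonal_subspace_decomp_exists[of S v] S by (metis span_eq_iff)
  have "z \<noteq> 0" using yz v by auto
  have "v \<bullet> z = z \<bullet> z"
    unfolding yz(3) inner_add_left using yz(2)[OF yz(1)] by (simp add: orthogonal_def inner_commute)
  obtain w where w: "?T w = (1 / (z \<bullet> z)) *\<^sub>R z" 
    using surjD[OF \<open>surj ?T\<close>, of "(1 / (z \<bullet> z)) *\<^sub>R z"] by (elim exE) (erule that[OF sym])
  show thesis
  proof (rule that[of w])
    show "B s w = 0" if "s \<in> S" for s
      using TB[of s w] w yz(2)[OF that] by (simp add: orthogonal_def inner_commute)
    show "B v w = 1" using TB[of v w] w \<open>v \<bullet> z = z \<bullet> z\<close> \<open>z \<noteq> 0\<close> by simp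
  qed
qed

section \<open>Wedge products as skew endomorphisms\<close>

lemma bounded_linear_B_left: "bounded_linear (\<lambda>x. B x y)"
  using B.bounded_linear_left by auto

lemma wedge_apply [simp]: "blinfun_apply (wedge B a b) c = B a c *\<^sub>R b - B b c *\<^sub>R a"
proof -
  have "bounded_linear (\<lambda>c. B a c *\<^sub>R b - B b c *\<^sub>R a)"
    by (intro bounded_linear_sub bounded_linear_scaleR_const B.bounded_linear_right)
  then show ?thesis unfolding wedge_def by (simp add: bounded_linear_Blinfun_apply)
qed

lemma bounded_bilinear_wedge: "bounded_bilinear (wedge B)"
proof
  show "wedge B (a + a') b = wedge B a b + wedge B a' b" for a a' b
    by (rule blinfun_eqI) (simp add: blinfun.add_left B_simps algebra_simps)
  show "wedge B a (b + b') = wedge B a b + wedge B a b'" for a b b'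
    by (rule blinfun_eqI) (simp add: blinfun.add_left B_simps algebra_simps)
  show "wedge B (r *\<^sub>R a) b = r *\<^sub>R wedge B a b" for r a b
    by (rule blinfun_eqI) (simp add: blinfun.scaleR_left B_simps algebra_simps)
  show "wedge B a (r *\<^sub>R b) = r *\<^sub>R wedge B a b" for r a b
    by (rule blinfun_eqI) (simp add: blinfun.scaleR_left B_simps algebra_simps)
  obtain K where K: "K > 0" "\<And>a b. norm (B a b) \<le> norm a * norm b * K" using B.pos_bounded by blast
  have "norm (wedge B a b) \<le> norm a * norm b * (2 * K)" for a b
  proof (rule norm_blinfun_bound)
    show "0 \<le> norm a * norm b * (2 * K)" using K(1) by simp
    fix c
    have "norm (blinfun_apply (wedge B a b) c) \<le> norm (B a c) * norm b + norm (B b c) * norm a"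
      using norm_triangle_ineq4[of "B a c *\<^sub>R b" "B b c *\<^sub>R a"] by simp
    also have "\<dots> \<le> (norm a * norm c * K) * norm b + (norm b * norm c * K) * norm a"
      by (intro add_mono mult_right_mono K(2)) auto
    finally show "norm (blinfun_apply (wedge B a b) c) \<le> norm a * norm b * (2 * K) * norm c"
      by (simp add: algebra_simps)
  qed
  then show "\<exists>K. \<forall>a b. norm (wedge B a b) \<le> norm a * norm b * K" by blast
qed

sublocale W: bounded_bilinear "wedge B" by (rule bounded_bilinear_wedge)

lemmas W_simps = W.add_left W.add_right W.diff_left W.diff_right W.minus_left W.minus_right
  W.scaleR_left W.scaleR_right W.zero_left W.zero_right

lemma wedge_self [simp]: "wedge B a a = 0"
  by (rule blinfun_eqI) simp

lemma wedge_skew: "wedge B a b = - wedge B b a"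
  by (rule blinfun_eqI) (simp add: blinfun.minus_left)

lemma wedge_space_mem: "a \<in> V \<Longrightarrow> b \<in> W \<Longrightarrow> wedge B a b \<in> wedge_space B V W"
  unfolding wedge_space_def by (rule span_base) blast

lemma subspace_wedge_space: "subspace (wedge_space B V W)"
  unfolding wedge_space_def by simp

lemma wedge_space_mono: "V \<subseteq> V' \<Longrightarrow> W \<subseteq> W' \<Longrightarrow> wedge_space B V W \<subseteq> wedge_space B V' W'"
  unfolding wedge_space_def by (rule span_mono) blast

text \<open>Characterises \<open>f \<and> f\<^sup>\<bottom>\<close> inside \<open>\<and>\<^sup>2\<real>\<^sup>4\<^sup>,\<^sup>2\<close> by its action.\<close>

definition nilpotent_skew :: "'v set \<Rightarrow> ('v \<Rightarrow>\<^sub>L 'v) \<Rightarrow> bool" where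
  "nilpotent_skew W \<omega> \<longleftrightarrow> (\<forall>a b. B (blinfun_apply \<omega> a) b = - B a (blinfun_apply \<omega> b)) \<and>
     (\<forall>v\<in>W. blinfun_apply \<omega> v = 0) \<and> (\<forall>v\<in>perp B W. blinfun_apply \<omega> v \<in> W)"

lemma nilpotent_skewD:
  assumes "nilpotent_skew W \<omega>"
  shows "B (blinfun_apply \<omega> a) b = - B a (blinfun_apply \<omega> b)"
    "v \<in> W \<Longrightarrow> blinfun_apply \<omega> v = 0" "v \<in> perp B W \<Longrightarrow> blinfun_apply \<omega> v \<in> W"
  using assms unfolding nilpotent_skew_def by blast+

lemma subspace_nilpotent_skew:
  assumes "subspace W" shows "subspace {\<omega>. nilpotent_skew W \<omega>}"
  unfolding subspace_def nilpotent_skew_def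
  using subspace_0[OF assms] subspace_add[OF assms] subspace_scale[OF assms]
  by (auto simp: blinfun.add_left blinfun.scaleR_left B_simps)

lemma wedge_space_nilpotent:
  assumes W: "W \<in> lie_grassmannian B" and "\<omega> \<in> wedge_space B W (perp B W)"
  shows "nilpotent_skew W \<omega>"
proof -
  note Wd = lie_grassmannianD[OF W]
  have "{wedge B a b |a b. a \<in> W \<and> b \<in> perp B W} \<subseteq> {\<omega>. nilpotent_skew W \<omega>}"
  proof clarify
    fix a b assume ab: "a \<in> W" "b \<in> perp B W"
    show "nilpotent_skew W (wedge B a b)"
      unfolding nilpotent_skew_def using ab Wd perpD perpD'
      by (auto simp: B_simps B_sym[of _ b] B_sym[of _ a] subspace_scale subspace_neg)
  qed
  then have "span {wedge B a b |a b. a \<in> W \<and> b \<in> perp B W} \<subseteq> {\<omega>. nilpotent_skew W \<omega>}"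
    by (rule span_minimal[OF _ subspace_nilpotent_skew[OF Wd(1)]])
  then show ?thesis using assms(2) unfolding wedge_space_def by auto
qed

lemma wedge_space_pair:
  assumes "\<omega> \<in> wedge_space B (span {a, b}) (span {a, b})"
  shows "\<exists>k. \<omega> = k *\<^sub>R wedge B a b"
proof -
  have "{wedge B v w |v w. v \<in> span {a, b} \<and> w \<in> span {a, b}} \<subseteq> span {wedge B a b}"
  proof clarify
    fix v w assume "v \<in> span {a, b}" "w \<in> span {a, b}"
    then obtain k l m n where "v = k *\<^sub>R a + l *\<^sub>R b" "w = m *\<^sub>R a + n *\<^sub>R b" by (auto simp: span_pair)
    then have "wedge B v w = (k * n - l * m) *\<^sub>R wedge B a b"
      by (simp add: W_simps wedge_skew[of b a] algebra_simps)
    then show "wedge B v w \<in> span {wedge B a b}" by (simp add: span_base span_scale)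
  qed
  then have "wedge_space B (span {a, b}) (span {a, b}) \<subseteq> span {wedge B a b}"
    unfolding wedge_space_def by (rule span_minimal) simp
  then show ?thesis using assms by (auto simp: span_singleton)
qed

lemma wedge_space_perp_zero:
  assumes "\<omega> \<in> wedge_space B S T" "\<And>s. s \<in> S \<Longrightarrow> B s v = 0" "\<And>t. t \<in> T \<Longrightarrow> B t v = 0"
  shows "blinfun_apply \<omega> v = 0"
proof -
  have "wedge_space B S T \<subseteq> {\<omega>. blinfun_apply \<omega> v = 0}"
    unfolding wedge_space_def
    by (rule span_minimal) (use assms in \<open>auto simp: subspace_def blinfun.add_left blinfun.scaleR_left\<close>)
  then show ?thesis using assms(1) by auto
qed

lemma wedge_space_range:
  assumes "\<omega> \<in> wedge_space B S S" "subspace S"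
  shows "blinfun_apply \<omega> v \<in> S"
proof -
  have "wedge_space B S S \<subseteq> {\<omega>. blinfun_apply \<omega> v \<in> S}"
    unfolding wedge_space_def using assms(2)
    by (intro span_minimal) (auto simp: subspace_def blinfun.add_left blinfun.scaleR_left intro!: subspace_diff[OF assms(2)])
  then show ?thesis using assms(1) by auto
qed

end

text \<open>\<open>trace_on\<close> picks an unspecified basis. For an endomorphism of this shape
  the diagonal sum in any basis reassembles \<open>\<phi> a\<close> and \<open>\<psi> b\<close> from
  the coordinates of \<open>a\<close> and \<open>b\<close>.\<close>

lemma trace_on_eq:
  fixes W :: "'v::euclidean_space set"
  assumes sub: "subspace W" and L: "\<And>w. w \<in> W \<Longrightarrow> L w = (\<phi> w) *\<^sub>R a + (\<psi> w) *\<^sub>R b"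
    and ab: "a \<in> W" "b \<in> W" and lin: "linear \<phi>" "linear \<psi>"
  shows "trace_on W L = \<phi> a + \<psi> b"
proof -
  define E where "E = (SOME E. independent E \<and> span E = W)"
  have "\<exists>E. independent E \<and> span E = W"
    using maximal_independent_subset[of W] sub by (metis span_minimal subset_antisym)
  then have E: "independent E" "span E = W" unfolding E_def using someI_ex[of "\<lambda>E. independent E \<and> span E = W"] by auto
  have fin: "finite E" using E(1) by (rule independent_imp_finite)
  have EW: "e \<in> W" if "e \<in> E" for e using E(2) that span_base by blast
  have rep: "(\<Sum>e\<in>E. \<theta> e * representation E w e) = \<theta> w" if "linear \<theta>" "w \<in> W" for \<theta> :: "'v \<Rightarrow> real" and w
  proof -
    have "\<theta> w = \<theta> (\<Sum>e\<in>E. representation E w e *\<^sub>R e)"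
      using real_vector.sum_representation_eq[OF E(1) _ fin order_refl, of w] that(2) E(2) by simp
    also have "\<dots> = (\<Sum>e\<in>E. representation E w e * \<theta> e)"
      by (simp add: linear_sum[OF that(1)] linear_cmul[OF that(1)])
    finally show ?thesis by (simp add: mult.commute)
  qed
  have "representation E (L e) e = \<phi> e * representation E a e + \<psi> e * representation E b e" if "e \<in> E" for e
  proof -
    have "representation E (\<phi> e *\<^sub>R a + \<psi> e *\<^sub>R b) = (\<lambda>x. representation E (\<phi> e *\<^sub>R a) x + representation E (\<psi> e *\<^sub>R b) x)"
      by (rule real_vector.representation_add[OF E(1)]) (use ab E(2) in \<open>auto intro: span_scale\<close>)
    then show ?thesis
      using L[OF EW[OF that]] real_vector.representation_scale[OF E(1)] ab E(2) by simp
  qed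
  then have "trace_on W L = (\<Sum>e\<in>E. \<phi> e * representation E a e + \<psi> e * representation E b e)"
    unfolding trace_on_def E_def[symmetric] Let_def by (rule sum.cong[OF refl])
  then show ?thesis using rep[OF lin(1) ab(1)] rep[OF lin(2) ab(2)] by (simp add: sum.distrib)
qed

section \<open>Local frames\<close>

lemma fd_const_on:
  assumes "open N" "z \<in> N" "\<And>y. y \<in> N \<Longrightarrow> g y = c"
  shows "fd g z u = 0"
  using fd_cong_open[OF assms(1,2), of g "\<lambda>_. c"] assms(3) by simp

lemma independent_pair:
  fixes a b :: "'v::euclidean_space"
  assumes "\<And>k l. k *\<^sub>R a + l *\<^sub>R b = 0 \<Longrightarrow> k = 0 \<and> l = 0"
  shows "a \<noteq> b" "a \<notin> span {b}" "independent {a, b}"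
proof -
  show ne: "a \<noteq> b" using assms[of 1 "-1"] by auto
  have b0: "b \<noteq> 0" using assms[of 0 1] by auto
  show "a \<notin> span {b}"
  proof
    assume "a \<in> span {b}"
    then obtain k where "a = k *\<^sub>R b" by (auto simp: span_singleton)
    then show False using assms[of 1 "- k"] by simp
  qed
  then show "independent {a, b}" using b0 ne by (simp add: independent_insert)
qed

lemma span_pair_eq:
  fixes W :: "'v::euclidean_space set"
  assumes "subspace W" "dim W = 2" "a \<in> W" "b \<in> W" "\<And>k l. k *\<^sub>R a + l *\<^sub>R b = 0 \<Longrightarrow> k = 0 \<and> l = 0"
  shows "W = span {a, b}"
proof
  have "a \<noteq> b" by (rule independent_pair(1)) (rule assms(5))
  moreover have "independent {a, b}" by (rule independent_pair(3)) (rule assms(5))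
  ultimately show "W \<subseteq> span {a, b}"
    using card_ge_dim_independent[of "{a, b}" W] assms(1-4) by simp
  show "span {a, b} \<subseteq> W" using assms by (simp add: span_minimal)
qed

lemma real2_pair_spans:
  fixes a b :: "real ^ 2"
  assumes "\<And>k l. k *\<^sub>R a + l *\<^sub>R b = 0 \<Longrightarrow> k = 0 \<and> l = 0"
  shows "\<exists>k l. u = k *\<^sub>R a + l *\<^sub>R b"
proof -
  have "UNIV = span {a, b}" by (rule span_pair_eq) (use assms in auto)
  then show ?thesis using span_pair[of u a b] by blast
qed

section \<open>Moving frames of a Legendre map over a plane domain\<close>

locale lie_frame = R42 B
  for B :: "'v::euclidean_space \<Rightarrow> 'v \<Rightarrow> real" +
  fixes V :: "(real ^ 2) set" and F :: "real ^ 2 \<Rightarrow> 'v set" and s1 s2 :: "real ^ 2 \<Rightarrow> 'v"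
  assumes open_V: "open V" and smooth_s1: "smooth_on V s1" and smooth_s2: "smooth_on V s2"
    and F_span: "z \<in> V \<Longrightarrow> F z = span {s1 z, s2 z}"
    and F_lie: "z \<in> V \<Longrightarrow> F z \<in> lie_grassmannian B"
    and fd_s1_perp: "z \<in> V \<Longrightarrow> fd s1 z u \<in> perp B (F z)"
    and fd_s2_perp: "z \<in> V \<Longrightarrow> fd s2 z u \<in> perp B (F z)"
begin

lemma subspace_F: "z \<in> V \<Longrightarrow> subspace (F z)"
  and dim_F: "z \<in> V \<Longrightarrow> dim (F z) = 2"
  and F_null: "z \<in> V \<Longrightarrow> a \<in> F z \<Longrightarrow> b \<in> F z \<Longrightarrow> B a b = 0"
  using F_lie lie_grassmannianD by blast+

lemma s_mem: "z \<in> V \<Longrightarrow> s1 z \<in> F z" "z \<in> V \<Longrightarrow> s2 z \<in> F z"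
  using F_span span_base[of _ "{s1 z, s2 z}"] by auto

lemma F_pair: "z \<in> V \<Longrightarrow> v \<in> F z \<longleftrightarrow> (\<exists>k l. v = k *\<^sub>R s1 z + l *\<^sub>R s2 z)"
  using F_span span_pair by blast

lemma frame_independent: "z \<in> V \<Longrightarrow> k *\<^sub>R s1 z + l *\<^sub>R s2 z = 0 \<Longrightarrow> k = 0 \<and> l = 0"
  using dim_span_pair_independent dim_F F_span by metis

lemma frame_unique:
  assumes "z \<in> V" "k *\<^sub>R s1 z + l *\<^sub>R s2 z = k' *\<^sub>R s1 z + l' *\<^sub>R s2 z"
  shows "k = k' \<and> l = l'"
proof -
  have "(k - k') *\<^sub>R s1 z + (l - l') *\<^sub>R s2 z = 0" using assms(2) by (simp add: algebra_simps)
  then show ?thesis using frame_independent[OF assms(1)] by fastforce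
qed

definition gram :: "real ^ 2 \<Rightarrow> real" where
  "gram z = (s1 z \<bullet> s1 z) * (s2 z \<bullet> s2 z) - (s1 z \<bullet> s2 z) * (s1 z \<bullet> s2 z)"

text \<open>Coordinates with respect to the frame, extended to \<open>'v\<close> by Euclidean projection.\<close>

definition c1 :: "real ^ 2 \<Rightarrow> 'v \<Rightarrow> real" where
  "c1 z v = ((v \<bullet> s1 z) * (s2 z \<bullet> s2 z) - (v \<bullet> s2 z) * (s1 z \<bullet> s2 z)) / gram z"

definition c2 :: "real ^ 2 \<Rightarrow> 'v \<Rightarrow> real" where
  "c2 z v = ((v \<bullet> s2 z) * (s1 z \<bullet> s1 z) - (v \<bullet> s1 z) * (s1 z \<bullet> s2 z)) / gram z"

lemma gram_nonzero: assumes "z \<in> V" shows "gram z \<noteq> 0"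
proof
  assume g: "gram z = 0"
  \<comment> \<open>A Gram-Schmidt vector: the part of \<open>s1\<close> orthogonal to
    \<open>s2\<close>, scaled by the squared length of \<open>s2\<close> to avoid a
    division.\<close>
  let ?w = "(s2 z \<bullet> s2 z) *\<^sub>R s1 z + (- (s1 z \<bullet> s2 z)) *\<^sub>R s2 z"
  have "?w \<bullet> ?w = (s2 z \<bullet> s2 z) * gram z"
    by (simp add: gram_def inner_add_left inner_add_right inner_diff_left inner_diff_right algebra_simps inner_commute)
  then have "?w = 0" using g by simp
  then have "s2 z \<bullet> s2 z = 0" using frame_independent[OF assms] by blast
  then have "s2 z = 0" by simp
  then show False using frame_independent[OF assms, of 0 1] by simp
qed

lemma linear_c: "linear (c1 z)" "linear (c2 z)"
  unfolding c1_def c2_def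
  by (auto intro!: linearI simp: inner_add_left algebra_simps diff_divide_distrib add_divide_distrib)

lemma c_frame [simp]:
  assumes "z \<in> V"
  shows "c1 z (s1 z) = 1" "c1 z (s2 z) = 0" "c2 z (s1 z) = 0" "c2 z (s2 z) = 1"
  using gram_nonzero[OF assms] unfolding c1_def c2_def
  by (auto simp: gram_def field_simps inner_commute)

lemmas c_linear = linear_add[OF linear_c(1)] linear_add[OF linear_c(2)] linear_cmul[OF linear_c(1)]
  linear_cmul[OF linear_c(2)] linear_0[OF linear_c(1)] linear_0[OF linear_c(2)]
  linear_diff[OF linear_c(1)] linear_diff[OF linear_c(2)] linear_neg[OF linear_c(1)] linear_neg[OF linear_c(2)]

lemma c_expand: "z \<in> V \<Longrightarrow> v \<in> F z \<Longrightarrow> v = c1 z v *\<^sub>R s1 z + c2 z v *\<^sub>R s2 z"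
  using F_pair by (auto simp: c_linear)

lemma smooth_c:
  assumes "open N" "N \<subseteq> V" "smooth_on N r"
  shows "smooth_on N (\<lambda>z. c1 z (r z))" "smooth_on N (\<lambda>z. c2 z (r z))"
  unfolding c1_def c2_def gram_def
  by (intro smooth_on_intros assms smooth_on_subset[OF smooth_s1] smooth_on_subset[OF smooth_s2];
      use assms gram_nonzero in \<open>auto simp: gram_def\<close>)+

definition local_section :: "(real ^ 2) set \<Rightarrow> (real ^ 2 \<Rightarrow> 'v) \<Rightarrow> bool" where
  "local_section N r \<longleftrightarrow> open N \<and> N \<subseteq> V \<and> smooth_on N r \<and> (\<forall>z\<in>N. r z \<in> F z)"

lemma local_section_frame: "local_section V s1" "local_section V s2"
  unfolding local_section_def using open_V smooth_s1 smooth_s2 s_mem by auto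

text \<open>The derivatives of the coefficients multiply \<open>s1\<close> and \<open>s2\<close> and
  so stay in \<open>F\<close>; modulo \<open>F\<close>, differentiating a section is therefore
  tensorial.\<close>

lemma section_fd:
  assumes "local_section N r" "z \<in> N"
  shows "fd r z u - (c1 z (r z) *\<^sub>R fd s1 z u + c2 z (r z) *\<^sub>R fd s2 z u) \<in> F z"
proof -
  have N: "open N" "N \<subseteq> V" "smooth_on N r" "\<And>z. z \<in> N \<Longrightarrow> r z \<in> F z"
    using assms unfolding local_section_def by auto
  have zV: "z \<in> V" using N assms by auto
  have d: "(\<lambda>z. c1 z (r z)) differentiable at z" "(\<lambda>z. c2 z (r z)) differentiable at z"
      "s1 differentiable at z" "s2 differentiable at z"
    using smooth_on_differentiable smooth_c[OF N(1-3)] assms(2) smooth_s1 smooth_s2 zV by blast+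
  have "fd r z u = fd (\<lambda>z. c1 z (r z) *\<^sub>R s1 z + c2 z (r z) *\<^sub>R s2 z) z u"
    using fd_cong_open[OF N(1) assms(2), of r "\<lambda>z. c1 z (r z) *\<^sub>R s1 z + c2 z (r z) *\<^sub>R s2 z"]
      c_expand N(2,4) by (simp add: subset_iff)
  also have "\<dots> = (c1 z (r z) *\<^sub>R fd s1 z u + fd (\<lambda>z. c1 z (r z)) z u *\<^sub>R s1 z) +
      (c2 z (r z) *\<^sub>R fd s2 z u + fd (\<lambda>z. c2 z (r z)) z u *\<^sub>R s2 z)"
    using fd_add[OF differentiable_scaleR[OF d(1,3)] differentiable_scaleR[OF d(2,4)]]
      fd_scaleR[OF d(1,3)] fd_scaleR[OF d(2,4)] by simp
  finally have "fd r z u - (c1 z (r z) *\<^sub>R fd s1 z u + c2 z (r z) *\<^sub>R fd s2 z u) =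
      fd (\<lambda>z. c1 z (r z)) z u *\<^sub>R s1 z + fd (\<lambda>z. c2 z (r z)) z u *\<^sub>R s2 z" by simp
  then show ?thesis using F_pair[OF zV] by blast
qed

lemma section_fd_perp:
  assumes "local_section N r" "z \<in> N"
  shows "fd r z u \<in> perp B (F z)"
proof -
  have zV: "z \<in> V" using assms unfolding local_section_def by auto
  let ?d = "c1 z (r z) *\<^sub>R fd s1 z u + c2 z (r z) *\<^sub>R fd s2 z u"
  have "fd r z u - ?d \<in> perp B (F z)"
    using section_fd[OF assms] subset_perp[OF F_lie[OF zV]] by blast
  moreover have "?d \<in> perp B (F z)"
    using fd_s1_perp[OF zV] fd_s2_perp[OF zV] by (intro subspace_add subspace_scale subspace_perp)
  ultimately show ?thesis using subspace_add[OF subspace_perp] by (metis diff_add_cancel)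
qed

lemma section_smooth: "local_section N r \<Longrightarrow> smooth_on N r"
  and section_mem: "local_section N r \<Longrightarrow> z \<in> N \<Longrightarrow> r z \<in> F z"
  and section_open: "local_section N r \<Longrightarrow> open N"
  and section_sub: "local_section N r \<Longrightarrow> z \<in> N \<Longrightarrow> z \<in> V"
  unfolding local_section_def by auto

text \<open>Differentiates \<open>B (r y) (fd r' y v) = 0\<close>, the Legendre condition.\<close>

lemma section_hessian:
  assumes r: "local_section N r" "local_section N r'" and z: "z \<in> N"
  shows "B (fd r z u) (fd r' z v) = - B (r z) (fd (\<lambda>y. fd r' y v) z u)"
proof -
  have "fd (\<lambda>y. B (r y) (fd r' y v)) z u = 0"
    by (rule fd_const_on[OF section_open[OF r(1)] z])
      (use section_fd_perp[OF r(2)] section_mem[OF r(1)] perpD in blast)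
  then show ?thesis
    using fd_bilinear[OF bounded_bilinear_B smooth_on_differentiable[OF section_smooth[OF r(1)] z]
        smooth_on_differentiable[OF smooth_on_fd_const[OF section_smooth[OF r(2)]] z], of v u] by simp
qed

text \<open>The right-hand side of \<open>section_hessian\<close> is symmetric in \<open>u\<close>
  and \<open>v\<close>. The orthogonality of \<open>y1\<close> and \<open>x2\<close> rests on
  this.\<close>

lemma section_sym:
  assumes r: "local_section N r" "local_section N r'" and z: "z \<in> N"
  shows "B (fd r z u) (fd r' z v) = B (fd r z v) (fd r' z u)"
  using section_hessian[OF assms] fd_fd_commute[OF section_open[OF r(2)] z section_smooth[OF r(2)], of u v] by simp

lemma local_section_mono: "local_section N r \<Longrightarrow> open N' \<Longrightarrow> N' \<subseteq> N \<Longrightarrow> local_section N' r"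
  unfolding local_section_def using smooth_on_subset by blast

lemma local_section_comb: "local_section V (\<lambda>z. k *\<^sub>R s1 z + l *\<^sub>R s2 z)"
  unfolding local_section_def using F_pair
  by (auto intro!: smooth_on_intros open_V smooth_s1 smooth_s2)

end

section \<open>Closed forms with values in \<open>f \<and> f\<^sup>\<bottom>\<close>\<close>

locale frame_form = lie_frame B V F s1 s2
  for B :: "'v::euclidean_space \<Rightarrow> 'v \<Rightarrow> real" and V F s1 s2 +
  fixes \<Omega> :: "real ^ 2 \<Rightarrow> real ^ 2 \<Rightarrow> 'v \<Rightarrow>\<^sub>L 'v"
  assumes smooth_form: "smooth_on V (\<lambda>z. \<Omega> z u)"
    and linear_form: "z \<in> V \<Longrightarrow> linear (\<Omega> z)"
    and nilpotent_form: "z \<in> V \<Longrightarrow> nilpotent_skew (F z) (\<Omega> z u)"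
    and closed_form: "z \<in> V \<Longrightarrow> fd (\<lambda>z. \<Omega> z v) z u = fd (\<lambda>z. \<Omega> z u) z v"
begin

lemmas form_skew = nilpotent_skewD(1)[OF nilpotent_form]
lemmas form_kill = nilpotent_skewD(2)[OF nilpotent_form]

lemma form_section_swap:
  assumes r: "local_section N r" and z: "z \<in> N"
  shows "blinfun_apply (\<Omega> z v) (fd r z u) = blinfun_apply (\<Omega> z u) (fd r z v)"
proof -
  have zV: "z \<in> V" using r z section_sub by blast
  have 0: "fd (\<lambda>y. blinfun_apply (\<Omega> y v) (r y)) z u = 0" for u v
    by (rule fd_const_on[OF section_open[OF r] z]) (simp add: form_kill[OF section_sub[OF r] section_mem[OF r]])
  have *: "blinfun_apply (\<Omega> z v) (fd r z u) = - blinfun_apply (fd (\<lambda>z. \<Omega> z v) z u) (r z)" for u v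
    using fd_bilinear[OF bounded_bilinear_blinfun_apply smooth_on_differentiable[OF smooth_form zV]
        smooth_on_differentiable[OF section_smooth[OF r] z], of v u]
    unfolding 0[of v u] by (metis eq_neg_iff_add_eq_0)
  show ?thesis using *[of v u] *[of u v] closed_form[OF zV, of v u] by simp
qed

lemma smooth_form_field: "N \<subseteq> V \<Longrightarrow> open N \<Longrightarrow> smooth_on N w \<Longrightarrow> smooth_on N (\<lambda>z. \<Omega> z (w z))"
  by (rule smooth_on_linear_family) (use linear_form smooth_form smooth_on_subset in blast)+

end

section \<open>Frames of curvature spheres and gauge transformations\<close>

locale curvature_frame = lie_frame B V F s1 s2
  for B :: "'v::euclidean_space \<Rightarrow> 'v \<Rightarrow> real" and V F s1 s2 +
  fixes X Y :: "real ^ 2 \<Rightarrow> real ^ 2"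
  assumes smooth_X: "smooth_on V X" and smooth_Y: "smooth_on V Y"
    and X1: "z \<in> V \<Longrightarrow> fd s1 z (X z) \<in> F z" and Y2: "z \<in> V \<Longrightarrow> fd s2 z (Y z) \<in> F z"
    and X2: "z \<in> V \<Longrightarrow> fd s2 z (X z) \<notin> F z" and Y1: "z \<in> V \<Longrightarrow> fd s1 z (Y z) \<notin> F z"
begin

text \<open>The two spheres play symmetric roles, so statements proved for \<open>s1\<close> and
  \<open>Y\<close> transfer to \<open>s2\<close> and \<open>X\<close>.\<close>

lemma swapped: "curvature_frame B V F s2 s1 Y X"
  by unfold_locales
    (use open_V smooth_s1 smooth_s2 F_span F_lie fd_s1_perp fd_s2_perp smooth_X smooth_Y X1 X2 Y1 Y2 in
      \<open>auto simp: insert_commute\<close>)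

abbreviation y1 where "y1 z \<equiv> fd s1 z (Y z)"
abbreviation x2 where "x2 z \<equiv> fd s2 z (X z)"

lemma smooth_y1: "smooth_on V y1" and smooth_x2: "smooth_on V x2"
  by (auto intro!: smooth_on_intros open_V smooth_s1 smooth_s2 smooth_X smooth_Y)

text \<open>By \<open>section_sym\<close> the product equals
  \<open>B (fd s1 z (X z)) (fd s2 z u)\<close>, and \<open>fd s1 z (X z)\<close> lies in
  \<open>F\<close>.\<close>

lemma x2_orth: "z \<in> V \<Longrightarrow> B (fd s1 z u) (x2 z) = 0"
  using section_sym[OF local_section_frame, of z u "X z"] X1 fd_s2_perp perpD by metis

lemma y1_orth: "z \<in> V \<Longrightarrow> B (fd s2 z u) (y1 z) = 0"
  using section_sym[OF local_section_frame, of z "Y z" u] Y2 fd_s1_perp perpD' B_sym by metis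

lemma y1_pos: "z \<in> V \<Longrightarrow> B (y1 z) (y1 z) > 0" and x2_pos: "z \<in> V \<Longrightarrow> B (x2 z) (x2 z) > 0"
  using perp_positive F_lie fd_s1_perp fd_s2_perp X2 Y1 by blast+

lemma frame_perp_expand:
  assumes "z \<in> V" "v \<in> perp B (F z)"
  shows "v - (B v (y1 z) / B (y1 z) (y1 z)) *\<^sub>R y1 z - (B v (x2 z) / B (x2 z) (x2 z)) *\<^sub>R x2 z \<in> F z"
  using assms by (intro perp_expand F_lie fd_s1_perp fd_s2_perp X2 Y1 y1_orth)

lemma fd_s1_expand:
  assumes "z \<in> V"
  shows "fd s1 z u - (B (fd s1 z u) (y1 z) / B (y1 z) (y1 z)) *\<^sub>R y1 z \<in> F z"
  using frame_perp_expand[OF assms fd_s1_perp[OF assms], of u] x2_orth[OF assms] by simp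

lemma fd_s2_expand:
  assumes "z \<in> V"
  shows "fd s2 z u - (B (fd s2 z u) (x2 z) / B (x2 z) (x2 z)) *\<^sub>R x2 z \<in> F z"
  using frame_perp_expand[OF assms fd_s2_perp[OF assms], of u] y1_orth[OF assms] by simp

text \<open>Modulo \<open>F\<close>, \<open>fd s1\<close> kills \<open>X\<close> but not
  \<open>Y\<close>, and \<open>fd s2\<close> kills \<open>Y\<close> but not \<open>X\<close>;
  pairing with \<open>y1\<close> and \<open>x2\<close> isolates the two coefficients.\<close>

lemma XY_independent:
  assumes z: "z \<in> V" and "k *\<^sub>R X z + l *\<^sub>R Y z = 0" shows "k = 0 \<and> l = 0"
proof -
  have lin: "linear (fd s1 z)" "linear (fd s2 z)" using linear_fd smooth_s1 smooth_s2 z by blast+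
  have 1: "k *\<^sub>R fd s1 z (X z) + l *\<^sub>R y1 z = 0"
    using linear_add[OF lin(1)] linear_cmul[OF lin(1)] linear_0[OF lin(1)] assms(2) by metis
  have 2: "k *\<^sub>R x2 z + l *\<^sub>R fd s2 z (Y z) = 0"
    using linear_add[OF lin(2)] linear_cmul[OF lin(2)] linear_0[OF lin(2)] assms(2) by metis
  have "B (k *\<^sub>R fd s1 z (X z) + l *\<^sub>R y1 z) (y1 z) = 0" "B (k *\<^sub>R x2 z + l *\<^sub>R fd s2 z (Y z)) (x2 z) = 0"
    unfolding 1 2 by (simp_all add: B_simps)
  moreover have "B (fd s1 z (X z)) (y1 z) = 0" "B (fd s2 z (Y z)) (x2 z) = 0"
    using X1 Y2 fd_s1_perp fd_s2_perp perpD z by blast+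
  ultimately show ?thesis using y1_pos[OF z] x2_pos[OF z] by (auto simp: B_simps)
qed

lemma XY_expand: "z \<in> V \<Longrightarrow> \<exists>k l. u = k *\<^sub>R X z + l *\<^sub>R Y z"
  using real2_pair_spans XY_independent by blast

text \<open>The coframe dual to \<open>X\<close> and \<open>Y\<close>, written through inner
  products so that its smoothness is visible.\<close>

definition \<theta>X :: "real ^ 2 \<Rightarrow> real ^ 2 \<Rightarrow> real" where "\<theta>X z u = B (fd s2 z u) (x2 z) / B (x2 z) (x2 z)"
definition \<theta>Y :: "real ^ 2 \<Rightarrow> real ^ 2 \<Rightarrow> real" where "\<theta>Y z u = B (fd s1 z u) (y1 z) / B (y1 z) (y1 z)"

lemma \<theta>_expand: assumes z: "z \<in> V" shows "u = \<theta>X z u *\<^sub>R X z + \<theta>Y z u *\<^sub>R Y z"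
proof -
  obtain k l where u: "u = k *\<^sub>R X z + l *\<^sub>R Y z" using XY_expand z by blast
  have lin: "linear (fd s1 z)" "linear (fd s2 z)" using linear_fd smooth_s1 smooth_s2 z by blast+
  have o: "B (fd s1 z (X z)) (y1 z) = 0" "B (fd s2 z (Y z)) (x2 z) = 0"
    using X1 Y2 fd_s1_perp fd_s2_perp perpD z by blast+
  have "\<theta>X z u = k" "\<theta>Y z u = l"
    unfolding \<theta>X_def \<theta>Y_def u using o y1_pos[OF z] x2_pos[OF z]
    by (auto simp: linear_add[OF lin(1)] linear_cmul[OF lin(1)] linear_add[OF lin(2)] linear_cmul[OF lin(2)] B_simps)
  then show ?thesis using u by simp
qed

lemma smooth_\<theta>: "smooth_on V (\<lambda>z. \<theta>X z u)" "smooth_on V (\<lambda>z. \<theta>Y z u)"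
  unfolding \<theta>X_def \<theta>Y_def
  by (intro smooth_on_divide smooth_on_bilinear[OF bounded_bilinear_B] smooth_on_fd_const smooth_s1 smooth_s2 open_V
      smooth_y1 smooth_x2; use x2_pos y1_pos in force)+

lemma wedge_F:
  assumes z: "z \<in> V" and t: "t \<in> wedge_space B (F z) (F z)"
  shows "v \<in> perp B (F z) \<Longrightarrow> blinfun_apply t v = 0" "blinfun_apply t v \<in> F z"
    "B (blinfun_apply t a) b = - B a (blinfun_apply t b)"
proof -
  show "v \<in> perp B (F z) \<Longrightarrow> blinfun_apply t v = 0"
    using wedge_space_perp_zero[OF t] perpD by blast
  show "blinfun_apply t v \<in> F z" using wedge_space_range[OF t] subspace_F[OF z] by blast
  show "B (blinfun_apply t a) b = - B a (blinfun_apply t b)"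
  proof -
    have "t \<in> wedge_space B (F z) (perp B (F z))"
      using t wedge_space_mono[OF order_refl subset_perp[OF F_lie[OF z]]] by blast
    then show ?thesis using nilpotent_skewD(1)[OF wedge_space_nilpotent[OF F_lie[OF z]]] by blast
  qed
qed

text \<open>Differentiates \<open>\<tau> r = 0\<close>.\<close>

lemma fd_wedge_perp:
  assumes N: "open N" "N \<subseteq> V" "smooth_on N \<tau>" "\<And>z. z \<in> N \<Longrightarrow> \<tau> z \<in> wedge_space B (F z) (F z)"
    and z: "z \<in> N" and r: "smooth_on N r" "\<And>z. z \<in> N \<Longrightarrow> r z \<in> perp B (F z)"
  shows "blinfun_apply (fd \<tau> z u) (r z) = - blinfun_apply (\<tau> z) (fd r z u)"
proof -
  have "fd (\<lambda>y. blinfun_apply (\<tau> y) (r y)) z u = 0"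
    by (rule fd_const_on[OF N(1) z]) (use wedge_F(1) N r in blast)
  then show ?thesis
    using fd_bilinear[OF bounded_bilinear_blinfun_apply smooth_on_differentiable[OF N(3) z]
        smooth_on_differentiable[OF r(1) z], of u] by (simp add: add_eq_0_iff)
qed

text \<open>Keeps gauge transforms among the forms with values in
  \<open>f \<and> f\<^sup>\<bottom>\<close>. Since \<open>\<tau>\<close> kills
  \<open>f\<^sup>\<bottom>\<close> and maps into \<open>f\<close>, differentiating
  \<open>\<tau> r = 0\<close> for suitable fields \<open>r\<close> yields the kernel and the range
  condition.\<close>

lemma fd_wedge_nilpotent:
  assumes N: "open N" "N \<subseteq> V" "smooth_on N \<tau>" "\<And>z. z \<in> N \<Longrightarrow> \<tau> z \<in> wedge_space B (F z) (F z)"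
    and z: "z \<in> N"
  shows "nilpotent_skew (F z) (fd \<tau> z u)"
proof -
  have zV: "z \<in> V" using N z by auto
  have kill: "blinfun_apply (fd \<tau> z u) v = 0" if "v \<in> F z" for v
  proof -
    obtain k l where v: "v = k *\<^sub>R s1 z + l *\<^sub>R s2 z" using F_pair zV \<open>v \<in> F z\<close> by blast
    have sec: "local_section N (\<lambda>z. k *\<^sub>R s1 z + l *\<^sub>R s2 z)"
      using local_section_mono[OF local_section_comb N(1,2)] .
    have "blinfun_apply (fd \<tau> z u) v = - blinfun_apply (\<tau> z) (fd (\<lambda>z. k *\<^sub>R s1 z + l *\<^sub>R s2 z) z u)"
      unfolding v
      by (rule fd_wedge_perp[OF N z section_smooth[OF sec]])
        (use subset_perp[OF F_lie] section_mem[OF sec] N(2) in blast)+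
    also have "\<dots> = 0" using wedge_F(1)[OF zV N(4)[OF z] section_fd_perp[OF sec z]] by simp
    finally show ?thesis .
  qed
  have rng: "blinfun_apply (fd \<tau> z u) v \<in> F z" if v: "v \<in> perp B (F z)" for v
  proof -
    define a b where "a = B v (y1 z) / B (y1 z) (y1 z)" and "b = B v (x2 z) / B (x2 z) (x2 z)"
    have *: "v - a *\<^sub>R y1 z - b *\<^sub>R x2 z \<in> F z" unfolding a_def b_def by (rule frame_perp_expand[OF zV v])
    \<comment> \<open>Modulo \<open>F\<close>, the vector \<open>v\<close> is extended to a field in
      \<open>F\<^sup>\<bottom>\<close> by freezing the coefficients \<open>a\<close> and
      \<open>b\<close>.\<close>
    have sm: "smooth_on N (\<lambda>z. a *\<^sub>R y1 z + b *\<^sub>R x2 z)"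
      by (intro smooth_on_intros N smooth_on_subset[OF smooth_s1] smooth_on_subset[OF smooth_s2]
          smooth_on_subset[OF smooth_X] smooth_on_subset[OF smooth_Y])
    have "blinfun_apply (fd \<tau> z u) (a *\<^sub>R y1 z + b *\<^sub>R x2 z) = - blinfun_apply (\<tau> z) (fd (\<lambda>z. a *\<^sub>R y1 z + b *\<^sub>R x2 z) z u)"
      by (intro fd_wedge_perp[OF N z sm] subspace_add subspace_scale subspace_perp fd_s1_perp fd_s2_perp) (use N in auto)
    then have "blinfun_apply (fd \<tau> z u) (a *\<^sub>R y1 z + b *\<^sub>R x2 z) \<in> F z"
      using wedge_F(2)[OF zV N(4)[OF z]] subspace_neg[OF subspace_F[OF zV]] by simp
    moreover have "blinfun_apply (fd \<tau> z u) v = blinfun_apply (fd \<tau> z u) (a *\<^sub>R y1 z + b *\<^sub>R x2 z)"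
      using kill[OF *] by (simp add: blinfun.diff_right blinfun.add_right algebra_simps)
    ultimately show ?thesis by simp
  qed
  have skew: "B (blinfun_apply (fd \<tau> z u) a) b = - B a (blinfun_apply (fd \<tau> z u) b)" for a b
  proof -
    have d: "\<tau> differentiable at z" using smooth_on_differentiable[OF N(3) z] .
    have *: "fd (\<lambda>y. B (blinfun_apply (\<tau> y) a) b) z u = B (blinfun_apply (fd \<tau> z u) a) b" for a b
      by (rule fd_linear[OF _ d])
        (intro bounded_linear_compose[OF bounded_linear_B_left] blinfun.bounded_linear_left)
    have "fd (\<lambda>y. B (blinfun_apply (\<tau> y) a) b + B (blinfun_apply (\<tau> y) b) a) z u = 0"
      by (rule fd_const_on[OF N(1) z]) (use wedge_F(3)[OF subsetD[OF N(2)] N(4), of _ a b] B_sym[of a] in simp)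
    moreover have "(\<lambda>y. B (blinfun_apply (\<tau> y) a) b) differentiable at z" for a b
      by (rule bounded_linear_imp_differentiable[THEN differentiable_compose, OF _ d])
        (intro bounded_linear_compose[OF bounded_linear_B_left] blinfun.bounded_linear_left)
    ultimately show ?thesis using * by (simp add: fd_add B_sym[of a])
  qed
  show ?thesis unfolding nilpotent_skew_def using kill rng skew by blast
qed

text \<open>Gauge invariance of the quadratic form \<open>q\<close>.\<close>

lemma fd_wedge_trace:
  assumes N: "open N" "N \<subseteq> V" "smooth_on N \<tau>" "\<And>z. z \<in> N \<Longrightarrow> \<tau> z \<in> wedge_space B (F z) (F z)"
    and z: "z \<in> N"
  shows "c1 z (blinfun_apply (fd \<tau> z u) (fd s1 z w)) + c2 z (blinfun_apply (fd \<tau> z u) (fd s2 z w)) = 0"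
proof -
  have zV: "z \<in> V" using N z by auto
  obtain k where k: "\<tau> z = k *\<^sub>R wedge B (s1 z) (s2 z)"
    using wedge_space_pair N(4)[OF z] F_span[OF zV] by metis
  have e: "blinfun_apply (fd \<tau> z u) (fd s1 z w) = - blinfun_apply (\<tau> z) (fd (\<lambda>z. fd s1 z w) z u)"
    "blinfun_apply (fd \<tau> z u) (fd s2 z w) = - blinfun_apply (\<tau> z) (fd (\<lambda>z. fd s2 z w) z u)"
    using N(2) by (intro fd_wedge_perp[OF N z] smooth_on_fd_const smooth_on_subset[OF smooth_s1] smooth_on_subset[OF smooth_s2]
        fd_s1_perp fd_s2_perp; blast)+
  \<comment> \<open>With \<open>\<tau> = k s1 \<and> s2\<close> the two diagonal entries are
    \<open>k\<close> and \<open>- k\<close> times these products, whose equality makes the trace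
    vanish.\<close>
  have "B (s1 z) (fd (\<lambda>z. fd s2 z w) z u) = - B (fd s1 z u) (fd s2 z w)"
    "B (s2 z) (fd (\<lambda>z. fd s1 z w) z u) = - B (fd s2 z u) (fd s1 z w)"
    using section_hessian[OF local_section_frame(1,2) zV] section_hessian[OF local_section_frame(2,1) zV] by auto
  moreover have "B (fd s2 z u) (fd s1 z w) = B (fd s1 z u) (fd s2 z w)"
    using section_sym[OF local_section_frame(1,2) zV, of u w] B_sym by metis
  ultimately show ?thesis
    unfolding e by (simp add: k blinfun.scaleR_left c_linear c_frame[OF zV] right_diff_distrib)
qed

end

locale curvature_form = curvature_frame B V F s1 s2 X Y + frame_form B V F s1 s2 \<Omega>
  for B :: "'v::euclidean_space \<Rightarrow> 'v \<Rightarrow> real" and V F s1 s2 X Y \<Omega>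
begin

lemma form_X_y1: "z \<in> V \<Longrightarrow> blinfun_apply (\<Omega> z (X z)) (y1 z) = 0"
  using form_section_swap[OF local_section_frame(1), of z "X z" "Y z"] form_kill X1 by metis

lemma form_Y_x2: "z \<in> V \<Longrightarrow> blinfun_apply (\<Omega> z (Y z)) (x2 z) = 0"
  using form_section_swap[OF local_section_frame(2), of z "X z" "Y z"] form_kill Y2 by metis

lemma form_fd_s1:
  assumes "z \<in> V"
  shows "blinfun_apply (\<Omega> z u) (fd s1 z w) = \<theta>Y z w *\<^sub>R blinfun_apply (\<Omega> z u) (y1 z)"
  using form_kill[OF assms fd_s1_expand[OF assms, of w], of u] unfolding \<theta>Y_def
  by (simp add: blinfun.diff_right blinfun.scaleR_right)

lemma form_fd_s2:
  assumes "z \<in> V"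
  shows "blinfun_apply (\<Omega> z u) (fd s2 z w) = \<theta>X z w *\<^sub>R blinfun_apply (\<Omega> z u) (x2 z)"
  using form_kill[OF assms fd_s2_expand[OF assms, of w], of u] unfolding \<theta>X_def
  by (simp add: blinfun.diff_right blinfun.scaleR_right)

lemma form_expand: "z \<in> V \<Longrightarrow> \<Omega> z u = \<theta>X z u *\<^sub>R \<Omega> z (X z) + \<theta>Y z u *\<^sub>R \<Omega> z (Y z)"
  using linear_add[OF linear_form] linear_cmul[OF linear_form] \<theta>_expand by metis

end

text \<open>Leibniz rule for a derivative taken in the moving direction \<open>W\<close>: the second
  summand accounts for the motion of \<open>W\<close>, made explicit by expansion in the
  basis.\<close>

lemma fd_fd_field:
  fixes s :: "'m::euclidean_space \<Rightarrow> 'b::real_normed_vector"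
  assumes N: "open N" "z \<in> N" "smooth_on N s" "smooth_on N W"
  shows "fd (\<lambda>y. fd s y (W y)) z u = fd (\<lambda>y. fd s y (W z)) z u + fd s z (fd W z u)"
proof -
  have dW: "W differentiable at z" using N smooth_on_differentiable by blast
  have ds: "(\<lambda>y. fd s y b) differentiable at z" for b
    using N smooth_on_differentiable smooth_on_fd_const by blast
  have ex: "fd s y w = (\<Sum>b\<in>Basis. (w \<bullet> b) *\<^sub>R fd s y b)" if "y \<in> N" for y w
    using linear_basis_expand[OF linear_fd[OF N(3) that]] .
  have dWb: "((\<lambda>y. W y \<bullet> b) has_derivative (\<lambda>u. fd W z u \<bullet> b)) (at z)" for b
    using has_derivative_inner_left[OF has_derivative_fd[OF dW]] .
  have "((\<lambda>y. \<Sum>b\<in>Basis. (W y \<bullet> b) *\<^sub>R fd s y b) has_derivative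
      (\<lambda>u. \<Sum>b\<in>Basis. (W z \<bullet> b) *\<^sub>R fd (\<lambda>y. fd s y b) z u + (fd W z u \<bullet> b) *\<^sub>R fd s z b)) (at z)"
    by (intro has_derivative_sum has_derivative_scaleR dWb has_derivative_fd ds)
  from fd_eq[OF this] have "fd (\<lambda>y. \<Sum>b\<in>Basis. (W y \<bullet> b) *\<^sub>R fd s y b) z u =
      (\<Sum>b\<in>Basis. (W z \<bullet> b) *\<^sub>R fd (\<lambda>y. fd s y b) z u + (fd W z u \<bullet> b) *\<^sub>R fd s z b)"
    by simp
  moreover have "fd (\<lambda>y. fd s y (W y)) z = fd (\<lambda>y. \<Sum>b\<in>Basis. (W y \<bullet> b) *\<^sub>R fd s y b) z"
    by (rule fd_cong_open[OF N(1,2)]) (rule ex)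
  moreover have "fd (\<lambda>y. fd s y (W z)) z u = (\<Sum>b\<in>Basis. (W z \<bullet> b) *\<^sub>R fd (\<lambda>y. fd s y b) z u)" (is "fd (\<lambda>y. fd s y ?w) z u = _")
  proof -
    have "((\<lambda>y. \<Sum>b\<in>Basis. (?w \<bullet> b) *\<^sub>R fd s y b) has_derivative
        (\<lambda>u. \<Sum>b\<in>Basis. (?w \<bullet> b) *\<^sub>R fd (\<lambda>y. fd s y b) z u)) (at z)"
      by (intro has_derivative_sum bounded_linear.has_derivative[OF bounded_linear_scaleR_right] has_derivative_fd ds)
    from fd_eq[OF this] have "fd (\<lambda>y. \<Sum>b\<in>Basis. (?w \<bullet> b) *\<^sub>R fd s y b) z u = (\<Sum>b\<in>Basis. (?w \<bullet> b) *\<^sub>R fd (\<lambda>y. fd s y b) z u)"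
      by simp
    moreover have "fd (\<lambda>y. fd s y ?w) z = fd (\<lambda>y. \<Sum>b\<in>Basis. (?w \<bullet> b) *\<^sub>R fd s y b) z"
      by (rule fd_cong_open[OF N(1,2)]) (rule ex)
    ultimately show ?thesis by simp
  qed
  ultimately show ?thesis unfolding ex[OF N(2), of "fd W z u"] by (simp only: sum.distrib)
qed

text \<open>Divide \<open>\<alpha> f\<^sup>2 + \<beta> g\<^sup>2 = 0\<close> by \<open>t\<^sup>2\<close> along \<open>z + t v\<close>.\<close>

lemma fd_zero_of_squares:
  fixes f g \<alpha> \<beta> :: "'m::real_normed_vector \<Rightarrow> real"
  assumes N: "open N" "z \<in> N" and eq: "\<And>y. y \<in> N \<Longrightarrow> \<alpha> y * (f y)\<^sup>2 + \<beta> y * (g y)\<^sup>2 = 0"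
    and d: "f differentiable at z" "g differentiable at z" and c: "isCont \<alpha> z" "isCont \<beta> z"
    and 0: "f z = 0" "g z = 0" "fd g z v = 0" "\<alpha> z \<noteq> 0"
  shows "fd f z v = 0"
proof -
  have line: "((\<lambda>t. h (z + t *\<^sub>R v) / t) \<longlongrightarrow> fd h z v) (at 0)"
    if h: "h differentiable at z" "h z = 0" for h :: "'m \<Rightarrow> real"
  proof -
    have "((\<lambda>t. z + t *\<^sub>R v) has_derivative (\<lambda>s. s *\<^sub>R v)) (at 0)"
      by (auto intro!: derivative_eq_intros)
    from has_derivative_compose[OF this, of h "fd h z"] has_derivative_fd[OF h(1)]
    have "((\<lambda>t. h (z + t *\<^sub>R v)) has_derivative (\<lambda>s. fd h z (s *\<^sub>R v))) (at 0)" by simp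
    moreover have "fd h z (s *\<^sub>R v) = fd h z v * s" for s
      using linear_cmul[OF linear_frechet_derivative[OF h(1)], of s v] by simp
    ultimately have "((\<lambda>t. h (z + t *\<^sub>R v)) has_real_derivative fd h z v) (at 0)"
      by (simp add: has_field_derivative_def mult_commute_abs)
    then show ?thesis using h(2) by (simp add: DERIV_def)
  qed
  have zt: "((\<lambda>t. z + t *\<^sub>R v) \<longlongrightarrow> z) (at (0::real))"
    by (rule tendsto_eq_intros refl | simp)+
  have ab: "((\<lambda>t. \<alpha> (z + t *\<^sub>R v)) \<longlongrightarrow> \<alpha> z) (at (0::real))" "((\<lambda>t. \<beta> (z + t *\<^sub>R v)) \<longlongrightarrow> \<beta> z) (at (0::real))"
    using isCont_tendsto_compose[OF c(1) zt] isCont_tendsto_compose[OF c(2) zt] .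
  have "((\<lambda>t. \<alpha> (z + t *\<^sub>R v) * (f (z + t *\<^sub>R v) / t)\<^sup>2 + \<beta> (z + t *\<^sub>R v) * (g (z + t *\<^sub>R v) / t)\<^sup>2)
      \<longlongrightarrow> \<alpha> z * (fd f z v)\<^sup>2 + \<beta> z * (fd g z v)\<^sup>2) (at 0)"
    by (intro tendsto_intros ab line d 0)
  moreover have "\<forall>\<^sub>F t in at 0. \<alpha> (z + t *\<^sub>R v) * (f (z + t *\<^sub>R v) / t)\<^sup>2 + \<beta> (z + t *\<^sub>R v) * (g (z + t *\<^sub>R v) / t)\<^sup>2 = 0"
  proof -
    have "\<forall>\<^sub>F t in at (0::real). z + t *\<^sub>R v \<in> N"
      using topological_tendstoD[OF zt N] .
    then show ?thesis
    proof eventually_elim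
      case (elim t)
      have "\<alpha> (z + t *\<^sub>R v) * (f (z + t *\<^sub>R v) / t)\<^sup>2 + \<beta> (z + t *\<^sub>R v) * (g (z + t *\<^sub>R v) / t)\<^sup>2 =
          (\<alpha> (z + t *\<^sub>R v) * (f (z + t *\<^sub>R v))\<^sup>2 + \<beta> (z + t *\<^sub>R v) * (g (z + t *\<^sub>R v))\<^sup>2) / t\<^sup>2"
        by (simp add: power_divide add_divide_distrib)
      then show ?case using eq[OF elim] by simp
    qed
  qed
  ultimately have "((\<lambda>t. 0::real) \<longlongrightarrow> \<alpha> z * (fd f z v)\<^sup>2 + \<beta> z * (fd g z v)\<^sup>2) (at (0::real))"
    using tendsto_cong by force
  then have "\<alpha> z * (fd f z v)\<^sup>2 + \<beta> z * (fd g z v)\<^sup>2 = 0"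
    using tendsto_unique[OF _ tendsto_const] trivial_limit_at[of "0::real"] by metis
  then show ?thesis using 0 by simp
qed

context R42 begin

text \<open>Choose \<open>z\<close> with \<open>B s z = 1\<close> and \<open>B n z = 0\<close>. If
  \<open>\<omega>\<close> is the wedge of \<open>s\<close> with some \<open>m\<close>, then
  \<open>\<omega> z\<close> is \<open>m\<close> up to a multiple of \<open>s\<close>, so
  \<open>\<omega> z\<close> is the natural candidate for \<open>m\<close>. Skewness and
  \<open>\<omega> p = 0\<close> make it orthogonal to \<open>z\<close> and \<open>p\<close>.\<close>

lemma nilpotent_wedge:
  assumes W: "W \<in> lie_grassmannian B" and \<omega>: "nilpotent_skew W \<omega>" and p: "blinfun_apply \<omega> p = 0"
    and s: "s \<in> W" "s \<noteq> 0" "B s p = 0" and n: "n \<in> W" "B n p = 1"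
  shows "\<exists>m\<in>perp B W. B m p = 0 \<and> \<omega> = wedge B s m"
proof -
  note Wd = lie_grassmannianD[OF W]
  have ind: "k = 0 \<and> l = 0" if "k *\<^sub>R s + l *\<^sub>R n = 0" for k l
  proof -
    have "B (k *\<^sub>R s + l *\<^sub>R n) p = 0" unfolding that by (simp add: B_simps)
    then have "l = 0" using s n by (simp add: B_simps)
    then show ?thesis using s that by simp
  qed
  have Wsp: "W = span {s, n}" by (rule span_pair_eq[OF Wd(1,2) s(1) n(1) ind])
  have "s \<notin> span {n}" by (rule independent_pair(2)) (rule ind)
  then obtain z where z: "\<And>a. a \<in> span {n} \<Longrightarrow> B a z = 0" "B s z = 1"
    using perp_exists[of "span {n}" s] by auto
  have nz: "B n z = 0" using z(1) by (simp add: span_base)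
  define m where "m = blinfun_apply \<omega> z"
  note sk = nilpotent_skewD[OF \<omega>]
  have mW: "m \<in> perp B W"
    unfolding perp_def m_def using sk(1)[of _ z] sk(2) by (auto simp: B_simps) (metis B.zero_left neg_equal_0_iff_equal)
  have mp: "B m p = 0" using sk(1)[of z p] p by (simp add: m_def B_simps)
  have mz: "B m z = 0" using sk(1)[of z z] B_sym[of m z] by (simp add: m_def)
  have "blinfun_apply \<omega> v = blinfun_apply (wedge B s m) v" for v
  proof -
    \<comment> \<open>Subtracting multiples of \<open>z\<close> and \<open>p\<close> moves
      \<open>v\<close> into \<open>W\<^sup>\<bottom>\<close>; subtracting a multiple of
      \<open>n\<close> afterwards also makes it orthogonal to \<open>p\<close>.\<close>
    define w where "w = v - B s v *\<^sub>R z - B n v *\<^sub>R p"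
    have "B s w = 0" "B n w = 0" using s n z nz by (auto simp: w_def B_simps)
    then have wW: "w \<in> perp B W" unfolding perp_def Wsp by (auto simp: span_pair B_simps)
    define x where "x = w - B w p *\<^sub>R n"
    have xW: "x \<in> perp B W" unfolding x_def
      by (intro subspace_diff subspace_scale subspace_perp wW subsetD[OF subset_perp[OF W] n(1)])
    have xp: "B x p = 0" using n by (simp add: x_def B_simps)
    have ox: "blinfun_apply \<omega> x = - B m x *\<^sub>R s"
    proof -
      obtain k l where kl: "blinfun_apply \<omega> x = k *\<^sub>R s + l *\<^sub>R n"
        using sk(3)[OF xW] Wsp span_pair by blast
      have "B (blinfun_apply \<omega> x) p = 0" using sk(1)[of x p] p by (simp add: B_simps)
      then have "l = 0" using s n kl by (simp add: B_simps)
      moreover have "k = B (blinfun_apply \<omega> x) z" using kl z nz by (simp add: B_simps)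
      then have "k = - B m x" using sk(1)[of x z] B_sym[of x m] by (simp add: m_def)
      ultimately show ?thesis using kl by simp
    qed
    have v: "v = x + B w p *\<^sub>R n + B s v *\<^sub>R z + B n v *\<^sub>R p" by (simp add: x_def w_def)
    have "blinfun_apply \<omega> v = - B m x *\<^sub>R s + B s v *\<^sub>R m"
      by (subst v) (simp add: blinfun.add_right blinfun.scaleR_right ox sk(2)[OF n(1)] p m_def)
    moreover have "B m v = B m x"
      by (subst v) (use mp mz perpD'[OF mW n(1)] in \<open>simp add: B_simps\<close>)
    ultimately show ?thesis by simp
  qed
  then have "\<omega> = wedge B s m" by (rule blinfun_eqI)
  then show ?thesis using mW mp by blast
qed

end

section \<open>Second derivatives of curvature spheres and the middle condition\<close>

context curvature_frame begin

text \<open>Differentiates \<open>B (s1 z) (y1 z) = 0\<close> and \<open>B (s2 z) (y1 z) = 0\<close>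
  along \<open>Y\<close>; \<open>y1\<close> is orthogonal to all derivatives of
  \<open>s2\<close>.\<close>

lemma s1_fd_y1: assumes "z \<in> V" shows "B (s1 z) (fd y1 z (Y z)) = - B (y1 z) (y1 z)"
    "B (s2 z) (fd y1 z (Y z)) = 0"
proof -
  have d: "s1 differentiable at z" "s2 differentiable at z" "y1 differentiable at z"
    using smooth_on_differentiable smooth_s1 smooth_s2 smooth_y1 assms by blast+
  have "fd (\<lambda>z. B (s1 z) (y1 z)) z (Y z) = 0" "fd (\<lambda>z. B (s2 z) (y1 z)) z (Y z) = 0"
    using fd_const_on[OF open_V assms, of "\<lambda>z. B (s1 z) (y1 z)" 0] fd_const_on[OF open_V assms, of "\<lambda>z. B (s2 z) (y1 z)" 0]
      perpD[OF fd_s1_perp s_mem(1)] perpD[OF fd_s1_perp s_mem(2)] by simp_all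
  then show "B (s1 z) (fd y1 z (Y z)) = - B (y1 z) (y1 z)" "B (s2 z) (fd y1 z (Y z)) = 0"
    using fd_bilinear[OF bounded_bilinear_B d(1,3), of "Y z"] fd_bilinear[OF bounded_bilinear_B d(2,3), of "Y z"]
      y1_orth[OF assms, of "Y z"] by auto
qed

text \<open>\<open>d\<^sub>X d\<^sub>Y s\<^sub>1\<close> and \<open>d\<^sub>Y d\<^sub>X s\<^sub>1\<close> differ by a first derivative of \<open>s\<^sub>1\<close>, and \<open>d\<^sub>X s\<^sub>1\<close> is a section of \<open>f\<close>.\<close>

lemma y1_fd_x2: assumes z: "z \<in> V" shows "B (y1 z) (fd x2 z (X z)) = 0"
proof -
  let ?r = "\<lambda>y. fd s1 y (X y)"
  have d: "x2 differentiable at z" "y1 differentiable at z"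
    using smooth_on_differentiable smooth_x2 smooth_y1 assms by blast+
  have r: "local_section V ?r"
    unfolding local_section_def using open_V X1 by (auto intro!: smooth_on_intros smooth_s1 smooth_X)
  have "fd y1 z (X z) = fd (\<lambda>y. fd s1 y (Y z)) z (X z) + fd s1 z (fd Y z (X z))"
    by (rule fd_fd_field[OF open_V z smooth_s1 smooth_Y])
  moreover have "fd ?r z (Y z) = fd (\<lambda>y. fd s1 y (X z)) z (Y z) + fd s1 z (fd X z (Y z))"
    by (rule fd_fd_field[OF open_V z smooth_s1 smooth_X])
  moreover have "fd (\<lambda>y. fd s1 y (X z)) z (Y z) = fd (\<lambda>y. fd s1 y (Y z)) z (X z)"
    by (rule fd_fd_commute[OF open_V z smooth_s1])
  ultimately have "fd y1 z (X z) = fd ?r z (Y z) - fd s1 z (fd X z (Y z)) + fd s1 z (fd Y z (X z))" by simp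
  moreover have "B (fd ?r z (Y z)) (x2 z) = 0"
  proof -
    let ?e = "c1 z (?r z) *\<^sub>R fd s1 z (Y z) + c2 z (?r z) *\<^sub>R fd s2 z (Y z)"
    have "B (fd ?r z (Y z) - ?e) (x2 z) = 0"
      using section_fd[OF r z] fd_s2_perp[OF z] perpD by blast
    moreover have "B ?e (x2 z) = 0"
      using x2_orth[OF z] perpD[OF fd_s2_perp[OF z] Y2[OF z]] by (simp add: B_simps)
    ultimately show ?thesis by (simp add: B.diff_left)
  qed
  ultimately have "B (fd y1 z (X z)) (x2 z) = 0" using x2_orth[OF z] by (simp add: B_simps)
  moreover have "fd (\<lambda>y. B (y1 y) (x2 y)) z (X z) = 0"
    by (rule fd_const_on[OF open_V z]) (rule x2_orth)
  ultimately show ?thesis using fd_bilinear[OF bounded_bilinear_B d(2,1), of "X z"] by simp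
qed

text \<open>The middle condition, tested on a vector \<open>v\<close> orthogonal to \<open>S\<^sub>1\<close> but not to \<open>s\<^sub>2\<close>.\<close>

lemma middle_y1:
  assumes z: "z \<in> V" and \<omega>: "nilpotent_skew (F z) \<omega>" and dec: "\<omega> = b1 + b2 + c"
    and b1: "b1 \<in> wedge_space B S1 S1" and S1: "S1 \<subseteq> span {s1 z, y1 z, fd y1 z (Y z)}"
    and b2: "b2 \<in> wedge_space B S2 S2" and S2: "S2 \<subseteq> span {s2 z, x2 z, fd x2 z (X z)}"
    and c: "c \<in> wedge_space B (F z) (F z)"
  shows "blinfun_apply \<omega> (y1 z) \<in> span {s1 z}"
proof -
  let ?S1 = "span {s1 z, y1 z, fd y1 z (Y z)}" and ?S2 = "span {s2 z, x2 z, fd x2 z (X z)}"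
  have y1W: "y1 z \<in> perp B (F z)" using fd_s1_perp z by blast
  have o: "B (s1 z) (y1 z) = 0" "B (s2 z) (y1 z) = 0" "B (s1 z) (s1 z) = 0" "B (s1 z) (s2 z) = 0"
    using y1W perpD s_mem[OF z] F_null[OF z] by blast+
  \<comment> \<open>Pairing with \<open>s1\<close> eliminates the second derivative, pairing with
    \<open>y1\<close> the first, and \<open>s2\<close> is no multiple of \<open>s1\<close>.\<close>
  have "s2 z \<notin> ?S1"
  proof
    assume "s2 z \<in> ?S1"
    then obtain k where "s2 z - k *\<^sub>R s1 z \<in> span {y1 z, fd y1 z (Y z)}" by (auto simp: span_breakdown_eq)
    then obtain l m where e: "s2 z - k *\<^sub>R s1 z = l *\<^sub>R y1 z + m *\<^sub>R fd y1 z (Y z)" using span_pair by blast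
    have "B (s1 z) (l *\<^sub>R y1 z + m *\<^sub>R fd y1 z (Y z)) = 0" unfolding e[symmetric] using o by (simp add: B_simps)
    then have m: "m = 0" using o s1_fd_y1[OF z] y1_pos[OF z] by (auto simp: B_simps)
    have "B (l *\<^sub>R y1 z + m *\<^sub>R fd y1 z (Y z)) (y1 z) = 0" unfolding e[symmetric] using o by (simp add: B_simps)
    then have "l = 0" using m y1_pos[OF z] by (auto simp: B_simps)
    then have "(-k) *\<^sub>R s1 z + 1 *\<^sub>R s2 z = 0" using e m by simp
    then show False using frame_independent[OF z] by (metis zero_neq_one)
  qed
  then obtain v where v: "\<And>s. s \<in> ?S1 \<Longrightarrow> B s v = 0" "B (s2 z) v = 1"
    using perp_exists[of ?S1 "s2 z"] by auto
  have s1v: "B (s1 z) v = 0" using v(1) by (simp add: span_base)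
  obtain k l where kl: "blinfun_apply \<omega> (y1 z) = k *\<^sub>R s1 z + l *\<^sub>R s2 z"
    using nilpotent_skewD(3)[OF \<omega> y1W] F_pair[OF z] by blast
  have "l = B (blinfun_apply \<omega> (y1 z)) v" using kl s1v v by (simp add: B_simps)
  also have "\<dots> = - B (y1 z) (blinfun_apply \<omega> v)" using nilpotent_skewD(1)[OF \<omega>] by blast
  also have "blinfun_apply \<omega> v = blinfun_apply b2 v + blinfun_apply c v"
    using wedge_space_perp_zero[OF b1] v(1) S1 unfolding dec by (simp add: blinfun.add_left subset_iff)
  \<comment> \<open>\<open>y1\<close> is orthogonal to \<open>?S2\<close> and to \<open>F\<close>,
    so neither of the remaining components contributes.\<close>
  also have "B (y1 z) (blinfun_apply b2 v + blinfun_apply c v) = 0"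
  proof -
    have "b2 \<in> wedge_space B ?S2 ?S2" using b2 wedge_space_mono[OF S2 S2] by blast
    then have "blinfun_apply b2 v \<in> ?S2" by (rule wedge_space_range) simp
    moreover have "?S2 \<subseteq> {w. B (y1 z) w = 0}"
      by (rule span_minimal)
        (use o x2_orth[OF z] y1_fd_x2[OF z] in \<open>auto simp: subspace_def B_simps B_sym[of "y1 z" "s2 z"]\<close>)
    ultimately have "B (y1 z) (blinfun_apply b2 v) = 0" by blast
    moreover have "B (y1 z) (blinfun_apply c v) = 0"
      using wedge_F(2)[OF z c] perpD'[OF y1W] by blast
    ultimately show ?thesis by (simp add: B_simps)
  qed
  finally show ?thesis using kl by (simp add: span_base span_scale)
qed

text \<open>The section is \<open>g s1\<close> and the field is \<open>h Y\<close> for smooth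
  functions \<open>g\<close> and \<open>h\<close>. By the Leibniz rule these functions only mix the
  three vectors formed from \<open>s1\<close> and \<open>Y\<close>.\<close>

lemma osculating_generators:
  assumes N: "open N" "N \<subseteq> V" and z: "z \<in> N" and r: "smooth_on N r" "\<And>y. y \<in> N \<Longrightarrow> r y \<in> span {s1 y}"
    and W: "smooth_on N W" "\<And>y. y \<in> N \<Longrightarrow> fd s2 y (W y) \<in> F y"
  shows "{r z, fd r z (W z), fd (\<lambda>y. fd r y (W y)) z (W z)} \<subseteq> span {s1 z, y1 z, fd y1 z (Y z)}"
proof -
  let ?S = "span {s1 z, y1 z, fd y1 z (Y z)}"
  have zV: "z \<in> V" using N z by auto
  define g where "g y = c1 y (r y)" for y
  define h where "h y = \<theta>Y y (W y)" for y
  have g: "smooth_on N g" unfolding g_def by (rule smooth_c[OF N r(1)])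
  have rg: "r y = g y *\<^sub>R s1 y" if "y \<in> N" for y
    using r(2)[OF that] N(2) that by (auto simp: span_singleton g_def c_linear)
  have sub: "smooth_on N s1" "smooth_on N s2" "smooth_on N y1" "smooth_on N Y"
    using smooth_on_subset N(2) smooth_s1 smooth_s2 smooth_y1 smooth_Y by blast+
  have h: "smooth_on N h"
    unfolding h_def \<theta>Y_def
    by (intro smooth_on_divide smooth_on_bilinear[OF bounded_bilinear_B] smooth_on_fd N sub W)
      (use y1_pos N(2) in force)
  have Wh: "W y = h y *\<^sub>R Y y" if "y \<in> N" for y
  proof -
    have yV: "y \<in> V" using N(2) that by auto
    have "B (fd s2 y (W y)) (x2 y) = 0" using W(2)[OF that] fd_s2_perp[OF yV] perpD by blast
    then show ?thesis using \<theta>_expand[OF yV, of "W y"] by (simp add: \<theta>X_def h_def)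
  qed
  have fdr: "fd r y w = g y *\<^sub>R fd s1 y w + fd g y w *\<^sub>R s1 y" if "y \<in> N" for y w
  proof -
    have "fd r y = fd (\<lambda>y. g y *\<^sub>R s1 y) y" by (rule fd_cong_open[OF N(1) that rg])
    then show ?thesis
      using fd_scaleR[OF smooth_on_differentiable[OF g that] smooth_on_differentiable[OF sub(1) that]] by simp
  qed
  have lin: "linear (fd s1 y)" if "y \<in> N" for y using linear_fd[OF sub(1) that] .
  have fds: "fd s1 y (W y) = h y *\<^sub>R y1 y" if "y \<in> N" for y
    using Wh[OF that] linear_cmul[OF lin[OF that]] by simp
  define P where "P y = g y * h y" for y
  define Q where "Q y = fd g y (W y)" for y
  have P: "smooth_on N P" and Q: "smooth_on N Q"
    unfolding P_def Q_def by (intro smooth_on_intros N g h W)+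
  have G: "fd r y (W y) = P y *\<^sub>R y1 y + Q y *\<^sub>R s1 y" if "y \<in> N" for y
    using fdr[OF that] fds[OF that] by (simp add: P_def Q_def)
  note d = smooth_on_differentiable[OF P z] smooth_on_differentiable[OF Q z]
    smooth_on_differentiable[OF sub(1) z] smooth_on_differentiable[OF sub(3) z]
  have "fd (\<lambda>y. fd r y (W y)) z (W z) = fd (\<lambda>y. P y *\<^sub>R y1 y + Q y *\<^sub>R s1 y) z (W z)"
    using fd_cong_open[OF N(1) z G] by simp
  also have "\<dots> = (P z *\<^sub>R fd y1 z (W z) + fd P z (W z) *\<^sub>R y1 z) + (Q z *\<^sub>R fd s1 z (W z) + fd Q z (W z) *\<^sub>R s1 z)"
    using fd_add[OF differentiable_scaleR[OF d(1,4)] differentiable_scaleR[OF d(2,3)]]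
      fd_scaleR[OF d(1,4)] fd_scaleR[OF d(2,3)] by simp
  also have "fd y1 z (W z) = h z *\<^sub>R fd y1 z (Y z)"
    using Wh[OF z] linear_cmul[OF linear_fd[OF sub(3) z]] by simp
  finally have 3: "fd (\<lambda>y. fd r y (W y)) z (W z) \<in> ?S"
    unfolding fds[OF z] by (simp add: span_add span_scale span_base)
  have 2: "fd r z (W z) \<in> ?S" unfolding G[OF z] by (simp add: span_add span_scale span_base)
  have 1: "r z \<in> ?S" unfolding rg[OF z] by (simp add: span_scale span_base)
  show ?thesis using 1 2 3 by blast
qed

end

text \<open>The assumptions on \<open>p1\<close> are the coefficients of \<open>t\<close> and
  \<open>t\<^sup>2\<close> in the conservation law and in the constancy of
  \<open>(p(t), p(t))\<close>; \<open>middle1\<close> to \<open>nonzero2\<close> distil the middle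
  condition and the non-degeneracy of \<open>q\<close>.\<close>

locale middle_frame = curvature_form B V F s1 s2 X Y \<Omega>
  for B :: "'v::euclidean_space \<Rightarrow> 'v \<Rightarrow> real" and V F s1 s2 X Y \<Omega> +
  fixes p :: 'v and p1 :: "real ^ 2 \<Rightarrow> 'v"
  assumes middle1: "z \<in> V \<Longrightarrow> blinfun_apply (\<Omega> z u) (y1 z) \<in> span {s1 z}"
    and middle2: "z \<in> V \<Longrightarrow> blinfun_apply (\<Omega> z u) (x2 z) \<in> span {s2 z}"
    and nonzero1: "z \<in> V \<Longrightarrow> blinfun_apply (\<Omega> z (Y z)) (y1 z) \<noteq> 0"
    and nonzero2: "z \<in> V \<Longrightarrow> blinfun_apply (\<Omega> z (X z)) (x2 z) \<noteq> 0"
    and smooth_p1: "smooth_on V p1"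
    and fd_p1: "z \<in> V \<Longrightarrow> fd p1 z u = - blinfun_apply (\<Omega> z u) p"
    and form_p1: "z \<in> V \<Longrightarrow> blinfun_apply (\<Omega> z u) (p1 z) = 0"
    and null_p1: "z \<in> V \<Longrightarrow> B (p1 z) (p1 z) = 0"
    and p1_p: "z \<in> V \<Longrightarrow> B (p1 z) p = 0"
    and p_not_null: "B p p \<noteq> 0"
begin

definition a where "a z = c1 z (blinfun_apply (\<Omega> z (Y z)) (y1 z))"
definition b where "b z = c2 z (blinfun_apply (\<Omega> z (X z)) (x2 z))"

lemma form_a: assumes "z \<in> V" shows "blinfun_apply (\<Omega> z (Y z)) (y1 z) = a z *\<^sub>R s1 z" "a z \<noteq> 0"
proof -
  obtain k where k: "blinfun_apply (\<Omega> z (Y z)) (y1 z) = k *\<^sub>R s1 z"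
    using middle1[OF assms] by (auto simp: span_singleton)
  then have "a z = k" using assms by (simp add: a_def c_linear)
  then show "blinfun_apply (\<Omega> z (Y z)) (y1 z) = a z *\<^sub>R s1 z" "a z \<noteq> 0" using k nonzero1[OF assms] by auto
qed

lemma form_b: assumes "z \<in> V" shows "blinfun_apply (\<Omega> z (X z)) (x2 z) = b z *\<^sub>R s2 z" "b z \<noteq> 0"
proof -
  obtain k where k: "blinfun_apply (\<Omega> z (X z)) (x2 z) = k *\<^sub>R s2 z"
    using middle2[OF assms] by (auto simp: span_singleton)
  then have "b z = k" using assms by (simp add: b_def c_linear)
  then show "blinfun_apply (\<Omega> z (X z)) (x2 z) = b z *\<^sub>R s2 z" "b z \<noteq> 0" using k nonzero2[OF assms] by auto
qed

text \<open>Skewness turns \<open>\<Omega> p1 = 0\<close> into orthogonality of \<open>p1\<close> to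
  the image vectors \<open>a s1\<close> and \<open>b s2\<close>. So \<open>p1\<close> lies in
  \<open>F\<^sup>\<bottom>\<close>, whose null vectors all lie in \<open>F\<close>.\<close>

lemma p1_mem: assumes z: "z \<in> V" shows "p1 z \<in> F z"
proof -
  have "B (p1 z) (a z *\<^sub>R s1 z) = 0" "B (p1 z) (b z *\<^sub>R s2 z) = 0"
    using form_skew[OF z, of _ "p1 z"] form_p1[OF z] form_a(1)[OF z] form_b(1)[OF z]
    by (metis B.zero_left neg_equal_0_iff_equal)+
  then have "B (p1 z) (s1 z) = 0" "B (p1 z) (s2 z) = 0"
    using form_a(2)[OF z] form_b(2)[OF z] by (auto simp: B_simps)
  then have "p1 z \<in> perp B (F z)"
    unfolding perp_def using F_pair[OF z] B_sym[of _ "p1 z"] by (auto simp: B_simps)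
  then show ?thesis using perp_null F_lie null_p1 z by blast
qed

lemma p1_section: "local_section V p1"
  unfolding local_section_def using open_V smooth_p1 p1_mem by auto

definition u1 where "u1 z = B (s1 z) p"
definition u2 where "u2 z = B (s2 z) p"
definition \<alpha> where "\<alpha> z = a z / B (y1 z) (y1 z)"
definition \<beta> where "\<beta> z = b z / B (x2 z) (x2 z)"

lemma \<alpha>\<beta>_nonzero: "z \<in> V \<Longrightarrow> \<alpha> z \<noteq> 0" "z \<in> V \<Longrightarrow> \<beta> z \<noteq> 0"
  using form_a(2) form_b(2) y1_pos x2_pos unfolding \<alpha>_def \<beta>_def by force+

lemma p1_fd_y1:
  assumes z: "z \<in> V"
  shows "B (fd p1 z u) (y1 z) = c1 z (p1 z) * B (fd s1 z u) (y1 z)"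
    and "B (fd p1 z u) (x2 z) = c2 z (p1 z) * B (fd s2 z u) (x2 z)"
proof -
  let ?e = "c1 z (p1 z) *\<^sub>R fd s1 z u + c2 z (p1 z) *\<^sub>R fd s2 z u"
  have "B (fd p1 z u - ?e) (y1 z) = 0" "B (fd p1 z u - ?e) (x2 z) = 0"
    using section_fd[OF p1_section z] fd_s1_perp[OF z] fd_s2_perp[OF z] perpD by blast+
  then show "B (fd p1 z u) (y1 z) = c1 z (p1 z) * B (fd s1 z u) (y1 z)"
    "B (fd p1 z u) (x2 z) = c2 z (p1 z) * B (fd s2 z u) (x2 z)"
    using y1_orth[OF z] x2_orth[OF z] by (auto simp: B_simps)
qed

text \<open>Computes the product of \<open>fd p1 z (Y z)\<close> with \<open>y1\<close> twice, from
  the conservation law with skewness of \<open>\<Omega>\<close> and from the Leibniz rule in the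
  frame; likewise along \<open>X\<close> against \<open>x2\<close>.\<close>

lemma p1_coeff:
  assumes z: "z \<in> V"
  shows "c1 z (p1 z) = \<alpha> z * u1 z" "c2 z (p1 z) = \<beta> z * u2 z"
proof -
  have "B (fd p1 z (Y z)) (y1 z) = a z * u1 z"
    using form_skew[OF z, of "Y z" p "y1 z"] form_a(1)[OF z] fd_p1[OF z] B_sym[of p] by (simp add: B_simps u1_def)
  then show "c1 z (p1 z) = \<alpha> z * u1 z"
    using p1_fd_y1(1)[OF z, of "Y z"] y1_pos[OF z] by (simp add: \<alpha>_def field_simps)
  have "B (fd p1 z (X z)) (x2 z) = b z * u2 z"
    using form_skew[OF z, of "X z" p "x2 z"] form_b(1)[OF z] fd_p1[OF z] B_sym[of p] by (simp add: B_simps u2_def)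
  then show "c2 z (p1 z) = \<beta> z * u2 z"
    using p1_fd_y1(2)[OF z, of "X z"] x2_pos[OF z] by (simp add: \<beta>_def field_simps)
qed

lemma p1_expand: "z \<in> V \<Longrightarrow> p1 z = (\<alpha> z * u1 z) *\<^sub>R s1 z + (\<beta> z * u2 z) *\<^sub>R s2 z"
  using c_expand[OF _ p1_mem] p1_coeff by metis

lemma squares: assumes z: "z \<in> V" shows "\<alpha> z * (u1 z)\<^sup>2 + \<beta> z * (u2 z)\<^sup>2 = 0"
proof -
  have "B ((\<alpha> z * u1 z) *\<^sub>R s1 z + (\<beta> z * u2 z) *\<^sub>R s2 z) p = 0"
    using p1_expand p1_p z by metis
  then show ?thesis by (simp add: B_simps u1_def u2_def power2_eq_square)
qed

lemma smooth_u: "smooth_on V u1" "smooth_on V u2"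
  unfolding u1_def u2_def by (intro smooth_on_linear[OF bounded_linear_B_left] open_V smooth_s1 smooth_s2)+

lemma smooth_\<alpha>\<beta>: "smooth_on V \<alpha>" "smooth_on V \<beta>"
  unfolding \<alpha>_def \<beta>_def a_def b_def
  by (intro smooth_on_divide smooth_c smooth_on_bilinear[OF bounded_bilinear_B] order_refl
      smooth_on_bilinear[OF bounded_bilinear_blinfun_apply] smooth_form_field
      smooth_y1 smooth_x2 open_V smooth_X smooth_Y; use y1_pos x2_pos in force)+

text \<open>If \<open>p \<bottom> f\<close> at a point, then also \<open>p \<bottom> f\<^sup>(\<^sup>1\<^sup>) = f\<^sup>\<bottom>\<close> there, so that \<open>p \<in> f\<close> would be null.\<close>

lemma u_nonzero: assumes z: "z \<in> V" shows "u1 z \<noteq> 0" "u2 z \<noteq> 0"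
proof -
  have "\<not> (u1 z = 0 \<and> u2 z = 0)"
  proof
    assume 0: "u1 z = 0 \<and> u2 z = 0"
    have d: "u1 differentiable at z" "u2 differentiable at z" using smooth_on_differentiable smooth_u z by blast+
    have c: "isCont \<alpha> z" "isCont \<beta> z"
      using smooth_\<alpha>\<beta> smooth_on_continuous continuous_on_eq_continuous_at open_V z by blast+
    have fu: "fd u1 z w = B (fd s1 z w) p" "fd u2 z w = B (fd s2 z w) p" for w
      unfolding u1_def u2_def
      using fd_linear[OF bounded_linear_B_left smooth_on_differentiable[OF smooth_s1 z]]
        fd_linear[OF bounded_linear_B_left smooth_on_differentiable[OF smooth_s2 z]] by blast+
    have Fp: "B w p = 0" if "w \<in> F z" for w
      using that 0 F_pair[OF z] by (auto simp: u1_def u2_def B_simps)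
    \<comment> \<open>Along \<open>Y\<close> the derivative of \<open>u2\<close> vanishes, as
      \<open>fd s2 z (Y z)\<close> lies in \<open>F\<close> and \<open>F\<close> is orthogonal to
      \<open>p\<close> at this point; the relation between the squares passes this on to
      \<open>u1\<close>.\<close>
    have "fd u1 z (Y z) = 0"
      by (rule fd_zero_of_squares[OF open_V z squares d c]) (use 0 \<alpha>\<beta>_nonzero z fu Fp[OF Y2[OF z]] in auto)
    moreover have "fd u2 z (X z) = 0"
      by (rule fd_zero_of_squares[OF open_V z _ d(2,1) c(2,1)])
        (use squares 0 \<alpha>\<beta>_nonzero z fu Fp[OF X1[OF z]] in \<open>auto simp: add.commute\<close>)
    ultimately have "B p (y1 z) = 0" "B p (x2 z) = 0" using fu B_sym by metis+
    moreover have "p \<in> perp B (F z)" unfolding perp_def using Fp by blast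
    ultimately have "p \<in> F z" using frame_perp_expand[OF z, of p] by simp
    then show False using F_null[OF z] p_not_null by blast
  qed
  then show "u1 z \<noteq> 0" "u2 z \<noteq> 0" using squares[OF z] \<alpha>\<beta>_nonzero[OF z] by auto
qed

lemma p1_nonzero: assumes "z \<in> V" shows "p1 z \<noteq> 0"
  using p1_coeff(1)[OF assms] \<alpha>\<beta>_nonzero(1)[OF assms] u_nonzero(1)[OF assms] by (auto simp: c_linear)

lemma F_int_perp: assumes z: "z \<in> V" shows "F z \<inter> perp B {p} = span {p1 z}"
proof
  show "span {p1 z} \<subseteq> F z \<inter> perp B {p}"
    using p1_mem[OF z] p1_p[OF z] B_sym[of p]
    by (intro span_minimal subspace_inter subspace_F subspace_perp z) (auto simp: perp_def)
  show "F z \<inter> perp B {p} \<subseteq> span {p1 z}"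
  proof
    fix v assume v: "v \<in> F z \<inter> perp B {p}"
    then obtain k l where kl: "v = k *\<^sub>R s1 z + l *\<^sub>R s2 z" using F_pair[OF z] by blast
    have "B v p = 0" using v B_sym[of p v] by (simp add: perp_def)
    then have e: "k * u1 z + l * u2 z = 0" using kl by (simp add: B_simps u1_def u2_def)
    \<comment> \<open>Fitted to the coefficient of \<open>s1\<close>; the relation between the
      squares then forces the coefficient of \<open>s2\<close> to match.\<close>
    define t where "t = k / (\<alpha> z * u1 z)"
    have t1: "t * (\<alpha> z * u1 z) = k" using u_nonzero[OF z] \<alpha>\<beta>_nonzero[OF z] by (simp add: t_def)
    have "t * (\<alpha> z * (u1 z)\<^sup>2 + \<beta> z * (u2 z)\<^sup>2) = 0" using squares[OF z] by simp
    then have "t * (\<alpha> z * u1 z) * u1 z + (t * (\<beta> z * u2 z)) * u2 z = 0" by (simp add: power2_eq_square algebra_simps)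
    then have "(t * (\<beta> z * u2 z)) * u2 z = l * u2 z" using e unfolding t1 by linarith
    then have t2: "t * (\<beta> z * u2 z) = l" using u_nonzero[OF z] by simp
    have "v = t *\<^sub>R p1 z" unfolding p1_expand[OF z] kl scaleR_add_right scaleR_scaleR t1 t2 ..
    then show "v \<in> span {p1 z}" by (simp add: span_base span_scale)
  qed
qed

text \<open>Both coefficients of \<open>p1\<close> are non-zero, so the products of its derivative
  with \<open>y1\<close> and \<open>x2\<close> detect \<open>\<theta>Y\<close> and
  \<open>\<theta>X\<close>.\<close>

lemma p1_immersed: assumes z: "z \<in> V" and "fd p1 z u \<in> F z" shows "u = 0"
proof -
  have "B (fd p1 z u) (y1 z) = 0" "B (fd p1 z u) (x2 z) = 0"
    using assms(2) fd_s1_perp[OF z] fd_s2_perp[OF z] perpD by blast+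
  then have "\<theta>X z u = 0" "\<theta>Y z u = 0"
    using p1_fd_y1[OF z, of u] p1_coeff[OF z] \<alpha>\<beta>_nonzero[OF z] u_nonzero[OF z] by (auto simp: \<theta>X_def \<theta>Y_def)
  then show ?thesis using \<theta>_expand[OF z, of u] by simp
qed

text \<open>Normalised by \<open>\<tau> p = - p1\<close>, so that
  \<open>d\<tau> p = - dp1 = \<Omega> p\<close> and the gauged form kills \<open>p\<close>. The
  second factor is just one vector of \<open>F\<close> whose product with \<open>p\<close> is
  1.\<close>

definition \<tau> where "\<tau> z = wedge B (p1 z) ((1 / u1 z) *\<^sub>R s1 z)"

lemma smooth_\<tau>: "smooth_on V \<tau>"
  unfolding \<tau>_def
  by (intro smooth_on_bilinear[OF bounded_bilinear_wedge] smooth_on_scaleR smooth_on_divide smooth_on_const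
      smooth_p1 smooth_s1 smooth_u open_V) (use u_nonzero in auto)

text \<open>Makes \<open>\<tau>\<close> independent of the frame, so that the local definitions
  agree on overlaps.\<close>

lemma \<tau>_unique: assumes z: "z \<in> V" and n: "n \<in> F z" "B n p = 1" shows "wedge B (p1 z) n = \<tau> z"
proof -
  let ?n = "(1 / u1 z) *\<^sub>R s1 z"
  have "B ?n p = 1" using u_nonzero[OF z] by (simp add: B_simps u1_def)
  then have "B p (n - ?n) = 0" using n B_sym[of p] by (simp add: B_simps)
  then have "n - ?n \<in> span {p1 z}"
    unfolding F_int_perp[OF z, symmetric] perp_def
    using subspace_diff[OF subspace_F[OF z] n(1) subspace_scale[OF subspace_F[OF z] s_mem(1)[OF z]]] by simp
  then obtain k where "n - ?n = k *\<^sub>R p1 z" by (auto simp: span_singleton)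
  then have "n = ?n + k *\<^sub>R p1 z" by (metis add_diff_cancel_left' add.commute diff_add_cancel)
  then have "wedge B (p1 z) n = wedge B (p1 z) ?n + k *\<^sub>R wedge B (p1 z) (p1 z)"
    by (simp only: W.add_right W.scaleR_right)
  then show ?thesis by (simp add: \<tau>_def)
qed

lemma \<tau>_mem: "z \<in> V \<Longrightarrow> \<tau> z \<in> wedge_space B (F z) (F z)"
  unfolding \<tau>_def by (intro wedge_space_mem p1_mem subspace_scale subspace_F s_mem)

lemma \<tau>_p: "z \<in> V \<Longrightarrow> blinfun_apply (\<tau> z) p = - p1 z"
  using u_nonzero p1_p by (simp add: \<tau>_def B_simps u1_def)

lemma gauged_nilpotent: assumes z: "z \<in> V" shows "nilpotent_skew (F z) (\<Omega> z u - fd \<tau> z u)"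
  using subspace_diff[OF subspace_nilpotent_skew[OF subspace_F[OF z]], of "\<Omega> z u" "fd \<tau> z u"]
    nilpotent_form[OF z] fd_wedge_nilpotent[OF open_V order_refl smooth_\<tau> \<tau>_mem z] by simp

lemma gauged_p: assumes z: "z \<in> V" shows "blinfun_apply (\<Omega> z u - fd \<tau> z u) p = 0"
proof -
  have "blinfun_apply (fd \<tau> z u) p = fd (\<lambda>z. blinfun_apply (\<tau> z) p) z u"
    using fd_linear[OF blinfun.bounded_linear_left smooth_on_differentiable[OF smooth_\<tau> z], of p u] by simp
  also have "\<dots> = fd (\<lambda>z. - p1 z) z u" using fd_cong_open[OF open_V z \<tau>_p] by simp
  also have "\<dots> = - fd p1 z u"
    by (rule fd_linear[OF bounded_linear_minus[OF bounded_linear_ident] smooth_on_differentiable[OF smooth_p1 z]])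
  finally show ?thesis using fd_p1[OF z] by (simp add: blinfun.diff_left)
qed

lemma gauged_wedge:
  assumes z: "z \<in> V"
  shows "\<exists>m\<in>span {p1 z, fd p1 z (X z), fd p1 z (Y z)}. \<Omega> z u - fd \<tau> z u = wedge B (p1 z) m"
proof -
  have n: "(1 / u1 z) *\<^sub>R s1 z \<in> F z" "B ((1 / u1 z) *\<^sub>R s1 z) p = 1"
    using subspace_scale[OF subspace_F[OF z] s_mem(1)[OF z]] u_nonzero[OF z] by (auto simp: B_simps u1_def)
  obtain m where m: "m \<in> perp B (F z)" "B m p = 0" "\<Omega> z u - fd \<tau> z u = wedge B (p1 z) m"
    using nilpotent_wedge[OF F_lie[OF z] gauged_nilpotent[OF z] gauged_p[OF z] p1_mem[OF z] p1_nonzero[OF z] p1_p[OF z] n]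
    by blast
  \<comment> \<open>\<open>k\<close> and \<open>l\<close> match the products of \<open>m\<close>
    with \<open>x2\<close> and \<open>y1\<close>; the remainder \<open>?w\<close> then lies in
    \<open>F\<close> and is orthogonal to \<open>p\<close>, hence is a multiple of
    \<open>p1\<close>.\<close>
  define k where "k = B m (x2 z) / (c2 z (p1 z) * B (x2 z) (x2 z))"
  define l where "l = B m (y1 z) / (c1 z (p1 z) * B (y1 z) (y1 z))"
  let ?w = "m - k *\<^sub>R fd p1 z (X z) - l *\<^sub>R fd p1 z (Y z)"
  have nz: "c1 z (p1 z) \<noteq> 0" "c2 z (p1 z) \<noteq> 0" "B (y1 z) (y1 z) \<noteq> 0" "B (x2 z) (x2 z) \<noteq> 0"
    using p1_coeff[OF z] \<alpha>\<beta>_nonzero[OF z] u_nonzero[OF z] y1_pos[OF z] x2_pos[OF z] by auto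
  have o: "B (fd s1 z (X z)) (y1 z) = 0" "B (fd s2 z (Y z)) (x2 z) = 0"
    using X1[OF z] Y2[OF z] fd_s1_perp[OF z] fd_s2_perp[OF z] perpD by blast+
  have wW: "?w \<in> perp B (F z)"
    by (intro subspace_diff subspace_scale subspace_perp m section_fd_perp[OF p1_section z])
  have "B ?w (y1 z) = 0" "B ?w (x2 z) = 0"
    using nz o p1_fd_y1[OF z] by (auto simp: B_simps k_def l_def)
  then have wF: "?w \<in> F z" using frame_perp_expand[OF z wW] by simp
  have "B (fd p1 z u) p = 0" for u
  proof -
    have "fd (\<lambda>z. B (p1 z) p) z u = 0" by (rule fd_const_on[OF open_V z p1_p])
    then show ?thesis using fd_linear[OF bounded_linear_B_left smooth_on_differentiable[OF smooth_p1 z], of p u] by simp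
  qed
  then have "B p ?w = 0" using m(2) B_sym[of p] by (simp add: B_simps)
  then have "?w \<in> span {p1 z}" using wF F_int_perp[OF z] by (auto simp: perp_def)
  then have "?w \<in> span {p1 z, fd p1 z (X z), fd p1 z (Y z)}" using span_mono[of "{p1 z}"] by blast
  then have "?w + k *\<^sub>R fd p1 z (X z) + l *\<^sub>R fd p1 z (Y z) \<in> span {p1 z, fd p1 z (X z), fd p1 z (Y z)}"
    by (intro span_add span_scale) (auto simp: span_base)
  then have "m \<in> span {p1 z, fd p1 z (X z), fd p1 z (Y z)}" by simp
  then show ?thesis using m(3) by blast
qed

text \<open>On \<open>y1\<close>, the form \<open>\<Omega>\<close> in direction \<open>Y\<close>
  gives a non-zero multiple of \<open>s1\<close>, whereas \<open>d\<tau>\<close> gives a multiple of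
  \<open>s2\<close>, because \<open>fd y1 z (Y z)\<close> is orthogonal to
  \<open>s2\<close>.\<close>

lemma gauged_nonzero: assumes z: "z \<in> V" shows "\<Omega> z (Y z) - fd \<tau> z (Y z) \<noteq> 0"
proof
  assume "\<Omega> z (Y z) - fd \<tau> z (Y z) = 0"
  then have "a z *\<^sub>R s1 z = blinfun_apply (fd \<tau> z (Y z)) (y1 z)" using form_a(1)[OF z] by simp
  also have "\<dots> = - blinfun_apply (\<tau> z) (fd y1 z (Y z))"
    by (rule fd_wedge_perp[OF open_V order_refl smooth_\<tau> \<tau>_mem z smooth_y1 fd_s1_perp])
  finally have *: "a z *\<^sub>R s1 z = - blinfun_apply (\<tau> z) (fd y1 z (Y z))" .
  obtain k where k: "\<tau> z = k *\<^sub>R wedge B (s1 z) (s2 z)"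
    using wedge_space_pair \<tau>_mem[OF z] F_span[OF z] by metis
  have "a z = c1 z (- blinfun_apply (\<tau> z) (fd y1 z (Y z)))" using *[symmetric] z by (simp add: c_linear)
  also have "\<dots> = 0" using s1_fd_y1(2)[OF z] z by (simp add: k c_linear blinfun.scaleR_left)
  finally show False using form_a(2)[OF z] by simp
qed

end

section \<open>Curvature spheres\<close>

lemma real2_expand: "(u :: real ^ 2) = (u $ 1) *\<^sub>R axis 1 1 + (u $ 2) *\<^sub>R axis 2 1"
  by (simp add: vec_eq_iff forall_2 axis_def)

lemma linear_real2:
  fixes L :: "real ^ 2 \<Rightarrow> 'b::real_vector"
  assumes "linear L"
  shows "L u = (u $ 1) *\<^sub>R L (axis 1 1) + (u $ 2) *\<^sub>R L (axis 2 1)"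
  by (subst real2_expand) (simp add: linear_add[OF assms] linear_cmul[OF assms])

section \<open>Kernel directions and changes of frame\<close>

context lie_frame begin

text \<open>The kernel of a non-zero functional \<open>L\<close> on the plane is spanned by \<open>(L e\<^sub>2, - L e\<^sub>1)\<close>.\<close>

lemma kernel_field:
  assumes s: "smooth_on V s" "\<And>z u. z \<in> V \<Longrightarrow> fd s z u \<in> perp B (F z)"
    and ker: "\<And>z. z \<in> V \<Longrightarrow> \<exists>u. u \<noteq> 0 \<and> fd s z u \<in> F z"
    and z0: "z0 \<in> V" "fd s z0 w \<notin> F z0"
  shows "\<exists>V' X. open V' \<and> z0 \<in> V' \<and> V' \<subseteq> V \<and> smooth_on V X \<and> (\<forall>z\<in>V'. X z \<noteq> 0 \<and> fd s z (X z) \<in> F z)"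
proof -
  define L where "L z u = B (fd s z u) (fd s z w)" for z u
  define X where "X z = L z (axis 2 1) *\<^sub>R axis 1 1 - L z (axis 1 1) *\<^sub>R (axis 2 1 :: real ^ 2)" for z
  have smL: "smooth_on V (\<lambda>z. L z u)" for u
    unfolding L_def by (intro smooth_on_bilinear[OF bounded_bilinear_B] smooth_on_fd_const s open_V)
  have smX: "smooth_on V X" unfolding X_def by (intro smooth_on_intros open_V smL)
  define V' where "V' = {z \<in> V. L z w > 0}"
  have "V' = V \<inter> (\<lambda>z. L z w) -` {0<..}" by (auto simp: V'_def)
  then have op: "open V'"
    using continuous_open_preimage[OF smooth_on_continuous[OF smL] open_V, of "{0<..}" w] by simp
  have "z0 \<in> V'" using perp_positive[OF F_lie[OF z0(1)] s(2) z0(2)] z0 by (simp add: V'_def L_def)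
  moreover have "X z \<noteq> 0 \<and> fd s z (X z) \<in> F z" if z: "z \<in> V'" for z
  proof -
    have zV: "z \<in> V" and Lw: "L z w > 0" using z by (auto simp: V'_def)
    have lin: "linear (fd s z)" using linear_fd s zV by blast
    have linL: "linear (L z)"
      unfolding L_def by (rule linearI) (simp_all add: linear_add[OF lin] linear_cmul[OF lin] B_simps)
    have L12: "L z v = v $ 1 * L z (axis 1 1) + v $ 2 * L z (axis 2 1)" for v
      using linear_real2[OF linL, of v] by simp
    have ne: "L z (axis 1 1) \<noteq> 0 \<or> L z (axis 2 1) \<noteq> 0" using Lw L12[of w] by auto
    have X12: "X z $ 1 = L z (axis 2 1)" "X z $ 2 = - L z (axis 1 1)" by (auto simp: X_def axis_def)
    \<comment> \<open>The kernel direction \<open>u\<close> of \<open>fd s z\<close> modulo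
      \<open>F\<close> is also annihilated by \<open>L z\<close>, whose kernel is the line spanned
      by \<open>X z\<close>; so \<open>X z\<close> inherits the property of
      \<open>u\<close>.\<close>
    obtain u where u: "u \<noteq> 0" "fd s z u \<in> F z" using ker zV by blast
    have "L z u = 0" unfolding L_def using perpD[OF s(2)[OF zV] u(2)] .
    then have e: "u $ 1 * L z (axis 1 1) + u $ 2 * L z (axis 2 1) = 0" unfolding L12[of u] .
    obtain t where t: "u = t *\<^sub>R X z"
    proof (cases "L z (axis 2 1) = 0")
      case True
      then have "u $ 1 = 0" "L z (axis 1 1) \<noteq> 0" using e ne by auto
      then have "u = (u $ 2 / - L z (axis 1 1)) *\<^sub>R X z" using True X12 by (simp add: vec_eq_iff forall_2)
      then show ?thesis using that by blast
    next
      case False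
      have "u $ 2 * L z (axis 2 1) = u $ 1 * - L z (axis 1 1)" using e by linarith
      then have "u $ 2 = (u $ 1 / L z (axis 2 1)) * - L z (axis 1 1)"
        using False by (simp add: field_simps)
      then have "u = (u $ 1 / L z (axis 2 1)) *\<^sub>R X z" using False X12 by (simp add: vec_eq_iff forall_2)
      then show ?thesis using that by blast
    qed
    then have "t \<noteq> 0" using u by auto
    have "fd s z (X z) = (1 / t) *\<^sub>R fd s z u" using t \<open>t \<noteq> 0\<close> by (simp add: linear_cmul[OF lin])
    moreover have "X z \<noteq> 0" using t u by auto
    ultimately show ?thesis using subspace_scale[OF subspace_F[OF zV] u(2)] by simp
  qed
  moreover have "V' \<subseteq> V" by (auto simp: V'_def)
  ultimately show ?thesis using op smX by blast
qed

lemma lie_frame_subset: "open V' \<Longrightarrow> V' \<subseteq> V \<Longrightarrow> lie_frame B V' F s1 s2"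
proof unfold_locales
  assume V': "open V'" "V' \<subseteq> V"
  show "open V'" "smooth_on V' s1" "smooth_on V' s2"
    using V' smooth_on_subset smooth_s1 smooth_s2 by auto
  fix z u assume "z \<in> V'"
  then have z: "z \<in> V" using V' by auto
  show "F z = span {s1 z, s2 z}" "F z \<in> lie_grassmannian B" "fd s1 z u \<in> perp B (F z)" "fd s2 z u \<in> perp B (F z)"
    by (rule F_span[OF z] F_lie[OF z] fd_s1_perp[OF z] fd_s2_perp[OF z])+
qed

lemma curvature_frame_exists:
  assumes ker: "\<And>z. z \<in> V \<Longrightarrow> \<exists>u. u \<noteq> 0 \<and> fd s1 z u \<in> F z" "\<And>z. z \<in> V \<Longrightarrow> \<exists>u. u \<noteq> 0 \<and> fd s2 z u \<in> F z"
    and inj: "\<And>z u. z \<in> V \<Longrightarrow> fd s1 z u \<in> F z \<Longrightarrow> fd s2 z u \<in> F z \<Longrightarrow> u = 0"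
    and z0: "z0 \<in> V"
  shows "\<exists>V' X Y. z0 \<in> V' \<and> V' \<subseteq> V \<and> curvature_frame B V' F s1 s2 X Y"
proof -
  obtain w1 where "fd s1 z0 w1 \<notin> F z0" using ker(2)[OF z0] inj[OF z0] by blast
  then have "\<exists>V' X. open V' \<and> z0 \<in> V' \<and> V' \<subseteq> V \<and> smooth_on V X \<and> (\<forall>z\<in>V'. X z \<noteq> 0 \<and> fd s1 z (X z) \<in> F z)"
    by (intro kernel_field[where w = w1] smooth_s1 fd_s1_perp ker(1) z0)
  then obtain V1 X where X': "open V1 \<and> z0 \<in> V1 \<and> V1 \<subseteq> V \<and> smooth_on V X \<and> (\<forall>z\<in>V1. X z \<noteq> 0 \<and> fd s1 z (X z) \<in> F z)"
    by (elim exE) (rule that)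
  then have X: "open V1" "z0 \<in> V1" "V1 \<subseteq> V" "smooth_on V X" "\<And>z. z \<in> V1 \<Longrightarrow> X z \<noteq> 0 \<and> fd s1 z (X z) \<in> F z"
    by auto
  obtain w2 where "fd s2 z0 w2 \<notin> F z0" using ker(1)[OF z0] inj[OF z0] by blast
  then have "\<exists>V' X. open V' \<and> z0 \<in> V' \<and> V' \<subseteq> V \<and> smooth_on V X \<and> (\<forall>z\<in>V'. X z \<noteq> 0 \<and> fd s2 z (X z) \<in> F z)"
    by (intro kernel_field[where w = w2] smooth_s2 fd_s2_perp ker(2) z0)
  then obtain V2 Y where Y': "open V2 \<and> z0 \<in> V2 \<and> V2 \<subseteq> V \<and> smooth_on V Y \<and> (\<forall>z\<in>V2. Y z \<noteq> 0 \<and> fd s2 z (Y z) \<in> F z)"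
    by (elim exE) (rule that)
  then have Y: "open V2" "z0 \<in> V2" "V2 \<subseteq> V" "smooth_on V Y" "\<And>z. z \<in> V2 \<Longrightarrow> Y z \<noteq> 0 \<and> fd s2 z (Y z) \<in> F z"
    by auto
  have "curvature_frame B (V1 \<inter> V2) F s1 s2 X Y"
  proof (intro curvature_frame.intro lie_frame_subset curvature_frame_axioms.intro)
    show "smooth_on (V1 \<inter> V2) X" "smooth_on (V1 \<inter> V2) Y"
      using smooth_on_subset[OF X(4), of "V1 \<inter> V2"] smooth_on_subset[OF Y(4), of "V1 \<inter> V2"] X(3) by auto
    fix z assume z: "z \<in> V1 \<inter> V2"
    then have zV: "z \<in> V" "z \<in> V1" "z \<in> V2" using X(3) by auto
    show "fd s1 z (X z) \<in> F z" "fd s2 z (Y z) \<in> F z" using X(5) Y(5) zV by auto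
    show "fd s2 z (X z) \<notin> F z" using inj[OF zV(1)] X(5)[OF zV(2)] by blast
    show "fd s1 z (Y z) \<notin> F z" using inj[OF zV(1)] Y(5)[OF zV(3)] by blast
  qed (use X Y in auto)
  then show ?thesis using X(2,3) Y(2) by (intro exI[of _ "V1 \<inter> V2"] exI[of _ X] exI[of _ Y]) auto
qed

text \<open>Serves to put a chosen line of \<open>f\<close> at a point into the place of
  \<open>s2\<close>.\<close>

lemma lie_frame_change:
  assumes "k * l' - l * k' \<noteq> 0"
  shows "lie_frame B V F (\<lambda>z. k *\<^sub>R s1 z + l *\<^sub>R s2 z) (\<lambda>z. k' *\<^sub>R s1 z + l' *\<^sub>R s2 z)"
proof
  show "smooth_on V (\<lambda>z. k *\<^sub>R s1 z + l *\<^sub>R s2 z)" "smooth_on V (\<lambda>z. k' *\<^sub>R s1 z + l' *\<^sub>R s2 z)"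
    using local_section_comb section_smooth by blast+
  fix z u assume z: "z \<in> V"
  show "F z \<in> lie_grassmannian B" using F_lie z .
  show "fd (\<lambda>z. k *\<^sub>R s1 z + l *\<^sub>R s2 z) z u \<in> perp B (F z)" "fd (\<lambda>z. k' *\<^sub>R s1 z + l' *\<^sub>R s2 z) z u \<in> perp B (F z)"
    using section_fd_perp[OF local_section_comb z] by blast+
  show "F z = span {k *\<^sub>R s1 z + l *\<^sub>R s2 z, k' *\<^sub>R s1 z + l' *\<^sub>R s2 z}"
  proof (rule span_pair_eq[OF subspace_F[OF z] dim_F[OF z]])
    show "k *\<^sub>R s1 z + l *\<^sub>R s2 z \<in> F z" "k' *\<^sub>R s1 z + l' *\<^sub>R s2 z \<in> F z" using F_pair[OF z] by blast+
    fix m n assume "m *\<^sub>R (k *\<^sub>R s1 z + l *\<^sub>R s2 z) + n *\<^sub>R (k' *\<^sub>R s1 z + l' *\<^sub>R s2 z) = 0"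
    then have "(m * k + n * k') *\<^sub>R s1 z + (m * l + n * l') *\<^sub>R s2 z = 0" by (simp add: algebra_simps)
    then have e: "m * k + n * k' = 0" "m * l + n * l' = 0" using frame_independent[OF z] by blast+
    have "m * (k * l' - l * k') = (m * k + n * k') * l' - (m * l + n * l') * k'"
      "n * (k * l' - l * k') = (m * l + n * l') * k - (m * k + n * k') * l" by (simp_all add: algebra_simps)
    then have "m * (k * l' - l * k') = 0" "n * (k * l' - l * k') = 0" unfolding e by simp_all
    then show "m = 0 \<and> n = 0" using assms by simp
  qed
qed (rule open_V)

section \<open>Curvature spheres as roots of a quadratic equation\<close>

definition sphere :: "real ^ 2 \<Rightarrow> real \<Rightarrow> real \<Rightarrow> bool" where
  "sphere z k l \<longleftrightarrow> (\<exists>u. u \<noteq> 0 \<and> k *\<^sub>R fd s1 z u + l *\<^sub>R fd s2 z u \<in> F z)"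

text \<open>If \<open>s\<^sub>2\<close> is not a curvature sphere, \<open>s\<^sub>1 - t s\<^sub>2\<close> is one iff \<open>det (h - t g) = 0\<close> for the symmetric
  matrices \<open>h = B (ds\<^sub>1) (ds\<^sub>2)\<close> and \<open>g = B (ds\<^sub>2) (ds\<^sub>2)\<close>.\<close>

definition g_mat :: "real ^ 2 \<Rightarrow> 2 \<Rightarrow> 2 \<Rightarrow> real" where
  "g_mat z i j = B (fd s2 z (axis i 1)) (fd s2 z (axis j 1))"

definition h_mat :: "real ^ 2 \<Rightarrow> 2 \<Rightarrow> 2 \<Rightarrow> real" where
  "h_mat z i j = B (fd s1 z (axis i 1)) (fd s2 z (axis j 1))"

lemma g_mat_sym: "g_mat z i j = g_mat z j i" by (simp add: g_mat_def B_sym)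

lemma h_mat_sym: "z \<in> V \<Longrightarrow> h_mat z i j = h_mat z j i"
  unfolding h_mat_def by (rule section_sym[OF local_section_frame])

definition g_det where "g_det z = g_mat z 1 1 * g_mat z 2 2 - g_mat z 1 2 * g_mat z 1 2"
definition h_det where "h_det z = h_mat z 1 1 * h_mat z 2 2 - h_mat z 1 2 * h_mat z 1 2"
definition gh_mix where
  "gh_mix z = h_mat z 1 1 * g_mat z 2 2 + h_mat z 2 2 * g_mat z 1 1 - 2 * (h_mat z 1 2 * g_mat z 1 2)"

lemma smooth_mat: "smooth_on V (\<lambda>z. g_mat z i j)" "smooth_on V (\<lambda>z. h_mat z i j)"
  unfolding g_mat_def h_mat_def
  by (intro smooth_on_bilinear[OF bounded_bilinear_B] smooth_on_fd_const smooth_s1 smooth_s2 open_V)+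

lemma smooth_dets: "smooth_on V g_det" "smooth_on V h_det" "smooth_on V gh_mix"
  unfolding g_det_def h_det_def gh_mix_def by (intro smooth_on_intros smooth_mat open_V)+

lemma g_det_pos:
  assumes z: "z \<in> V" and "\<not> sphere z 0 1"
  shows "g_det z > 0"
proof -
  have lin: "linear (fd s2 z)" using linear_fd smooth_s2 z by blast
  have nF: "fd s2 z u \<notin> F z" if "u \<noteq> 0" for u using assms(2) that by (auto simp: sphere_def)
  have pos: "B (fd s2 z u) (fd s2 z u) > 0" if "u \<noteq> 0" for u
    using perp_positive[OF F_lie[OF z] fd_s2_perp[OF z] nF[OF that]] .
  have g11: "g_mat z 1 1 > 0" unfolding g_mat_def by (rule pos) (simp add: axis_eq_0_iff)
  \<comment> \<open>The Gram-Schmidt vector of the second axis with respect to \<open>g\<close>,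
    cleared of denominators.\<close>
  let ?u = "(- g_mat z 1 2) *\<^sub>R axis 1 1 + (g_mat z 1 1) *\<^sub>R (axis 2 1 :: real ^ 2)"
  have "?u $ 2 \<noteq> 0" using g11 by (simp add: axis_def)
  then have "?u \<noteq> 0" by (metis zero_index)
  from pos[OF this] have "0 < B (fd s2 z ?u) (fd s2 z ?u)" .
  also have "B (fd s2 z ?u) (fd s2 z ?u) = g_mat z 1 1 * g_det z"
    by (simp add: linear_add[OF lin] linear_cmul[OF lin] linear_diff[OF lin] B_simps g_det_def g_mat_sym[of z 2 1] algebra_simps flip: g_mat_def)
  finally show ?thesis using g11 by (simp add: zero_less_mult_iff)
qed

lemma not_sphere_of_det:
  assumes z: "z \<in> V" and "g_det z > 0" shows "\<not> sphere z 0 1"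
proof
  assume "sphere z 0 1"
  then obtain u where u: "u \<noteq> 0" "fd s2 z u \<in> F z" by (auto simp: sphere_def)
  have lin: "linear (fd s2 z)" using linear_fd smooth_s2 z by blast
  have "B (fd s2 z u) (fd s2 z v) = 0" for v using perpD[OF fd_s2_perp[OF z] u(2)] .
  then have "u $ 1 * g_mat z 1 j + u $ 2 * g_mat z 2 j = 0" for j
    unfolding g_mat_def using linear_real2[OF lin, of u] by (metis B.add_left B.scaleR_left real_scaleR_def)
  from this[of 1] this[of 2] have e: "u $ 1 * g_mat z 1 1 + u $ 2 * g_mat z 1 2 = 0" "u $ 1 * g_mat z 1 2 + u $ 2 * g_mat z 2 2 = 0"
    using g_mat_sym[of z 2 1] by auto
  have "u $ 1 * g_det z = (u $ 1 * g_mat z 1 1 + u $ 2 * g_mat z 1 2) * g_mat z 2 2 - (u $ 1 * g_mat z 1 2 + u $ 2 * g_mat z 2 2) * g_mat z 1 2"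
    "u $ 2 * g_det z = (u $ 1 * g_mat z 1 2 + u $ 2 * g_mat z 2 2) * g_mat z 1 1 - (u $ 1 * g_mat z 1 1 + u $ 2 * g_mat z 1 2) * g_mat z 1 2"
    by (simp_all add: g_det_def algebra_simps)
  then have "u $ 1 = 0" "u $ 2 = 0" using e assms(2) by auto
  then show False using u(1) by (simp add: vec_eq_iff forall_2)
qed

text \<open>The products of \<open>fd s1 - t fd s2\<close> with the derivatives of \<open>s2\<close>
  form the matrix \<open>n = h - t g\<close>. Those derivatives span
  \<open>f\<^sup>\<bottom>\<close> modulo \<open>f\<close>, so a kernel vector of \<open>n\<close>
  is exactly a direction in which \<open>s1 - t s2\<close> is a curvature sphere.\<close>

lemma sphere_iff_root:
  assumes z: "z \<in> V" and pos: "g_det z > 0"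
  shows "sphere z 1 (- t) \<longleftrightarrow> g_det z * t\<^sup>2 - gh_mix z * t + h_det z = 0"
proof -
  define n where "n i j = h_mat z i j - t * g_mat z i j" for i j
  have lin: "linear (fd s1 z)" "linear (fd s2 z)" using linear_fd smooth_s1 smooth_s2 z by blast+
  have nsym: "n 2 1 = n 1 2" using h_mat_sym[OF z, of 2 1] g_mat_sym[of z 2 1] by (simp add: n_def)
  have det: "n 1 1 * n 2 2 - n 1 2 * n 1 2 = g_det z * t\<^sup>2 - gh_mix z * t + h_det z"
    by (simp add: n_def g_det_def h_det_def gh_mix_def power2_eq_square algebra_simps)
  define w where "w u = 1 *\<^sub>R fd s1 z u + (- t) *\<^sub>R fd s2 z u" for u
  have Bw: "B (w u) (fd s2 z (axis j 1)) = u $ 1 * n 1 j + u $ 2 * n 2 j" for u j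
  proof -
    have "w u = (u $ 1) *\<^sub>R w (axis 1 1) + (u $ 2) *\<^sub>R w (axis 2 1)"
      unfolding w_def using linear_real2[OF lin(1), of u] linear_real2[OF lin(2), of u] by (simp add: algebra_simps)
    then show ?thesis by (simp add: B_simps w_def n_def h_mat_def g_mat_def)
  qed
  have wperp: "w u \<in> perp B (F z)" for u
    unfolding w_def by (intro subspace_add subspace_scale subspace_perp fd_s1_perp fd_s2_perp z)
  show ?thesis
  proof
    assume "sphere z 1 (- t)"
    then obtain u where u: "u \<noteq> 0" "w u \<in> F z" by (auto simp: sphere_def w_def)
    have "B (w u) (fd s2 z v) = 0" for v using perpD[OF fd_s2_perp[OF z] u(2)] .
    then have e: "u $ 1 * n 1 1 + u $ 2 * n 1 2 = 0" "u $ 1 * n 1 2 + u $ 2 * n 2 2 = 0"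
      using Bw[of u 1] Bw[of u 2] nsym by auto
    have "u $ 1 * (n 1 1 * n 2 2 - n 1 2 * n 1 2) = (u $ 1 * n 1 1 + u $ 2 * n 1 2) * n 2 2 - (u $ 1 * n 1 2 + u $ 2 * n 2 2) * n 1 2"
      "u $ 2 * (n 1 1 * n 2 2 - n 1 2 * n 1 2) = (u $ 1 * n 1 2 + u $ 2 * n 2 2) * n 1 1 - (u $ 1 * n 1 1 + u $ 2 * n 1 2) * n 1 2"
      by (simp_all add: algebra_simps)
    then have "u $ 1 * (n 1 1 * n 2 2 - n 1 2 * n 1 2) = 0" "u $ 2 * (n 1 1 * n 2 2 - n 1 2 * n 1 2) = 0" using e by auto
    moreover have "u $ 1 \<noteq> 0 \<or> u $ 2 \<noteq> 0" using u(1) by (auto simp: vec_eq_iff forall_2)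
    ultimately show "g_det z * t\<^sup>2 - gh_mix z * t + h_det z = 0" using det by auto
  next
    assume "g_det z * t\<^sup>2 - gh_mix z * t + h_det z = 0"
    then have d0: "n 1 1 * n 2 2 = n 1 2 * n 1 2" using det by simp
    \<comment> \<open>A kernel vector of the singular symmetric matrix \<open>n\<close>: an axis if
      its first row vanishes, otherwise that row turned by a right angle.\<close>
    obtain u :: "real ^ 2" where u: "u \<noteq> 0" "u $ 1 * n 1 1 + u $ 2 * n 1 2 = 0" "u $ 1 * n 1 2 + u $ 2 * n 2 2 = 0"
    proof (cases "n 1 2 = 0 \<and> n 1 1 = 0")
      case True
      have "axis 1 1 \<noteq> (0 :: real ^ 2)" by (simp add: axis_eq_0_iff)
      then show ?thesis by (rule that) (use True in \<open>auto simp: axis_def\<close>)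
    next
      case False
      let ?u = "(- n 1 2) *\<^sub>R axis 1 1 + n 1 1 *\<^sub>R (axis 2 1 :: real ^ 2)"
      have 12: "?u $ 1 = - n 1 2" "?u $ 2 = n 1 1" by (simp_all add: axis_def)
      show ?thesis
        by (rule that[of ?u], use 12 False in \<open>metis neg_equal_0_iff_equal zero_index\<close>, unfold 12)
          (use d0 in \<open>simp_all add: algebra_simps\<close>)
    qed
    then have o: "B (w u) (fd s2 z (axis 1 1)) = 0" "B (w u) (fd s2 z (axis 2 1)) = 0"
      using Bw[of u 1] Bw[of u 2] nsym by auto
    have nF: "fd s2 z v \<notin> F z" if "v \<noteq> 0" for v
      using not_sphere_of_det[OF z pos] that by (auto simp: sphere_def)
    let ?y = "fd s2 z (axis 1 1)"
    \<comment> \<open>Gram-Schmidt again: \<open>k\<close> makes \<open>fd s2 z ?v\<close>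
      orthogonal to \<open>?y\<close>, which provides the orthogonal basis for
      \<open>perp_expand\<close>.\<close>
    define k where "k = g_mat z 1 2 / g_mat z 1 1"
    have y: "?y \<notin> F z" by (rule nF) (simp add: axis_eq_0_iff)
    then have yy: "B ?y ?y > 0" using perp_positive[OF F_lie[OF z] fd_s2_perp[OF z]] by blast
    let ?v = "axis 2 1 - k *\<^sub>R axis 1 1 :: real ^ 2"
    have "?v $ 2 \<noteq> 0" by (simp add: axis_def)
    then have "?v \<noteq> 0" by (metis zero_index)
    then have x: "fd s2 z ?v \<notin> F z" by (rule nF)
    have xe: "fd s2 z ?v = fd s2 z (axis 2 1) - k *\<^sub>R ?y"
      by (simp add: linear_diff[OF lin(2)] linear_cmul[OF lin(2)])
    have xy: "B (fd s2 z ?v) ?y = 0"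
      unfolding xe using yy by (simp add: B_simps k_def g_mat_def B_sym)
    have "B (w u) (fd s2 z ?v) = 0" unfolding xe using o by (simp add: B_simps)
    then have "w u \<in> F z"
      using perp_expand[OF F_lie[OF z] fd_s2_perp[OF z] x fd_s2_perp[OF z] y xy wperp[of u]] o by simp
    then show "sphere z 1 (- t)" using u(1) by (auto simp: sphere_def w_def)
  qed
qed

definition root_plus where "root_plus z = (gh_mix z + sqrt ((gh_mix z)\<^sup>2 - 4 * g_det z * h_det z)) / (2 * g_det z)"
definition root_minus where "root_minus z = (gh_mix z - sqrt ((gh_mix z)\<^sup>2 - 4 * g_det z * h_det z)) / (2 * g_det z)"

text \<open>With \<open>P = g_det z\<close>, Vieta gives \<open>gh_mix z = P * (t + t')\<close> and
  \<open>h_det z = P * (t * t')\<close>, so the discriminant is the positive square of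
  \<open>P * (t - t')\<close>.\<close>

lemma roots:
  assumes z: "z \<in> V" and pos: "g_det z > 0" and two: "sphere z 1 (- t)" "sphere z 1 (- t')" "t \<noteq> t'"
  shows "(gh_mix z)\<^sup>2 - 4 * g_det z * h_det z > 0" "sphere z 1 (- root_plus z)" "sphere z 1 (- root_minus z)"
    "root_plus z \<noteq> root_minus z"
proof -
  define P Q R where "P = g_det z" and "Q = gh_mix z" and "R = h_det z"
  have e: "P * t\<^sup>2 - Q * t + R = 0" "P * t'\<^sup>2 - Q * t' + R = 0" "P > 0"
    using sphere_iff_root[OF z pos] two pos by (auto simp: P_def Q_def R_def)
  have "(t - t') * (P * (t + t') - Q) = 0" using e by (simp add: algebra_simps power2_eq_square)
  then have Q: "Q = P * (t + t')" using two(3) by simp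
  have R: "R = P * (t * t')" using e(1) unfolding Q by (simp add: algebra_simps power2_eq_square)
  have "Q\<^sup>2 - 4 * P * R = (P * (t - t'))\<^sup>2" unfolding Q R by (simp add: algebra_simps power2_eq_square)
  moreover have "(P * (t - t'))\<^sup>2 > 0" using e(3) two(3) by simp
  ultimately show disc: "(gh_mix z)\<^sup>2 - 4 * g_det z * h_det z > 0" by (simp add: P_def Q_def R_def)
  define S where "S = sqrt (Q\<^sup>2 - 4 * P * R)"
  have S: "S\<^sup>2 = Q\<^sup>2 - 4 * P * R" "S > 0" using disc by (auto simp: S_def P_def Q_def R_def)
  have rt: "P * ((Q + k) / (2 * P))\<^sup>2 - Q * ((Q + k) / (2 * P)) + R = 0" if "k\<^sup>2 = Q\<^sup>2 - 4 * P * R" for k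
  proof -
    have "P * ((Q + k) / (2 * P))\<^sup>2 - Q * ((Q + k) / (2 * P)) + R = (k\<^sup>2 - Q\<^sup>2 + 4 * P * R) / (4 * P)"
      using e(3) by (simp add: field_simps power2_eq_square)
    then show ?thesis using that by simp
  qed
  show "sphere z 1 (- root_plus z)" "sphere z 1 (- root_minus z)"
    using rt[of S] rt[of "- S"] S sphere_iff_root[OF z pos]
    by (auto simp: root_plus_def root_minus_def P_def Q_def R_def S_def)
  show "root_plus z \<noteq> root_minus z"
    using disc pos by (auto simp: root_plus_def root_minus_def divide_cancel_right)
qed

text \<open>A positive discriminant keeps the square root away from its singularity at 0.\<close>

lemma smooth_roots:
  assumes "open V'" "V' \<subseteq> V" "\<And>z. z \<in> V' \<Longrightarrow> g_det z > 0" "\<And>z. z \<in> V' \<Longrightarrow> (gh_mix z)\<^sup>2 - 4 * g_det z * h_det z > 0"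
  shows "smooth_on V' root_plus" "smooth_on V' root_minus"
proof -
  have "smooth_on V' (\<lambda>z. sqrt (gh_mix z * gh_mix z - 4 * g_det z * h_det z))"
    using assms(4) by (intro smooth_on_intros assms smooth_on_subset[OF smooth_dets(1)] smooth_on_subset[OF smooth_dets(2)]
      smooth_on_subset[OF smooth_dets(3)]) (auto simp: power2_eq_square)
  then have sq: "smooth_on V' (\<lambda>z. sqrt ((gh_mix z)\<^sup>2 - 4 * g_det z * h_det z))" by (simp add: power2_eq_square)
  have "2 * g_det z \<noteq> 0" if "z \<in> V'" for z using assms(3)[OF that] by simp
  then show "smooth_on V' root_plus" "smooth_on V' root_minus"
    unfolding root_plus_def root_minus_def
    by (intro smooth_on_divide smooth_on_add smooth_on_diff smooth_on_mult smooth_on_const sq assms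
        smooth_on_subset[OF smooth_dets(1)] smooth_on_subset[OF smooth_dets(3)]; simp)+
qed

end

section \<open>Legendre maps in charts\<close>

locale chart_frame = surface A + lie_frame B "snd c ` N" "\<lambda>z. f (chart_inv c z)" s1 s2
  for A :: "'a::{t2_space, second_countable_topology} chart set"
    and B :: "'v::euclidean_space \<Rightarrow> 'v \<Rightarrow> real" and f :: "'a \<Rightarrow> 'v set" and c N s1 s2 +
  assumes c_mem: "c \<in> A" and open_N: "open N" and N_dom: "N \<subseteq> fst c"
begin

lemma inv_c [simp]: "y \<in> N \<Longrightarrow> chart_inv c (snd c y) = y"
  using c_mem N_dom by auto

lemma mem_V: "y \<in> N \<Longrightarrow> snd c y \<in> snd c ` N" by simp

lemma N_fst: "y \<in> N \<Longrightarrow> y \<in> fst c" using N_dom by auto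

abbreviation T where "T y \<equiv> tangent_to_chart A c y"

lemma f_pair: "y \<in> N \<Longrightarrow> v \<in> f y \<longleftrightarrow> (\<exists>k l. v = k *\<^sub>R s1 (snd c y) + l *\<^sub>R s2 (snd c y))"
  using F_pair[OF mem_V, of y v] by simp

lemma f_subspace: "y \<in> N \<Longrightarrow> subspace (f y)"
  using subspace_F[OF mem_V, of y] by simp

lemma section_at_local:
  assumes "section_at A f y \<sigma>" "y \<in> N"
  shows "\<exists>M. open M \<and> y \<in> M \<and> M \<subseteq> N \<and> smooth_fun A M \<sigma> \<and> local_section (snd c ` M) (\<lambda>z. \<sigma> (chart_inv c z))"
proof -
  obtain M where M: "open M" "y \<in> M" "smooth_fun A M \<sigma>" "\<forall>x\<in>M. \<sigma> x \<in> f x"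
    using assms(1) unfolding section_at_def by blast
  have sm: "smooth_fun A (M \<inter> N) \<sigma>" using smooth_fun_mono[OF M(3)] by blast
  have "local_section (snd c ` (M \<inter> N)) (\<lambda>z. \<sigma> (chart_inv c z))"
    unfolding local_section_def
  proof (intro conjI ballI)
    show "open (snd c ` (M \<inter> N))" using chart_open_image'[OF c_mem] M(1) open_N N_dom by auto
    show "smooth_on (snd c ` (M \<inter> N)) (\<lambda>z. \<sigma> (chart_inv c z))"
      by (rule smooth_fun_chartD[OF sm c_mem]) (use N_dom in auto)
  qed (use M in auto)
  then show ?thesis using M assms(2) open_N sm by (intro exI[of _ "M \<inter> N"]) auto
qed

lemma dder_section:
  assumes "section_at A f y \<sigma>" "y \<in> N"
  shows "dder A \<sigma> y X - (c1 (snd c y) (\<sigma> y) *\<^sub>R fd s1 (snd c y) (T y X) + c2 (snd c y) (\<sigma> y) *\<^sub>R fd s2 (snd c y) (T y X)) \<in> f y"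
proof -
  obtain M where M: "open M" "y \<in> M" "M \<subseteq> N" "smooth_fun A M \<sigma>" "local_section (snd c ` M) (\<lambda>z. \<sigma> (chart_inv c z))"
    using section_at_local[OF assms] by blast
  have "snd c y \<in> snd c ` M" using M by auto
  from section_fd[OF M(5) this, of "T y X"] show ?thesis
    using dder_chart[OF M(1,2,4) c_mem N_fst[OF assms(2)]] assms(2) by simp
qed

lemma section_at_pull: "y \<in> N \<Longrightarrow> section_at A f y (\<lambda>x. k *\<^sub>R s1 (snd c x) + l *\<^sub>R s2 (snd c x))"
  unfolding section_at_def
proof (intro exI[of _ N] conjI ballI)
  show "smooth_fun A N (\<lambda>x. k *\<^sub>R s1 (snd c x) + l *\<^sub>R s2 (snd c x))"
    by (rule smooth_fun_pull[OF c_mem open_N N_dom section_smooth[OF local_section_comb]])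
  show "k *\<^sub>R s1 (snd c x) + l *\<^sub>R s2 (snd c x) \<in> f x" if "x \<in> N" for x
    using f_pair[OF that] by blast
qed (use open_N in auto)

lemma dder_section_pull:
  assumes "y \<in> N"
  shows "dder A (\<lambda>x. k *\<^sub>R s1 (snd c x) + l *\<^sub>R s2 (snd c x)) y X =
    k *\<^sub>R fd s1 (snd c y) (T y X) + l *\<^sub>R fd s2 (snd c y) (T y X)"
proof -
  let ?z = "snd c y" and ?u = "T y X"
  have d: "s1 differentiable at ?z" "s2 differentiable at ?z"
    using smooth_on_differentiable smooth_s1 smooth_s2 assms by blast+
  have "fd (\<lambda>z. k *\<^sub>R s1 z + l *\<^sub>R s2 z) ?z ?u = fd (\<lambda>z. k *\<^sub>R s1 z) ?z ?u + fd (\<lambda>z. l *\<^sub>R s2 z) ?z ?u"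
    by (rule fd_add) (use d in auto)
  also have "\<dots> = k *\<^sub>R fd s1 ?z ?u + l *\<^sub>R fd s2 ?z ?u"
    using fd_linear[OF bounded_linear_scaleR_right d(1)] fd_linear[OF bounded_linear_scaleR_right d(2)] by simp
  finally show ?thesis
    using dder_pull[OF c_mem open_N N_dom section_smooth[OF local_section_comb] assms] by simp
qed

text \<open>\<open>curvature_space\<close> quantifies over all sections; by tensoriality modulo
  \<open>f\<close> the one with constant coefficients decides.\<close>

lemma curvature_space_pair:
  assumes y: "y \<in> N"
  shows "X \<in> curvature_space A f y (span {k *\<^sub>R s1 (snd c y) + l *\<^sub>R s2 (snd c y)}) \<longleftrightarrow>
    k *\<^sub>R fd s1 (snd c y) (T y X) + l *\<^sub>R fd s2 (snd c y) (T y X) \<in> f y"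
proof
  let ?\<sigma> = "\<lambda>x. k *\<^sub>R s1 (snd c x) + l *\<^sub>R s2 (snd c x)"
  assume "X \<in> curvature_space A f y (span {?\<sigma> y})"
  then have "dder A ?\<sigma> y X \<in> f y"
    unfolding curvature_space_def using section_at_pull[OF y, of k l] by (auto simp: span_base)
  then show "k *\<^sub>R fd s1 (snd c y) (T y X) + l *\<^sub>R fd s2 (snd c y) (T y X) \<in> f y"
    unfolding dder_section_pull[OF y] .
next
  assume *: "k *\<^sub>R fd s1 (snd c y) (T y X) + l *\<^sub>R fd s2 (snd c y) (T y X) \<in> f y"
  show "X \<in> curvature_space A f y (span {k *\<^sub>R s1 (snd c y) + l *\<^sub>R s2 (snd c y)})"
    unfolding curvature_space_def
  proof (intro CollectI allI impI)
    fix \<sigma> assume \<sigma>: "section_at A f y \<sigma> \<and> \<sigma> y \<in> span {k *\<^sub>R s1 (snd c y) + l *\<^sub>R s2 (snd c y)}"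
    then obtain t where t: "\<sigma> y = t *\<^sub>R (k *\<^sub>R s1 (snd c y) + l *\<^sub>R s2 (snd c y))" by (auto simp: span_singleton)
    have "c1 (snd c y) (\<sigma> y) = t * k" "c2 (snd c y) (\<sigma> y) = t * l" using y by (auto simp: t c_linear)
    then have "dder A \<sigma> y X - t *\<^sub>R (k *\<^sub>R fd s1 (snd c y) (T y X) + l *\<^sub>R fd s2 (snd c y) (T y X)) \<in> f y"
      using dder_section[OF conjunct1[OF \<sigma>] y, of X] by (simp add: scaleR_add_right)
    then show "dder A \<sigma> y X \<in> f y"
      using subspace_add[OF f_subspace[OF y] _ subspace_scale[OF f_subspace[OF y] *, of t]] by fastforce
  qed
qed

lemma tangent_zero_iff: "y \<in> N \<Longrightarrow> T y X = 0 \<longleftrightarrow> X = 0"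
  by (metis N_fst c_mem chart_to_tangent_to_chart linear_0 linear_tangent_to_chart linear_chart_to_tangent)

lemma curvature_spheres_iff:
  assumes y: "y \<in> N"
  shows "l \<in> curvature_spheres A f y \<longleftrightarrow>
    (\<exists>k m. (k \<noteq> 0 \<or> m \<noteq> 0) \<and> l = span {k *\<^sub>R s1 (snd c y) + m *\<^sub>R s2 (snd c y)} \<and> sphere (snd c y) k m)"
proof -
  have sph: "sphere (snd c y) k m \<longleftrightarrow> (\<exists>X\<in>curvature_space A f y (span {k *\<^sub>R s1 (snd c y) + m *\<^sub>R s2 (snd c y)}). X \<noteq> 0)" for k m
  proof
    assume "sphere (snd c y) k m"
    then obtain u where u: "u \<noteq> 0" "k *\<^sub>R fd s1 (snd c y) u + m *\<^sub>R fd s2 (snd c y) u \<in> f y"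
      using y by (auto simp: sphere_def)
    let ?X = "chart_to_tangent A c y u"
    have "T y ?X = u" using c_mem N_fst[OF y] by simp
    then show "\<exists>X\<in>curvature_space A f y (span {k *\<^sub>R s1 (snd c y) + m *\<^sub>R s2 (snd c y)}). X \<noteq> 0"
      using u curvature_space_pair[OF y, of ?X k m] tangent_zero_iff[OF y, of ?X] by auto
  next
    assume "\<exists>X\<in>curvature_space A f y (span {k *\<^sub>R s1 (snd c y) + m *\<^sub>R s2 (snd c y)}). X \<noteq> 0"
    then obtain X where "X \<noteq> 0" "k *\<^sub>R fd s1 (snd c y) (T y X) + m *\<^sub>R fd s2 (snd c y) (T y X) \<in> f y"
      using curvature_space_pair[OF y] by blast
    then show "sphere (snd c y) k m" unfolding sphere_def using tangent_zero_iff[OF y] y by auto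
  qed
  show ?thesis
  proof
    assume l: "l \<in> curvature_spheres A f y"
    then have l': "subspace l" "dim l = 1" "l \<subseteq> f y" by (auto simp: curvature_spheres_def)
    obtain b where b: "b \<in> l" "b \<noteq> 0" using l'(2) dim_eq_0[of l] by fastforce
    have "span {b} \<subseteq> l" using b l' by (simp add: span_minimal)
    moreover have "dim {b} = 1" using b by (simp add: dim_insert)
    ultimately have lb: "l = span {b}"
      using l' subspace_dim_equal[of "span {b}" l] by (simp add: dim_span)
    obtain k m where km: "b = k *\<^sub>R s1 (snd c y) + m *\<^sub>R s2 (snd c y)" using f_pair[OF y] b l' by blast
    then have "k \<noteq> 0 \<or> m \<noteq> 0" using b by auto
    then show "\<exists>k m. (k \<noteq> 0 \<or> m \<noteq> 0) \<and> l = span {k *\<^sub>R s1 (snd c y) + m *\<^sub>R s2 (snd c y)} \<and> sphere (snd c y) k m"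
      using lb km l sph by (auto simp: curvature_spheres_def)
  next
    assume "\<exists>k m. (k \<noteq> 0 \<or> m \<noteq> 0) \<and> l = span {k *\<^sub>R s1 (snd c y) + m *\<^sub>R s2 (snd c y)} \<and> sphere (snd c y) k m"
    then obtain k m where km: "k \<noteq> 0 \<or> m \<noteq> 0" "l = span {k *\<^sub>R s1 (snd c y) + m *\<^sub>R s2 (snd c y)}" "sphere (snd c y) k m"
      by blast
    have "k *\<^sub>R s1 (snd c y) + m *\<^sub>R s2 (snd c y) \<noteq> 0" using frame_independent[OF mem_V[OF y]] km(1) by blast
    then have "dim l = 1" unfolding km(2) dim_span by (simp add: dim_insert)
    moreover have "l \<subseteq> f y" unfolding km(2) using f_pair[OF y] by (intro span_minimal f_subspace[OF y]) auto
    ultimately show "l \<in> curvature_spheres A f y" using km sph by (auto simp: curvature_spheres_def)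
  qed
qed

text \<open>\<open>q_endo\<close> is well defined because \<open>\<eta> y X\<close> kills \<open>f\<close>; the two terms are the diagonal entries.\<close>

lemma q_form_frame:
  assumes y: "y \<in> N" and nil: "\<And>X. nilpotent_skew (f y) (\<eta> y X)"
  shows "q_form A f \<eta> y X W = c1 (snd c y) (blinfun_apply (\<eta> y X) (fd s1 (snd c y) (T y W))) +
    c2 (snd c y) (blinfun_apply (\<eta> y X) (fd s2 (snd c y) (T y W)))"
proof -
  let ?z = "snd c y"
  define \<omega> where "\<omega> = \<eta> y X"
  define v1 v2 where "v1 = blinfun_apply \<omega> (fd s1 ?z (T y W))" and "v2 = blinfun_apply \<omega> (fd s2 ?z (T y W))"
  have nil': "nilpotent_skew (f y) \<omega>" using nil by (simp add: \<omega>_def)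
  have vf: "v1 \<in> f y" "v2 \<in> f y"
    using nilpotent_skewD(3)[OF nil'] fd_s1_perp[OF mem_V[OF y]] fd_s2_perp[OF mem_V[OF y]] y by (auto simp: v1_def v2_def)
  have val: "blinfun_apply \<omega> (dder A \<sigma> y W) = c1 ?z (\<sigma> y) *\<^sub>R v1 + c2 ?z (\<sigma> y) *\<^sub>R v2" if "section_at A f y \<sigma>" for \<sigma>
    using nilpotent_skewD(2)[OF nil' dder_section[OF that y, of W]]
    by (simp add: blinfun.diff_right blinfun.add_right blinfun.scaleR_right v1_def v2_def)
  have endo: "q_endo A f \<eta> y X W a = c1 ?z a *\<^sub>R v1 + c2 ?z a *\<^sub>R v2" if a: "a \<in> f y" for a
    unfolding q_endo_def
  proof (rule the_equality)
    let ?\<sigma> = "\<lambda>x. c1 ?z a *\<^sub>R s1 (snd c x) + c2 ?z a *\<^sub>R s2 (snd c x)"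
    have "?\<sigma> y = a" using c_expand[OF mem_V[OF y], of a] a y by simp
    then show "\<exists>\<sigma>. section_at A f y \<sigma> \<and> \<sigma> y = a \<and> c1 ?z a *\<^sub>R v1 + c2 ?z a *\<^sub>R v2 = blinfun_apply (\<eta> y X) (dder A \<sigma> y W)"
      using val[OF section_at_pull[OF y]] section_at_pull[OF y] unfolding \<omega>_def by (intro exI[of _ ?\<sigma>]) simp
    show "w = c1 ?z a *\<^sub>R v1 + c2 ?z a *\<^sub>R v2"
      if "\<exists>\<sigma>. section_at A f y \<sigma> \<and> \<sigma> y = a \<and> w = blinfun_apply (\<eta> y X) (dder A \<sigma> y W)" for w
      using that val unfolding \<omega>_def by auto
  qed
  show ?thesis
    unfolding q_form_def
    using trace_on_eq[OF f_subspace[OF y] endo vf linear_c] by (simp add: v1_def v2_def \<omega>_def)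
qed

end

section \<open>Charts with a frame of curvature spheres\<close>

locale curvature_chart = chart_frame A B f c N s1 s2 +
    curvature_frame B "snd c ` N" "\<lambda>z. f (chart_inv c z)" s1 s2 X Y
  for A :: "'a::{t2_space, second_countable_topology} chart set"
    and B :: "'v::euclidean_space \<Rightarrow> 'v \<Rightarrow> real" and f c N s1 s2 X Y
begin

lemma swapped_chart: "curvature_chart A B f c N s2 s1 Y X"
proof -
  have "curvature_frame B (snd c ` N) (\<lambda>z. f (chart_inv c z)) s2 s1 Y X" by (rule swapped)
  then show ?thesis
    unfolding curvature_chart_def chart_frame_def chart_frame_axioms_def curvature_frame_def
    using surface_axioms c_mem open_N N_dom by blast
qed

text \<open>Pairing with \<open>y1\<close> and \<open>x2\<close> splits the condition into
  \<open>k * \<theta>Y z u = 0\<close> and \<open>l * \<theta>X z u = 0\<close> with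
  \<open>u\<close> non-zero. Conversely, \<open>X\<close> and \<open>Y\<close> serve as
  directions.\<close>

lemma sphere_frame: assumes "z \<in> snd c ` N" shows "sphere z k l \<longleftrightarrow> k = 0 \<or> l = 0"
proof
  assume "sphere z k l"
  then obtain u where u: "u \<noteq> 0" "k *\<^sub>R fd s1 z u + l *\<^sub>R fd s2 z u \<in> f (chart_inv c z)" unfolding sphere_def by blast
  have "B (k *\<^sub>R fd s1 z u + l *\<^sub>R fd s2 z u) (y1 z) = 0" "B (k *\<^sub>R fd s1 z u + l *\<^sub>R fd s2 z u) (x2 z) = 0"
    using u(2) fd_s1_perp[OF assms] fd_s2_perp[OF assms] perpD by blast+
  then have "k * \<theta>Y z u = 0" "l * \<theta>X z u = 0"
    using y1_orth[OF assms] x2_orth[OF assms] by (auto simp: B_simps \<theta>X_def \<theta>Y_def)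
  then show "k = 0 \<or> l = 0" using \<theta>_expand[OF assms, of u] u(1) by auto
next
  have nz: "X z \<noteq> 0" "Y z \<noteq> 0" using XY_independent[OF assms, of 1 0] XY_independent[OF assms, of 0 1] by auto
  assume "k = 0 \<or> l = 0"
  then show "sphere z k l"
    unfolding sphere_def
    using nz subspace_scale[OF subspace_F[OF assms] X1[OF assms], of k] subspace_scale[OF subspace_F[OF assms] Y2[OF assms], of l]
    by (auto intro: exI[of _ "X z"] exI[of _ "Y z"])
qed

lemma curvature_spheres_frame:
  assumes y: "y \<in> N"
  shows "curvature_spheres A f y = {span {s1 (snd c y)}, span {s2 (snd c y)}}"
proof -
  have sc: "span {k *\<^sub>R v} = span {v}" if "k \<noteq> 0" for k :: real and v :: 'v
    using span_image_scale[of "{v}" "\<lambda>_. k"] that by simp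
  show ?thesis
    using curvature_spheres_iff[OF y] sphere_frame[OF mem_V[OF y]] sc
    by (auto simp: set_eq_iff) (metis add.right_neutral add.left_neutral scaleR_one scaleR_zero_left zero_neq_one)+
qed

lemma second_osculating_subset:
  assumes y: "y \<in> N" and b1: "\<And>x. x \<in> N \<Longrightarrow> b1 x = span {s1 (snd c x)}" and b2: "\<And>x. x \<in> N \<Longrightarrow> b2 x = span {s2 (snd c x)}"
  shows "second_osculating A b1 (\<lambda>x. curvature_space A f x (b2 x)) y \<subseteq>
    span {s1 (snd c y), y1 (snd c y), fd y1 (snd c y) (Y (snd c y))}"
  unfolding second_osculating_def
proof (intro span_minimal subspace_span, clarify)
  fix v \<sigma> W
  assume v: "v \<in> {\<sigma> y, dder A \<sigma> y (W y), dder A (\<lambda>x. dder A \<sigma> x (W x)) y (W y)}"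
    and \<sigma>: "section_at A b1 y \<sigma>" and W: "vector_field_at A (\<lambda>x. curvature_space A f x (b2 x)) y W"
  obtain M1 where M1: "open M1" "y \<in> M1" "smooth_fun A M1 \<sigma>" "\<And>x. x \<in> M1 \<Longrightarrow> \<sigma> x \<in> b1 x"
    using \<sigma> unfolding section_at_def by blast
  obtain M2 where M2: "open M2" "y \<in> M2" "\<And>x. x \<in> M2 \<Longrightarrow> W x \<in> curvature_space A f x (b2 x)"
    "smooth_on (snd c ` (M2 \<inter> fst c)) (\<lambda>z. T (chart_inv c z) (W (chart_inv c z)))"
    using W c_mem unfolding vector_field_at_def by (auto simp: o_def)
  define M where "M = M1 \<inter> M2 \<inter> N"
  have M: "open M" "y \<in> M" "M \<subseteq> N" "M \<subseteq> fst c" using M1 M2 open_N y N_dom by (auto simp: M_def)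
  define r where "r z = \<sigma> (chart_inv c z)" for z
  define w where "w z = T (chart_inv c z) (W (chart_inv c z))" for z
  have opM: "open (snd c ` M)" using chart_open_image'[OF c_mem M(1,4)] .
  have sM: "smooth_fun A M \<sigma>" by (rule smooth_fun_mono[OF M1(3)]) (auto simp: M_def)
  have r: "smooth_on (snd c ` M) r"
    unfolding r_def by (rule smooth_fun_chartD[OF sM c_mem]) (use M in auto)
  have w: "smooth_on (snd c ` M) w"
    unfolding w_def by (rule smooth_on_subset[OF M2(4)]) (use M in \<open>auto simp: M_def\<close>)
  define G where "G z = fd r z (w z)" for z
  have G: "smooth_on (snd c ` M) G" unfolding G_def by (rule smooth_on_fd[OF opM r w])
  have inv: "chart_inv c (snd c x) = x" if "x \<in> M" for x using that M inv_c by blast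
  \<comment> \<open>Stated on all of \<open>M\<close> and not only at \<open>y\<close>, because the
    outer derivative differentiates this expression as a function of the point.\<close>
  have d1: "dder A \<sigma> x (W x) = G (snd c x)" if "x \<in> M" for x
    using dder_chart[OF M(1) that sM c_mem] subsetD[OF M(4) that] inv[OF that]
    by (simp add: G_def w_def r_def[abs_def])
  have "dder A (\<lambda>x. dder A \<sigma> x (W x)) y (W y) = dder A (\<lambda>x. G (snd c x)) y (W y)"
    by (rule dder_cong[OF M(1,2)]) (rule d1)
  also have "\<dots> = fd G (snd c y) (w (snd c y))"
    using dder_pull[OF c_mem M(1,4) G M(2)] inv[OF M(2)] by (simp add: w_def)
  finally have d2: "dder A (\<lambda>x. dder A \<sigma> x (W x)) y (W y) = fd (\<lambda>z. fd r z (w z)) (snd c y) (w (snd c y))"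
    by (simp add: G_def[abs_def])
  have "{r (snd c y), fd r (snd c y) (w (snd c y)), fd (\<lambda>z. fd r z (w z)) (snd c y) (w (snd c y))}
      \<subseteq> span {s1 (snd c y), y1 (snd c y), fd y1 (snd c y) (Y (snd c y))}"
  proof (rule osculating_generators[OF opM _ _ r _ w])
    show "snd c ` M \<subseteq> snd c ` N" "snd c y \<in> snd c ` M" using M by auto
    show "r z \<in> span {s1 z}" if "z \<in> snd c ` M" for z
    proof -
      obtain x where x: "x \<in> M1" "x \<in> M" "x \<in> N" "z = snd c x" using \<open>z \<in> snd c ` M\<close> by (auto simp: M_def)
      have "\<sigma> x \<in> span {s1 (snd c x)}" using M1(4)[OF x(1)] unfolding b1[OF x(3)] .
      then show ?thesis using inv[OF x(2)] x(4) by (simp add: r_def)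
    qed
    show "fd s2 z (w z) \<in> f (chart_inv c z)" if "z \<in> snd c ` M" for z
    proof -
      obtain x where x: "x \<in> M" "z = snd c x" using \<open>z \<in> snd c ` M\<close> by auto
      have xN: "x \<in> N" using x M by auto
      have "W x \<in> curvature_space A f x (span {0 *\<^sub>R s1 (snd c x) + 1 *\<^sub>R s2 (snd c x)})"
        using M2(3)[of x] x b2[OF xN] by (simp add: M_def)
      then show ?thesis using curvature_space_pair[OF xN, of "W x" 0 1] x inv by (simp add: w_def)
    qed
  qed
  moreover have "r (snd c y) = \<sigma> y" using inv[OF M(2)] by (simp add: r_def)
  ultimately show "v \<in> span {s1 (snd c y), y1 (snd c y), fd y1 (snd c y) (Y (snd c y))}"
    using v d1[OF M(2)] d2 by (auto simp: G_def)
qed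

lemma frame_vector_field:
  assumes y: "y \<in> N" and b1: "\<And>x. x \<in> N \<Longrightarrow> b1 x = span {s1 (snd c x)}"
  shows "vector_field_at A (\<lambda>x. curvature_space A f x (b1 x)) y (\<lambda>x. chart_to_tangent A c x (X (snd c x)))"
proof (rule vector_field_at_pull[OF c_mem open_N N_dom smooth_X y])
  fix x assume x: "x \<in> N"
  have "fd s1 (snd c x) (X (snd c x)) \<in> f x" using X1[OF mem_V[OF x]] x by simp
  then show "chart_to_tangent A c x (X (snd c x)) \<in> curvature_space A f x (b1 x)"
    using curvature_space_pair[OF x, of "chart_to_tangent A c x (X (snd c x))" 1 0] b1[OF x] c_mem N_fst[OF x] by simp
qed

end

section \<open>Umbilic-free Legendre surfaces\<close>

locale legendre_surface = surface A + R42 B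
  for A :: "'a::{t2_space, second_countable_topology} chart set" and B :: "'v::euclidean_space \<Rightarrow> 'v \<Rightarrow> real" +
  fixes f :: "'a \<Rightarrow> 'v set"
  assumes legendre: "legendre_map A B f" and umbilic_free: "umbilic_free A f"
begin

lemma f_lie: "f x \<in> lie_grassmannian B"
  using legendre unfolding legendre_map_def by blast

lemma chart_frameI:
  assumes c: "c \<in> A" "open N" "N \<subseteq> fst c" and sm: "smooth_on (snd c ` N) s1" "smooth_on (snd c ` N) s2"
    and sp: "\<And>y. y \<in> N \<Longrightarrow> f y = span {s1 (snd c y), s2 (snd c y)}"
  shows "chart_frame A B f c N s1 s2"
proof unfold_locales
  have inv: "chart_inv c (snd c y) = y" if "y \<in> N" for y using that c by auto
  show "open (snd c ` N)" using chart_open_image' c by blast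
  fix z assume z: "z \<in> snd c ` N"
  show "f (chart_inv c z) = span {s1 z, s2 z}" using z sp inv by auto
  show "f (chart_inv c z) \<in> lie_grassmannian B" by (rule f_lie)
  have perp: "fd s z u \<in> perp B (f (chart_inv c z))"
    if s: "smooth_on (snd c ` N) s" "\<And>y. y \<in> N \<Longrightarrow> s (snd c y) \<in> f y" for s u
  proof -
    obtain y where y: "y \<in> N" "z = snd c y" using z by auto
    have sec: "section_at A f y (\<lambda>x. s (snd c x))"
      unfolding section_at_def using smooth_fun_pull[OF c s(1)] c(2) y(1) s(2) by blast
    have "dder A (\<lambda>x. s (snd c x)) y (chart_to_tangent A c y u) \<in> derived_bundle A f y"
      unfolding derived_bundle_def using sec by (intro span_base) blast
    then have "dder A (\<lambda>x. s (snd c x)) y (chart_to_tangent A c y u) \<in> perp B (f y)"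
      using legendre unfolding legendre_map_def by blast
    moreover have "y \<in> fst c" using y c by auto
    ultimately show ?thesis using dder_pull[OF c s(1) y(1)] c(1) y inv by simp
  qed
  show "fd s1 z u \<in> perp B (f (chart_inv c z))" "fd s2 z u \<in> perp B (f (chart_inv c z))" for u
    using perp[OF sm(1)] perp[OF sm(2)] sp by (simp_all add: span_base)
qed (use assms in auto)

lemma chart_frame_exists:
  assumes c: "c \<in> A" "x \<in> fst c"
  shows "\<exists>N s1 s2. x \<in> N \<and> chart_frame A B f c N s1 s2"
proof -
  have "\<exists>N e. open N \<and> x \<in> N \<and> (\<forall>i<(2::nat). smooth_fun A N (e i)) \<and> (\<forall>y\<in>N. f y = span ((\<lambda>i. e i y) ` {..<2}))"
    using legendre unfolding legendre_map_def smooth_subbundle_def by blast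
  then obtain N e where N: "open N" "x \<in> N" "\<And>i. i < (2::nat) \<Longrightarrow> smooth_fun A N (e i)"
    "\<And>y. y \<in> N \<Longrightarrow> f y = span ((\<lambda>i. e i y) ` {..<2})" by blast
  have "{..<2::nat} = {0, 1}" by auto
  have "chart_frame A B f c (N \<inter> fst c) (\<lambda>z. e 0 (chart_inv c z)) (\<lambda>z. e 1 (chart_inv c z))"
    using N c(1) chart_open[OF c(1)] \<open>{..<2::nat} = {0, 1}\<close>
    by (intro chart_frameI smooth_fun_chartD[OF N(3)]) auto
  then show ?thesis using N(2) c(2) by blast
qed

text \<open>The immersion condition in the definition of a Legendre map, tested on a frame alone;
  tensoriality modulo \<open>f\<close> covers all other sections.\<close>

lemma legendre_injective:
  assumes "chart_frame A B f c N s1 s2" "y \<in> N" "fd s1 (snd c y) u \<in> f y" "fd s2 (snd c y) u \<in> f y"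
  shows "u = 0"
proof -
  interpret chart_frame A B f c N s1 s2 by fact
  let ?X = "chart_to_tangent A c y u"
  have TX: "T y ?X = u" using c_mem N_fst[OF assms(2)] by simp
  have "dder A \<sigma> y ?X \<in> f y" if "section_at A f y \<sigma>" for \<sigma>
  proof -
    let ?e = "c1 (snd c y) (\<sigma> y) *\<^sub>R fd s1 (snd c y) u + c2 (snd c y) (\<sigma> y) *\<^sub>R fd s2 (snd c y) u"
    have "dder A \<sigma> y ?X - ?e \<in> f y" using dder_section[OF that assms(2), of ?X] TX by simp
    moreover have "?e \<in> f y" by (intro subspace_add subspace_scale f_subspace assms)
    ultimately show ?thesis using subspace_add[OF f_subspace[OF assms(2)]] by fastforce
  qed
  then have "?X = 0" using legendre unfolding legendre_map_def by blast
  then show ?thesis using tangent_zero_iff[OF assms(2), of ?X] TX by simp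
qed

lemma subset_chart_frame:
  assumes "chart_frame A B f c N s1 s2" "open M" "M \<subseteq> N"
  shows "chart_frame A B f c M s1 s2"
proof -
  interpret chart_frame A B f c N s1 s2 by fact
  have "smooth_on (snd c ` M) s1" "smooth_on (snd c ` M) s2"
    using smooth_on_subset[OF smooth_s1 image_mono[OF assms(3)]] smooth_on_subset[OF smooth_s2 image_mono[OF assms(3)]] .
  moreover have "f y = span {s1 (snd c y), s2 (snd c y)}" if "y \<in> M" for y
    using F_span[OF mem_V, of y] inv_c[of y] that assms(3) by auto
  ultimately show ?thesis using c_mem assms N_dom by (intro chart_frameI) auto
qed

lemma curvature_chart_exists:
  assumes fr: "chart_frame A B f c N s1 s2" and x: "x \<in> N"
    and sp: "\<And>y. y \<in> N \<Longrightarrow> span {s1 (snd c y)} \<in> curvature_spheres A f y" "\<And>y. y \<in> N \<Longrightarrow> span {s2 (snd c y)} \<in> curvature_spheres A f y"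
  shows "\<exists>M X Y. x \<in> M \<and> M \<subseteq> N \<and> curvature_chart A B f c M s1 s2 X Y"
proof -
  interpret chart_frame A B f c N s1 s2 by fact
  have "\<exists>u. u \<noteq> 0 \<and> k *\<^sub>R fd s1 z u + l *\<^sub>R fd s2 z u \<in> f (chart_inv c z)"
    if z: "z \<in> snd c ` N" and kl: "\<And>y. y \<in> N \<Longrightarrow> span {k *\<^sub>R s1 (snd c y) + l *\<^sub>R s2 (snd c y)} \<in> curvature_spheres A f y" for z k l
  proof -
    obtain y where y: "y \<in> N" "z = snd c y" using z by auto
    obtain X where X: "X \<in> curvature_space A f y (span {k *\<^sub>R s1 z + l *\<^sub>R s2 z})" "X \<noteq> 0"
      using kl[OF y(1)] unfolding curvature_spheres_def y by blast
    then show ?thesis using curvature_space_pair[OF y(1), of X k l] tangent_zero_iff[OF y(1), of X] y by auto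
  qed
  from this[of _ 1 0] this[of _ 0 1] have ker: "\<exists>u. u \<noteq> 0 \<and> fd s1 z u \<in> f (chart_inv c z)" "\<exists>u. u \<noteq> 0 \<and> fd s2 z u \<in> f (chart_inv c z)"
    if "z \<in> snd c ` N" for z using that sp by auto
  have inj: "u = 0" if "z \<in> snd c ` N" "fd s1 z u \<in> f (chart_inv c z)" "fd s2 z u \<in> f (chart_inv c z)" for z u
    using that legendre_injective[OF fr] by auto
  obtain V' X Y where V': "snd c x \<in> V'" "V' \<subseteq> snd c ` N" "curvature_frame B V' (\<lambda>z. f (chart_inv c z)) s1 s2 X Y"
  proof -
    have "\<exists>V' X Y. snd c x \<in> V' \<and> V' \<subseteq> snd c ` N \<and> curvature_frame B V' (\<lambda>z. f (chart_inv c z)) s1 s2 X Y"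
      by (rule curvature_frame_exists[OF _ _ _ mem_V[OF x]]) (use ker inj in blast)+
    then show ?thesis using that by blast
  qed
  interpret C: curvature_frame B V' "\<lambda>z. f (chart_inv c z)" s1 s2 X Y by fact
  define M where "M = {y \<in> fst c. snd c y \<in> V'}"
  have MN: "M \<subseteq> N"
  proof
    fix y assume y: "y \<in> M"
    then obtain y' where y': "y' \<in> N" "snd c y = snd c y'" using V'(2) by (auto simp: M_def)
    then show "y \<in> N" using inv_c[OF y'(1)] chart_inv_left[OF c_mem, of y] y by (auto simp: M_def)
  qed
  have img: "snd c ` M = V'" using V'(2) N_dom by (auto simp: M_def)
  have opM: "open M" unfolding M_def by (rule chart_open_preimage[OF c_mem C.open_V])
  have "curvature_chart A B f c M s1 s2 X Y"
    unfolding curvature_chart_def using subset_chart_frame[OF fr opM MN] V'(3) unfolding img by blast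
  then show ?thesis using x V'(1) MN N_dom by (intro exI[of _ M] exI[of _ X] exI[of _ Y]) (auto simp: M_def)
qed

text \<open>The two lines are distinct, so generators of them form a frame of \<open>f\<close>; the
  labels of the given bundles are kept.\<close>

lemma bundle_chart:
  assumes b: "curvature_sphere_bundles A f U b1 b2" and x: "x \<in> U" and c: "c \<in> A" "x \<in> fst c"
  shows "\<exists>N s1 s2 X Y. x \<in> N \<and> N \<subseteq> U \<and> curvature_chart A B f c N s1 s2 X Y \<and>
    (\<forall>y\<in>N. b1 y = span {s1 (snd c y)} \<and> b2 y = span {s2 (snd c y)})"
proof -
  have ex: "\<exists>N e. open N \<and> x \<in> N \<and> N \<subseteq> U \<and> smooth_fun A N e \<and> (\<forall>y\<in>N. bb y = span {e y})"
    if "smooth_subbundle A U 1 bb" for bb :: "'a \<Rightarrow> 'v set"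
  proof -
    have "\<exists>N (e :: nat \<Rightarrow> 'a \<Rightarrow> 'v). open N \<and> x \<in> N \<and> N \<subseteq> U \<and> (\<forall>i<1. smooth_fun A N (e i)) \<and> (\<forall>y\<in>N. bb y = span ((\<lambda>i. e i y) ` {..<1}))"
      using that x unfolding smooth_subbundle_def by blast
    then obtain N and e :: "nat \<Rightarrow> 'a \<Rightarrow> 'v" where "open N" "x \<in> N" "N \<subseteq> U" "smooth_fun A N (e 0)"
      "\<forall>y\<in>N. bb y = span ((\<lambda>i. e i y) ` {..<1})" by auto
    moreover have "{..<1::nat} = {0}" by auto
    ultimately show ?thesis by (intro exI[of _ N] exI[of _ "e 0"]) simp
  qed
  have sub: "smooth_subbundle A U 1 b1" "smooth_subbundle A U 1 b2"
    using b unfolding curvature_sphere_bundles_def by blast+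
  obtain N1 e1 where N1: "open N1" "x \<in> N1" "N1 \<subseteq> U" "smooth_fun A N1 e1" "\<And>y. y \<in> N1 \<Longrightarrow> b1 y = span {e1 y}"
    using ex[OF sub(1)] by blast
  obtain N2 e2 where N2: "open N2" "x \<in> N2" "N2 \<subseteq> U" "smooth_fun A N2 e2" "\<And>y. y \<in> N2 \<Longrightarrow> b2 y = span {e2 y}"
    using ex[OF sub(2)] by blast
  define N where "N = N1 \<inter> N2 \<inter> fst c"
  define s1 s2 where "s1 z = e1 (chart_inv c z)" and "s2 z = e2 (chart_inv c z)" for z
  have N: "open N" "N \<subseteq> fst c" "x \<in> N" "N \<subseteq> U" using N1 N2 c chart_open[OF c(1)] by (auto simp: N_def)
  have inv: "chart_inv c (snd c y) = y" if "y \<in> N" for y using that N c by auto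
  have bs: "b1 y = span {s1 (snd c y)}" "b2 y = span {s2 (snd c y)}" if "y \<in> N" for y
    using N1(5) N2(5) that inv[OF that] by (auto simp: s1_def s2_def N_def)
  have cs: "curvature_spheres A f y = {b1 y, b2 y}" "b1 y \<noteq> b2 y" if "y \<in> N" for y
    using b that N unfolding curvature_sphere_bundles_def by blast+
  have fr: "chart_frame A B f c N s1 s2"
  proof (rule chart_frameI[OF c(1) N(1,2)])
    show "smooth_on (snd c ` N) s1" "smooth_on (snd c ` N) s2"
      unfolding s1_def s2_def using smooth_fun_chartD[OF N1(4) c(1), of N] smooth_fun_chartD[OF N2(4) c(1), of N] by (auto simp: N_def)
    fix y assume y: "y \<in> N"
    have sub: "span {s1 (snd c y)} \<subseteq> f y" "span {s2 (snd c y)} \<subseteq> f y" "dim (span {s1 (snd c y)}) = 1" "dim (span {s2 (snd c y)}) = 1"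
      using cs(1)[OF y] bs[OF y] unfolding curvature_spheres_def by blast+
    have nz: "s1 (snd c y) \<noteq> 0" "s2 (snd c y) \<noteq> 0" using sub(3,4) by (auto simp: dim_span)
    have sc: "span {k *\<^sub>R v} = span {v}" if "k \<noteq> 0" for k :: real and v :: 'v
      using span_image_scale[of "{v}" "\<lambda>_. k"] that by simp
    show "f y = span {s1 (snd c y), s2 (snd c y)}"
    proof (rule span_pair_eq)
      show "subspace (f y)" "dim (f y) = 2" using lie_grassmannianD[OF f_lie] by auto
      show "s1 (snd c y) \<in> f y" "s2 (snd c y) \<in> f y" using sub by (auto simp: span_base)
      fix k l assume e: "k *\<^sub>R s1 (snd c y) + l *\<^sub>R s2 (snd c y) = 0"
      have "k = 0"
      proof (rule ccontr)
        assume k: "k \<noteq> 0"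
        have "k *\<^sub>R s1 (snd c y) = (- l) *\<^sub>R s2 (snd c y)" using e by (simp add: add_eq_0_iff2)
        moreover have "l \<noteq> 0" using e k nz by auto
        ultimately show False using cs(2)[OF y] bs[OF y] sc[OF k, of "s1 (snd c y)"] sc[of "- l" "s2 (snd c y)"] by simp
      qed
      then show "k = 0 \<and> l = 0" using e nz by simp
    qed
  qed
  obtain M X Y where "x \<in> M" "M \<subseteq> N" "curvature_chart A B f c M s1 s2 X Y"
    using curvature_chart_exists[OF fr N(3)] cs bs by (metis insertCI)
  then show ?thesis using N bs by (intro exI[of _ M] exI[of _ s1] exI[of _ s2] exI[of _ X] exI[of _ Y]) auto
qed

end

lemma (in surface) smooth_line_bundle:
  fixes e :: "'a \<Rightarrow> 'w::euclidean_space"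
  assumes "open U" "smooth_fun A U e" "\<And>y. y \<in> U \<Longrightarrow> e y \<noteq> 0" "\<And>y. y \<in> U \<Longrightarrow> W y = span {e y}"
  shows "smooth_subbundle A U 1 W"
  unfolding smooth_subbundle_def
proof (intro ballI conjI)
  fix y assume y: "y \<in> U"
  show "subspace (W y)" using assms(4)[OF y] by simp
  show "dim (W y) = 1" unfolding assms(4)[OF y] dim_span using assms(3)[OF y] by (simp add: dim_insert)
  show "\<exists>N e. open N \<and> y \<in> N \<and> N \<subseteq> U \<and> (\<forall>i<1. smooth_fun A N (e i)) \<and> (\<forall>y\<in>N. W y = span ((\<lambda>i. e i y) ` {..<1::nat}))"
    using assms(1,2,4) y by (intro exI[of _ U] exI[of _ "\<lambda>_. e"]) (auto simp: lessThan_Suc)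
qed

section \<open>Smoothness of the curvature sphere bundles\<close>

context legendre_surface begin

text \<open>Some line of \<open>f\<close> at \<open>x\<close> is no curvature sphere. Taken as
  \<open>s2\<close>, it leaves nearby spheres in the form \<open>s1 - t s2\<close> with
  \<open>t\<close> a root of the quadratic. Both roots are simple, hence smooth, and their order
  supplies local labels.\<close>

lemma curvature_sphere_bundles_exist:
  "\<exists>U b1 b2. curvature_sphere_bundles A f U b1 b2 \<and> x \<in> U"
proof -
  let ?c = "chart_at A x"
  note c = chart_at_mem[of x] chart_at_dom[of x]
  obtain N e1 e2 where N: "x \<in> N" "chart_frame A B f ?c N e1 e2" using chart_frame_exists[OF c] by blast
  interpret E: chart_frame A B f ?c N e1 e2 by fact
  let ?z0 = "snd ?c x"
  have two: "card (curvature_spheres A f y) = 2" for y using umbilic_free unfolding umbilic_free_def by blast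
  have spe: "span {k *\<^sub>R e1 ?z0 + l *\<^sub>R e2 ?z0} \<noteq> span {k' *\<^sub>R e1 ?z0 + l' *\<^sub>R e2 ?z0}"
    if "k * l' - l * k' \<noteq> 0" for k l k' l'
  proof
    assume "span {k *\<^sub>R e1 ?z0 + l *\<^sub>R e2 ?z0} = span {k' *\<^sub>R e1 ?z0 + l' *\<^sub>R e2 ?z0}"
    then have "k *\<^sub>R e1 ?z0 + l *\<^sub>R e2 ?z0 \<in> span {k' *\<^sub>R e1 ?z0 + l' *\<^sub>R e2 ?z0}" by (metis singletonI span_base)
    then obtain t where "k *\<^sub>R e1 ?z0 + l *\<^sub>R e2 ?z0 = (t * k') *\<^sub>R e1 ?z0 + (t * l') *\<^sub>R e2 ?z0"
      by (auto simp: span_singleton scaleR_add_right)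
    then have "k = t * k' \<and> l = t * l'" using E.frame_unique[OF E.mem_V[OF N(1)]] by blast
    then show False using that by simp
  qed
  \<comment> \<open>Three pairwise different lines cannot all be among two curvature
    spheres.\<close>
  have "\<exists>k l. (k \<noteq> 0 \<or> l \<noteq> 0) \<and> span {k *\<^sub>R e1 ?z0 + l *\<^sub>R e2 ?z0} \<notin> curvature_spheres A f x"
  proof (rule ccontr)
    assume neg: "\<not> ?thesis"
    let ?l = "\<lambda>k l. span {k *\<^sub>R e1 ?z0 + l *\<^sub>R e2 ?z0}"
    have "?l k l \<in> curvature_spheres A f x" if "k \<noteq> 0 \<or> l \<noteq> 0" for k l using neg that by blast
    from this[of 1 0] this[of 0 1] this[of 1 1]
    have "{?l 1 0, ?l 0 1, ?l 1 1} \<subseteq> curvature_spheres A f x" by (simp del: scaleR_one scaleR_zero_left)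
    moreover have "card {?l 1 0, ?l 0 1, ?l 1 1} = 3"
      using spe[of 1 1 0 0] spe[of 1 1 0 1] spe[of 0 1 1 1] by (simp add: card_insert_if)
    moreover have "finite (curvature_spheres A f x)" by (rule card_ge_0_finite) (simp add: two)
    ultimately show False using two[of x] card_mono[of "curvature_spheres A f x" "{?l 1 0, ?l 0 1, ?l 1 1}"] by simp
  qed
  then obtain k l where kl: "k \<noteq> 0 \<or> l \<noteq> 0" "span {k *\<^sub>R e1 ?z0 + l *\<^sub>R e2 ?z0} \<notin> curvature_spheres A f x" by blast
  have "l * l + k * k \<noteq> 0" using kl(1) unfolding sum_squares_eq_zero_iff by blast
  then have det: "l * l - (- k) * k \<noteq> 0" by simp
  \<comment> \<open>The coefficient vector of \<open>s1\<close> is that of \<open>s2\<close> turned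
    by a right angle, so the change of frame has determinant
    \<open>k\<^sup>2 + l\<^sup>2\<close>.\<close>
  define s1 where "s1 z = l *\<^sub>R e1 z + (- k) *\<^sub>R e2 z" for z
  define s2 where "s2 z = k *\<^sub>R e1 z + l *\<^sub>R e2 z" for z
  have fr: "chart_frame A B f ?c N s1 s2"
    using E.lie_frame_change[OF det] E.c_mem E.open_N E.N_dom surface_axioms
    unfolding chart_frame_def chart_frame_axioms_def s1_def[abs_def] s2_def[abs_def] by blast
  interpret chart_frame A B f ?c N s1 s2 by (rule fr)
  have ns: "\<not> sphere ?z0 0 1"
  proof
    assume "sphere ?z0 0 1"
    then have "span {0 *\<^sub>R s1 ?z0 + 1 *\<^sub>R s2 ?z0} \<in> curvature_spheres A f x"
      unfolding curvature_spheres_iff[OF N(1)] by (intro exI[of _ 0] exI[of _ 1]) simp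
    then show False using kl(2) by (simp add: s2_def)
  qed
  define V' where "V' = {z \<in> snd ?c ` N. g_det z > 0}"
  have "V' = (snd ?c ` N) \<inter> g_det -` {0<..}" by (auto simp: V'_def)
  then have opV: "open V'"
    using continuous_open_preimage[OF smooth_on_continuous[OF smooth_dets(1)] open_V, of "{0<..}"] by simp
  define M where "M = {y \<in> fst ?c. snd ?c y \<in> V'}"
  have MN: "M \<subseteq> N"
  proof
    fix y assume y: "y \<in> M"
    then obtain y' where y': "y' \<in> N" "snd ?c y = snd ?c y'" by (auto simp: M_def V'_def)
    then show "y \<in> N" using inv_c[OF y'(1)] chart_inv_left[OF c_mem, of y] y by (auto simp: M_def)
  qed
  have img: "snd ?c ` M = V'" using N_dom by (auto simp: M_def V'_def)
  have opM: "open M" unfolding M_def by (rule chart_open_preimage[OF c_mem opV])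
  have xM: "x \<in> M" using g_det_pos[OF mem_V[OF N(1)] ns] N(1) c(2) by (auto simp: M_def V'_def)
  have gpos: "g_det (snd ?c y) > 0" if "y \<in> M" for y using that by (auto simp: M_def V'_def)
  have rts: "(gh_mix (snd ?c y))\<^sup>2 - 4 * g_det (snd ?c y) * h_det (snd ?c y) > 0"
      "sphere (snd ?c y) 1 (- root_plus (snd ?c y))" "sphere (snd ?c y) 1 (- root_minus (snd ?c y))"
      "root_plus (snd ?c y) \<noteq> root_minus (snd ?c y)" if y: "y \<in> M" for y
  proof -
    let ?z = "snd ?c y"
    have yN: "y \<in> N" using y MN by auto
    obtain l1 l2 where l12: "curvature_spheres A f y = {l1, l2}" "l1 \<noteq> l2" using two[of y] by (meson card_2_iff)
    have ex: "\<exists>t. l = span {s1 ?z + (- t) *\<^sub>R s2 ?z} \<and> sphere ?z 1 (- t)" if l: "l \<in> curvature_spheres A f y" for l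
    proof -
      obtain k m where km: "k \<noteq> 0 \<or> m \<noteq> 0" "l = span {k *\<^sub>R s1 ?z + m *\<^sub>R s2 ?z}" "sphere ?z k m"
        using l curvature_spheres_iff[OF yN] by blast
      obtain u where u: "u \<noteq> 0" "k *\<^sub>R fd s1 ?z u + m *\<^sub>R fd s2 ?z u \<in> f y" using km(3) yN by (auto simp: sphere_def)
      \<comment> \<open>Positivity of \<open>g_det\<close> at \<open>y\<close> excludes
        \<open>s2\<close> as a curvature sphere there, too.\<close>
      have k0: "k \<noteq> 0"
      proof
        assume "k = 0"
        then have "m \<noteq> 0" "m *\<^sub>R fd s2 ?z u \<in> f y" using km u by auto
        then have "fd s2 ?z u \<in> f y" using subspace_scale[OF f_subspace[OF yN], of "m *\<^sub>R fd s2 ?z u" "1 / m"] by simp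
        then have "sphere ?z 0 1" unfolding sphere_def using u(1) yN by auto
        then show False using not_sphere_of_det[OF mem_V[OF yN] gpos[OF y]] by blast
      qed
      have "s1 ?z + (- (- m / k)) *\<^sub>R s2 ?z = (1 / k) *\<^sub>R (k *\<^sub>R s1 ?z + m *\<^sub>R s2 ?z)"
        using k0 by (simp add: scaleR_add_right)
      then have "span {s1 ?z + (- (- m / k)) *\<^sub>R s2 ?z} = l"
        using span_image_scale[of "{k *\<^sub>R s1 ?z + m *\<^sub>R s2 ?z}" "\<lambda>_. 1 / k"] k0 km(2) by simp
      moreover have "1 *\<^sub>R fd s1 ?z u + (- (- m / k)) *\<^sub>R fd s2 ?z u = (1 / k) *\<^sub>R (k *\<^sub>R fd s1 ?z u + m *\<^sub>R fd s2 ?z u)"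
        using k0 by (simp add: scaleR_add_right)
      then have "sphere ?z 1 (- (- m / k))"
        unfolding sphere_def using u yN subspace_scale[OF f_subspace[OF yN] u(2), of "1 / k"] by auto
      ultimately show ?thesis by blast
    qed
    have "l1 \<in> curvature_spheres A f y" "l2 \<in> curvature_spheres A f y" using l12 by auto
    from ex[OF this(1)] ex[OF this(2)] obtain t t' where
      t: "l1 = span {s1 ?z + (- t) *\<^sub>R s2 ?z}" "sphere ?z 1 (- t)"
      "l2 = span {s1 ?z + (- t') *\<^sub>R s2 ?z}" "sphere ?z 1 (- t')" by (elim exE conjE)
    have "t \<noteq> t'" using t l12 by auto
    note roots[OF mem_V[OF yN] gpos[OF y] t(2,4) this]
    then show "(gh_mix (snd ?c y))\<^sup>2 - 4 * g_det (snd ?c y) * h_det (snd ?c y) > 0"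
      "sphere (snd ?c y) 1 (- root_plus (snd ?c y))" "sphere (snd ?c y) 1 (- root_minus (snd ?c y))"
      "root_plus (snd ?c y) \<noteq> root_minus (snd ?c y)" by auto
  qed
  have "V' \<subseteq> snd ?c ` N" by (auto simp: V'_def)
  note smr = smooth_roots[OF opV this]
  have "0 < g_det z" "(gh_mix z)\<^sup>2 - 4 * g_det z * h_det z > 0" if "z \<in> V'" for z
    using that rts(1) gpos unfolding img[symmetric] by auto
  note smr = smr[OF this]
  define bb where "bb r y = span {s1 (snd ?c y) + (- r (snd ?c y)) *\<^sub>R s2 (snd ?c y)}" for r and y :: 'a
  have sub: "smooth_subbundle A M 1 (bb r)" if r: "smooth_on V' r" for r
  proof (rule smooth_line_bundle[OF opM, of "\<lambda>y. s1 (snd ?c y) + (- r (snd ?c y)) *\<^sub>R s2 (snd ?c y)"])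
    have sm: "smooth_on (snd ?c ` M) (\<lambda>z. s1 z + (- r z) *\<^sub>R s2 z)"
      unfolding img using opV r img MN
      by (intro smooth_on_add smooth_on_scaleR smooth_on_minus smooth_on_subset[OF smooth_s1] smooth_on_subset[OF smooth_s2]) auto
    show "smooth_fun A M (\<lambda>y. s1 (snd ?c y) + (- r (snd ?c y)) *\<^sub>R s2 (snd ?c y))"
      using smooth_fun_pull[OF c_mem opM _ sm] MN N_dom by blast
    show "s1 (snd ?c y) + (- r (snd ?c y)) *\<^sub>R s2 (snd ?c y) \<noteq> 0" if "y \<in> M" for y
      using frame_independent[OF mem_V, of y 1 "- r (snd ?c y)"] that MN by auto
  qed (simp add: bb_def)
  have "bb root_plus y \<noteq> bb root_minus y \<and> curvature_spheres A f y = {bb root_plus y, bb root_minus y}" if y: "y \<in> M" for y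
  proof -
    have yN: "y \<in> N" using y MN by auto
    have mem: "bb r y \<in> curvature_spheres A f y" if "sphere (snd ?c y) 1 (- r (snd ?c y))" for r
    proof -
      have "span {1 *\<^sub>R s1 (snd ?c y) + (- r (snd ?c y)) *\<^sub>R s2 (snd ?c y)} \<in> curvature_spheres A f y"
        unfolding curvature_spheres_iff[OF yN]
        by (intro exI[of _ 1] exI[of _ "- r (snd ?c y)"] conjI that) simp_all
      then show ?thesis by (simp add: bb_def)
    qed
    have ne: "bb root_plus y \<noteq> bb root_minus y"
    proof
      assume "bb root_plus y = bb root_minus y"
      then have "s1 (snd ?c y) + (- root_plus (snd ?c y)) *\<^sub>R s2 (snd ?c y) \<in> bb root_minus y"
        unfolding bb_def by (metis singletonI span_base)
      then obtain t where "1 *\<^sub>R s1 (snd ?c y) + (- root_plus (snd ?c y)) *\<^sub>R s2 (snd ?c y) =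
          t *\<^sub>R s1 (snd ?c y) + (t * - root_minus (snd ?c y)) *\<^sub>R s2 (snd ?c y)"
        unfolding bb_def span_singleton
        by (metis (no_types, lifting) imageE scaleR_add_right scaleR_one scaleR_scaleR)
      from frame_unique[OF mem_V[OF yN] this] rts(4)[OF y] show False by simp
    qed
    moreover have "finite (curvature_spheres A f y)" by (rule card_ge_0_finite) (simp add: two)
    then have "{bb root_plus y, bb root_minus y} = curvature_spheres A f y"
      by (rule card_subset_eq) (use mem rts[OF y] two[of y] ne in auto)
    ultimately show ?thesis by simp
  qed
  then have "curvature_sphere_bundles A f M (bb root_plus) (bb root_minus)"
    unfolding curvature_sphere_bundles_def using opM sub smr by blast
  then show ?thesis using xM by blast
qed

lemma curvature_chart_at:
  assumes "c \<in> A" "x \<in> fst c"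
  shows "\<exists>N s1 s2 X Y. x \<in> N \<and> curvature_chart A B f c N s1 s2 X Y"
  using curvature_sphere_bundles_exist[of x] bundle_chart[OF _ _ assms] by meson

lemma dder_wedge_nilpotent:
  assumes "smooth_fun A UNIV \<tau>" "\<And>x. \<tau> x \<in> wedge_space B (f x) (f x)"
  shows "nilpotent_skew (f x) (dder A \<tau> x X)"
proof -
  let ?c = "chart_at A x"
  obtain N s1 s2 X' Y where N: "x \<in> N" "curvature_chart A B f ?c N s1 s2 X' Y"
    using curvature_chart_at[OF chart_at_mem chart_at_dom] by blast
  interpret curvature_chart A B f ?c N s1 s2 X' Y by fact
  have "nilpotent_skew (f (chart_inv ?c (snd ?c x))) (fd (\<lambda>z. \<tau> (chart_inv ?c z)) (snd ?c x) (T x X))"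
    by (rule fd_wedge_nilpotent[OF open_V order_refl smooth_fun_chartD[OF assms(1) c_mem] assms(2) mem_V[OF N(1)]])
      (use N_dom in auto)
  then show ?thesis using dder_chart[OF open_UNIV UNIV_I assms(1) c_mem chart_at_dom] N(1) by simp
qed

lemma curvature_formI:
  assumes "curvature_chart A B f c N s1 s2 X Y" "one_form A \<eta>" "Defs.closed_form A \<eta>" "\<And>x X. nilpotent_skew (f x) (\<eta> x X)"
  shows "curvature_form B (snd c ` N) (\<lambda>z. f (chart_inv c z)) s1 s2 X Y (\<lambda>z u. form_in_chart A \<eta> c u z)"
proof -
  interpret curvature_chart A B f c N s1 s2 X Y by fact
  show ?thesis
  proof (intro curvature_form.intro frame_form.intro frame_form_axioms.intro curvature_frame_axioms lie_frame_axioms)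
    show "smooth_on (snd c ` N) (\<lambda>z. form_in_chart A \<eta> c u z)" for u
      using assms(2) c_mem smooth_on_subset[OF _ image_mono[OF N_dom]] unfolding one_form_def by blast
    fix z u v assume z: "z \<in> snd c ` N"
    then have z': "z \<in> snd c ` fst c" using N_dom by auto
    show "linear (\<lambda>u. form_in_chart A \<eta> c u z)" by (rule linear_form_in_chart[OF assms(2) c_mem z'])
    show "nilpotent_skew (f (chart_inv c z)) (form_in_chart A \<eta> c u z)"
      unfolding form_in_chart_def by (rule assms(4))
    show "fd (\<lambda>z. form_in_chart A \<eta> c v z) z u = fd (\<lambda>z. form_in_chart A \<eta> c u z) z v"
      using assms(3)[unfolded closed_form_def, rule_format, OF c_mem z', of v u] by simp
  qed
qed

text \<open>In contrast to the definition of the middle potential, this does not depend on the labelling.\<close>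

lemma middle_potential_line:
  assumes mid: "middle_potential A B f \<eta> \<eta>'" and nil: "\<And>x X. nilpotent_skew (f x) (\<eta>' x X)"
    and l: "l \<in> curvature_spheres A f x" and \<sigma>: "section_at A f x \<sigma>" "\<sigma> x \<in> l"
  shows "blinfun_apply (\<eta>' x Z) (dder A \<sigma> x W) \<in> l"
proof -
  let ?c = "chart_at A x"
  obtain U b1 b2 where U: "curvature_sphere_bundles A f U b1 b2" "x \<in> U"
    and dec: "\<And>X. \<exists>a1 a2 a3. \<eta>' x X = a1 + a2 + a3 \<and>
       a1 \<in> wedge_space B (second_osculating A b1 (\<lambda>y. curvature_space A f y (b2 y)) x) (second_osculating A b1 (\<lambda>y. curvature_space A f y (b2 y)) x) \<and>
       a2 \<in> wedge_space B (second_osculating A b2 (\<lambda>y. curvature_space A f y (b1 y)) x) (second_osculating A b2 (\<lambda>y. curvature_space A f y (b1 y)) x) \<and>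
       a3 \<in> wedge_space B (f x) (f x)"
    using mid unfolding middle_potential_def Let_def by blast
  obtain N s1 s2 X Y where N: "x \<in> N" "curvature_chart A B f ?c N s1 s2 X Y"
    "\<And>y. y \<in> N \<Longrightarrow> b1 y = span {s1 (snd ?c y)}" "\<And>y. y \<in> N \<Longrightarrow> b2 y = span {s2 (snd ?c y)}"
    using bundle_chart[OF U chart_at_mem chart_at_dom] by blast
  interpret curvature_chart A B f ?c N s1 s2 X Y by fact
  interpret sw: curvature_chart A B f ?c N s2 s1 Y X by (rule swapped_chart)
  let ?z = "snd ?c x"
  obtain a1 a2 a3 where a: "\<eta>' x Z = a1 + a2 + a3"
       "a1 \<in> wedge_space B (second_osculating A b1 (\<lambda>y. curvature_space A f y (b2 y)) x) (second_osculating A b1 (\<lambda>y. curvature_space A f y (b2 y)) x)"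
       "a2 \<in> wedge_space B (second_osculating A b2 (\<lambda>y. curvature_space A f y (b1 y)) x) (second_osculating A b2 (\<lambda>y. curvature_space A f y (b1 y)) x)"
       "a3 \<in> wedge_space B (f x) (f x)" using dec[of Z] by blast
  have S1: "second_osculating A b1 (\<lambda>y. curvature_space A f y (b2 y)) x \<subseteq>
      span {s1 (snd ?c x), y1 (snd ?c x), fd y1 (snd ?c x) (Y (snd ?c x))}"
    by (rule second_osculating_subset[OF N(1)]) (use N(3,4) in auto)
  have S2: "second_osculating A b2 (\<lambda>y. curvature_space A f y (b1 y)) x \<subseteq>
      span {s2 (snd ?c x), x2 (snd ?c x), fd x2 (snd ?c x) (X (snd ?c x))}"
    by (rule sw.second_osculating_subset[OF N(1)]) (use N(3,4) in auto)
  note zV = mem_V[OF N(1)]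
  have fz: "f (chart_inv ?c ?z) = f x" using N(1) by simp
  have 1: "blinfun_apply (\<eta>' x Z) (y1 ?z) \<in> span {s1 ?z}"
    by (rule middle_y1[OF zV _ a(1) a(2) S1 a(3) S2, unfolded fz, OF nil a(4)])
  \<comment> \<open>The second sphere follows from the first by exchanging the labels, and with them
    the two summands.\<close>
  have a': "\<eta>' x Z = a2 + a1 + a3" using a(1) by simp
  have 2: "blinfun_apply (\<eta>' x Z) (x2 ?z) \<in> span {s2 ?z}"
    by (rule sw.middle_y1[OF zV _ a' a(3) S2 a(2) S1, unfolded fz, OF nil a(4)])
  have kill: "blinfun_apply (\<eta>' x Z) v = 0" if "v \<in> f x" for v using nilpotent_skewD(2)[OF nil that] .
  let ?e = "c1 ?z (\<sigma> x) *\<^sub>R fd s1 ?z (T x W) + c2 ?z (\<sigma> x) *\<^sub>R fd s2 ?z (T x W)"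
  have "blinfun_apply (\<eta>' x Z) (dder A \<sigma> x W) = blinfun_apply (\<eta>' x Z) ?e"
    using kill[OF dder_section[OF \<sigma>(1) N(1), of W]] by (simp add: blinfun.diff_right)
  also have "\<dots> = c1 ?z (\<sigma> x) *\<^sub>R blinfun_apply (\<eta>' x Z) (fd s1 ?z (T x W)) + c2 ?z (\<sigma> x) *\<^sub>R blinfun_apply (\<eta>' x Z) (fd s2 ?z (T x W))"
    by (simp add: blinfun.add_right blinfun.scaleR_right)
  also have "blinfun_apply (\<eta>' x Z) (fd s1 ?z (T x W)) = \<theta>Y ?z (T x W) *\<^sub>R blinfun_apply (\<eta>' x Z) (y1 ?z)"
    using kill[of "fd s1 ?z (T x W) - \<theta>Y ?z (T x W) *\<^sub>R y1 ?z"] fd_s1_expand[OF zV, of "T x W"] fz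
    by (simp add: \<theta>Y_def blinfun.diff_right blinfun.scaleR_right)
  also have "blinfun_apply (\<eta>' x Z) (fd s2 ?z (T x W)) = \<theta>X ?z (T x W) *\<^sub>R blinfun_apply (\<eta>' x Z) (x2 ?z)"
    using kill[of "fd s2 ?z (T x W) - \<theta>X ?z (T x W) *\<^sub>R x2 ?z"] fd_s2_expand[OF zV, of "T x W"] fz
    by (simp add: \<theta>X_def blinfun.diff_right blinfun.scaleR_right)
  finally have eq: "blinfun_apply (\<eta>' x Z) (dder A \<sigma> x W) =
    c1 ?z (\<sigma> x) *\<^sub>R \<theta>Y ?z (T x W) *\<^sub>R blinfun_apply (\<eta>' x Z) (y1 ?z) + c2 ?z (\<sigma> x) *\<^sub>R \<theta>X ?z (T x W) *\<^sub>R blinfun_apply (\<eta>' x Z) (x2 ?z)" .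
  have "l = span {s1 ?z} \<or> l = span {s2 ?z}" using l curvature_spheres_frame[OF N(1)] by blast
  then show ?thesis
  proof
    assume l1: "l = span {s1 ?z}"
    then have "c2 ?z (\<sigma> x) = 0" using \<sigma>(2) zV by (auto simp: span_singleton c_linear)
    then show ?thesis unfolding eq l1 using 1 by (simp add: span_scale)
  next
    assume l2: "l = span {s2 ?z}"
    then have "c1 ?z (\<sigma> x) = 0" using \<sigma>(2) zV by (auto simp: span_singleton c_linear)
    then show ?thesis unfolding eq l2 using 2 by (simp add: span_scale)
  qed
qed

end

text \<open>In a diagonalising basis, non-degeneracy means that neither of the two basis vectors is
  null, and \<open>m + n\<close> counts those that are not.\<close>

lemma signature_nondegenerate:
  fixes b :: "real ^ 2 \<Rightarrow> real ^ 2 \<Rightarrow> real"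
  assumes lin: "\<And>Y. linear (\<lambda>X. b X Y)" "\<And>X. linear (b X)" and sig: "has_signature b m n"
  shows "(\<forall>X. (\<forall>Y. b X Y = 0) \<longrightarrow> X = 0) \<longleftrightarrow> m + n = 2"
proof -
  obtain E where E: "independent E" "span E = UNIV" "\<And>e e'. e \<in> E \<Longrightarrow> e' \<in> E \<Longrightarrow> e \<noteq> e' \<Longrightarrow> b e e' = 0"
    "card {e \<in> E. b e e > 0} = m" "card {e \<in> E. b e e < 0} = n"
    using sig unfolding has_signature_def by blast
  have fin: "finite E" using E(1) by (rule independent_imp_finite)
  have cE: "card E = 2" using dim_span_eq_card_independent[OF E(1)] E(2) by (simp add: dim_UNIV)
  let ?P = "{e \<in> E. b e e > 0}" and ?N = "{e \<in> E. b e e < 0}"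
  have cPN: "card (?P \<union> ?N) = m + n"
    using card_Un_disjoint[of ?P ?N] fin E(4,5) by (simp add: disjoint_iff)
  have expand: "b (\<Sum>e\<in>E. c e *\<^sub>R e) e' = c e' * b e' e'" if "e' \<in> E" for c e'
  proof -
    have "b (\<Sum>e\<in>E. c e *\<^sub>R e) e' = (\<Sum>e\<in>E. c e * b e e')"
      unfolding linear_sum[OF lin(1)] linear_cmul[OF lin(1)] by simp
    also have "\<dots> = (\<Sum>e\<in>E. if e = e' then c e' * b e' e' else 0)"
      using that E(3) by (intro sum.cong) auto
    finally show ?thesis using that fin by simp
  qed
  have sp: "\<exists>c. v = (\<Sum>e\<in>E. c e *\<^sub>R e)" for v
    using span_finite[OF fin] E(2) by auto
  show ?thesis
  proof
    assume nd: "\<forall>X. (\<forall>Y. b X Y = 0) \<longrightarrow> X = 0"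
    have "b e e \<noteq> 0" if e: "e \<in> E" for e
    proof
      assume "b e e = 0"
      then have z: "b e e' = 0" if "e' \<in> E" for e' using that E(3)[OF e that] by (cases "e = e'") auto
      have "b e Y = 0" for Y
      proof -
        obtain c where c: "Y = (\<Sum>e\<in>E. c e *\<^sub>R e)" using sp by blast
        show ?thesis unfolding c using z by (simp add: linear_sum[OF lin(2)] linear_cmul[OF lin(2)])
      qed
      then have "e = 0" using nd by blast
      then show False using e E(1) dependent_zero by blast
    qed
    then have "?P \<union> ?N = E" by (auto simp: neq_iff)
    then show "m + n = 2" using cPN cE by simp
  next
    assume mn: "m + n = 2"
    have PN: "?P \<union> ?N = E" by (rule card_subset_eq[OF fin]) (use cPN cE mn in auto)
    show "\<forall>X. (\<forall>Y. b X Y = 0) \<longrightarrow> X = 0"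
    proof (intro allI impI)
      fix X assume X: "\<forall>Y. b X Y = 0"
      obtain c where c: "X = (\<Sum>e\<in>E. c e *\<^sub>R e)" using sp by blast
      have "c e = 0" if e: "e \<in> E" for e
      proof -
        have "c e * b e e = 0" using expand[OF e, of c] X c by simp
        moreover have "e \<in> ?P \<union> ?N" using e PN by simp
        then have "b e e \<noteq> 0" by force
        ultimately show ?thesis by simp
      qed
      then show "X = 0" using c by simp
    qed
  qed
qed

section \<open>From conserved quantities to isothermic surfaces\<close>

lemma (in surface) dder_affine:
  assumes "smooth_fun A UNIV g"
  shows "dder A (\<lambda>x. k + t *\<^sub>R g x) x X = t *\<^sub>R dder A g x X"
proof -
  let ?c = "chart_at A x"
  have d: "(\<lambda>z. g (chart_inv ?c z)) differentiable at (snd ?c x)"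
    by (rule smooth_on_differentiable[OF smooth_fun_chartD[OF assms chart_at_mem]]) (use chart_at_dom in auto)
  have "fd (\<lambda>z. k + t *\<^sub>R g (chart_inv ?c z)) (snd ?c x) X =
      fd (\<lambda>z. k) (snd ?c x) X + fd (\<lambda>z. t *\<^sub>R g (chart_inv ?c z)) (snd ?c x) X"
    by (rule fd_add) (use d in auto)
  also have "\<dots> = t *\<^sub>R fd (\<lambda>z. g (chart_inv ?c z)) (snd ?c x) X"
    using fd_linear[OF bounded_linear_scaleR_right d, of t X] by simp
  finally show ?thesis by (simp add: dder_def o_def)
qed

lemma poly_section_1: "poly_section p 1 t x = p 0 x + t *\<^sub>R p 1 x"
  by (simp add: poly_section_def)

lemma (in surface) conserved_polynomial_1:
  assumes cons: "conserved_polynomial A \<eta> p 1" and p0: "\<And>x. p 0 x = k"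
  shows "smooth_fun A UNIV (p 1)" "dder A (p 1) x X = - blinfun_apply (\<eta> x X) k" "blinfun_apply (\<eta> x X) (p 1 x) = 0"
proof -
  show sm: "smooth_fun A UNIV (p 1)" using cons unfolding conserved_polynomial_def by blast
  have "dder A (poly_section p 1 t) x X + t *\<^sub>R blinfun_apply (\<eta> x X) (poly_section p 1 t x) = 0" for t
    using cons unfolding conserved_polynomial_def by blast
  moreover have "poly_section p 1 t = (\<lambda>x. k + t *\<^sub>R p 1 x)" for t
    using poly_section_1[of p t] p0 by (simp add: fun_eq_iff)
  ultimately have "t *\<^sub>R dder A (p 1) x X + t *\<^sub>R (blinfun_apply (\<eta> x X) k + t *\<^sub>R blinfun_apply (\<eta> x X) (p 1 x)) = 0" for t
    using dder_affine[OF sm] by (simp add: blinfun.add_right blinfun.scaleR_right)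
  \<comment> \<open>The equation is quadratic in \<open>t\<close> without constant term; the values
    1 and -1 separate its two coefficients.\<close>
  from this[of 1] this[of "-1"]
  have 1: "dder A (p 1) x X + (blinfun_apply (\<eta> x X) k + blinfun_apply (\<eta> x X) (p 1 x)) = 0"
    and 2: "dder A (p 1) x X + (blinfun_apply (\<eta> x X) k - blinfun_apply (\<eta> x X) (p 1 x)) = 0"
    by (simp_all add: algebra_simps)
  have "2 *\<^sub>R blinfun_apply (\<eta> x X) (p 1 x) = (dder A (p 1) x X + (blinfun_apply (\<eta> x X) k + blinfun_apply (\<eta> x X) (p 1 x)))
     - (dder A (p 1) x X + (blinfun_apply (\<eta> x X) k - blinfun_apply (\<eta> x X) (p 1 x)))" by (simp add: scaleR_2)
  then show "blinfun_apply (\<eta> x X) (p 1 x) = 0" unfolding 1 2 by simp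
  then show "dder A (p 1) x X = - blinfun_apply (\<eta> x X) k" using 1 by (simp add: eq_neg_iff_add_eq_0)
qed

context legendre_surface begin

lemma gauge_orbitD:
  assumes g: "gauge_potential A B f \<eta>" and o: "\<eta>' \<in> gauge_orbit A B f \<eta>"
  obtains \<tau> where "smooth_fun A UNIV \<tau>" "\<And>x. \<tau> x \<in> wedge_space B (f x) (f x)"
    "\<And>x X. \<eta>' x X = \<eta> x X - dder A \<tau> x X" "one_form A \<eta>'" "closed_form A \<eta>'"
    "\<And>x X. nilpotent_skew (f x) (\<eta> x X)" "\<And>x X. nilpotent_skew (f x) (\<eta>' x X)"
proof -
  obtain \<tau> where \<tau>: "smooth_fun A UNIV \<tau>" "\<And>x. \<tau> x \<in> wedge_space B (f x) (f x)" "\<eta>' = (\<lambda>x X. \<eta> x X - dder A \<tau> x X)"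
    using o unfolding gauge_orbit_def by blast
  have \<eta>: "one_form A \<eta>" "closed_form A \<eta>" "\<And>x X. \<eta> x X \<in> wedge_space B (f x) (perp B (f x))"
    using g unfolding gauge_potential_def by blast+
  have nil: "nilpotent_skew (f x) (\<eta> x X)" for x X using wedge_space_nilpotent[OF f_lie \<eta>(3)] .
  have nil': "nilpotent_skew (f x) (\<eta>' x X)" for x X
    using subspace_diff[OF subspace_nilpotent_skew[OF lie_grassmannianD(1)[OF f_lie]], of "\<eta> x X" x "dder A \<tau> x X"]
      nil dder_wedge_nilpotent[OF \<tau>(1,2)] by (simp add: \<tau>(3))
  show thesis
    by (rule that[OF \<tau>(1,2) _ _ _ nil nil'])
      (simp_all add: \<tau>(3) one_form_diff closed_form_diff \<eta> one_form_dder[OF \<tau>(1)] closed_form_dder[OF \<tau>(1)])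
qed

text \<open>Being of constant signature, \<open>q\<close> cannot degenerate off the dense set.\<close>

lemma Omega_potential_nondegenerate:
  assumes Om: "Omega_potential A B f \<eta>" and nil: "\<And>x X. nilpotent_skew (f x) (\<eta> x X)"
    and q: "\<And>Y. q_form A f \<eta> x X Y = 0"
  shows "X = 0"
proof -
  have lin: "linear (\<lambda>X. q_form A f \<eta> y X W)" "linear (\<lambda>W. q_form A f \<eta> y X W)" for y X W
  proof -
    obtain N s1 s2 where N: "y \<in> N" "chart_frame A B f (chart_at A y) N s1 s2"
      using chart_frame_exists[OF chart_at_mem chart_at_dom] by blast
    interpret chart_frame A B f "chart_at A y" N s1 s2 by fact
    have \<eta>: "linear (\<eta> y)" using Om unfolding Omega_potential_def gauge_potential_def one_form_def by blast
    have T: "linear (T y)" using linear_tangent_to_chart[OF c_mem chart_at_dom] .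
    have l: "linear (fd s1 (snd (chart_at A y) y))" "linear (fd s2 (snd (chart_at A y) y))"
      using linear_fd smooth_s1 smooth_s2 N(1) by blast+
    show "linear (\<lambda>X. q_form A f \<eta> y X W)" "linear (\<lambda>W. q_form A f \<eta> y X W)"
      unfolding q_form_frame[where \<eta> = \<eta>, OF N(1) nil]
      by (auto intro!: linearI simp: linear_add[OF \<eta>] linear_cmul[OF \<eta>] linear_add[OF T] linear_cmul[OF T]
          linear_add[OF l(1)] linear_cmul[OF l(1)] linear_add[OF l(2)] linear_cmul[OF l(2)]
          blinfun.add_left blinfun.add_right blinfun.scaleR_left blinfun.scaleR_right c_linear algebra_simps)
  qed
  obtain D m n where D: "closure D = UNIV" "\<And>x X. x \<in> D \<Longrightarrow> (\<forall>Y. q_form A f \<eta> x X Y = 0) \<longrightarrow> X = 0"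
    and sig: "\<And>x. has_signature (q_form A f \<eta> x) m n"
    using Om unfolding Omega_potential_def by blast
  have "D \<noteq> {}" using D(1) by auto
  then obtain y where "y \<in> D" by blast
  then have "m + n = 2" using signature_nondegenerate[OF lin sig, of y] D(2) by blast
  then show ?thesis using signature_nondegenerate[OF lin sig, of x] q by blast
qed

lemma q_form_gauge:
  assumes fr: "curvature_chart A B f c N s1 s2 X Y" and y: "y \<in> N"
    and \<tau>: "smooth_fun A UNIV \<tau>" "\<And>x. \<tau> x \<in> wedge_space B (f x) (f x)"
    and nil: "\<And>x X. nilpotent_skew (f x) (\<eta> x X)" "\<And>x X. nilpotent_skew (f x) (\<eta>' x X)"
    and eq: "\<And>x X. \<eta>' x X = \<eta> x X - dder A \<tau> x X"
  shows "q_form A f \<eta> y Z W = q_form A f \<eta>' y Z W"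
proof -
  interpret curvature_chart A B f c N s1 s2 X Y by fact
  let ?z = "snd c y"
  have "c1 ?z (blinfun_apply (fd (\<lambda>z. \<tau> (chart_inv c z)) ?z (T y Z)) (fd s1 ?z (T y W))) +
      c2 ?z (blinfun_apply (fd (\<lambda>z. \<tau> (chart_inv c z)) ?z (T y Z)) (fd s2 ?z (T y W))) = 0"
    by (rule fd_wedge_trace[OF open_V order_refl smooth_fun_chartD[OF \<tau>(1) c_mem] \<tau>(2) mem_V[OF y]]) (use N_dom in auto)
  moreover have "dder A \<tau> y Z = fd (\<lambda>z. \<tau> (chart_inv c z)) ?z (T y Z)"
    using dder_chart[OF open_UNIV UNIV_I \<tau>(1) c_mem N_fst[OF y]] .
  ultimately show ?thesis
    unfolding q_form_frame[where \<eta> = \<eta>, OF y nil(1)] q_form_frame[where \<eta> = \<eta>', OF y nil(2)] eq by (simp add: blinfun.diff_left c_linear)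
qed

lemma middle_frame_exists:
  assumes Om: "Omega_potential A B f \<eta>" and mid: "middle_potential A B f \<eta> \<eta>'"
    and p1: "smooth_fun A UNIV p1" "\<And>x X. dder A p1 x X = - blinfun_apply (\<eta>' x X) p" "\<And>x X. blinfun_apply (\<eta>' x X) (p1 x) = 0"
    and norm: "\<And>x. B (p1 x) (p1 x) = 0" "\<And>x. B (p1 x) p = 0" "B p p \<noteq> 0"
    and c: "c \<in> A" "x \<in> fst c"
  shows "\<exists>N s1 s2 X Y. x \<in> N \<and> curvature_chart A B f c N s1 s2 X Y \<and>
    middle_frame B (snd c ` N) (\<lambda>z. f (chart_inv c z)) s1 s2 X Y (\<lambda>z u. form_in_chart A \<eta>' c u z) p (\<lambda>z. p1 (chart_inv c z))"
proof -
  obtain \<tau> where \<tau>: "smooth_fun A UNIV \<tau>" "\<And>x. \<tau> x \<in> wedge_space B (f x) (f x)"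
    "\<And>x X. \<eta>' x X = \<eta> x X - dder A \<tau> x X" "one_form A \<eta>'" "closed_form A \<eta>'"
    and nil: "\<And>x X. nilpotent_skew (f x) (\<eta> x X)" "\<And>x X. nilpotent_skew (f x) (\<eta>' x X)"
    using gauge_orbitD[of \<eta> \<eta>'] Om mid unfolding Omega_potential_def middle_potential_def by metis
  obtain N s1 s2 X Y where N: "x \<in> N" "curvature_chart A B f c N s1 s2 X Y"
    using curvature_chart_at[OF c] by blast
  interpret curvature_chart A B f c N s1 s2 X Y by fact
  interpret curvature_form B "snd c ` N" "\<lambda>z. f (chart_inv c z)" s1 s2 X Y "\<lambda>z u. form_in_chart A \<eta>' c u z"
    by (rule curvature_formI[OF N(2) \<tau>(4,5) nil(2)])
  have line: "blinfun_apply (form_in_chart A \<eta>' c u z) (k *\<^sub>R fd s1 z w + l *\<^sub>R fd s2 z w) \<in> span {k *\<^sub>R s1 z + l *\<^sub>R s2 z}"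
    if z: "z \<in> snd c ` N" and kl: "span {k *\<^sub>R s1 z + l *\<^sub>R s2 z} \<in> curvature_spheres A f (chart_inv c z)" for z u w k l
  proof -
    obtain y where y: "y \<in> N" "z = snd c y" using z by auto
    let ?s = "\<lambda>x. k *\<^sub>R s1 (snd c x) + l *\<^sub>R s2 (snd c x)"
    have "blinfun_apply (\<eta>' y (chart_to_tangent A c y u)) (dder A ?s y (chart_to_tangent A c y w)) \<in> span {?s y}"
      by (rule middle_potential_line[OF mid nil(2) _ section_at_pull[OF y(1)]]) (use kl y in \<open>auto simp: span_base\<close>)
    then show ?thesis
      using y c_mem N_fst[OF y(1)] by (simp add: dder_section_pull form_in_chart_def)
  qed
  have cs: "curvature_spheres A f (chart_inv c z) = {span {s1 z}, span {s2 z}}" if z: "z \<in> snd c ` N" for z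
    using curvature_spheres_frame z by auto
  \<comment> \<open>The hypothesis expresses the form \<open>q\<close> of the original potential
    through the gauged one, so a direction annihilated by it must vanish.\<close>
  have nd: "u = 0" if z: "z \<in> snd c ` N"
    and q: "\<And>w. c1 z (blinfun_apply (form_in_chart A \<eta>' c u z) (fd s1 z w)) + c2 z (blinfun_apply (form_in_chart A \<eta>' c u z) (fd s2 z w)) = 0" for z u
  proof -
    obtain y where y: "y \<in> N" "z = snd c y" using z by auto
    have "q_form A f \<eta> y (chart_to_tangent A c y u) W = 0" for W
      unfolding q_form_gauge[OF N(2) y(1) \<tau>(1,2) nil \<tau>(3)] q_form_frame[where \<eta> = \<eta>', OF y(1) nil(2)]
      using q[of "T y W"] y by (simp add: form_in_chart_def)
    then have "chart_to_tangent A c y u = 0" by (rule Omega_potential_nondegenerate[OF Om nil(1)])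
    then show ?thesis
      using tangent_to_chart_to_tangent[OF c_mem N_fst[OF y(1)], of u] tangent_zero_iff[OF y(1), of 0] by metis
  qed
  have "middle_frame B (snd c ` N) (\<lambda>z. f (chart_inv c z)) s1 s2 X Y (\<lambda>z u. form_in_chart A \<eta>' c u z) p (\<lambda>z. p1 (chart_inv c z))"
  proof (intro middle_frame.intro middle_frame_axioms.intro curvature_form_axioms)
    show "smooth_on (snd c ` N) (\<lambda>z. p1 (chart_inv c z))"
      by (rule smooth_fun_chartD[OF p1(1) c_mem]) (use N_dom in auto)
    show "B (p1 (chart_inv c z)) (p1 (chart_inv c z)) = 0" "B (p1 (chart_inv c z)) p = 0" "B p p \<noteq> 0" for z
      using norm by auto
    show "blinfun_apply (form_in_chart A \<eta>' c u z) (p1 (chart_inv c z)) = 0" for u z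
      by (simp add: form_in_chart_def p1)
    fix z assume z: "z \<in> snd c ` N"
    show "fd (\<lambda>z. p1 (chart_inv c z)) z u = - blinfun_apply (form_in_chart A \<eta>' c u z) p" for u
      using p1(2) dder_chart_to_tangent[OF open_UNIV UNIV_I p1(1) c_mem] z N_fst by (auto simp: form_in_chart_def)
    show "blinfun_apply (form_in_chart A \<eta>' c u z) (y1 z) \<in> span {s1 z}" for u
      using line[OF z, of 1 0 u "Y z"] cs[OF z] by simp
    show "blinfun_apply (form_in_chart A \<eta>' c u z) (x2 z) \<in> span {s2 z}" for u
      using line[OF z, of 0 1 u "X z"] cs[OF z] by simp
    have XY: "X z \<noteq> 0" "Y z \<noteq> 0"
      using XY_independent[OF z, of 1 0] XY_independent[OF z, of 0 1] by auto
    show "blinfun_apply (form_in_chart A \<eta>' c (Y z) z) (y1 z) \<noteq> 0"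
    proof
      \<comment> \<open>In direction \<open>Y\<close> the potential kills \<open>x2\<close> in any
        case. It would then kill all derivatives of sections of \<open>f\<close>, and
        \<open>Y\<close> would lie in the kernel of \<open>q\<close>.\<close>
      assume "blinfun_apply (form_in_chart A \<eta>' c (Y z) z) (y1 z) = 0"
      then have "Y z = 0"
        using form_fd_s1[OF z, of "Y z"] form_fd_s2[OF z, of "Y z"] form_Y_x2[OF z]
        by (intro nd[OF z]) (metis add.right_neutral c_linear(5,6) scaleR_zero_right)
      then show False using XY by blast
    qed
    show "blinfun_apply (form_in_chart A \<eta>' c (X z) z) (x2 z) \<noteq> 0"
    proof
      assume "blinfun_apply (form_in_chart A \<eta>' c (X z) z) (x2 z) = 0"
      then have "X z = 0"
        using form_fd_s1[OF z, of "X z"] form_fd_s2[OF z, of "X z"] form_X_y1[OF z]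
        by (intro nd[OF z]) (metis add.right_neutral c_linear(5,6) scaleR_zero_right)
      then show False using XY by blast
    qed
  qed
  then show ?thesis using N by blast
qed

lemma special_imp_isothermic:
  assumes Om: "Omega_potential A B f \<eta>" and mid: "middle_potential A B f \<eta> \<eta>'"
    and cons: "conserved_polynomial A \<eta>' P 1" and P0: "\<And>x. poly_section P 1 0 x = p"
    and norm: "\<And>t x. B (poly_section P 1 t x) (poly_section P 1 t x) = C" and pp: "B p p \<noteq> 0"
  shows "isothermic_surface A B p (\<lambda>x. f x \<inter> perp B {p})"
proof -
  define p1 where "p1 = P 1"
  have P0': "P 0 x = p" for x using P0[of x] unfolding poly_section_1 by simp
  note p1 = conserved_polynomial_1[OF cons P0', folded p1_def]
  have n: "B (p + t *\<^sub>R p1 x) (p + t *\<^sub>R p1 x) = C" for t x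
    using norm[of t x] unfolding poly_section_1 P0' p1_def .
  \<comment> \<open>The values at \<open>t = 0, 1, -1\<close> separate the coefficients of the
    constant polynomial \<open>(p(t), p(t))\<close>.\<close>
  have "B p p = C" "B p p + 2 * B (p1 x) p + B (p1 x) (p1 x) = C" "B p p - 2 * B (p1 x) p + B (p1 x) (p1 x) = C" for x
    using n[of 0 x] n[of 1 x] n[of "-1" x] B_sym[of p "p1 x"] by (simp_all add: B_simps)
  then have null: "B (p1 x) (p1 x) = 0" "B (p1 x) p = 0" for x by (smt (verit))+
  have "one_form A \<eta>' \<and> closed_form A \<eta>'"
    using gauge_orbitD[of \<eta> \<eta>'] Om mid unfolding Omega_potential_def middle_potential_def by metis
  then have \<eta>': "one_form A \<eta>'" "closed_form A \<eta>'" by auto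
  \<comment> \<open>This pointwise choice need not be continuous; the wedge product
    \<open>\<tau>\<close> built from it is smooth because it does not depend on the choice.\<close>
  define n where "n x = (SOME n. n \<in> f x \<and> B n p = 1)" for x
  define \<tau> where "\<tau> x = wedge B (p1 x) (n x)" for x
  let ?\<Lambda> = "\<lambda>x. f x \<inter> perp B {p}"
  have "\<exists>N. open N \<and> x \<in> N \<and> smooth_fun A N \<tau> \<and> p1 x \<noteq> 0 \<and> f x \<inter> perp B {p} = span {p1 x} \<and>
     (\<forall>X. dder A p1 x X \<in> f x \<longrightarrow> X = 0) \<and>
     (\<exists>X. \<eta>' x X - dder A \<tau> x X \<noteq> 0) \<and>
     (\<forall>X. \<exists>m\<in>span (insert (p1 x) (range (dder A p1 x))). \<eta>' x X - dder A \<tau> x X = wedge B (p1 x) m)" for x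
  proof -
    let ?c = "chart_at A x"
    obtain N s1 s2 X Y where N: "x \<in> N" "curvature_chart A B f ?c N s1 s2 X Y"
     "middle_frame B (snd ?c ` N) (\<lambda>z. f (chart_inv ?c z)) s1 s2 X Y (\<lambda>z u. form_in_chart A \<eta>' ?c u z) p (\<lambda>z. p1 (chart_inv ?c z))"
      using middle_frame_exists[OF Om mid p1 null pp chart_at_mem chart_at_dom] by blast
    interpret curvature_chart A B f ?c N s1 s2 X Y by fact
    interpret M: middle_frame B "snd ?c ` N" "\<lambda>z. f (chart_inv ?c z)" s1 s2 X Y "\<lambda>z u. form_in_chart A \<eta>' ?c u z" p "\<lambda>z. p1 (chart_inv ?c z)"
      by fact
    let ?z = "snd ?c x"
    note zV = mem_V[OF N(1)]
    have \<tau>_eq: "M.\<tau> (snd ?c y) = \<tau> y" if y: "y \<in> N" for y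
    proof -
      have "(1 / M.u1 (snd ?c y)) *\<^sub>R s1 (snd ?c y) \<in> f y \<and> B ((1 / M.u1 (snd ?c y)) *\<^sub>R s1 (snd ?c y)) p = 1"
        using subspace_scale[OF f_subspace[OF y] s_mem(1)[OF mem_V[OF y], unfolded inv_c[OF y]]] M.u_nonzero(1)[OF mem_V[OF y]]
        by (auto simp: M.u1_def B_simps)
      then have "n y \<in> f y \<and> B (n y) p = 1" unfolding n_def by (rule someI)
      then show ?thesis using M.\<tau>_unique[OF mem_V[OF y], of "n y"] y by (simp add: \<tau>_def)
    qed
    have sm: "smooth_fun A N \<tau>"
      by (rule smooth_fun_cong[OF open_N smooth_fun_pull[OF c_mem open_N N_dom M.smooth_\<tau>] \<tau>_eq])
    have dp1: "dder A p1 x V = fd (\<lambda>z. p1 (chart_inv ?c z)) ?z (T x V)" for V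
      using dder_chart[OF open_UNIV UNIV_I p1(1) c_mem chart_at_dom] .
    have d\<tau>: "dder A \<tau> x V = fd M.\<tau> ?z (T x V)" for V
      using dder_cong[OF open_N N(1), of \<tau> "\<lambda>y. M.\<tau> (snd ?c y)" V] \<tau>_eq dder_pull[OF c_mem open_N N_dom M.smooth_\<tau> N(1), of V] by simp
    have e: "\<eta>' x V - dder A \<tau> x V = form_in_chart A \<eta>' ?c (T x V) ?z - fd M.\<tau> ?z (T x V)" for V
      unfolding d\<tau> using form_in_chart_tangent[OF c_mem chart_at_dom, of \<eta>' V] by simp
    have ct: "T x (chart_to_tangent A ?c x u) = u" for u using c_mem chart_at_dom by simp
    have "p1 x \<noteq> 0" "f x \<inter> perp B {p} = span {p1 x}"
      using M.p1_nonzero[OF zV] M.F_int_perp[OF zV] N(1) by auto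
    moreover have "V = 0" if "dder A p1 x V \<in> f x" for V
      using M.p1_immersed[OF zV, of "T x V"] that N(1) tangent_zero_iff[OF N(1)] unfolding dp1 by simp
    moreover have "\<eta>' x (chart_to_tangent A ?c x (Y ?z)) - dder A \<tau> x (chart_to_tangent A ?c x (Y ?z)) \<noteq> 0"
      unfolding e ct by (rule M.gauged_nonzero[OF zV])
    moreover have "\<exists>m\<in>span (insert (p1 x) (range (dder A p1 x))). \<eta>' x V - dder A \<tau> x V = wedge B (p1 x) m" for V
    proof -
      obtain m where m: "m \<in> span {p1 (chart_inv ?c ?z), fd (\<lambda>z. p1 (chart_inv ?c z)) ?z (X ?z), fd (\<lambda>z. p1 (chart_inv ?c z)) ?z (Y ?z)}"
        "form_in_chart A \<eta>' ?c (T x V) ?z - fd M.\<tau> ?z (T x V) = wedge B (p1 (chart_inv ?c ?z)) m"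
        using M.gauged_wedge[OF zV, of "T x V"] by blast
      have "fd (\<lambda>z. p1 (chart_inv ?c z)) ?z u \<in> range (dder A p1 x)" for u
        using dp1[of "chart_to_tangent A ?c x u"] unfolding ct by (metis rangeI)
      then have "span {p1 (chart_inv ?c ?z), fd (\<lambda>z. p1 (chart_inv ?c z)) ?z (X ?z), fd (\<lambda>z. p1 (chart_inv ?c z)) ?z (Y ?z)}
          \<subseteq> span (insert (p1 x) (range (dder A p1 x)))"
        using N(1) by (intro span_mono) auto
      then show ?thesis using m N(1) unfolding e by auto
    qed
    ultimately show ?thesis using open_N N(1) sm by blast
  qed
  note loc = this
  have sec: "section_at A ?\<Lambda> x p1" for x
    unfolding section_at_def
  proof (intro exI[of _ UNIV] conjI ballI)
    show "p1 y \<in> f y \<inter> perp B {p}" for y using loc[of y] by (metis singletonI span_base)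
  qed (auto simp: p1)
  have sm: "smooth_fun A UNIV \<tau>" by (rule smooth_fun_local) (use loc in blast)
  show ?thesis
    unfolding isothermic_surface_def
  proof (intro conjI allI impI exI[of _ "\<lambda>x X. \<eta>' x X - dder A \<tau> x X"])
    show "smooth_subbundle A UNIV 1 ?\<Lambda>"
      by (rule smooth_line_bundle[OF open_UNIV p1(1)]) (use loc in blast)+
    show "f x \<inter> perp B {p} \<subseteq> lightcone B \<inter> perp B {p}" for x
      using lie_grassmannianD(3)[OF f_lie] by (auto simp: lightcone_def)
    show "X = 0" if "\<forall>\<sigma>. section_at A ?\<Lambda> x \<sigma> \<longrightarrow> dder A \<sigma> x X \<in> f x \<inter> perp B {p}" for x X
      using that sec[of x] loc[of x] by blast
    show "one_form A (\<lambda>x X. \<eta>' x X - dder A \<tau> x X)" by (rule one_form_diff[OF \<eta>'(1) one_form_dder[OF sm]])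
    show "closed_form A (\<lambda>x X. \<eta>' x X - dder A \<tau> x X)"
      by (rule closed_form_diff[OF \<eta>'(1) one_form_dder[OF sm] \<eta>'(2) closed_form_dder[OF sm]])
    show "nonzero_form (\<lambda>x X. \<eta>' x X - dder A \<tau> x X)"
      unfolding nonzero_form_def
    proof
      fix C :: "'a set" assume "C \<in> components UNIV"
      then obtain x where "x \<in> C" using in_components_nonempty by blast
      moreover have "\<exists>X. \<eta>' x X - dder A \<tau> x X \<noteq> 0" using loc[of x] by blast
      ultimately show "\<exists>x\<in>C. \<exists>X. \<eta>' x X - dder A \<tau> x X \<noteq> 0" by blast
    qed
    show "\<eta>' x X - dder A \<tau> x X \<in> wedge_space B (f x \<inter> perp B {p}) (derived_bundle A ?\<Lambda> x)" for x X
    proof -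
      obtain m where m: "m \<in> span (insert (p1 x) (range (dder A p1 x)))" "\<eta>' x X - dder A \<tau> x X = wedge B (p1 x) m"
        using loc[of x] by blast
      have "span (insert (p1 x) (range (dder A p1 x))) \<subseteq> derived_bundle A ?\<Lambda> x"
      proof -
        have "p1 x \<in> {\<sigma> x |\<sigma>. section_at A ?\<Lambda> x \<sigma>}"
          "dder A p1 x X \<in> {dder A \<sigma> x X |\<sigma> X. section_at A ?\<Lambda> x \<sigma>}" for X
          using sec[of x] by blast+
        then show ?thesis unfolding derived_bundle_def by (intro span_mono) auto
      qed
      moreover have "p1 x \<in> f x \<inter> perp B {p}" using loc[of x] span_base[of "p1 x" "{p1 x}"] by auto
      ultimately show ?thesis unfolding m(2) using m(1) by (intro wedge_space_mem) auto
    qed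
  qed
qed

end

section \<open>From isothermic surfaces to conserved quantities\<close>

text \<open>Rescaling multiplies each derivative by a non-zero factor and adds a multiple of the
  section itself, which is invisible modulo \<open>F\<close>.\<close>

lemma (in curvature_frame) curvature_frame_scale:
  assumes g: "smooth_on V g1" "smooth_on V g2" "\<And>z. z \<in> V \<Longrightarrow> g1 z \<noteq> 0" "\<And>z. z \<in> V \<Longrightarrow> g2 z \<noteq> 0"
  shows "curvature_frame B V F (\<lambda>z. g1 z *\<^sub>R s1 z) (\<lambda>z. g2 z *\<^sub>R s2 z) X Y"
proof -
  have fds: "fd (\<lambda>z. g z *\<^sub>R s z) z u = g z *\<^sub>R fd s z u + fd g z u *\<^sub>R s z"
    if "smooth_on V g" "smooth_on V s" "z \<in> V" for g s z u
    using fd_scaleR[OF smooth_on_differentiable[OF that(1,3)] smooth_on_differentiable[OF that(2,3)]] .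
  have iff: "c *\<^sub>R v + k *\<^sub>R w \<in> F z \<longleftrightarrow> v \<in> F z" if "z \<in> V" "w \<in> F z" "c \<noteq> 0" for c z v k w
  proof
    assume "c *\<^sub>R v + k *\<^sub>R w \<in> F z"
    then have "(1 / c) *\<^sub>R (c *\<^sub>R v + k *\<^sub>R w - k *\<^sub>R w) \<in> F z"
      using that by (intro subspace_scale subspace_diff subspace_F)
    then show "v \<in> F z" using that(3) by simp
  qed (use that in \<open>intro subspace_add subspace_scale subspace_F\<close>)
  have sec: "local_section V (\<lambda>z. g z *\<^sub>R s z)" if "smooth_on V g" "local_section V s" for g s
    using that unfolding local_section_def by (auto intro: smooth_on_scaleR subspace_scale[OF subspace_F])
  show ?thesis
  proof (intro curvature_frame.intro lie_frame.intro lie_frame_axioms.intro curvature_frame_axioms.intro R42_axioms)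
    fix z u assume z: "z \<in> V"
    show "F z = span {g1 z *\<^sub>R s1 z, g2 z *\<^sub>R s2 z}"
    proof (rule span_pair_eq[OF subspace_F[OF z] dim_F[OF z]])
      show "g1 z *\<^sub>R s1 z \<in> F z" "g2 z *\<^sub>R s2 z \<in> F z" using subspace_scale[OF subspace_F] s_mem z by blast+
      show "k = 0 \<and> l = 0" if "k *\<^sub>R (g1 z *\<^sub>R s1 z) + l *\<^sub>R (g2 z *\<^sub>R s2 z) = 0" for k l
        using frame_independent[OF z, of "k * g1 z" "l * g2 z"] that g(3,4)[OF z] by simp
    qed
    show "fd (\<lambda>z. g1 z *\<^sub>R s1 z) z u \<in> perp B (F z)" "fd (\<lambda>z. g2 z *\<^sub>R s2 z) z u \<in> perp B (F z)"
      using section_fd_perp[OF sec[OF g(1) local_section_frame(1)] z] section_fd_perp[OF sec[OF g(2) local_section_frame(2)] z] .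
    show "fd (\<lambda>z. g1 z *\<^sub>R s1 z) z (X z) \<in> F z" "fd (\<lambda>z. g1 z *\<^sub>R s1 z) z (Y z) \<notin> F z"
      unfolding fds[OF g(1) smooth_s1 z] iff[OF z s_mem(1)[OF z] g(3)[OF z]] by (rule X1[OF z], rule Y1[OF z])
    show "fd (\<lambda>z. g2 z *\<^sub>R s2 z) z (Y z) \<in> F z" "fd (\<lambda>z. g2 z *\<^sub>R s2 z) z (X z) \<notin> F z"
      unfolding fds[OF g(2) smooth_s2 z] iff[OF z s_mem(2)[OF z] g(4)[OF z]] by (rule Y2[OF z], rule X2[OF z])
  qed (auto intro: smooth_on_scaleR g open_V smooth_s1 smooth_s2 smooth_X smooth_Y F_lie)
qed

text \<open>The spheres are scaled so that \<open>s1 + s2\<close> spans the isothermic line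
  \<open>\<Lambda>\<close>. The last assumption is what values in
  \<open>\<Lambda> \<and> \<Lambda>\<^sup>(\<^sup>1\<^sup>)\<close> amount to, because derivatives
  of sections of \<open>\<Lambda>\<close> lie in \<open>f\<^sup>\<bottom>\<close> and are orthogonal
  to \<open>p\<close>.\<close>

locale isothermic_frame = curvature_form B V F s1 s2 X Y \<Omega>
  for B :: "'v::euclidean_space \<Rightarrow> 'v \<Rightarrow> real" and V F s1 s2 X Y \<Omega> +
  fixes p :: 'v
  assumes s_p: "z \<in> V \<Longrightarrow> B (s1 z + s2 z) p = 0" and s1_p: "z \<in> V \<Longrightarrow> B (s1 z) p \<noteq> 0"
    and form_wedge: "z \<in> V \<Longrightarrow> \<exists>m\<in>perp B (F z). B m p = 0 \<and> \<Omega> z u = wedge B (s1 z + s2 z) m"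
begin

definition s where "s z = s1 z + s2 z"

lemma s_section: "local_section V s"
  unfolding s_def[abs_def] using local_section_comb[of 1 1] by simp

lemma s_F: "z \<in> V \<Longrightarrow> s z \<in> F z" using section_mem[OF s_section] .

lemma fd_s: assumes z: "z \<in> V" shows "fd s z u = fd s1 z u + fd s2 z u"
  unfolding s_def[abs_def]
  by (rule fd_add) (use smooth_on_differentiable[OF smooth_s1 z] smooth_on_differentiable[OF smooth_s2 z] in auto)

lemma c_s: "z \<in> V \<Longrightarrow> c1 z (s z) = 1" "z \<in> V \<Longrightarrow> c2 z (s z) = 1"
  by (auto simp: s_def c_linear)

lemma s_nonzero: "z \<in> V \<Longrightarrow> s z \<noteq> 0"
  using c_s(1)[of z] by (auto simp: c_linear)

text \<open>The products of \<open>s1\<close> and \<open>s2\<close> with \<open>p\<close> are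
  opposite and non-zero, so a combination orthogonal to \<open>p\<close> has equal
  coefficients.\<close>

lemma F_p: assumes z: "z \<in> V" and v: "v \<in> F z" "B v p = 0" shows "\<exists>k. v = k *\<^sub>R s z"
proof -
  obtain k l where kl: "v = k *\<^sub>R s1 z + l *\<^sub>R s2 z" using F_pair[OF z] v by blast
  have "B (s2 z) p = - B (s1 z) p" using s_p[OF z] by (simp add: B_simps)
  then have "(k - l) * B (s1 z) p = 0" using v(2) kl by (simp add: B_simps algebra_simps)
  then have "k = l" using s1_p[OF z] by simp
  then show ?thesis using kl by (auto simp: s_def scaleR_add_right)
qed

lemma fd_s_p: assumes z: "z \<in> V" shows "B (fd s z u) p = 0"
proof -
  have "fd (\<lambda>z. B (s z) p) z u = 0" by (rule fd_const_on[OF open_V z]) (use s_p in \<open>simp add: s_def\<close>)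
  then show ?thesis
    using fd_linear[OF bounded_linear_B_left smooth_on_differentiable[OF section_smooth[OF s_section] z], of p u] by simp
qed

lemma fd_s_x2: "z \<in> V \<Longrightarrow> B (fd s z u) (x2 z) = B (fd s2 z u) (x2 z)"
  and fd_s_y1: "z \<in> V \<Longrightarrow> B (fd s z u) (y1 z) = B (fd s1 z u) (y1 z)"
  using x2_orth y1_orth by (simp_all add: fd_s B_simps)

lemma fd_X_y1: "z \<in> V \<Longrightarrow> B (fd s1 z (X z)) (y1 z) = 0" and fd_Y_x2: "z \<in> V \<Longrightarrow> B (fd s2 z (Y z)) (x2 z) = 0"
  using X1 Y2 fd_s1_perp fd_s2_perp perpD by blast+

text \<open>The coefficients in \<open>\<Omega>(Y) = a s \<and> d\<^sub>Y s\<close> and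
  \<open>\<Omega>(X) = b s \<and> d\<^sub>X s\<close>, read off by evaluation on \<open>y1\<close>
  and \<open>x2\<close>; in this form they are visibly smooth.\<close>

definition a where "a z = - (c1 z (blinfun_apply (\<Omega> z (Y z)) (y1 z)) / B (y1 z) (y1 z))"
definition b where "b z = - (c1 z (blinfun_apply (\<Omega> z (X z)) (x2 z)) / B (x2 z) (x2 z))"

lemma smooth_b: "smooth_on V b"
  unfolding b_def
  by (intro smooth_on_minus smooth_on_divide smooth_c smooth_on_bilinear[OF bounded_bilinear_B] order_refl
      smooth_on_bilinear[OF bounded_bilinear_blinfun_apply] smooth_form_field smooth_x2 open_V smooth_X)
    (use x2_pos in force)

lemma smooth_a: "smooth_on V a"
  unfolding a_def
  by (intro smooth_on_minus smooth_on_divide smooth_c smooth_on_bilinear[OF bounded_bilinear_B] order_refl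
      smooth_on_bilinear[OF bounded_bilinear_blinfun_apply] smooth_form_field smooth_y1 open_V smooth_Y)
    (use y1_pos in force)

text \<open>Since \<open>\<Omega>\<close> in direction \<open>X\<close> kills \<open>y1\<close>, the
  vector \<open>m\<close> agrees with \<open>b d\<^sub>X s\<close> up to a vector of
  \<open>f\<close> orthogonal to \<open>p\<close>, that is, a multiple of \<open>s\<close>, which
  the wedge with \<open>s\<close> removes.\<close>

lemma form_X: assumes z: "z \<in> V" shows "\<Omega> z (X z) = b z *\<^sub>R wedge B (s z) (fd s z (X z))"
proof -
  obtain m where m: "m \<in> perp B (F z)" "B m p = 0" "\<Omega> z (X z) = wedge B (s z) m"
    using form_wedge[OF z] s_def by metis
  have o: "B (s z) (x2 z) = 0" "B (s z) (y1 z) = 0"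
    using s_F[OF z] fd_s1_perp[OF z] fd_s2_perp[OF z] perpD by blast+
  have "b z = B m (x2 z) / B (x2 z) (x2 z)" using m(3) o c_s[OF z] by (simp add: b_def c_linear)
  moreover have "B m (y1 z) = 0"
  proof -
    have "B m (y1 z) *\<^sub>R s z = 0" using form_X_y1[OF z] m(3) o by simp
    then show ?thesis using s_nonzero[OF z] by simp
  qed
  ultimately have bx: "B m (y1 z) = 0" "B m (x2 z) = b z * B (x2 z) (x2 z)" using x2_pos[OF z] by auto
  let ?w = "m - b z *\<^sub>R fd s z (X z)"
  have w: "?w \<in> perp B (F z)" by (intro subspace_diff subspace_scale subspace_perp m section_fd_perp[OF s_section z])
  have "B ?w (y1 z) = 0" "B ?w (x2 z) = 0"
    using bx fd_s_y1[OF z] fd_s_x2[OF z] fd_X_y1[OF z] by (auto simp: B_simps)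
  then have "?w \<in> F z" using frame_perp_expand[OF z w] by simp
  moreover have "B ?w p = 0" using m(2) fd_s_p[OF z] by (simp add: B_simps)
  ultimately obtain k where "?w = k *\<^sub>R s z" using F_p[OF z] by blast
  then have mk: "m = k *\<^sub>R s z + b z *\<^sub>R fd s z (X z)" by (simp add: diff_eq_eq)
  show ?thesis unfolding m(3) mk by (simp add: W_simps)
qed

lemma form_Y: assumes z: "z \<in> V" shows "\<Omega> z (Y z) = a z *\<^sub>R wedge B (s z) (fd s z (Y z))"
proof -
  obtain m where m: "m \<in> perp B (F z)" "B m p = 0" "\<Omega> z (Y z) = wedge B (s z) m"
    using form_wedge[OF z] s_def by metis
  have o: "B (s z) (x2 z) = 0" "B (s z) (y1 z) = 0"
    using s_F[OF z] fd_s1_perp[OF z] fd_s2_perp[OF z] perpD by blast+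
  have "a z = B m (y1 z) / B (y1 z) (y1 z)" using m(3) o c_s[OF z] by (simp add: a_def c_linear)
  moreover have "B m (x2 z) = 0"
  proof -
    have "B m (x2 z) *\<^sub>R s z = 0" using form_Y_x2[OF z] m(3) o by simp
    then show ?thesis using s_nonzero[OF z] by simp
  qed
  ultimately have bx: "B m (x2 z) = 0" "B m (y1 z) = a z * B (y1 z) (y1 z)" using y1_pos[OF z] by auto
  let ?w = "m - a z *\<^sub>R fd s z (Y z)"
  have w: "?w \<in> perp B (F z)" by (intro subspace_diff subspace_scale subspace_perp m section_fd_perp[OF s_section z])
  have "B ?w (y1 z) = 0" "B ?w (x2 z) = 0"
    using bx fd_s_y1[OF z] fd_s_x2[OF z] fd_Y_x2[OF z] by (auto simp: B_simps)
  then have "?w \<in> F z" using frame_perp_expand[OF z w] by simp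
  moreover have "B ?w p = 0" using m(2) fd_s_p[OF z] by (simp add: B_simps)
  ultimately obtain k where "?w = k *\<^sub>R s z" using F_p[OF z] by blast
  then have mk: "m = k *\<^sub>R s z + a z *\<^sub>R fd s z (Y z)" by (simp add: diff_eq_eq)
  show ?thesis unfolding m(3) mk by (simp add: W_simps)
qed

lemma form_Y_y1: assumes z: "z \<in> V" shows "blinfun_apply (\<Omega> z (Y z)) (y1 z) = (- a z * B (y1 z) (y1 z)) *\<^sub>R s z"
proof -
  have "B (s z) (y1 z) = 0" using s_F[OF z] fd_s1_perp[OF z] perpD by blast
  then show ?thesis unfolding form_Y[OF z] using fd_s_y1[OF z] by (simp add: blinfun.scaleR_left)
qed

lemma form_X_x2: assumes z: "z \<in> V" shows "blinfun_apply (\<Omega> z (X z)) (x2 z) = (- b z * B (x2 z) (x2 z)) *\<^sub>R s z"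
proof -
  have "B (s z) (x2 z) = 0" using s_F[OF z] fd_s2_perp[OF z] perpD by blast
  then show ?thesis unfolding form_X[OF z] using fd_s_x2[OF z] by (simp add: blinfun.scaleR_left)
qed

text \<open>The trace-free condition: apply \<open>d\<Omega>(X, Y) = 0\<close> to \<open>y\<^sub>1\<close> and reduce modulo \<open>s\<close>.\<close>

lemma a_eq: assumes z: "z \<in> V" shows "a z = - b z"
proof -
  let ?X = "X z" and ?Y = "Y z"
  \<comment> \<open>The factor in \<open>\<Omega>(v) y1 = \<phi> v s\<close>.\<close>
  define \<phi> where "\<phi> v y = - (\<theta>Y y v * (a y * B (y1 y) (y1 y)))" for v y
  have sm\<phi>: "smooth_on V (\<phi> v)" for v
    unfolding \<phi>_def
    by (intro smooth_on_minus smooth_on_mult smooth_\<theta> smooth_a smooth_on_bilinear[OF bounded_bilinear_B] smooth_y1 open_V)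
  have app: "blinfun_apply (\<Omega> y v) (y1 y) = \<phi> v y *\<^sub>R s y" if y: "y \<in> V" for v y
    using form_expand[OF y, of v] form_X_y1[OF y] form_Y_y1[OF y]
    by (simp add: blinfun.add_left blinfun.scaleR_left \<phi>_def)
  have d: "y1 differentiable at z" "s differentiable at z" "s1 differentiable at z" "s2 differentiable at z"
    using smooth_on_differentiable smooth_y1 smooth_s1 smooth_s2 section_smooth[OF s_section] z by blast+
  have main: "blinfun_apply (\<Omega> z v) (fd y1 z u) + blinfun_apply (fd (\<lambda>z. \<Omega> z v) z u) (y1 z) =
      \<phi> v z *\<^sub>R fd s z u + fd (\<phi> v) z u *\<^sub>R s z" for u v
  proof -
    have "fd (\<lambda>y. blinfun_apply (\<Omega> y v) (y1 y)) z u = fd (\<lambda>y. \<phi> v y *\<^sub>R s y) z u"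
      using fd_cong_open[OF open_V z app] by simp
    then show ?thesis
      using fd_bilinear[OF bounded_bilinear_blinfun_apply smooth_on_differentiable[OF smooth_form z] d(1)]
        fd_scaleR[OF smooth_on_differentiable[OF sm\<phi> z] d(2)] by simp
  qed
  have \<theta>: "\<theta>Y z ?Y = 1" "\<theta>Y z ?X = 0" using y1_pos[OF z] fd_X_y1[OF z] by (auto simp: \<theta>Y_def)
  have \<phi>z: "\<phi> ?Y z = - (a z * B (y1 z) (y1 z))" "\<phi> ?X z = 0" by (simp_all add: \<phi>_def \<theta>)
  have sw: "B (s z) (fd y1 z ?Y) = - B (y1 z) (y1 z)"
    using s1_fd_y1[OF z] by (simp add: s_def B_simps)
  have sx: "B (s z) (fd y1 z ?X) = 0"
  proof -
    have "fd (\<lambda>y. B (s y) (y1 y)) z ?X = 0"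
      by (rule fd_const_on[OF open_V z]) (use s_F fd_s1_perp perpD in blast)
    then show ?thesis
      using fd_bilinear[OF bounded_bilinear_B d(2,1), of ?X] fd_s_y1[OF z] fd_X_y1[OF z] by simp
  qed
  have main': "\<phi> v z *\<^sub>R fd s z u + fd (\<phi> v) z u *\<^sub>R s z - blinfun_apply (\<Omega> z v) (fd y1 z u) =
      blinfun_apply (fd (\<lambda>z. \<Omega> z v) z u) (y1 z)" for u v
    unfolding main[of v u, symmetric] by simp
  have "\<phi> ?Y z *\<^sub>R fd s z ?X + fd (\<phi> ?Y) z ?X *\<^sub>R s z - blinfun_apply (\<Omega> z ?Y) (fd y1 z ?X) =
     \<phi> ?X z *\<^sub>R fd s z ?Y + fd (\<phi> ?X) z ?Y *\<^sub>R s z - blinfun_apply (\<Omega> z ?X) (fd y1 z ?Y)"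
    unfolding main' by (rule arg_cong[OF closed_form[OF z]])
  \<comment> \<open>Pairing with \<open>x2\<close> drops the multiples of \<open>s\<close> and
    leaves only the coefficients of \<open>d\<^sub>X s\<close>.\<close>
  then have "B (\<phi> ?Y z *\<^sub>R fd s z ?X + fd (\<phi> ?Y) z ?X *\<^sub>R s z - blinfun_apply (\<Omega> z ?Y) (fd y1 z ?X)) (x2 z) =
     B (\<phi> ?X z *\<^sub>R fd s z ?Y + fd (\<phi> ?X) z ?Y *\<^sub>R s z - blinfun_apply (\<Omega> z ?X) (fd y1 z ?Y)) (x2 z)" by simp
  moreover have "B (s z) (x2 z) = 0" using s_F[OF z] fd_s2_perp[OF z] perpD by blast
  ultimately have "- (a z * B (y1 z) (y1 z)) * B (x2 z) (x2 z) = b z * B (y1 z) (y1 z) * B (x2 z) (x2 z)"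
    unfolding form_Y[OF z] form_X[OF z] using \<phi>z fd_s_x2[OF z] sw sx
    by (simp add: B_simps blinfun.scaleR_left)
  then have "(- a z) * (B (y1 z) (y1 z) * B (x2 z) (x2 z)) = b z * (B (y1 z) (y1 z) * B (x2 z) (x2 z))" by simp
  moreover have "B (y1 z) (y1 z) * B (x2 z) (x2 z) \<noteq> 0" using y1_pos[OF z] x2_pos[OF z] by simp
  ultimately have "- a z = b z" using mult_right_cancel by blast
  then show ?thesis by simp
qed

section \<open>The differential equation for the coefficient \<open>b\<close>\<close>

definition \<kappa> where
  "\<kappa> u z = \<theta>X z u *\<^sub>R wedge B (s z) (fd s z (X z)) - \<theta>Y z u *\<^sub>R wedge B (s z) (fd s z (Y z))"

lemma form_\<kappa>: "z \<in> V \<Longrightarrow> \<Omega> z u = b z *\<^sub>R \<kappa> u z"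
  using form_expand[of z u] form_X[of z] form_Y[of z] a_eq[of z] by (simp add: \<kappa>_def scaleR_diff_right mult.commute)

lemma smooth_\<kappa>: "smooth_on V (\<kappa> u)"
  unfolding \<kappa>_def
  by (intro smooth_on_diff smooth_on_scaleR smooth_\<theta> smooth_on_bilinear[OF bounded_bilinear_wedge]
      smooth_on_fd smooth_X smooth_Y section_smooth[OF s_section] open_V)

lemma \<kappa>_y1: assumes z: "z \<in> V" shows "blinfun_apply (\<kappa> u z) (y1 z) = (\<theta>Y z u * B (y1 z) (y1 z)) *\<^sub>R s z"
proof -
  have "B (s z) (y1 z) = 0" using s_F[OF z] fd_s1_perp[OF z] perpD by blast
  then show ?thesis unfolding \<kappa>_def using fd_s_y1[OF z] fd_X_y1[OF z] by (simp add: blinfun.scaleR_left blinfun.diff_left)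
qed

lemma \<kappa>_x2: assumes z: "z \<in> V" shows "blinfun_apply (\<kappa> u z) (x2 z) = (- \<theta>X z u * B (x2 z) (x2 z)) *\<^sub>R s z"
proof -
  have "B (s z) (x2 z) = 0" using s_F[OF z] fd_s2_perp[OF z] perpD by blast
  then show ?thesis unfolding \<kappa>_def using fd_s_x2[OF z] fd_Y_x2[OF z] by (simp add: blinfun.scaleR_left blinfun.diff_left)
qed

text \<open>\<open>R\<close> is \<open>d\<kappa>\<close> on the coordinate fields. Evaluated on
  \<open>y1\<close> and \<open>x2\<close>, the equation
  \<open>db \<and> \<kappa> = - b d\<kappa>\<close> becomes two linear equations for
  \<open>db\<close> with right-hand sides \<open>- b r1\<close> and \<open>- b r2\<close>. Their
  determinant is \<open>D\<close>, the value of \<open>\<theta>X \<and> \<theta>Y\<close> on the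
  coordinate fields, and Cramer's rule yields \<open>db = b \<rho>\<close>.\<close>

definition R where "R z = fd (\<kappa> (axis 2 1)) z (axis 1 1) - fd (\<kappa> (axis 1 1)) z (axis 2 1)"
definition r1 where "r1 z = c1 z (blinfun_apply (R z) (y1 z)) / B (y1 z) (y1 z)"
definition r2 where "r2 z = c1 z (blinfun_apply (R z) (x2 z)) / B (x2 z) (x2 z)"
definition D where "D z = \<theta>X z (axis 1 1) * \<theta>Y z (axis 2 1) - \<theta>X z (axis 2 1) * \<theta>Y z (axis 1 1)"
definition \<rho> where "\<rho> u z = - (r1 z * \<theta>X z u + r2 z * \<theta>Y z u) / D z"

lemma D_nonzero: assumes z: "z \<in> V" shows "D z \<noteq> 0"
proof
  assume D: "D z = 0"
  let ?e = "axis 1 1 :: real ^ 2" and ?f = "axis 2 1 :: real ^ 2"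
  have ind: "k = 0 \<and> l = 0" if "k *\<^sub>R ?e + l *\<^sub>R ?f = 0" for k l
  proof -
    have "(k *\<^sub>R ?e + l *\<^sub>R ?f) $ 1 = 0" "(k *\<^sub>R ?e + l *\<^sub>R ?f) $ 2 = 0" unfolding that by simp_all
    then show ?thesis by (simp add: axis_def)
  qed
  \<comment> \<open>Eliminates \<open>Y\<close>, respectively \<open>X\<close>, between the
    expansions of the two axes.\<close>
  have "\<theta>Y z ?f *\<^sub>R (\<theta>X z ?e *\<^sub>R X z + \<theta>Y z ?e *\<^sub>R Y z) + (- \<theta>Y z ?e) *\<^sub>R (\<theta>X z ?f *\<^sub>R X z + \<theta>Y z ?f *\<^sub>R Y z) = D z *\<^sub>R X z"
    "\<theta>X z ?f *\<^sub>R (\<theta>X z ?e *\<^sub>R X z + \<theta>Y z ?e *\<^sub>R Y z) + (- \<theta>X z ?e) *\<^sub>R (\<theta>X z ?f *\<^sub>R X z + \<theta>Y z ?f *\<^sub>R Y z) = - D z *\<^sub>R Y z"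
    by (simp_all add: D_def algebra_simps)
  then have "\<theta>Y z ?f *\<^sub>R ?e + (- \<theta>Y z ?e) *\<^sub>R ?f = 0" "\<theta>X z ?f *\<^sub>R ?e + (- \<theta>X z ?e) *\<^sub>R ?f = 0"
    unfolding \<theta>_expand[OF z, symmetric] D by simp_all
  from ind[OF this(1)] ind[OF this(2)] have "\<theta>X z ?e = 0" "\<theta>Y z ?e = 0" by auto
  then have "?e = 0" using \<theta>_expand[OF z, of ?e] by simp
  then show False by (simp add: axis_eq_0_iff)
qed

lemma smooth_\<rho>: "smooth_on V (\<rho> u)"
proof -
  have R: "smooth_on V R" unfolding R_def by (intro smooth_on_diff smooth_on_fd_const smooth_\<kappa> open_V)
  have "smooth_on V r1" "smooth_on V r2"
    unfolding r1_def r2_def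
    by (intro smooth_on_divide smooth_c smooth_on_bilinear[OF bounded_bilinear_B] order_refl
        smooth_on_bilinear[OF bounded_bilinear_blinfun_apply] R smooth_y1 smooth_x2 open_V; use x2_pos y1_pos in force)+
  then show ?thesis unfolding \<rho>_def D_def
    by (intro smooth_on_divide smooth_on_minus smooth_on_add smooth_on_diff smooth_on_mult smooth_\<theta> open_V)
      (use D_nonzero in \<open>auto simp: D_def\<close>)
qed

text \<open>Closedness of \<open>b \<kappa>\<close> is a total differential system for \<open>b\<close>.\<close>

lemma fd_b:
  assumes z: "z \<in> V"
  shows "fd b z u = b z * (u $ 1 * \<rho> (axis 1 1) z + u $ 2 * \<rho> (axis 2 1) z)"
proof -
  let ?e = "axis 1 1 :: real ^ 2" and ?f = "axis 2 1 :: real ^ 2"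
  have db: "b differentiable at z" using smooth_on_differentiable[OF smooth_b z] .
  have f\<Omega>: "fd (\<lambda>z. \<Omega> z v) z w = b z *\<^sub>R fd (\<kappa> v) z w + fd b z w *\<^sub>R \<kappa> v z" for v w
    using fd_cong_open[OF open_V z form_\<kappa>] fd_scaleR[OF db smooth_on_differentiable[OF smooth_\<kappa> z]] by simp
  have cl: "fd b z ?e *\<^sub>R \<kappa> ?f z - fd b z ?f *\<^sub>R \<kappa> ?e z = - b z *\<^sub>R R z"
    using closed_form[OF z, of ?f ?e] unfolding f\<Omega> by (simp add: R_def algebra_simps)
  have "c1 z (blinfun_apply (fd b z ?e *\<^sub>R \<kappa> ?f z - fd b z ?f *\<^sub>R \<kappa> ?e z) v) = - b z * c1 z (blinfun_apply (R z) v)" for v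
    unfolding cl by (simp add: blinfun.scaleR_left blinfun.minus_left c_linear)
  from this[of "y1 z"] this[of "x2 z"]
  have "(fd b z ?e * \<theta>Y z ?f - fd b z ?f * \<theta>Y z ?e) * B (y1 z) (y1 z) = - b z * c1 z (blinfun_apply (R z) (y1 z))"
    "(fd b z ?f * \<theta>X z ?e - fd b z ?e * \<theta>X z ?f) * B (x2 z) (x2 z) = - b z * c1 z (blinfun_apply (R z) (x2 z))"
    by (simp_all add: blinfun.diff_left blinfun.scaleR_left \<kappa>_y1[OF z] \<kappa>_x2[OF z] c_linear c_s[OF z] algebra_simps)
  then have 1: "fd b z ?e * \<theta>Y z ?f - fd b z ?f * \<theta>Y z ?e = - b z * r1 z"
    and 2: "fd b z ?f * \<theta>X z ?e - fd b z ?e * \<theta>X z ?f = - b z * r2 z"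
    using y1_pos[OF z] x2_pos[OF z] by (simp_all add: r1_def r2_def field_simps)
  have "fd b z ?e * D z = (fd b z ?e * \<theta>Y z ?f - fd b z ?f * \<theta>Y z ?e) * \<theta>X z ?e + (fd b z ?f * \<theta>X z ?e - fd b z ?e * \<theta>X z ?f) * \<theta>Y z ?e"
    "fd b z ?f * D z = (fd b z ?e * \<theta>Y z ?f - fd b z ?f * \<theta>Y z ?e) * \<theta>X z ?f + (fd b z ?f * \<theta>X z ?e - fd b z ?e * \<theta>X z ?f) * \<theta>Y z ?f"
    by (simp_all add: D_def algebra_simps)
  then have "fd b z ?e = b z * \<rho> ?e z" "fd b z ?f = b z * \<rho> ?f z"
    unfolding 1 2 \<rho>_def using D_nonzero[OF z] by (simp_all add: field_simps)
  then show ?thesis using linear_real2[OF linear_frechet_derivative[OF db], of u] by (simp add: algebra_simps)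
qed

text \<open>On a small ball continuity bounds the coefficients \<open>\<rho>\<close> by their size
  at \<open>z\<close> plus one, so \<open>gronwall_ball\<close> applies to \<open>b\<close>.\<close>

lemma b_zero_open:
  assumes z: "z \<in> V" and "b z = 0"
  shows "\<exists>e>0. ball z e \<subseteq> V \<and> (\<forall>y\<in>ball z e. b y = 0)"
proof -
  define h where "h y = \<bar>\<rho> (axis 1 1) y\<bar> + \<bar>\<rho> (axis 2 1) y\<bar>" for y
  have cont: "continuous_on V h"
    unfolding h_def by (intro continuous_on_add continuous_on_rabs smooth_on_continuous smooth_\<rho>)
  have "open (V \<inter> h -` {..< h z + 1})" by (rule continuous_open_preimage[OF cont open_V]) simp
  moreover have "z \<in> V \<inter> h -` {..< h z + 1}" using z by simp
  ultimately obtain e where e: "e > 0" "ball z e \<subseteq> V \<inter> h -` {..< h z + 1}"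
    using open_contains_ball by metis
  have bound: "\<bar>fd b y u\<bar> \<le> (h z + 1) * norm u * \<bar>b y\<bar>" if y: "y \<in> ball z e" for y u
  proof -
    have yV: "y \<in> V" and hy: "h y \<le> h z + 1" using e(2) y by auto
    have "\<bar>u $ 1 * \<rho> (axis 1 1) y + u $ 2 * \<rho> (axis 2 1) y\<bar> \<le> \<bar>u $ 1\<bar> * \<bar>\<rho> (axis 1 1) y\<bar> + \<bar>u $ 2\<bar> * \<bar>\<rho> (axis 2 1) y\<bar>"
      using abs_triangle_ineq by (metis abs_mult)
    also have "\<dots> \<le> norm u * \<bar>\<rho> (axis 1 1) y\<bar> + norm u * \<bar>\<rho> (axis 2 1) y\<bar>"
      by (intro add_mono mult_right_mono component_le_norm_cart) auto
    also have "\<dots> = h y * norm u" by (simp add: h_def algebra_simps)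
    also have "\<dots> \<le> (h z + 1) * norm u" using hy by (intro mult_right_mono) auto
    finally have "\<bar>b y\<bar> * \<bar>u $ 1 * \<rho> (axis 1 1) y + u $ 2 * \<rho> (axis 2 1) y\<bar> \<le> \<bar>b y\<bar> * ((h z + 1) * norm u)"
      by (intro mult_left_mono) auto
    then show ?thesis unfolding fd_b[OF yV] abs_mult by (simp add: mult.commute mult.left_commute)
  qed
  have "b y = 0" if "y \<in> ball z e" for y
  proof (rule gronwall_ball[where h = b and z = z and r = e and C = "h z + 1"])
    show "b differentiable at y" if "y \<in> ball z e" for y
      using smooth_on_differentiable[OF smooth_b, of y] e(2) that by blast
  qed (use bound assms(2) that in auto)
  then show ?thesis using e by blast
qed

lemma form_zero_iff: assumes z: "z \<in> V" shows "(\<forall>u. \<Omega> z u = 0) \<longleftrightarrow> b z = 0"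
proof
  assume "\<forall>u. \<Omega> z u = 0"
  then have "(b z * B (x2 z) (x2 z)) *\<^sub>R s z = 0" using form_X_x2[OF z] by simp
  moreover have "s z \<noteq> 0" using c_s[OF z] by (auto simp: c_linear)
  ultimately show "b z = 0" using x2_pos[OF z] by simp
qed (simp add: form_\<kappa>[OF z])

lemma form_fd_s:
  assumes z: "z \<in> V"
  shows "blinfun_apply (\<Omega> z u) (fd s1 z w) = (b z * B (y1 z) (y1 z) * \<theta>Y z u * \<theta>Y z w) *\<^sub>R s z"
    "blinfun_apply (\<Omega> z u) (fd s2 z w) = - (b z * B (x2 z) (x2 z) * \<theta>X z u * \<theta>X z w) *\<^sub>R s z"
proof -
  show "blinfun_apply (\<Omega> z u) (fd s1 z w) = (b z * B (y1 z) (y1 z) * \<theta>Y z u * \<theta>Y z w) *\<^sub>R s z"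
    using form_fd_s1[OF z, of u w] \<kappa>_y1[OF z, of u] unfolding form_\<kappa>[OF z]
    by (simp add: blinfun.scaleR_left mult.commute mult.left_commute)
  show "blinfun_apply (\<Omega> z u) (fd s2 z w) = - (b z * B (x2 z) (x2 z) * \<theta>X z u * \<theta>X z w) *\<^sub>R s z"
    using form_fd_s2[OF z, of u w] \<kappa>_x2[OF z, of u] unfolding form_\<kappa>[OF z]
    by (simp add: blinfun.scaleR_left mult.commute mult.left_commute)
qed

definition \<tau> where "\<tau> z = b z *\<^sub>R wedge B (s1 z) (s2 z)"

lemma smooth_\<tau>: "smooth_on V \<tau>"
  unfolding \<tau>_def by (intro smooth_on_scaleR smooth_on_bilinear[OF bounded_bilinear_wedge] smooth_b smooth_s1 smooth_s2 open_V)

lemma \<tau>_mem: "z \<in> V \<Longrightarrow> \<tau> z \<in> wedge_space B (F z) (F z)"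
  unfolding \<tau>_def using subspace_scale[OF subspace_wedge_space] wedge_space_mem s_mem by blast

text \<open>The terms \<open>s1 \<and> x2\<close> and \<open>s2 \<and> y1\<close> of
  \<open>b \<kappa>\<close> cancel against those of \<open>d\<tau>\<close>. Up to
  \<open>\<and>\<^sup>2f\<close>, what remains lies in the wedge squares of the two osculating
  spaces, which is the middle condition.\<close>

lemma gauged_expand:
  assumes z: "z \<in> V"
  shows "\<exists>c\<in>wedge_space B (F z) (F z). \<Omega> z u - fd \<tau> z u =
    (- (b z * \<theta>Y z u)) *\<^sub>R wedge B (s1 z) (y1 z) + (b z * \<theta>X z u) *\<^sub>R wedge B (s2 z) (x2 z) + c"
proof -
  have d: "s1 differentiable at z" "s2 differentiable at z" "b differentiable at z"
    using smooth_on_differentiable smooth_s1 smooth_s2 smooth_b z by blast+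
  have dw: "(\<lambda>z. wedge B (s1 z) (s2 z)) differentiable at z"
    by (rule smooth_on_differentiable[OF smooth_on_bilinear[OF bounded_bilinear_wedge open_V smooth_s1 smooth_s2] z])
  have f\<tau>: "fd \<tau> z u = b z *\<^sub>R (wedge B (s1 z) (fd s2 z u) + wedge B (fd s1 z u) (s2 z)) + fd b z u *\<^sub>R wedge B (s1 z) (s2 z)"
    unfolding \<tau>_def[abs_def] using fd_scaleR[OF d(3) dw] fd_bilinear[OF bounded_bilinear_wedge d(1,2)] by simp
  define e1 e2 where "e1 = fd s1 z u - \<theta>Y z u *\<^sub>R y1 z" and "e2 = fd s2 z u - \<theta>X z u *\<^sub>R x2 z"
  have e: "e1 \<in> F z" "e2 \<in> F z" "fd s1 z u = \<theta>Y z u *\<^sub>R y1 z + e1" "fd s2 z u = \<theta>X z u *\<^sub>R x2 z + e2"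
    using fd_s1_expand[OF z, of u] fd_s2_expand[OF z, of u] by (simp_all add: e1_def e2_def \<theta>X_def \<theta>Y_def)
  define k1 k2 where "k1 = fd s1 z (X z)" and "k2 = fd s2 z (Y z)"
  have k: "k1 \<in> F z" "k2 \<in> F z" "fd s z (X z) = k1 + x2 z" "fd s z (Y z) = y1 z + k2"
    using X1[OF z] Y2[OF z] by (simp_all add: k1_def k2_def fd_s[OF z])
  let ?c = "b z *\<^sub>R (\<theta>X z u *\<^sub>R wedge B (s z) k1 - \<theta>Y z u *\<^sub>R wedge B (s z) k2 - wedge B (s1 z) e2 - wedge B e1 (s2 z))
     - fd b z u *\<^sub>R wedge B (s1 z) (s2 z)"
  have "?c \<in> wedge_space B (F z) (F z)"
    by (intro subspace_diff subspace_scale subspace_wedge_space wedge_space_mem e k s_F s_mem z)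
  moreover have "\<Omega> z u - fd \<tau> z u =
    (- (b z * \<theta>Y z u)) *\<^sub>R wedge B (s1 z) (y1 z) + (b z * \<theta>X z u) *\<^sub>R wedge B (s2 z) (x2 z) + ?c"
    unfolding f\<tau> form_\<kappa>[OF z] \<kappa>_def k(3,4) e(3,4)
    by (simp add: s_def W_simps wedge_skew[of "s2 z" "y1 z"] algebra_simps)
  ultimately show ?thesis by blast
qed

lemma \<tau>_p: assumes z: "z \<in> V" shows "blinfun_apply (\<tau> z) p = (b z * B (s1 z) p) *\<^sub>R s z"
proof -
  have "B (s2 z) p = - B (s1 z) p" using s_p[OF z] by (simp add: B_simps)
  then show ?thesis by (simp add: \<tau>_def s_def blinfun.scaleR_left algebra_simps)
qed

end

lemma signature_1_1:
  fixes q :: "real ^ 2 \<Rightarrow> real ^ 2 \<Rightarrow> real"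
  assumes ind: "\<And>k l. k *\<^sub>R a + l *\<^sub>R e = 0 \<Longrightarrow> k = 0 \<and> l = 0"
    and q: "q a e = 0" "q e a = 0" "q a a > 0" "q e e < 0"
  shows "has_signature q 1 1"
proof -
  have "independent {a, e}" by (rule independent_pair(3)) (rule ind)
  moreover have "span {a, e} = UNIV" using span_pair_eq[of UNIV a e] ind by simp
  moreover have "{x \<in> {a, e}. q x x > 0} = {a}" "{x \<in> {a, e}. q x x < 0} = {e}" using q by auto
  then have "card {x \<in> {a, e}. q x x > 0} = 1" "card {x \<in> {a, e}. q x x < 0} = 1" by simp_all
  moreover have "\<forall>x\<in>{a, e}. \<forall>y\<in>{a, e}. x \<noteq> y \<longrightarrow> q x y = 0" using q by auto
  ultimately show ?thesis unfolding has_signature_def by blast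
qed

lemma (in surface) dder_bounded_linear:
  assumes h: "bounded_linear h" and N: "open N" "x \<in> N" "smooth_fun A N g"
  shows "dder A (\<lambda>x. h (g x)) x X = h (dder A g x X)"
proof -
  let ?c = "chart_at A x"
  have d: "(\<lambda>z. g (chart_inv ?c z)) differentiable at (snd ?c x)"
    by (rule smooth_on_differentiable[OF smooth_fun_chartD[OF N(3) chart_at_mem order_refl]]) (use chart_at_dom N(2) in auto)
  show ?thesis using fd_linear[OF h d] by (simp add: dder_def o_def)
qed

lemma (in surface) smooth_fun_bounded_linear:
  assumes "bounded_linear h" "smooth_fun A UNIV g"
  shows "smooth_fun A UNIV (\<lambda>x. h (g x))"
  unfolding smooth_fun_def
proof
  fix c assume c: "c \<in> A"
  have "open (snd c ` (UNIV \<inter> fst c))" using chart_open_image[OF c open_UNIV] .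
  from smooth_on_linear[OF assms(1) this] assms(2) c
  show "smooth_on (snd c ` (UNIV \<inter> fst c)) ((\<lambda>x. h (g x)) \<circ> chart_inv c)" by (auto simp: smooth_fun_def o_def)
qed

context R42 begin

lemma wedge_space_line:
  assumes "\<omega> \<in> wedge_space B (span {v}) M" "subspace M"
  shows "\<exists>m\<in>M. \<omega> = wedge B v m"
proof -
  have "wedge_space B (span {v}) M \<subseteq> wedge B v ` M"
    unfolding wedge_space_def
  proof (rule span_minimal)
    show "{wedge B a b |a b. a \<in> span {v} \<and> b \<in> M} \<subseteq> wedge B v ` M"
    proof clarify
      fix a b assume "a \<in> span {v}" "b \<in> M"
      then obtain k where "a = k *\<^sub>R v" by (auto simp: span_singleton)
      then have "wedge B a b = wedge B v (k *\<^sub>R b)" by (simp add: W_simps)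
      then show "wedge B a b \<in> wedge B v ` M" using subspace_scale[OF assms(2) \<open>b \<in> M\<close>] by blast
    qed
    have "linear (wedge B v)" by (rule bounded_linear.linear[OF W.bounded_linear_right])
    then show "subspace (wedge B v ` M)" by (rule linear_subspace_image[OF _ assms(2)])
  qed
  then show ?thesis using assms(1) by blast
qed

text \<open>Either composite sends \<open>c\<close> to \<open>- (B m n * B v c)\<close> times
  \<open>v\<close>.\<close>

lemma wedge_commute:
  assumes "B v v = 0" "B v m = 0" "B v n = 0"
  shows "wedge B v m o\<^sub>L wedge B v n = wedge B v n o\<^sub>L wedge B v m"
  by (rule blinfun_eqI) (use assms B_sym[of m v] B_sym[of n v] B_sym[of n m] in \<open>simp add: B_simps algebra_simps\<close>)

end

context curvature_frame begin

lemma fd_s1_inner: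
  assumes z: "z \<in> V"
  shows "B (fd s1 z u) (fd s1 z w) = \<theta>Y z u * \<theta>Y z w * B (y1 z) (y1 z)"
proof -
  have "B (fd s1 z u - \<theta>Y z u *\<^sub>R y1 z) (fd s1 z w) = 0"
    using fd_s1_expand[OF z, of u] fd_s1_perp[OF z] perpD unfolding \<theta>Y_def by blast
  then show ?thesis using B_sym[of "y1 z" "fd s1 z w"] y1_pos[OF z] by (simp add: B_simps \<theta>Y_def)
qed

lemma fd_s2_inner:
  assumes z: "z \<in> V"
  shows "B (fd s2 z u) (fd s2 z w) = \<theta>X z u * \<theta>X z w * B (x2 z) (x2 z)"
proof -
  have "B (fd s2 z u - \<theta>X z u *\<^sub>R x2 z) (fd s2 z w) = 0"
    using fd_s2_expand[OF z, of u] fd_s2_perp[OF z] perpD unfolding \<theta>X_def by blast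
  then show ?thesis using B_sym[of "x2 z" "fd s2 z w"] x2_pos[OF z] by (simp add: B_simps \<theta>X_def)
qed

end

context curvature_chart begin

text \<open>Provides the vectors in which \<open>gauged_expand\<close> is written.\<close>

lemma osculating_mem:
  assumes y: "y \<in> N" and b1: "\<And>x. x \<in> N \<Longrightarrow> b1 x = span {s1 (snd c x)}" and b2: "\<And>x. x \<in> N \<Longrightarrow> b2 x = span {s2 (snd c x)}"
  shows "s1 (snd c y) \<in> second_osculating A b1 (\<lambda>x. curvature_space A f x (b2 x)) y"
    "y1 (snd c y) \<in> second_osculating A b1 (\<lambda>x. curvature_space A f x (b2 x)) y"
proof -
  interpret sw: curvature_chart A B f c N s2 s1 Y X by (rule swapped_chart)
  let ?\<sigma> = "\<lambda>x. s1 (snd c x)" and ?W = "\<lambda>x. chart_to_tangent A c x (Y (snd c x))"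
  have sec: "section_at A b1 y ?\<sigma>"
    unfolding section_at_def
    using open_N y smooth_fun_pull[OF c_mem open_N N_dom smooth_s1] b1 by (intro exI[of _ N]) (auto simp: span_base)
  have W: "vector_field_at A (\<lambda>x. curvature_space A f x (b2 x)) y ?W"
    by (rule sw.frame_vector_field[OF y b2])
  have "{?\<sigma> y, dder A ?\<sigma> y (?W y), dder A (\<lambda>x. dder A ?\<sigma> x (?W x)) y (?W y)} \<subseteq>
      second_osculating A b1 (\<lambda>x. curvature_space A f x (b2 x)) y"
    unfolding second_osculating_def using sec W by (intro order_trans[OF _ span_superset]) blast
  moreover have "dder A ?\<sigma> y (?W y) = y1 (snd c y)"
    using dder_pull[OF c_mem open_N N_dom smooth_s1 y] c_mem N_fst[OF y] by simp
  ultimately show "s1 (snd c y) \<in> second_osculating A b1 (\<lambda>x. curvature_space A f x (b2 x)) y"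
    "y1 (snd c y) \<in> second_osculating A b1 (\<lambda>x. curvature_space A f x (b2 x)) y" by auto
qed

end

section \<open>The isothermic line bundle inside \<open>f\<close>\<close>

context legendre_surface begin

context
  fixes p :: 'v and \<Lambda> :: "'a \<Rightarrow> 'v set"
  assumes \<Lambda>: "\<And>x. \<Lambda> x = f x \<inter> perp B {p}"
    and line: "\<And>x. dim (\<Lambda> x) = 1"
    and immersed: "\<forall>x X. (\<forall>\<sigma>. section_at A \<Lambda> x \<sigma> \<longrightarrow> dder A \<sigma> x X \<in> \<Lambda> x) \<longrightarrow> X = 0"
begin

lemma section_line:
  assumes "section_at A \<Lambda> x \<sigma>"
  shows "section_at A f x \<sigma>" "B (\<sigma> x) p = 0" "B (dder A \<sigma> x X) p = 0"
proof -
  obtain N where N: "open N" "x \<in> N" "smooth_fun A N \<sigma>" "\<And>y. y \<in> N \<Longrightarrow> \<sigma> y \<in> \<Lambda> y"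
    using assms unfolding section_at_def by blast
  have "\<sigma> y \<in> f y" if "y \<in> N" for y using N(4)[OF that] by (simp add: \<Lambda>)
  then show "section_at A f x \<sigma>" unfolding section_at_def using N(1-3) by blast
  have 0: "B (\<sigma> y) p = 0" if "y \<in> N" for y using N(4)[OF that] B_sym[of p "\<sigma> y"] by (simp add: \<Lambda> perp_def)
  then show "B (\<sigma> x) p = 0" using N by blast
  have "B (dder A \<sigma> x X) p = dder A (\<lambda>x. B (\<sigma> x) p) x X"
    using dder_bounded_linear[OF bounded_linear_B_left N(1-3)] by simp
  also have "\<dots> = dder A (\<lambda>x. 0 :: real) x X" by (rule dder_cong[OF N(1,2) 0])
  also have "\<dots> = 0" by (simp add: dder_def o_def)
  finally show "B (dder A \<sigma> x X) p = 0" .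
qed

lemma derived_line: "derived_bundle A \<Lambda> x \<subseteq> perp B (f x) \<inter> {v. B v p = 0}"
  unfolding derived_bundle_def
proof (rule span_minimal)
  show "subspace (perp B (f x) \<inter> {v. B v p = 0})"
    by (intro subspace_inter subspace_perp) (auto simp: subspace_def B_simps)
  have "\<sigma> x \<in> perp B (f x)" "dder A \<sigma> x X \<in> perp B (f x)" if \<sigma>: "section_at A f x \<sigma>" for \<sigma> X
  proof -
    have "\<sigma> x \<in> f x" using \<sigma> unfolding section_at_def by blast
    then show "\<sigma> x \<in> perp B (f x)" using subset_perp[OF f_lie] by blast
    have "dder A \<sigma> x X \<in> derived_bundle A f x" unfolding derived_bundle_def using \<sigma> by (intro span_base) blast
    then show "dder A \<sigma> x X \<in> perp B (f x)" using legendre unfolding legendre_map_def by blast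
  qed
  then show "{\<sigma> x |\<sigma>. section_at A \<Lambda> x \<sigma>} \<union> {dder A \<sigma> x X |\<sigma> X. section_at A \<Lambda> x \<sigma>} \<subseteq> perp B (f x) \<inter> {v. B v p = 0}"
    using section_line by auto
qed

text \<open>Otherwise \<open>\<Lambda>\<close> would be the sphere \<open>s1\<close> at
  \<open>y\<close>, and the derivative along \<open>X\<close> of any section of
  \<open>\<Lambda>\<close> would lie in \<open>f\<close> and be orthogonal to \<open>p\<close>,
  hence lie in \<open>\<Lambda>\<close>, against immersedness.\<close>

lemma sphere_not_perp:
  assumes fr: "curvature_chart A B f c N s1 s2 X Y" and y: "y \<in> N"
  shows "B (s1 (snd c y)) p \<noteq> 0"
proof
  interpret curvature_chart A B f c N s1 s2 X Y by fact
  let ?z = "snd c y"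
  assume 0: "B (s1 ?z) p = 0"
  have sf: "s1 ?z \<in> f y" using s_mem(1)[OF mem_V[OF y]] y by simp
  then have "s1 ?z \<in> \<Lambda> y" using 0 by (simp add: \<Lambda> perp_def B_sym)
  moreover have "s1 ?z \<noteq> 0" using frame_independent[OF mem_V[OF y], of 1 0] by auto
  moreover have "subspace (\<Lambda> y)" unfolding \<Lambda> by (intro subspace_inter f_subspace[OF y] subspace_perp)
  ultimately have L: "\<Lambda> y = span {s1 ?z}"
    using subspace_dim_equal[of "span {s1 ?z}" "\<Lambda> y"] line[of y] by (auto simp: dim_insert span_minimal)
  let ?X = "chart_to_tangent A c y (X ?z)"
  have TX: "T y ?X = X ?z" using c_mem N_fst[OF y] by simp
  have "dder A \<sigma> y ?X \<in> \<Lambda> y" if \<sigma>: "section_at A \<Lambda> y \<sigma>" for \<sigma>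
  proof -
    have "\<sigma> y \<in> \<Lambda> y" using \<sigma> unfolding section_at_def by blast
    then have "c2 ?z (\<sigma> y) = 0" using y by (auto simp: L span_singleton c_linear)
    then have "dder A \<sigma> y ?X - c1 ?z (\<sigma> y) *\<^sub>R fd s1 ?z (X ?z) \<in> f y"
      using dder_section[OF section_line(1)[OF \<sigma>] y, of ?X] TX by simp
    moreover have "fd s1 ?z (X ?z) \<in> f y" using X1[OF mem_V[OF y]] y by simp
    then have "c1 ?z (\<sigma> y) *\<^sub>R fd s1 ?z (X ?z) \<in> f y" by (rule subspace_scale[OF f_subspace[OF y]])
    ultimately have "dder A \<sigma> y ?X \<in> f y" using subspace_add[OF f_subspace[OF y]] by fastforce
    then show ?thesis using section_line(3)[OF \<sigma>, of ?X] by (simp add: \<Lambda> perp_def B_sym)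
  qed
  then have "?X = 0" using immersed by blast
  then have "X ?z = 0" using TX tangent_zero_iff[OF y, of ?X] by simp
  then show False using XY_independent[OF mem_V[OF y], of 1 0] by simp
qed

context
  fixes \<eta> :: "'a \<Rightarrow> real ^ 2 \<Rightarrow> 'v \<Rightarrow>\<^sub>L 'v"
  assumes one_form: "one_form A \<eta>" and closed: "closed_form A \<eta>"
    and form_value: "\<And>x X. \<eta> x X \<in> wedge_space B (\<Lambda> x) (derived_bundle A \<Lambda> x)"
begin

lemma line_nilpotent: "nilpotent_skew (f x) (\<eta> x X)"
proof (rule wedge_space_nilpotent[OF f_lie])
  have "wedge_space B (\<Lambda> x) (derived_bundle A \<Lambda> x) \<subseteq> wedge_space B (f x) (perp B (f x))"
    by (rule wedge_space_mono) (use derived_line[of x] in \<open>auto simp: \<Lambda>\<close>)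
  then show "\<eta> x X \<in> wedge_space B (f x) (perp B (f x))" using form_value by blast
qed

lemma isothermic_frame_exists:
  assumes fr: "curvature_chart A B f c N t1 t2 X Y"
  shows "\<exists>s1 s2. curvature_chart A B f c N s1 s2 X Y \<and>
    isothermic_frame B (snd c ` N) (\<lambda>z. f (chart_inv c z)) s1 s2 X Y (\<lambda>z u. form_in_chart A \<eta> c u z) p \<and>
    (\<forall>z\<in>snd c ` N. span {s1 z} = span {t1 z} \<and> span {s2 z} = span {t2 z})"
proof -
  interpret t: curvature_chart A B f c N t1 t2 X Y by fact
  \<comment> \<open>Each sphere will be scaled by the product belonging to the other, with one sign,
    so that \<open>s1\<close> and \<open>s2\<close> have opposite products with
    \<open>p\<close>.\<close>
  define u1 u2 where "u1 z = B (t1 z) p" and "u2 z = - B (t2 z) p" for z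
  have u: "u1 z \<noteq> 0" "u2 z \<noteq> 0" if "z \<in> snd c ` N" for z
    using sphere_not_perp[OF fr] sphere_not_perp[OF t.swapped_chart] that by (auto simp: u1_def u2_def)
  have smu: "smooth_on (snd c ` N) u1" "smooth_on (snd c ` N) u2"
    unfolding u1_def u2_def
    by (intro smooth_on_minus smooth_on_linear[OF bounded_linear_B_left] t.open_V t.smooth_s1 t.smooth_s2)+
  define s1 s2 where "s1 z = u2 z *\<^sub>R t1 z" and "s2 z = u1 z *\<^sub>R t2 z" for z
  have cf: "curvature_frame B (snd c ` N) (\<lambda>z. f (chart_inv c z)) s1 s2 X Y"
    unfolding s1_def[abs_def] s2_def[abs_def] by (rule t.curvature_frame_scale[OF smu(2,1) u(2,1)])
  have ch: "curvature_chart A B f c N s1 s2 X Y"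
    using cf t.c_mem t.open_N t.N_dom surface_axioms
    unfolding curvature_chart_def chart_frame_def chart_frame_axioms_def curvature_frame_def by blast
  interpret s: curvature_chart A B f c N s1 s2 X Y by (rule ch)
  interpret sf: curvature_form B "snd c ` N" "\<lambda>z. f (chart_inv c z)" s1 s2 X Y "\<lambda>z u. form_in_chart A \<eta> c u z"
    by (rule curvature_formI[OF ch one_form closed line_nilpotent])
  have "isothermic_frame B (snd c ` N) (\<lambda>z. f (chart_inv c z)) s1 s2 X Y (\<lambda>z u. form_in_chart A \<eta> c u z) p"
  proof (intro isothermic_frame.intro sf.curvature_form_axioms isothermic_frame_axioms.intro)
    fix z v assume z: "z \<in> snd c ` N"
    show sp: "B (s1 z + s2 z) p = 0" by (simp add: s1_def s2_def u1_def u2_def B_simps)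
    show "B (s1 z) p \<noteq> 0" using u[OF z] by (simp add: s1_def B_simps flip: u1_def)
    obtain y where y: "y \<in> N" "z = snd c y" using z by auto
    let ?s = "s1 z + s2 z"
    have sf: "?s \<in> f y" using subspace_add[OF s.f_subspace[OF y(1)]] s.s_mem[OF z] y by auto
    then have "?s \<in> \<Lambda> y" using sp by (simp add: \<Lambda> perp_def B_sym)
    moreover have "?s \<noteq> 0" using s.frame_independent[OF z, of 1 1] by auto
    moreover have "subspace (\<Lambda> y)" unfolding \<Lambda> by (intro subspace_inter s.f_subspace[OF y(1)] subspace_perp)
    ultimately have L: "\<Lambda> y = span {?s}"
      using subspace_dim_equal[of "span {?s}" "\<Lambda> y"] line[of y] by (auto simp: dim_insert span_minimal)
    have "subspace (derived_bundle A \<Lambda> y)" by (simp add: derived_bundle_def)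
    then obtain m where "m \<in> derived_bundle A \<Lambda> y" "form_in_chart A \<eta> c v z = wedge B ?s m"
      using wedge_space_line form_value L unfolding form_in_chart_def y(2) s.inv_c[OF y(1)] by metis
    then show "\<exists>m\<in>perp B (f (chart_inv c z)). B m p = 0 \<and> form_in_chart A \<eta> c v z = wedge B ?s m"
      using derived_line[of y] y by auto
  qed
  moreover have "span {s1 z} = span {t1 z}" "span {s2 z} = span {t2 z}" if "z \<in> snd c ` N" for z
    using span_image_scale[of "{t1 z}" "\<lambda>_. u2 z"] span_image_scale[of "{t2 z}" "\<lambda>_. u1 z"] u[OF that]
    by (auto simp: s1_def s2_def)
  ultimately show ?thesis using ch by blast
qed

text \<open>The zero set of \<open>\<eta>\<close> is open by uniqueness for linear differential systems, and closed.\<close>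

lemma form_nowhere_zero:
  assumes nz: "nonzero_form \<eta>"
  shows "\<exists>X. \<eta> x X \<noteq> 0"
proof (rule ccontr)
  assume neg: "\<not> ?thesis"
  define Z where "Z = {x. \<forall>X. \<eta> x X = 0}"
  have loc: "\<exists>M. open M \<and> y \<in> M \<and> (if y \<in> Z then M \<subseteq> Z else M \<subseteq> - Z)" for y
  proof -
    let ?c = "chart_at A y"
    obtain N t1 t2 X Y where t: "y \<in> N" "curvature_chart A B f ?c N t1 t2 X Y"
      using curvature_chart_at[OF chart_at_mem chart_at_dom] by blast
    obtain s1 s2 where s: "curvature_chart A B f ?c N s1 s2 X Y"
      "isothermic_frame B (snd ?c ` N) (\<lambda>z. f (chart_inv ?c z)) s1 s2 X Y (\<lambda>z u. form_in_chart A \<eta> ?c u z) p"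
      using isothermic_frame_exists[OF t(2)] by blast
    interpret curvature_chart A B f ?c N s1 s2 X Y by fact
    interpret I: isothermic_frame B "snd ?c ` N" "\<lambda>z. f (chart_inv ?c z)" s1 s2 X Y "\<lambda>z u. form_in_chart A \<eta> ?c u z" p by fact
    have Zb: "y' \<in> Z \<longleftrightarrow> I.b (snd ?c y') = 0" if y': "y' \<in> N" for y'
    proof -
      have "(\<forall>X. \<eta> y' X = 0) \<longleftrightarrow> (\<forall>u. form_in_chart A \<eta> ?c u (snd ?c y') = 0)"
        using form_in_chart_tangent[OF c_mem N_fst[OF y'], of \<eta>] y' by (auto simp: form_in_chart_def)
      then show ?thesis unfolding Z_def using I.form_zero_iff[OF mem_V[OF y']] by simp
    qed
    define W where "W = (if y \<in> Z then {z \<in> snd ?c ` N. I.b z = 0} else {z \<in> snd ?c ` N. I.b z \<noteq> 0})"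
    have "\<exists>V. open V \<and> snd ?c y \<in> V \<and> V \<subseteq> W"
    proof (cases "y \<in> Z")
      case True
      then have "I.b (snd ?c y) = 0" using Zb[OF t(1)] by blast
      then obtain e where "e > 0" "ball (snd ?c y) e \<subseteq> snd ?c ` N" "\<forall>z\<in>ball (snd ?c y) e. I.b z = 0"
        using I.b_zero_open[OF mem_V[OF t(1)]] by blast
      then show ?thesis using True by (intro exI[of _ "ball (snd ?c y) e"]) (auto simp: W_def)
    next
      case False
      have "open ((snd ?c ` N) \<inter> I.b -` (- {0}))"
        by (rule continuous_open_preimage[OF smooth_on_continuous[OF I.smooth_b] open_V]) auto
      moreover have "(snd ?c ` N) \<inter> I.b -` (- {0}) = W" using False by (auto simp: W_def)
      moreover have "snd ?c y \<in> W" using False t(1) Zb[OF t(1)] by (auto simp: W_def)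
      ultimately show ?thesis by auto
    qed
    then obtain V where V: "open V" "snd ?c y \<in> V" "V \<subseteq> W" by blast
    let ?M = "N \<inter> {x \<in> fst ?c. snd ?c x \<in> V}"
    have "open ?M" using open_N chart_open_preimage[OF c_mem V(1)] by blast
    moreover have "y \<in> ?M" using t(1) V(2) chart_at_dom by auto
    moreover have "if y \<in> Z then ?M \<subseteq> Z else ?M \<subseteq> - Z"
      using V(3) Zb by (auto simp: W_def split: if_splits)
    ultimately show ?thesis by blast
  qed
  have op: "open Z" "open (- Z)"
    unfolding open_subopen[of Z] open_subopen[of "- Z"] using loc by (metis ComplD)+
  define C where "C = connected_component_set UNIV x"
  have C: "C \<in> components UNIV" "x \<in> C" "connected C"
    by (auto simp: C_def components_def)
  have "Z \<inter> C = {} \<or> - Z \<inter> C = {}"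
    using connectedD[OF C(3) op] by blast
  moreover have "x \<in> Z" using neg by (simp add: Z_def)
  ultimately have "C \<subseteq> Z" using C(2) by blast
  then show False using nz C(1) unfolding nonzero_form_def Z_def by blast
qed

end

end

section \<open>Gluing the gauge transformation and the conserved quantity\<close>

lemma isothermic_imp_special:
  assumes iso: "isothermic_surface A B p (\<lambda>x. f x \<inter> perp B {p})"
  shows "\<exists>\<eta> \<eta>' P. Omega_potential A B f \<eta> \<and> middle_potential A B f \<eta> \<eta>' \<and> conserved_polynomial A \<eta>' P 1 \<and>
    (\<forall>x. poly_section P 1 0 x = p) \<and> (\<forall>t x. B (poly_section P 1 t x) (poly_section P 1 t x) = B p p)"
proof -
  define \<Lambda> where "\<Lambda> x = f x \<inter> perp B {p}" for x
  have iso': "isothermic_surface A B p \<Lambda>" using iso by (simp add: \<Lambda>_def[abs_def])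
  have line: "dim (\<Lambda> x) = 1" for x using iso' unfolding isothermic_surface_def smooth_subbundle_def by blast
  have imm: "\<forall>x X. (\<forall>\<sigma>. section_at A \<Lambda> x \<sigma> \<longrightarrow> dder A \<sigma> x X \<in> \<Lambda> x) \<longrightarrow> X = 0"
    using iso' unfolding isothermic_surface_def by blast
  obtain \<eta> where \<eta>: "one_form A \<eta>" "closed_form A \<eta>" "nonzero_form \<eta>"
    "\<And>x X. \<eta> x X \<in> wedge_space B (\<Lambda> x) (derived_bundle A \<Lambda> x)"
    using iso' unfolding isothermic_surface_def by blast
  note nil = line_nilpotent[OF \<Lambda>_def line imm \<eta>(1,2,4)]
  note frame = isothermic_frame_exists[OF \<Lambda>_def line imm \<eta>(1,2,4)]
  note nowhere = form_nowhere_zero[OF \<Lambda>_def line imm \<eta>(1,2,4) \<eta>(3)]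
  note derived = derived_line[OF \<Lambda>_def line imm]
  \<comment> \<open>\<open>gauge x t\<close> characterises \<open>t = b s\<^sub>1 \<and> s\<^sub>2\<close> for local curvature spheres with \<open>s\<^sub>1 + s\<^sub>2 \<in> \<Lambda>\<close> and
    \<open>\<eta>(X) = b (s\<^sub>1 + s\<^sub>2) \<and> d\<^sub>X(s\<^sub>1 + s\<^sub>2)\<close>, without reference to labels, scaling or charts.\<close>
  define gauge where "gauge x t \<longleftrightarrow> t \<in> wedge_space B (f x) (f x) \<and>
    (\<forall>l\<in>curvature_spheres A f x. \<forall>\<sigma>. section_at A f x \<sigma> \<and> \<sigma> x \<in> l \<longrightarrow>
      (\<forall>V W w. B (\<sigma> x) w *\<^sub>R blinfun_apply (\<eta> x V) (dder A \<sigma> x W) - B (dder A \<sigma> x V) (dder A \<sigma> x W) *\<^sub>R blinfun_apply t w \<in> l))" for x t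
  define \<tau> where "\<tau> x = (THE t. gauge x t)" for x
  have gauge_frame: "\<tau> y = isothermic_frame.\<tau> B s1 s2 X (\<lambda>z u. form_in_chart A \<eta> c u z) (snd c y)"
    if fr: "curvature_chart A B f c N s1 s2 X Y"
      and I: "isothermic_frame B (snd c ` N) (\<lambda>z. f (chart_inv c z)) s1 s2 X Y (\<lambda>z u. form_in_chart A \<eta> c u z) p"
      and y: "y \<in> N" for c N s1 s2 X Y y
  proof -
    interpret curvature_chart A B f c N s1 s2 X Y by (rule fr)
    interpret I: isothermic_frame B "snd c ` N" "\<lambda>z. f (chart_inv c z)" s1 s2 X Y "\<lambda>z u. form_in_chart A \<eta> c u z" p by (rule I)
    let ?z = "snd c y"
    note zV = mem_V[OF y]
    have fz: "f (chart_inv c ?z) = f y" using y by simp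
    have \<eta>T: "\<eta> y V = form_in_chart A \<eta> c (T y V) ?z" for V by (rule form_in_chart_tangent[OF c_mem N_fst[OF y]])
    have dd: "\<exists>e\<in>f y. dder A \<sigma> y V = c1 ?z (\<sigma> y) *\<^sub>R fd s1 ?z (T y V) + c2 ?z (\<sigma> y) *\<^sub>R fd s2 ?z (T y V) + e"
      if "section_at A f y \<sigma>" for \<sigma> V
      using dder_section[OF that y, of V] by (metis add.commute diff_add_cancel)
    have kill: "blinfun_apply (\<eta> y V) e = 0" if "e \<in> f y" for e V using nilpotent_skewD(2)[OF nil that] .
    have perp0: "B e (fd s1 ?z u) = 0" "B e (fd s2 ?z u) = 0" "B (fd s1 ?z u) e = 0" "B (fd s2 ?z u) e = 0" if "e \<in> f y" for e u
      using fd_s1_perp[OF zV, of u] fd_s2_perp[OF zV, of u] that perpD perpD' unfolding fz by blast+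
    have ff: "B e e' = 0" if "e \<in> f y" "e' \<in> f y" for e e' using lie_grassmannianD(3)[OF f_lie that] .
    have line1: "blinfun_apply (\<eta> y V) (dder A \<sigma> y W) = (k * I.b ?z * B (y1 ?z) (y1 ?z) * \<theta>Y ?z (T y V) * \<theta>Y ?z (T y W)) *\<^sub>R I.s ?z"
        "B (dder A \<sigma> y V) (dder A \<sigma> y W) = k * k * (\<theta>Y ?z (T y V) * \<theta>Y ?z (T y W) * B (y1 ?z) (y1 ?z))"
      if \<sigma>: "section_at A f y \<sigma>" "\<sigma> y = k *\<^sub>R s1 ?z" for \<sigma> k V W
    proof -
      have c: "c1 ?z (\<sigma> y) = k" "c2 ?z (\<sigma> y) = 0" using zV by (simp_all add: \<sigma>(2) c_linear)
      obtain e e' where e: "e \<in> f y" "dder A \<sigma> y V = k *\<^sub>R fd s1 ?z (T y V) + e" "e' \<in> f y" "dder A \<sigma> y W = k *\<^sub>R fd s1 ?z (T y W) + e'"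
        using dd[OF \<sigma>(1), of V] dd[OF \<sigma>(1), of W] unfolding c by auto
      show "blinfun_apply (\<eta> y V) (dder A \<sigma> y W) = (k * I.b ?z * B (y1 ?z) (y1 ?z) * \<theta>Y ?z (T y V) * \<theta>Y ?z (T y W)) *\<^sub>R I.s ?z"
        unfolding e(4) blinfun.add_right blinfun.scaleR_right kill[OF e(3)] unfolding \<eta>T I.form_fd_s(1)[OF zV] by (simp add: mult.assoc)
      show "B (dder A \<sigma> y V) (dder A \<sigma> y W) = k * k * (\<theta>Y ?z (T y V) * \<theta>Y ?z (T y W) * B (y1 ?z) (y1 ?z))"
        unfolding e(2,4) using perp0[OF e(1)] perp0[OF e(3)] ff[OF e(1,3)] by (simp add: B_simps fd_s1_inner[OF zV, of "T y V" "T y W"])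
    qed
    have line2: "blinfun_apply (\<eta> y V) (dder A \<sigma> y W) = - (k * I.b ?z * B (x2 ?z) (x2 ?z) * \<theta>X ?z (T y V) * \<theta>X ?z (T y W)) *\<^sub>R I.s ?z"
        "B (dder A \<sigma> y V) (dder A \<sigma> y W) = k * k * (\<theta>X ?z (T y V) * \<theta>X ?z (T y W) * B (x2 ?z) (x2 ?z))"
      if \<sigma>: "section_at A f y \<sigma>" "\<sigma> y = k *\<^sub>R s2 ?z" for \<sigma> k V W
    proof -
      have c: "c1 ?z (\<sigma> y) = 0" "c2 ?z (\<sigma> y) = k" using zV by (simp_all add: \<sigma>(2) c_linear)
      obtain e e' where e: "e \<in> f y" "dder A \<sigma> y V = k *\<^sub>R fd s2 ?z (T y V) + e" "e' \<in> f y" "dder A \<sigma> y W = k *\<^sub>R fd s2 ?z (T y W) + e'"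
        using dd[OF \<sigma>(1), of V] dd[OF \<sigma>(1), of W] unfolding c by auto
      show "blinfun_apply (\<eta> y V) (dder A \<sigma> y W) = - (k * I.b ?z * B (x2 ?z) (x2 ?z) * \<theta>X ?z (T y V) * \<theta>X ?z (T y W)) *\<^sub>R I.s ?z"
        unfolding e(4) blinfun.add_right blinfun.scaleR_right kill[OF e(3)] unfolding \<eta>T I.form_fd_s(2)[OF zV] by (simp add: mult.assoc)
      show "B (dder A \<sigma> y V) (dder A \<sigma> y W) = k * k * (\<theta>X ?z (T y V) * \<theta>X ?z (T y W) * B (x2 ?z) (x2 ?z))"
        unfolding e(2,4) using perp0[OF e(1)] perp0[OF e(3)] ff[OF e(1,3)] by (simp add: B_simps fd_s2_inner[OF zV, of "T y V" "T y W"])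
    qed
    have "gauge y (I.\<tau> ?z)"
      unfolding gauge_def
    proof (intro conjI ballI allI impI)
      show "I.\<tau> ?z \<in> wedge_space B (f y) (f y)" using I.\<tau>_mem[OF zV] unfolding fz .
      fix l \<sigma> V W w assume l: "l \<in> curvature_spheres A f y" and \<sigma>: "section_at A f y \<sigma> \<and> \<sigma> y \<in> l"
      let ?e = "B (\<sigma> y) w *\<^sub>R blinfun_apply (\<eta> y V) (dder A \<sigma> y W) - B (dder A \<sigma> y V) (dder A \<sigma> y W) *\<^sub>R blinfun_apply (I.\<tau> ?z) w"
      consider "l = span {s1 ?z}" | "l = span {s2 ?z}" using l curvature_spheres_frame[OF y] by blast
      then show "?e \<in> l"
      proof cases
        case 1
        then obtain k where k: "\<sigma> y = k *\<^sub>R s1 ?z" using \<sigma> by (auto simp: span_singleton)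
        \<comment> \<open>Both terms of \<open>?e\<close> are quadratic in the section, so its
          scaling only enters through \<open>k * k\<close>; the components along \<open>s2\<close>
          cancel because \<open>I.\<tau>\<close> carries the same coefficient \<open>b\<close> as
          the form.\<close>
        let ?K = "k * k * I.b ?z * (\<theta>Y ?z (T y V) * \<theta>Y ?z (T y W) * B (y1 ?z) (y1 ?z))"
        have "?e = (?K * (B (s1 ?z) w + B (s2 ?z) w)) *\<^sub>R s1 ?z"
          unfolding line1[OF conjunct1[OF \<sigma>] k] k
          by (simp add: I.s_def I.\<tau>_def B_simps blinfun.scaleR_left algebra_simps)
        then show ?thesis unfolding 1 by (simp add: span_base span_scale)
      next
        case 2
        then obtain k where k: "\<sigma> y = k *\<^sub>R s2 ?z" using \<sigma> by (auto simp: span_singleton)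
        let ?K = "k * k * I.b ?z * (\<theta>X ?z (T y V) * \<theta>X ?z (T y W) * B (x2 ?z) (x2 ?z))"
        have "?e = (- ?K * (B (s1 ?z) w + B (s2 ?z) w)) *\<^sub>R s2 ?z"
          unfolding line2[OF conjunct1[OF \<sigma>] k] k
          by (simp add: I.s_def I.\<tau>_def B_simps blinfun.scaleR_left algebra_simps)
        then show ?thesis unfolding 2 by (simp add: span_base span_scale span_neg)
      qed
    qed
    moreover have "t = I.\<tau> ?z" if t: "gauge y t" for t
    proof -
      have "t \<in> wedge_space B (span {s1 ?z, s2 ?z}) (span {s1 ?z, s2 ?z})"
        using t F_span[OF zV] unfolding gauge_def fz by simp
      then obtain k where k: "t = k *\<^sub>R wedge B (s1 ?z) (s2 ?z)" using wedge_space_pair by blast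
      have "s1 ?z \<noteq> 0" using frame_independent[OF zV, of 1 0] by auto
      \<comment> \<open>For uniqueness it is enough to test the section \<open>s1\<close> in the
        direction \<open>Y\<close> on a vector \<open>w\<close> dual to \<open>s1\<close>: the
        vanishing component along \<open>s2\<close> determines the coefficient.\<close>
      then obtain w where w: "B (s1 ?z) w = 1"
        using perp_exists[of "{0}" "s1 ?z"] by (auto simp: subspace_def)
      let ?\<sigma> = "\<lambda>x. 1 *\<^sub>R s1 (snd c x) + 0 *\<^sub>R s2 (snd c x)"
      let ?V = "chart_to_tangent A c y (Y ?z)"
      have \<sigma>: "section_at A f y ?\<sigma>" "?\<sigma> y = 1 *\<^sub>R s1 ?z" by (rule section_at_pull[OF y]) simp
      have TV: "\<theta>Y ?z (T y ?V) = 1" using c_mem N_fst[OF y] y1_pos[OF zV] by (simp add: \<theta>Y_def)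
      have "span {s1 ?z} \<in> curvature_spheres A f y" using curvature_spheres_frame[OF y] by blast
      moreover have "?\<sigma> y \<in> span {s1 ?z}" by (simp add: span_base)
      ultimately have "B (?\<sigma> y) w *\<^sub>R blinfun_apply (\<eta> y ?V) (dder A ?\<sigma> y ?V) - B (dder A ?\<sigma> y ?V) (dder A ?\<sigma> y ?V) *\<^sub>R blinfun_apply t w \<in> span {s1 ?z}"
        using t \<sigma>(1) unfolding gauge_def by blast
      then obtain r where "B (?\<sigma> y) w *\<^sub>R blinfun_apply (\<eta> y ?V) (dder A ?\<sigma> y ?V) - B (dder A ?\<sigma> y ?V) (dder A ?\<sigma> y ?V) *\<^sub>R blinfun_apply t w = r *\<^sub>R s1 ?z"
        by (auto simp: span_singleton)
      then have "(I.b ?z * B (y1 ?z) (y1 ?z)) *\<^sub>R I.s ?z - (B (y1 ?z) (y1 ?z) * k) *\<^sub>R (s2 ?z - B (s2 ?z) w *\<^sub>R s1 ?z) = r *\<^sub>R s1 ?z"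
        unfolding line1[OF \<sigma>] unfolding \<sigma>(2) TV k by (simp add: w blinfun.scaleR_left)
      then have "c2 ?z ((I.b ?z * B (y1 ?z) (y1 ?z)) *\<^sub>R I.s ?z - (B (y1 ?z) (y1 ?z) * k) *\<^sub>R (s2 ?z - B (s2 ?z) w *\<^sub>R s1 ?z)) = 0"
        using zV by (simp add: c_linear)
      then have "I.b ?z = k" using zV I.c_s[OF zV] y1_pos[OF zV] by (simp add: c_linear)
      then show ?thesis by (simp add: k I.\<tau>_def)
    qed
    ultimately show ?thesis unfolding \<tau>_def by (rule the_equality)
  qed
  have fr_at: "\<exists>U b1 b2 N s1 s2 X Y. curvature_sphere_bundles A f U b1 b2 \<and> x \<in> U \<and> x \<in> N \<and>
      curvature_chart A B f (chart_at A x) N s1 s2 X Y \<and>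
      isothermic_frame B (snd (chart_at A x) ` N) (\<lambda>z. f (chart_inv (chart_at A x) z)) s1 s2 X Y (\<lambda>z u. form_in_chart A \<eta> (chart_at A x) u z) p \<and>
      (\<forall>y\<in>N. b1 y = span {s1 (snd (chart_at A x) y)} \<and> b2 y = span {s2 (snd (chart_at A x) y)})" for x
  proof -
    obtain U b1 b2 where U: "curvature_sphere_bundles A f U b1 b2" "x \<in> U" using curvature_sphere_bundles_exist by blast
    obtain N t1 t2 X Y where t: "x \<in> N" "curvature_chart A B f (chart_at A x) N t1 t2 X Y"
      "\<And>y. y \<in> N \<Longrightarrow> b1 y = span {t1 (snd (chart_at A x) y)} \<and> b2 y = span {t2 (snd (chart_at A x) y)}"
      using bundle_chart[OF U chart_at_mem chart_at_dom] by blast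
    from frame[OF t(2)] obtain s1 s2 where "curvature_chart A B f (chart_at A x) N s1 s2 X Y"
      "isothermic_frame B (snd (chart_at A x) ` N) (\<lambda>z. f (chart_inv (chart_at A x) z)) s1 s2 X Y (\<lambda>z u. form_in_chart A \<eta> (chart_at A x) u z) p"
      "\<forall>z\<in>snd (chart_at A x) ` N. span {s1 z} = span {t1 z} \<and> span {s2 z} = span {t2 z}" by blast
    then show ?thesis using U t
      by (intro exI[of _ U] exI[of _ b1] exI[of _ b2] exI[of _ N] exI[of _ s1] exI[of _ s2] exI[of _ X] exI[of _ Y]) simp
  qed
  have loc: "(\<exists>N. open N \<and> x \<in> N \<and> smooth_fun A N \<tau>) \<and> \<tau> x \<in> wedge_space B (f x) (f x) \<and> blinfun_apply (\<tau> x) p \<noteq> 0 \<and>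
      (\<forall>V. (\<forall>W. q_form A f \<eta> x V W = 0) \<longrightarrow> V = 0) \<and> has_signature (q_form A f \<eta> x) 1 1 \<and>
      (\<forall>V W. \<eta> x V o\<^sub>L \<eta> x W = \<eta> x W o\<^sub>L \<eta> x V) \<and> (\<forall>V. blinfun_apply (\<eta> x V) p = 0) \<and>
      (\<exists>U b1 b2. curvature_sphere_bundles A f U b1 b2 \<and> x \<in> U \<and>
        (\<forall>V. \<exists>a1 a2 a3. \<eta> x V - dder A \<tau> x V = a1 + a2 + a3 \<and>
          a1 \<in> wedge_space B (second_osculating A b1 (\<lambda>y. curvature_space A f y (b2 y)) x) (second_osculating A b1 (\<lambda>y. curvature_space A f y (b2 y)) x) \<and>
          a2 \<in> wedge_space B (second_osculating A b2 (\<lambda>y. curvature_space A f y (b1 y)) x) (second_osculating A b2 (\<lambda>y. curvature_space A f y (b1 y)) x) \<and>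
          a3 \<in> wedge_space B (second_osculating A b1 (\<lambda>y. curvature_space A f y (b2 y)) x) (second_osculating A b2 (\<lambda>y. curvature_space A f y (b1 y)) x) \<and>
          a3 \<in> wedge_space B (f x) (f x)))" for x
  proof -
    let ?c = "chart_at A x"
    obtain U b1 b2 N s1 s2 X Y where U: "curvature_sphere_bundles A f U b1 b2" "x \<in> U" and N: "x \<in> N"
      and fr: "curvature_chart A B f ?c N s1 s2 X Y"
      and I: "isothermic_frame B (snd ?c ` N) (\<lambda>z. f (chart_inv ?c z)) s1 s2 X Y (\<lambda>z u. form_in_chart A \<eta> ?c u z) p"
      and b12: "\<forall>y\<in>N. b1 y = span {s1 (snd ?c y)} \<and> b2 y = span {s2 (snd ?c y)}"
      using fr_at[of x] by (elim exE conjE)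
    interpret curvature_chart A B f ?c N s1 s2 X Y by (rule fr)
    interpret I: isothermic_frame B "snd ?c ` N" "\<lambda>z. f (chart_inv ?c z)" s1 s2 X Y "\<lambda>z u. form_in_chart A \<eta> ?c u z" p by (rule I)
    interpret sw: curvature_chart A B f ?c N s2 s1 Y X by (rule swapped_chart)
    let ?z = "snd ?c x"
    note zV = mem_V[OF N]
    have fz: "f (chart_inv ?c ?z) = f x" using N by simp
    have \<eta>T: "\<eta> x V = form_in_chart A \<eta> ?c (T x V) ?z" for V by (rule form_in_chart_tangent[OF c_mem chart_at_dom])
    have ct: "T x (chart_to_tangent A ?c x u) = u" for u using c_mem chart_at_dom by simp
    have \<tau>N: "\<tau> y = I.\<tau> (snd ?c y)" if "y \<in> N" for y by (rule gauge_frame[OF fr I that])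
    have bnz: "I.b ?z \<noteq> 0" using nowhere[of x] I.form_zero_iff[OF zV] \<eta>T by metis
    have sm: "smooth_fun A N \<tau>"
      by (rule smooth_fun_cong[OF open_N smooth_fun_pull[OF c_mem open_N N_dom I.smooth_\<tau>]]) (simp add: \<tau>N)
    have d\<tau>: "dder A \<tau> x V = fd I.\<tau> ?z (T x V)" for V
      using dder_cong[OF open_N N \<tau>N] dder_pull[OF c_mem open_N N_dom I.smooth_\<tau> N, of V] by simp
    have mem: "\<tau> x \<in> wedge_space B (f x) (f x)" using I.\<tau>_mem[OF zV] unfolding \<tau>N[OF N] fz .
    have "blinfun_apply (\<tau> x) p \<noteq> 0"
      unfolding \<tau>N[OF N] I.\<tau>_p[OF zV] using bnz I.s1_p[OF zV] I.s_nonzero[OF zV] by simp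
    \<comment> \<open>Diagonal in the curvature directions, with entries of opposite sign because
      \<open>a = - b\<close>; the signature (1, 1) comes from here.\<close>
    moreover have q: "q_form A f \<eta> x V W = I.b ?z * B (y1 ?z) (y1 ?z) * \<theta>Y ?z (T x V) * \<theta>Y ?z (T x W)
        - I.b ?z * B (x2 ?z) (x2 ?z) * \<theta>X ?z (T x V) * \<theta>X ?z (T x W)" for V W
      unfolding q_form_frame[where \<eta> = \<eta>, OF N nil] \<eta>T I.form_fd_s[OF zV] using I.c_s[OF zV] by (simp add: c_linear)
    let ?CX = "chart_to_tangent A ?c x (X ?z)" and ?CY = "chart_to_tangent A ?c x (Y ?z)"
    have \<theta>: "\<theta>X ?z (X ?z) = 1" "\<theta>X ?z (Y ?z) = 0" "\<theta>Y ?z (X ?z) = 0" "\<theta>Y ?z (Y ?z) = 1"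
      using x2_pos[OF zV] y1_pos[OF zV] I.fd_X_y1[OF zV] I.fd_Y_x2[OF zV] by (auto simp: \<theta>X_def \<theta>Y_def)
    have pos: "B (y1 ?z) (y1 ?z) > 0" "B (x2 ?z) (x2 ?z) > 0" using x2_pos[OF zV] y1_pos[OF zV] by auto
    have qCY: "q_form A f \<eta> x V ?CY = I.b ?z * B (y1 ?z) (y1 ?z) * \<theta>Y ?z (T x V)" for V unfolding q ct \<theta> by simp
    have qCX: "q_form A f \<eta> x V ?CX = - I.b ?z * B (x2 ?z) (x2 ?z) * \<theta>X ?z (T x V)" for V unfolding q ct \<theta> by simp
    have "V = 0" if V: "\<forall>W. q_form A f \<eta> x V W = 0" for V
    proof -
      have "\<theta>Y ?z (T x V) = 0" "\<theta>X ?z (T x V) = 0"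
        using V qCY[of V] qCX[of V] bnz pos by auto
      then have "T x V = 0" using \<theta>_expand[OF zV, of "T x V"] by simp
      then show ?thesis using tangent_zero_iff[OF N] by simp
    qed
    moreover have "has_signature (q_form A f \<eta> x) 1 1"
    proof -
      have lin: "linear (chart_to_tangent A ?c x)" by (rule linear_chart_to_tangent[OF c_mem chart_at_dom])
      have ind: "k = 0 \<and> l = 0" if "k *\<^sub>R ?CX + l *\<^sub>R ?CY = 0" for k l
      proof -
        have "chart_to_tangent A ?c x (k *\<^sub>R X ?z + l *\<^sub>R Y ?z) = 0"
          using that by (simp add: linear_add[OF lin] linear_cmul[OF lin])
        then have "k *\<^sub>R X ?z + l *\<^sub>R Y ?z = 0"
          using ct[of "k *\<^sub>R X ?z + l *\<^sub>R Y ?z"] tangent_zero_iff[OF N, of 0] by simp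
        then show ?thesis using XY_independent[OF zV] by blast
      qed
      have qq: "q_form A f \<eta> x ?CX ?CY = 0" "q_form A f \<eta> x ?CY ?CX = 0"
        "q_form A f \<eta> x ?CX ?CX = - I.b ?z * B (x2 ?z) (x2 ?z)" "q_form A f \<eta> x ?CY ?CY = I.b ?z * B (y1 ?z) (y1 ?z)"
        unfolding qCX qCY ct \<theta> by simp_all
      show ?thesis
      \<comment> \<open>The sign of \<open>b\<close> decides which of the two curvature directions
        is positive.\<close>
      proof (cases "I.b ?z > 0")
        case True
        have ind': "k = 0 \<and> l = 0" if "k *\<^sub>R ?CY + l *\<^sub>R ?CX = 0" for k l
          using ind[of l k] that by (simp add: add.commute)
        show ?thesis
          by (rule signature_1_1[of ?CY ?CX, OF ind']) (use True qq pos in \<open>auto simp: mult_neg_pos\<close>)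
      next
        case False
        then have "I.b ?z < 0" using bnz by simp
        then show ?thesis
          by (intro signature_1_1[of ?CX ?CY, OF ind]) (use qq pos in \<open>auto simp: mult_neg_pos\<close>)
      qed
    qed
    moreover have wedge: "\<exists>m. B (I.s ?z) m = 0 \<and> B m p = 0 \<and> \<eta> x V = wedge B (I.s ?z) m" for V
    proof -
      obtain m where m: "m \<in> perp B (f x)" "B m p = 0" "\<eta> x V = wedge B (I.s ?z) m"
        using I.form_wedge[OF zV, of "T x V"] unfolding \<eta>T fz I.s_def by blast
      then show ?thesis using perpD[OF m(1), of "I.s ?z"] I.s_F[OF zV] unfolding fz by blast
    qed
    have ss: "B (I.s ?z) (I.s ?z) = 0" using F_null[OF zV I.s_F[OF zV] I.s_F[OF zV]] .
    have "\<eta> x V o\<^sub>L \<eta> x W = \<eta> x W o\<^sub>L \<eta> x V" for V W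
      using wedge[of V] wedge[of W] wedge_commute[OF ss] by metis
    moreover have "blinfun_apply (\<eta> x V) p = 0" for V
    proof -
      obtain m where "B m p = 0" "\<eta> x V = wedge B (I.s ?z) m" using wedge by blast
      then show ?thesis using I.s_p[OF zV] by (simp add: I.s_def)
    qed
    moreover have "\<exists>a1 a2 a3. \<eta> x V - dder A \<tau> x V = a1 + a2 + a3 \<and>
          a1 \<in> wedge_space B (second_osculating A b1 (\<lambda>y. curvature_space A f y (b2 y)) x) (second_osculating A b1 (\<lambda>y. curvature_space A f y (b2 y)) x) \<and>
          a2 \<in> wedge_space B (second_osculating A b2 (\<lambda>y. curvature_space A f y (b1 y)) x) (second_osculating A b2 (\<lambda>y. curvature_space A f y (b1 y)) x) \<and>
          a3 \<in> wedge_space B (second_osculating A b1 (\<lambda>y. curvature_space A f y (b2 y)) x) (second_osculating A b2 (\<lambda>y. curvature_space A f y (b1 y)) x) \<and>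
          a3 \<in> wedge_space B (f x) (f x)" for V
    proof -
      have b1: "b1 y = span {s1 (snd ?c y)}" and b2: "b2 y = span {s2 (snd ?c y)}" if "y \<in> N" for y using b12 that by auto
      note S1 = osculating_mem[of x b1 b2, OF N b1 b2]
      note S2 = sw.osculating_mem[of x b2 b1, OF N b2 b1]
      obtain a3 where a3: "a3 \<in> wedge_space B (f x) (f x)"
        "\<eta> x V - dder A \<tau> x V = (- (I.b ?z * \<theta>Y ?z (T x V))) *\<^sub>R wedge B (s1 ?z) (y1 ?z) + (I.b ?z * \<theta>X ?z (T x V)) *\<^sub>R wedge B (s2 ?z) (x2 ?z) + a3"
        using I.gauged_expand[OF zV, of "T x V"] unfolding \<eta>T d\<tau> fz by blast
      \<comment> \<open>Being a multiple of \<open>s1 \<and> s2\<close>, the remainder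
        \<open>a3\<close> also belongs to the wedge of the two osculating spaces.\<close>
      obtain k where k: "a3 = k *\<^sub>R wedge B (s1 ?z) (s2 ?z)"
        using wedge_space_pair a3(1) F_span[OF zV] unfolding fz by metis
      show ?thesis
        by (intro exI conjI, rule a3(2))
          (use S1 S2 a3(1) in \<open>auto simp: k intro!: subspace_scale subspace_wedge_space wedge_space_mem subspace_neg\<close>)
    qed
    ultimately show ?thesis using open_N N sm mem U by blast
  qed
  have \<tau>: "smooth_fun A UNIV \<tau>" "\<And>x. \<tau> x \<in> wedge_space B (f x) (f x)"
    by (rule smooth_fun_local) (use loc in blast)+
  define \<eta>' where "\<eta>' x V = \<eta> x V - dder A \<tau> x V" for x V
  define P where "P k x = (if k = 0 then p else if k = (1::nat) then blinfun_apply (\<tau> x) p else 0)" for k x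
  have skew: "B (blinfun_apply (\<tau> x) a) b = - B a (blinfun_apply (\<tau> x) b)" for x a b
    using wedge_space_nilpotent[OF f_lie, of "\<tau> x" x] \<tau>(2)[of x] wedge_space_mono[OF order_refl subset_perp[OF f_lie], of "f x" x]
      nilpotent_skewD(1) by blast
  have \<tau>f: "blinfun_apply (\<tau> x) p \<in> f x" for x
    using wedge_space_range[OF \<tau>(2)] lie_grassmannianD(1)[OF f_lie] by blast
  have Pt: "poly_section P 1 t x = p + t *\<^sub>R blinfun_apply (\<tau> x) p" for t x
    unfolding poly_section_1 by (simp add: P_def)
  have sm\<tau>p: "smooth_fun A UNIV (\<lambda>x. blinfun_apply (\<tau> x) p)"
    by (rule smooth_fun_bounded_linear[OF blinfun.bounded_linear_left \<tau>(1)])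
  have "Omega_potential A B f \<eta>"
    unfolding Omega_potential_def gauge_potential_def
  proof (intro conjI allI \<eta>)
    show "\<eta> x V \<in> wedge_space B (f x) (perp B (f x))" for x V
    proof -
      have "wedge_space B (\<Lambda> x) (derived_bundle A \<Lambda> x) \<subseteq> wedge_space B (f x) (perp B (f x))"
        by (rule wedge_space_mono) (use derived[of x] in \<open>auto simp: \<Lambda>_def\<close>)
      then show ?thesis using \<eta>(4) by blast
    qed
    show "2 *\<^sub>R (\<eta> x V o\<^sub>L \<eta> x W - \<eta> x W o\<^sub>L \<eta> x V) = 0" for x V W
    proof -
      have "\<eta> x V o\<^sub>L \<eta> x W = \<eta> x W o\<^sub>L \<eta> x V" using loc[of x] by blast
      then show ?thesis by simp
    qed
    have nd: "\<forall>V. (\<forall>W. q_form A f \<eta> x V W = 0) \<longrightarrow> V = 0" for x using loc[of x] by blast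
    have "(1 :: real ^ 2) \<noteq> 0" by (simp add: vec_eq_iff)
    then show "\<exists>x V W. q_form A f \<eta> x V W \<noteq> 0" using nd by blast
    show "\<exists>D. open D \<and> closure D = UNIV \<and> (\<forall>x\<in>D. \<forall>V. (\<forall>W. q_form A f \<eta> x V W = 0) \<longrightarrow> V = 0)"
      using nd by (intro exI[of _ UNIV]) simp
    have "has_signature (q_form A f \<eta> x) 1 1" for x using loc[of x] by blast
    then show "\<exists>m n. \<forall>x. has_signature (q_form A f \<eta> x) m n" by blast
  qed
  moreover have "middle_potential A B f \<eta> \<eta>'"
    unfolding middle_potential_def
  proof (intro conjI allI)
    show "\<eta>' \<in> gauge_orbit A B f \<eta>" unfolding gauge_orbit_def \<eta>'_def[abs_def] using \<tau> by blast
    show "\<exists>U b1 b2. curvature_sphere_bundles A f U b1 b2 \<and> x \<in> U \<and>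
        (let S1 = second_osculating A b1 (\<lambda>y. curvature_space A f y (b2 y)) x;
             S2 = second_osculating A b2 (\<lambda>y. curvature_space A f y (b1 y)) x
         in \<forall>X. \<exists>b1 b2 c. \<eta>' x X = b1 + b2 + c \<and>
              b1 \<in> wedge_space B S1 S1 \<and> b2 \<in> wedge_space B S2 S2 \<and> c \<in> wedge_space B S1 S2 \<and>
              c \<in> wedge_space B (f x) (f x))" for x
      unfolding Let_def \<eta>'_def using loc[of x] by (elim conjE)
  qed
  moreover have "conserved_polynomial A \<eta>' P 1"
    unfolding conserved_polynomial_def
  proof (intro conjI allI)
    show "smooth_fun A UNIV (P k)" for k
      unfolding P_def[abs_def] by (cases "k = 0"; cases "k = 1") (simp_all add: sm\<tau>p smooth_fun_const)
    show "\<exists>x. P 1 x \<noteq> 0" using loc by (simp add: P_def)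
    show "k > 1 \<longrightarrow> (\<forall>x. P k x = 0)" for k by (simp add: P_def)
    fix t x V
    have "poly_section P 1 t = (\<lambda>x. p + t *\<^sub>R blinfun_apply (\<tau> x) p)" using Pt by (simp add: fun_eq_iff)
    then have d: "dder A (poly_section P 1 t) x V = t *\<^sub>R dder A (\<lambda>x. blinfun_apply (\<tau> x) p) x V"
      using dder_affine[OF sm\<tau>p] by simp
    have d': "dder A (\<lambda>x. blinfun_apply (\<tau> x) p) x V = blinfun_apply (dder A \<tau> x V) p"
      by (rule dder_bounded_linear[OF blinfun.bounded_linear_left open_UNIV UNIV_I \<tau>(1)])
    \<comment> \<open>The gauge term \<open>- d\<tau> p\<close> in \<open>\<eta>' p\<close> cancels
      the derivative of \<open>\<tau> p\<close>; the terms in \<open>t\<^sup>2\<close> vanish since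
      \<open>\<tau> p\<close> lies in \<open>f\<close>, which \<open>\<eta>\<close> and
      \<open>d\<tau>\<close> kill.\<close>
    have "blinfun_apply (\<eta> x V) p = 0" using loc[of x] by blast
    moreover have "blinfun_apply (\<eta> x V) (blinfun_apply (\<tau> x) p) = 0" using nilpotent_skewD(2)[OF nil \<tau>f] .
    moreover have "blinfun_apply (dder A \<tau> x V) (blinfun_apply (\<tau> x) p) = 0"
      using nilpotent_skewD(2)[OF dder_wedge_nilpotent[OF \<tau>] \<tau>f] .
    ultimately show "dder A (poly_section P 1 t) x V + t *\<^sub>R blinfun_apply (\<eta>' x V) (poly_section P 1 t x) = 0"
      unfolding d d' Pt \<eta>'_def by (simp add: blinfun.diff_left blinfun.add_right blinfun.scaleR_right)
  qed
  moreover have "poly_section P 1 0 x = p" for x unfolding Pt by simp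
  moreover have "B (poly_section P 1 t x) (poly_section P 1 t x) = B p p" for t x
  proof -
    have "B (blinfun_apply (\<tau> x) p) p = 0" using skew[of x p p] B_sym[of p "blinfun_apply (\<tau> x) p"] by simp
    then show ?thesis
      unfolding Pt using lie_grassmannianD(3)[OF f_lie \<tau>f \<tau>f] B_sym[of p "blinfun_apply (\<tau> x) p"] by (simp add: B_simps)
  qed
  ultimately show ?thesis by blast
qed

end

theorem theorem5p3:
  fixes A :: "'a::{t2_space, second_countable_topology} chart set"
    and B :: "'v::euclidean_space \<Rightarrow> 'v \<Rightarrow> real"
    and f :: "'a \<Rightarrow> 'v set"
    and \<pp> :: 'v
  assumes "smooth_surface A"
    and "R42_form B"
    and "legendre_map A B f"
    and "umbilic_free A f"
    and "\<pp> \<noteq> 0"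
    and "\<pp> \<notin> lightcone B"
  shows "(\<exists>\<eta>. special_Omega_surface A B f \<eta> 1 \<and>
            (\<exists>\<eta>' p. middle_potential A B f \<eta> \<eta>' \<and> conserved_polynomial A \<eta>' p 1 \<and>
               (\<forall>x. poly_section p 1 0 x = \<pp>) \<and>
               (\<exists>C. C \<noteq> 0 \<and> (\<forall>t x. B (poly_section p 1 t x) (poly_section p 1 t x) = C))))
         \<longleftrightarrow> isothermic_surface A B \<pp> (\<lambda>x. f x \<inter> perp B {\<pp>})" (is "?L \<longleftrightarrow> ?R")
proof -
  interpret legendre_surface A B f by unfold_locales (use assms in auto)
  have pp: "B \<pp> \<pp> \<noteq> 0" using assms(6) by (simp add: lightcone_def)
  show ?thesis
  proof
    assume ?L
    then show ?R using special_imp_isothermic[OF _ _ _ _ _ pp] unfolding special_Omega_surface_def by blast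
  next
    assume ?R
    from isothermic_imp_special[OF this] show ?L
      unfolding special_Omega_surface_def using assms(3,4) pp by blast
  qed
qed

end
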